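(* Let $\mathbf{V}$ be a positive-dimensional dagger compact category. Then $\mathrm{CP}^*[\mathbf{V}]$, with composition, identities, tensor product, symmetric monoidal structure maps and dagger inherited from $\mathbf{V}$ (as described in the context), is again a dagger compact category.
   Context: Conventions. In a dagger compact category $\mathbf{V}$ (a symmetric monoidal category with an involutive identity-on-objects contravariant monoidal functor $\dagger$ such that all coherence isomorphisms are unitary, and with duals compatible with $\dagger$), every object $A$ has a dual $A^*$ with maps $\eta_A\colon I\to A^*\otimes A$ and $\varepsilon_A\colon A\otimes A^*\to I$ satisfying the snake equations and $\varepsilon_A=\eta_A^\dagger\circ\sigma_{A,A^*}$, where $\sigma$ is the symmetry. For $f\colon A\to B$, $f^*\colon B^*\to A^*$ is its dual and $f_*:=(f^\dagger)^*\colon A^*\to B^*$. Coherence isomorphisms are suppressed, and $(A\otimes B)^*$ is identified with $B^*\otimes A^*$. A morphism $g\colon A\to A$ is positive if $g=h^\dagger\circ h$ for some $h$, and positive definite if it is positive and an isomorphism. $\mathbf{V}$ is positive-dimensional if for each object $X$ there is a positive definite scalar $z\colon I\to I$ with $(z\circ z\circ \mathrm{Tr}_X(1_X))\otimes 1_X=1_X$, where $\mathrm{Tr}_X(1_X)=\eta_X^\dagger\circ\eta_X$. A Frobenius algebra is an object $A$ with a monoid structure $(m\colon A\otimes A\to A,\ u\colon I\to A)$ and a comonoid structure $(\delta\colon A\to A\otimes A,\ e\colon A\to I)$ with $(1_A\otimes m)\circ(\delta\otimes 1_A)=\delta\circ m=(m\otimes 1_A)\circ(1_A\otimes\delta)$.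 It is a dagger Frobenius algebra if $\delta=m^\dagger$ and $e=u^\dagger$; it is then denoted $(A,m)$. A map $z\colon A\to A$ is central if $m\circ(z\otimes 1_A)=z\circ m=m\circ(1_A\otimes z)$. A dagger Frobenius algebra is normalisable if there is a central positive definite $z\colon A\to A$ (a normaliser) with $\mathrm{Tr}_A(m)\circ z\circ z=e$, where $\mathrm{Tr}_A(m)=\varepsilon_A\circ(m\otimes 1_{A^*})\circ(1_A\otimes(\sigma_{A^*,A}\circ\eta_A))\colon A\to I$. The (right) action map of $(A,m)$ is $\mathrm{act}_A=(1_{A^*}\otimes m)\circ(\eta_A\otimes 1_A)\colon A\to A^*\otimes A$, and the coaction map is $\mathrm{coact}_A=(\eta_A^\dagger\otimes 1_A)\circ(1_{A^*}\otimes\delta)\colon A^*\otimes A\to A$. The category $\mathrm{CP}^*[\mathbf{V}]$: objects are normalisable dagger Frobenius algebras in $\mathbf{V}$; morphisms $(A,m)\to(B,n)$ are morphisms $f\colon A\to B$ of $\mathbf{V}$ satisfying the CP*-condition: there exist an object $X$ and $g\colon A\to X\otimes B$ in $\mathbf{V}$ with $$\mathrm{act}_B\circ f\circ\mathrm{coact}_A=(1_{B^*}\otimes\eta_X^\dagger\otimes 1_B)\circ(g_*\otimes g),$$ where $g_*\colon A^*\to B^*\otimes X^*$. Composition and identities are those of $\mathbf{V}$. Structure: $(A,m)\otimes(B,n):=(A\otimes B,\ (m\otimes n)\circ(1_A\otimes\sigma_{B,A}\otimes 1_B))$ (with unit the tensor of the units), the tensor unit is $I$ with its canonical algebra structure $I\otimes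 I\cong I$, and tensor of morphisms, coherence isomorphisms, symmetry and dagger are as in $\mathbf{V}$. *)

theory Defs
  imports Main
begin

section \<open>Dagger compact categories\<close>

text \<open>
  Categories are given by a set of objects and a family of hom-sets. The hom-sets need not
  be disjoint, so that one element of the type of morphisms may be a morphism between several
  pairs of objects. A category whose morphisms have unique endpoints is a special case; on the
  other hand, composition and tensor of the category \<open>CPstar\<close> below can be literally
  those of the underlying category.
\<close>

record ('o, 'm) category =
  Obj :: "'o set"
  Hom :: "'o \<Rightarrow> 'o \<Rightarrow> 'm set"
  comp_mor :: "'m \<Rightarrow> 'm \<Rightarrow> 'm" (infixr "\<cdot>\<index>" 70)
  ident :: "'o \<Rightarrow> 'm" ("\<one>\<index>[_]")

locale category =
  fixes V :: "('o, 'm, 'x) category_scheme" (structure)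
  assumes ident_in_Hom: "A \<in> Obj V \<Longrightarrow> \<one>[A] \<in> Hom V A A"
    and comp_in_Hom: "\<lbrakk>A \<in> Obj V; B \<in> Obj V; C \<in> Obj V; f \<in> Hom V A B; g \<in> Hom V B C\<rbrakk>
      \<Longrightarrow> g \<cdot> f \<in> Hom V A C"
    and ident_comp: "\<lbrakk>A \<in> Obj V; B \<in> Obj V; f \<in> Hom V A B\<rbrakk> \<Longrightarrow> \<one>[B] \<cdot> f = f"
    and comp_ident: "\<lbrakk>A \<in> Obj V; B \<in> Obj V; f \<in> Hom V A B\<rbrakk> \<Longrightarrow> f \<cdot> \<one>[A] = f"
    and comp_assoc: "\<lbrakk>A \<in> Obj V; B \<in> Obj V; C \<in> Obj V; D \<in> Obj V;
        f \<in> Hom V A B; g \<in> Hom V B C; h \<in> Hom V C D\<rbrakk>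
      \<Longrightarrow> (h \<cdot> g) \<cdot> f = h \<cdot> (g \<cdot> f)"

definition is_iso :: "('o, 'm, 'x) category_scheme \<Rightarrow> 'o \<Rightarrow> 'o \<Rightarrow> 'm \<Rightarrow> bool" where
  "is_iso V A B f \<longleftrightarrow> f \<in> Hom V A B \<and>
     (\<exists>g \<in> Hom V B A. g \<cdot>\<^bsub>V\<^esub> f = \<one>\<^bsub>V\<^esub>[A] \<and> f \<cdot>\<^bsub>V\<^esub> g = \<one>\<^bsub>V\<^esub>[B])"

record ('o, 'm) monoidal_category = "('o, 'm) category" +
  tensor_obj :: "'o \<Rightarrow> 'o \<Rightarrow> 'o" (infixr "\<odot>\<index>" 75)
  tensor :: "'m \<Rightarrow> 'm \<Rightarrow> 'm" (infixr "\<otimes>\<index>" 75)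
  unit_obj :: "'o" ("\<I>\<index>")
  associator :: "'o \<Rightarrow> 'o \<Rightarrow> 'o \<Rightarrow> 'm" ("\<a>\<index>[_, _, _]")
  left_unitor :: "'o \<Rightarrow> 'm" ("\<l>\<index>[_]")
  right_unitor :: "'o \<Rightarrow> 'm" ("\<r>\<index>[_]")

locale monoidal_category = category V
  for V :: "('o, 'm, 'x) monoidal_category_scheme" (structure) +
  assumes unit_obj_in_Obj: "\<I> \<in> Obj V"
    and tensor_obj_in_Obj: "\<lbrakk>A \<in> Obj V; B \<in> Obj V\<rbrakk> \<Longrightarrow> A \<odot> B \<in> Obj V"
    and tensor_in_Hom: "\<lbrakk>A \<in> Obj V; B \<in> Obj V; C \<in> Obj V; D \<in> Obj V;
        f \<in> Hom V A B; g \<in> Hom V C D\<rbrakk>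
      \<Longrightarrow> f \<otimes> g \<in> Hom V (A \<odot> C) (B \<odot> D)"
    and tensor_ident: "\<lbrakk>A \<in> Obj V; B \<in> Obj V\<rbrakk> \<Longrightarrow> \<one>[A] \<otimes> \<one>[B] = \<one>[A \<odot> B]"
    and tensor_comp: "\<lbrakk>A \<in> Obj V; B \<in> Obj V; C \<in> Obj V; A' \<in> Obj V; B' \<in> Obj V; C' \<in> Obj V;
        f \<in> Hom V A B; g \<in> Hom V B C; f' \<in> Hom V A' B'; g' \<in> Hom V B' C'\<rbrakk>
      \<Longrightarrow> (g \<cdot> f) \<otimes> (g' \<cdot> f') = (g \<otimes> g') \<cdot> (f \<otimes> f')"
    and associator_iso: "\<lbrakk>A \<in> Obj V; B \<in> Obj V; C \<in> Obj V\<rbrakk>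
      \<Longrightarrow> is_iso V ((A \<odot> B) \<odot> C) (A \<odot> (B \<odot> C)) \<a>[A, B, C]"
    and left_unitor_iso: "A \<in> Obj V \<Longrightarrow> is_iso V (\<I> \<odot> A) A \<l>[A]"
    and right_unitor_iso: "A \<in> Obj V \<Longrightarrow> is_iso V (A \<odot> \<I>) A \<r>[A]"
    and associator_natural: "\<lbrakk>A \<in> Obj V; B \<in> Obj V; C \<in> Obj V; A' \<in> Obj V; B' \<in> Obj V; C' \<in> Obj V;
        f \<in> Hom V A A'; g \<in> Hom V B B'; h \<in> Hom V C C'\<rbrakk>
      \<Longrightarrow> \<a>[A', B', C'] \<cdot> ((f \<otimes> g) \<otimes> h) = (f \<otimes> (g \<otimes> h)) \<cdot> \<a>[A, B, C]"
    and left_unitor_natural: "\<lbrakk>A \<in> Obj V; B \<in> Obj V; f \<in> Hom V A B\<rbrakk>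
      \<Longrightarrow> \<l>[B] \<cdot> (\<one>[\<I>] \<otimes> f) = f \<cdot> \<l>[A]"
    and right_unitor_natural: "\<lbrakk>A \<in> Obj V; B \<in> Obj V; f \<in> Hom V A B\<rbrakk>
      \<Longrightarrow> \<r>[B] \<cdot> (f \<otimes> \<one>[\<I>]) = f \<cdot> \<r>[A]"
    and pentagon: "\<lbrakk>A \<in> Obj V; B \<in> Obj V; C \<in> Obj V; D \<in> Obj V\<rbrakk>
      \<Longrightarrow> (\<one>[A] \<otimes> \<a>[B, C, D]) \<cdot> \<a>[A, B \<odot> C, D] \<cdot> (\<a>[A, B, C] \<otimes> \<one>[D])
        = \<a>[A, B, C \<odot> D] \<cdot> \<a>[A \<odot> B, C, D]"
    and triangle: "\<lbrakk>A \<in> Obj V; B \<in> Obj V\<rbrakk>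
      \<Longrightarrow> (\<one>[A] \<otimes> \<l>[B]) \<cdot> \<a>[A, \<I>, B] = \<r>[A] \<otimes> \<one>[B]"

record ('o, 'm) symmetric_monoidal_category = "('o, 'm) monoidal_category" +
  symmetry :: "'o \<Rightarrow> 'o \<Rightarrow> 'm" ("\<s>\<index>[_, _]")

locale symmetric_monoidal_category = monoidal_category V
  for V :: "('o, 'm, 'x) symmetric_monoidal_category_scheme" (structure) +
  assumes symmetry_in_Hom: "\<lbrakk>A \<in> Obj V; B \<in> Obj V\<rbrakk> \<Longrightarrow> \<s>[A, B] \<in> Hom V (A \<odot> B) (B \<odot> A)"
    and symmetry_natural: "\<lbrakk>A \<in> Obj V; B \<in> Obj V; A' \<in> Obj V; B' \<in> Obj V;
        f \<in> Hom V A A'; g \<in> Hom V B B'\<rbrakk>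
      \<Longrightarrow> \<s>[A', B'] \<cdot> (f \<otimes> g) = (g \<otimes> f) \<cdot> \<s>[A, B]"
    and symmetry_involutive: "\<lbrakk>A \<in> Obj V; B \<in> Obj V\<rbrakk> \<Longrightarrow> \<s>[B, A] \<cdot> \<s>[A, B] = \<one>[A \<odot> B]"
    and hexagon: "\<lbrakk>A \<in> Obj V; B \<in> Obj V; C \<in> Obj V\<rbrakk>
      \<Longrightarrow> \<a>[B, C, A] \<cdot> \<s>[A, B \<odot> C] \<cdot> \<a>[A, B, C]
        = (\<one>[B] \<otimes> \<s>[A, C]) \<cdot> \<a>[B, A, C] \<cdot> (\<s>[A, B] \<otimes> \<one>[C])"

record ('o, 'm) dagger_smc = "('o, 'm) symmetric_monoidal_category" +
  dagger :: "'m \<Rightarrow> 'm" ("_\<dagger>\<index>" [1000] 1000)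

definition is_unitary :: "('o, 'm, 'x) dagger_smc_scheme \<Rightarrow> 'o \<Rightarrow> 'o \<Rightarrow> 'm \<Rightarrow> bool" where
  "is_unitary V A B f \<longleftrightarrow> f \<in> Hom V A B \<and>
     f\<dagger>\<^bsub>V\<^esub> \<cdot>\<^bsub>V\<^esub> f = \<one>\<^bsub>V\<^esub>[A] \<and> f \<cdot>\<^bsub>V\<^esub> f\<dagger>\<^bsub>V\<^esub> = \<one>\<^bsub>V\<^esub>[B]"

locale dagger_smc = symmetric_monoidal_category V
  for V :: "('o, 'm, 'x) dagger_smc_scheme" (structure) +
  assumes dagger_in_Hom: "\<lbrakk>A \<in> Obj V; B \<in> Obj V; f \<in> Hom V A B\<rbrakk> \<Longrightarrow> f\<dagger> \<in> Hom V B A"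
    and dagger_dagger: "\<lbrakk>A \<in> Obj V; B \<in> Obj V; f \<in> Hom V A B\<rbrakk> \<Longrightarrow> f\<dagger>\<dagger> = f"
    and dagger_ident: "A \<in> Obj V \<Longrightarrow> \<one>[A]\<dagger> = \<one>[A]"
    and dagger_comp: "\<lbrakk>A \<in> Obj V; B \<in> Obj V; C \<in> Obj V; f \<in> Hom V A B; g \<in> Hom V B C\<rbrakk>
      \<Longrightarrow> (g \<cdot> f)\<dagger> = f\<dagger> \<cdot> g\<dagger>"
    and dagger_tensor: "\<lbrakk>A \<in> Obj V; B \<in> Obj V; C \<in> Obj V; D \<in> Obj V;
        f \<in> Hom V A B; g \<in> Hom V C D\<rbrakk> \<Longrightarrow> (f \<otimes> g)\<dagger> = f\<dagger> \<otimes> g\<dagger>"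
    and associator_unitary: "\<lbrakk>A \<in> Obj V; B \<in> Obj V; C \<in> Obj V\<rbrakk>
      \<Longrightarrow> is_unitary V ((A \<odot> B) \<odot> C) (A \<odot> (B \<odot> C)) \<a>[A, B, C]"
    and left_unitor_unitary: "A \<in> Obj V \<Longrightarrow> is_unitary V (\<I> \<odot> A) A \<l>[A]"
    and right_unitor_unitary: "A \<in> Obj V \<Longrightarrow> is_unitary V (A \<odot> \<I>) A \<r>[A]"
    and symmetry_unitary: "\<lbrakk>A \<in> Obj V; B \<in> Obj V\<rbrakk>
      \<Longrightarrow> is_unitary V (A \<odot> B) (B \<odot> A) \<s>[A, B]"

text \<open>
  From here on the inverses of coherence isomorphisms are written as their daggers.
\<close>

context
  fixes V :: "('o, 'm, 'x) dagger_smc_scheme" (structure)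
begin

definition dagger_dual :: "'o \<Rightarrow> 'o \<Rightarrow> 'm \<Rightarrow> 'm \<Rightarrow> bool" where
  "dagger_dual A A' \<eta> \<epsilon> \<longleftrightarrow>
     A \<in> Obj V \<and> A' \<in> Obj V \<and>
     \<eta> \<in> Hom V \<I> (A' \<odot> A) \<and> \<epsilon> \<in> Hom V (A \<odot> A') \<I> \<and>
     \<l>[A] \<cdot> (\<epsilon> \<otimes> \<one>[A]) \<cdot> \<a>[A, A', A]\<dagger> \<cdot> (\<one>[A] \<otimes> \<eta>) \<cdot> \<r>[A]\<dagger> = \<one>[A] \<and>
     \<r>[A'] \<cdot> (\<one>[A'] \<otimes> \<epsilon>) \<cdot> \<a>[A', A, A'] \<cdot> (\<eta> \<otimes> \<one>[A']) \<cdot> \<l>[A']\<dagger> = \<one>[A'] \<and>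
     \<epsilon> = \<eta>\<dagger> \<cdot> \<s>[A, A']"

end

locale dagger_compact = dagger_smc V
  for V :: "('o, 'm, 'x) dagger_smc_scheme" (structure) +
  fixes dual :: "'o \<Rightarrow> 'o" ("_\<^sup>\<star>" [1000] 1000)
    and \<eta> :: "'o \<Rightarrow> 'm"
    and \<epsilon> :: "'o \<Rightarrow> 'm"
  assumes dual: "A \<in> Obj V \<Longrightarrow> dagger_dual V A A\<^sup>\<star> (\<eta> A) (\<epsilon> A)"


section \<open>Positivity and Frobenius algebras\<close>

context
  fixes V :: "('o, 'm, 'x) dagger_smc_scheme" (structure)
begin

definition positive :: "'o \<Rightarrow> 'm \<Rightarrow> bool" where
  "positive A g \<longleftrightarrow> g \<in> Hom V A A \<and> (\<exists>X \<in> Obj V. \<exists>h \<in> Hom V A X. g = h\<dagger> \<cdot> h)"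

definition positive_definite :: "'o \<Rightarrow> 'm \<Rightarrow> bool" where
  "positive_definite A g \<longleftrightarrow> positive A g \<and> is_iso V A A g"

definition monoid_object :: "'o \<Rightarrow> 'm \<Rightarrow> 'm \<Rightarrow> bool" where
  "monoid_object A m u \<longleftrightarrow>
     A \<in> Obj V \<and> m \<in> Hom V (A \<odot> A) A \<and> u \<in> Hom V \<I> A \<and>
     m \<cdot> (m \<otimes> \<one>[A]) = m \<cdot> (\<one>[A] \<otimes> m) \<cdot> \<a>[A, A, A] \<and>
     m \<cdot> (u \<otimes> \<one>[A]) \<cdot> \<l>[A]\<dagger> = \<one>[A] \<and>
     m \<cdot> (\<one>[A] \<otimes> u) \<cdot> \<r>[A]\<dagger> = \<one>[A]"

definition comonoid_object :: "'o \<Rightarrow> 'm \<Rightarrow> 'm \<Rightarrow> bool" where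
  "comonoid_object A d e \<longleftrightarrow>
     A \<in> Obj V \<and> d \<in> Hom V A (A \<odot> A) \<and> e \<in> Hom V A \<I> \<and>
     \<a>[A, A, A] \<cdot> (d \<otimes> \<one>[A]) \<cdot> d = (\<one>[A] \<otimes> d) \<cdot> d \<and>
     \<l>[A] \<cdot> (e \<otimes> \<one>[A]) \<cdot> d = \<one>[A] \<and>
     \<r>[A] \<cdot> (\<one>[A] \<otimes> e) \<cdot> d = \<one>[A]"

definition frobenius_algebra :: "'o \<Rightarrow> 'm \<Rightarrow> 'm \<Rightarrow> 'm \<Rightarrow> 'm \<Rightarrow> bool" where
  "frobenius_algebra A m u d e \<longleftrightarrow>
     monoid_object A m u \<and> comonoid_object A d e \<and>
     (\<one>[A] \<otimes> m) \<cdot> \<a>[A, A, A] \<cdot> (d \<otimes> \<one>[A]) = d \<cdot> m \<and>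
     d \<cdot> m = (m \<otimes> \<one>[A]) \<cdot> \<a>[A, A, A]\<dagger> \<cdot> (\<one>[A] \<otimes> d)"

definition dagger_frobenius_algebra :: "'o \<Rightarrow> 'm \<Rightarrow> 'm \<Rightarrow> bool" where
  "dagger_frobenius_algebra A m u \<longleftrightarrow> frobenius_algebra A m u (m\<dagger>) (u\<dagger>)"

definition central :: "'o \<Rightarrow> 'm \<Rightarrow> 'm \<Rightarrow> bool" where
  "central A m z \<longleftrightarrow> z \<in> Hom V A A \<and>
     m \<cdot> (z \<otimes> \<one>[A]) = z \<cdot> m \<and> z \<cdot> m = m \<cdot> (\<one>[A] \<otimes> z)"

text \<open>The coherence isomorphism \<open>(A \<odot> B) \<odot> (C \<odot> D) \<rightarrow> A \<odot> ((B \<odot> C) \<odot> D)\<close>.\<close>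

definition regroup :: "'o \<Rightarrow> 'o \<Rightarrow> 'o \<Rightarrow> 'o \<Rightarrow> 'm" where
  "regroup A B C D = (\<one>[A] \<otimes> \<a>[B, C, D]\<dagger>) \<cdot> \<a>[A, B, C \<odot> D]"

definition tensor_mult :: "'o \<Rightarrow> 'm \<Rightarrow> 'o \<Rightarrow> 'm \<Rightarrow> 'm" where
  "tensor_mult A m B n =
     (m \<otimes> n) \<cdot> (regroup A A B B)\<dagger> \<cdot> (\<one>[A] \<otimes> (\<s>[B, A] \<otimes> \<one>[B])) \<cdot> regroup A B A B"

definition tensor_unit :: "'m \<Rightarrow> 'm \<Rightarrow> 'm" where
  "tensor_unit u v = (u \<otimes> v) \<cdot> \<l>[\<I>]\<dagger>"

text \<open>
  The dual \<open>Q' \<rightarrow> P'\<close> of \<open>f : P \<rightarrow> Q\<close> with respect to a unit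
  \<open>p : \<I> \<rightarrow> P' \<odot> P\<close> for \<open>P\<close> and a counit \<open>q : Q \<odot> Q' \<rightarrow> \<I>\<close> for \<open>Q\<close>.
\<close>

definition dual_map :: "'o \<Rightarrow> 'o \<Rightarrow> 'm \<Rightarrow> 'o \<Rightarrow> 'm \<Rightarrow> 'm \<Rightarrow> 'm" where
  "dual_map P P' p Q' q f =
     \<r>[P'] \<cdot> (\<one>[P'] \<otimes> (q \<cdot> (f \<otimes> \<one>[Q']))) \<cdot> \<a>[P', P, Q'] \<cdot> (p \<otimes> \<one>[Q']) \<cdot> \<l>[Q']\<dagger>"

end


section \<open>The CP*-construction\<close>

context
  fixes V :: "('o, 'm, 'x) dagger_smc_scheme" (structure)
    and dual :: "'o \<Rightarrow> 'o" ("_\<^sup>\<star>" [1000] 1000)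
    and \<eta> :: "'o \<Rightarrow> 'm"
    and \<epsilon> :: "'o \<Rightarrow> 'm"
begin

definition positive_dimensional :: bool where
  "positive_dimensional \<longleftrightarrow> (\<forall>X \<in> Obj V. \<exists>z. positive_definite V \<I> z \<and>
     \<l>[X] \<cdot> ((z \<cdot> z \<cdot> (\<eta> X)\<dagger> \<cdot> \<eta> X) \<otimes> \<one>[X]) \<cdot> \<l>[X]\<dagger> = \<one>[X])"

definition trace_mult :: "'o \<Rightarrow> 'm \<Rightarrow> 'm" where
  "trace_mult A m =
     \<epsilon> A \<cdot> (m \<otimes> \<one>[A\<^sup>\<star>]) \<cdot> \<a>[A, A, A\<^sup>\<star>]\<dagger> \<cdot> (\<one>[A] \<otimes> (\<s>[A\<^sup>\<star>, A] \<cdot> \<eta> A)) \<cdot> \<r>[A]\<dagger>"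

definition normalisable :: "'o \<Rightarrow> 'm \<Rightarrow> 'm \<Rightarrow> bool" where
  "normalisable A m u \<longleftrightarrow>
     (\<exists>z. central V A m z \<and> positive_definite V A z \<and> trace_mult A m \<cdot> z \<cdot> z = u\<dagger>)"

definition act :: "'o \<Rightarrow> 'm \<Rightarrow> 'm" where
  "act A m = (\<one>[A\<^sup>\<star>] \<otimes> m) \<cdot> \<a>[A\<^sup>\<star>, A, A] \<cdot> (\<eta> A \<otimes> \<one>[A]) \<cdot> \<l>[A]\<dagger>"

definition coact :: "'o \<Rightarrow> 'm \<Rightarrow> 'm" where
  "coact A m = \<l>[A] \<cdot> ((\<eta> A)\<dagger> \<otimes> \<one>[A]) \<cdot> \<a>[A\<^sup>\<star>, A, A]\<dagger> \<cdot> (\<one>[A\<^sup>\<star>] \<otimes> m\<dagger>)"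

text \<open>
  The unit \<open>\<I> \<rightarrow> (B\<^sup>\<star> \<odot> X\<^sup>\<star>) \<odot> (X \<odot> B)\<close> that exhibits \<open>B\<^sup>\<star> \<odot> X\<^sup>\<star>\<close> as a dual of \<open>X \<odot> B\<close>.
  Using it in \<open>conj_map\<close> amounts to identifying the chosen dual of \<open>X \<odot> B\<close> with
  \<open>B\<^sup>\<star> \<odot> X\<^sup>\<star>\<close>.
\<close>

definition eta_tensor :: "'o \<Rightarrow> 'o \<Rightarrow> 'm" where
  "eta_tensor X B =
     (regroup V B\<^sup>\<star> X\<^sup>\<star> X B)\<dagger> \<cdot> (\<one>[B\<^sup>\<star>] \<otimes> ((\<eta> X \<otimes> \<one>[B]) \<cdot> \<l>[B]\<dagger>)) \<cdot> \<eta> B"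

text \<open>For \<open>g : A \<rightarrow> X \<odot> B\<close>, this is \<open>g\<^sub>* = (g\<dagger>)\<^sup>* : A\<^sup>\<star> \<rightarrow> B\<^sup>\<star> \<odot> X\<^sup>\<star>\<close>.\<close>

definition conj_map :: "'o \<Rightarrow> 'o \<Rightarrow> 'o \<Rightarrow> 'm \<Rightarrow> 'm" where
  "conj_map A X B g =
     dual_map V (X \<odot> B) (B\<^sup>\<star> \<odot> X\<^sup>\<star>) (eta_tensor X B) A\<^sup>\<star> (\<epsilon> A) (g\<dagger>)"

definition cp_condition :: "'o \<Rightarrow> 'm \<Rightarrow> 'o \<Rightarrow> 'm \<Rightarrow> 'm \<Rightarrow> bool" where
  "cp_condition A m B n f \<longleftrightarrow> (\<exists>X \<in> Obj V. \<exists>g \<in> Hom V A (X \<odot> B).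
     act B n \<cdot> f \<cdot> coact A m =
       (\<one>[B\<^sup>\<star>] \<otimes> (\<l>[B] \<cdot> ((\<eta> X)\<dagger> \<otimes> \<one>[B]))) \<cdot> regroup V B\<^sup>\<star> X\<^sup>\<star> X B
         \<cdot> (conj_map A X B g \<otimes> g))"

text \<open>
  An object \<open>(A, m, u)\<close> consists of the carrier, multiplication and unit of a dagger Frobenius
  algebra; its comultiplication and counit are \<open>m\<dagger>\<close> and \<open>u\<dagger>\<close>.
\<close>

definition CPstar :: "('o \<times> 'm \<times> 'm, 'm) dagger_smc" where
  "CPstar = \<lparr>
     Obj = {(A, m, u). dagger_frobenius_algebra V A m u \<and> normalisable A m u},
     Hom = (\<lambda>(A, m, u) (B, n, v). {f \<in> Hom V A B. cp_condition A m B n f}),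
     comp_mor = comp_mor V,
     ident = (\<lambda>(A, m, u). \<one>[A]),
     tensor_obj = (\<lambda>(A, m, u) (B, n, v). (A \<odot> B, tensor_mult V A m B n, tensor_unit V u v)),
     tensor = tensor V,
     unit_obj = (\<I>, \<l>[\<I>], \<one>[\<I>]),
     associator = (\<lambda>(A, m, u) (B, n, v) (C, k, w). \<a>[A, B, C]),
     left_unitor = (\<lambda>(A, m, u). \<l>[A]),
     right_unitor = (\<lambda>(A, m, u). \<r>[A]),
     symmetry = (\<lambda>(A, m, u) (B, n, v). \<s>[A, B]),
     dagger = dagger V\<rparr>"

end

end

theory Submission
  imports Defs "HOL-Library.Multiset"
begin

text \<open>
For symmetric dagger Frobenius algebras \<open>(A, m)\<close> and \<open>(B, n)\<close>, bending the legs of type \<open>A\<^sup>*\<close> and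
\<open>B\<^sup>*\<close> of the CP*-condition by the Frobenius forms turns it into positivity of the endomorphism
\<open>H f = (1 \<otimes> n) (1 \<otimes> f \<otimes> 1) (m\<dagger> \<otimes> 1)\<close> of \<open>A \<otimes> B\<close>. A normalisable algebra is symmetric because the
trace is cyclic, and the normaliser condition becomes \<open>m m\<dagger> z z = 1\<close>. Positivity of \<open>H (g f)\<close>
follows from that of \<open>H f\<close> and \<open>H g\<close> by conjugating \<open>H f \<otimes> H g\<close> with a cup on the middle algebra in
which \<open>z\<close> has been inserted. The dual of \<open>(A, m, u)\<close> is the opposite algebra on the same object, with
unit \<open>m\<dagger> u\<close> and counit \<open>u\<dagger> m\<close>.

The equations between string diagrams are derived with nets of nodes joined along named wires. Their
denotation is a trace of a strictly commutative product, so that all coherence isomorphisms disappear.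
\<close>

section \<open>Typed arrows and coherence\<close>

text \<open>Two demands on nets shape the first half. Rewriting must be local, so that a law applies
  wherever its left side occurs, without cutting a diagram into layers; and loops must be allowed,
  since the trace of the multiplication is one. A trace meets both: a subnet may be traced out
  first, hence exchanged for any net with the same denotation, and composition is the case in which
  all joined wires run one way.

  In the composition argument the multiplications and comultiplications of the middle algebra leave
  a loop \<open>m \<cdot> m\<dagger>\<close>, which need not be an identity. A positive
  \<open>z\<close> is self-adjoint, so one \<open>z\<close> in the conjugating map contributes two
  to the conjugated product, which is what the normaliser condition pairs with that loop.

  Closure under dagger has another source: \<open>H (f\<dagger>)\<close> is the dagger of a
  transpose of \<open>H f\<close> along the Frobenius forms, and a transpose of
  \<open>k\<dagger> \<cdot> k\<close> factors through the dual \<open>X\<^sup>\<star>\<close>, where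
  the duals of the ambient category enter again.\<close>

datatype ('o, 'm) arr = Arr (dom: 'o) (mor: 'm) (cod: 'o)

context dagger_smc
begin

text \<open>Hom-sets may overlap, so a bare morphism does not determine its endpoints. Recording
  them lets the simplifier discharge the typing conditions of composites by computing
  \<open>dom\<close> and \<open>cod\<close>.\<close>

definition arrow :: "('o, 'm) arr \<Rightarrow> bool" where
  "arrow f \<longleftrightarrow> dom f \<in> Obj V \<and> cod f \<in> Obj V \<and> mor f \<in> Hom V (dom f) (cod f)"

definition cmp :: "('o, 'm) arr \<Rightarrow> ('o, 'm) arr \<Rightarrow> ('o, 'm) arr" (infixr "\<bullet>" 60) where
  "g \<bullet> f = Arr (dom f) (mor g \<cdot> mor f) (cod g)"

definition tns :: "('o, 'm) arr \<Rightarrow> ('o, 'm) arr \<Rightarrow> ('o, 'm) arr" (infixr "\<boxtimes>" 65) where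
  "f \<boxtimes> g = Arr (dom f \<odot> dom g) (mor f \<otimes> mor g) (cod f \<odot> cod g)"

definition dg :: "('o, 'm) arr \<Rightarrow> ('o, 'm) arr" where
  "dg f = Arr (cod f) ((mor f)\<dagger>) (dom f)"

definition ida :: "'o \<Rightarrow> ('o, 'm) arr" where "ida A = Arr A \<one>[A] A"
definition al :: "'o \<Rightarrow> 'o \<Rightarrow> 'o \<Rightarrow> ('o, 'm) arr" where
  "al A B C = Arr ((A \<odot> B) \<odot> C) \<a>[A, B, C] (A \<odot> (B \<odot> C))"
definition lu :: "'o \<Rightarrow> ('o, 'm) arr" where "lu A = Arr (\<I> \<odot> A) \<l>[A] A"
definition ru :: "'o \<Rightarrow> ('o, 'm) arr" where "ru A = Arr (A \<odot> \<I>) \<r>[A] A"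
definition sy :: "'o \<Rightarrow> 'o \<Rightarrow> ('o, 'm) arr" where "sy A B = Arr (A \<odot> B) \<s>[A, B] (B \<odot> A)"

lemma dom_cod [simp]:
  "dom (g \<bullet> f) = dom f" "cod (g \<bullet> f) = cod g"
  "dom (f \<boxtimes> g) = dom f \<odot> dom g" "cod (f \<boxtimes> g) = cod f \<odot> cod g"
  "dom (dg f) = cod f" "cod (dg f) = dom f"
  "dom (ida A) = A" "cod (ida A) = A"
  "dom (al A B C) = (A \<odot> B) \<odot> C" "cod (al A B C) = A \<odot> (B \<odot> C)"
  "dom (lu A) = \<I> \<odot> A" "cod (lu A) = A"
  "dom (ru A) = A \<odot> \<I>" "cod (ru A) = A"
  "dom (sy A B) = A \<odot> B" "cod (sy A B) = B \<odot> A"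
  by (simp_all add: cmp_def tns_def dg_def ida_def al_def lu_def ru_def sy_def)

lemma mor_simps:
  "mor (g \<bullet> f) = mor g \<cdot> mor f" "mor (f \<boxtimes> g) = mor f \<otimes> mor g" "mor (dg f) = (mor f)\<dagger>"
  "mor (ida A) = \<one>[A]" "mor (al A B C) = \<a>[A, B, C]" "mor (lu A) = \<l>[A]" "mor (ru A) = \<r>[A]"
  "mor (sy A B) = \<s>[A, B]"
  by (simp_all add: cmp_def tns_def dg_def ida_def al_def lu_def ru_def sy_def)

declare unit_obj_in_Obj [simp] tensor_obj_in_Obj [simp]

lemma arrow_obj [simp]: "arrow f \<Longrightarrow> dom f \<in> Obj V" "arrow f \<Longrightarrow> cod f \<in> Obj V"
  by (simp_all add: arrow_def)

lemma arrow_cmp [simp]: "arrow f \<Longrightarrow> arrow g \<Longrightarrow> dom g = cod f \<Longrightarrow> arrow (g \<bullet> f)"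
  unfolding arrow_def by (auto simp: mor_simps intro: comp_in_Hom)
lemma arrow_tns [simp]: "arrow f \<Longrightarrow> arrow g \<Longrightarrow> arrow (f \<boxtimes> g)"
  unfolding arrow_def by (auto simp: mor_simps intro: tensor_in_Hom)
lemma arrow_dg [simp]: "arrow f \<Longrightarrow> arrow (dg f)"
  unfolding arrow_def by (auto simp: mor_simps intro: dagger_in_Hom)
lemma arrow_ida [simp]: "A \<in> Obj V \<Longrightarrow> arrow (ida A)"
  unfolding arrow_def by (auto simp: mor_simps intro: ident_in_Hom)
lemma arrow_al [simp]: "A \<in> Obj V \<Longrightarrow> B \<in> Obj V \<Longrightarrow> C \<in> Obj V \<Longrightarrow> arrow (al A B C)"
  unfolding arrow_def using associator_iso[of A B C] by (auto simp: mor_simps is_iso_def)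
lemma arrow_lu [simp]: "A \<in> Obj V \<Longrightarrow> arrow (lu A)"
  unfolding arrow_def using left_unitor_iso[of A] by (auto simp: mor_simps is_iso_def)
lemma arrow_ru [simp]: "A \<in> Obj V \<Longrightarrow> arrow (ru A)"
  unfolding arrow_def using right_unitor_iso[of A] by (auto simp: mor_simps is_iso_def)
lemma arrow_sy [simp]: "A \<in> Obj V \<Longrightarrow> B \<in> Obj V \<Longrightarrow> arrow (sy A B)"
  unfolding arrow_def using symmetry_in_Hom[of A B] by (auto simp: mor_simps)

lemma arr_eqI: "dom f = dom g \<Longrightarrow> cod f = cod g \<Longrightarrow> mor f = mor g \<Longrightarrow> f = g"
  by (cases f, cases g) auto

lemma assoc_cmp [simp]:
  assumes "arrow f" "arrow g" "arrow h" "dom g = cod f" "dom h = cod g"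
  shows "(h \<bullet> g) \<bullet> f = h \<bullet> (g \<bullet> f)"
proof (rule arr_eqI)
  have "(mor h \<cdot> mor g) \<cdot> mor f = mor h \<cdot> (mor g \<cdot> mor f)"
    by (rule comp_assoc[of "dom f" "cod f" "cod g" "cod h"]) (use assms in \<open>simp_all add: arrow_def del: arrow_obj\<close>)
  then show "mor ((h \<bullet> g) \<bullet> f) = mor (h \<bullet> (g \<bullet> f))" by (simp add: mor_simps)
qed simp_all
lemma ida_l [simp]: "arrow f \<Longrightarrow> cod f = B \<Longrightarrow> ida B \<bullet> f = f"
  by (rule arr_eqI) (auto simp: mor_simps arrow_def simp del: arrow_obj intro: ident_comp)
lemma ida_r [simp]: "arrow f \<Longrightarrow> dom f = A \<Longrightarrow> f \<bullet> ida A = f"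
  by (rule arr_eqI) (auto simp: mor_simps arrow_def simp del: arrow_obj intro: comp_ident)
lemma tns_ida [simp]: "A \<in> Obj V \<Longrightarrow> B \<in> Obj V \<Longrightarrow> ida A \<boxtimes> ida B = ida (A \<odot> B)"
  by (rule arr_eqI) (auto simp: mor_simps intro: tensor_ident)
lemma tns_cmp:
  assumes "arrow f" "arrow g" "arrow f'" "arrow g'" "dom g = cod f" "dom g' = cod f'"
  shows "(g \<boxtimes> g') \<bullet> (f \<boxtimes> f') = (g \<bullet> f) \<boxtimes> (g' \<bullet> f')"
proof (rule arr_eqI)
  have "(mor g \<cdot> mor f) \<otimes> (mor g' \<cdot> mor f') = (mor g \<otimes> mor g') \<cdot> (mor f \<otimes> mor f')"
    by (rule tensor_comp[of "dom f" "cod f" "cod g" "dom f'" "cod f'" "cod g'"])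
      (use assms in \<open>simp_all add: arrow_def del: arrow_obj\<close>)
  then show "mor ((g \<boxtimes> g') \<bullet> (f \<boxtimes> f')) = mor ((g \<bullet> f) \<boxtimes> (g' \<bullet> f'))" by (simp add: mor_simps)
qed (use assms in simp_all)
lemma tns_cmp_assoc:
  "arrow f \<Longrightarrow> arrow g \<Longrightarrow> arrow f' \<Longrightarrow> arrow g' \<Longrightarrow> arrow h \<Longrightarrow> dom g = cod f \<Longrightarrow> dom g' = cod f' \<Longrightarrow>
   cod h = dom f \<odot> dom f' \<Longrightarrow>
   (g \<boxtimes> g') \<bullet> (f \<boxtimes> f') \<bullet> h = ((g \<bullet> f) \<boxtimes> (g' \<bullet> f')) \<bullet> h"
  by (subst assoc_cmp[symmetric]) (simp_all add: tns_cmp)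

lemma dg_dg [simp]: "arrow f \<Longrightarrow> dg (dg f) = f"
  by (rule arr_eqI) (auto simp: mor_simps arrow_def simp del: arrow_obj intro: dagger_dagger)
lemma dg_cmp [simp]: "arrow f \<Longrightarrow> arrow g \<Longrightarrow> dom g = cod f \<Longrightarrow> dg (g \<bullet> f) = dg f \<bullet> dg g"
  by (rule arr_eqI) (auto simp: mor_simps arrow_def simp del: arrow_obj intro: dagger_comp)
lemma dg_tns [simp]: "arrow f \<Longrightarrow> arrow g \<Longrightarrow> dg (f \<boxtimes> g) = dg f \<boxtimes> dg g"
  by (rule arr_eqI) (auto simp: mor_simps arrow_def simp del: arrow_obj intro: dagger_tensor)
lemma dg_ida [simp]: "A \<in> Obj V \<Longrightarrow> dg (ida A) = ida A"
  by (rule arr_eqI) (auto simp: mor_simps intro: dagger_ident)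

definition uni :: "('o, 'm) arr \<Rightarrow> bool" where
  "uni f \<longleftrightarrow> arrow f \<and> dg f \<bullet> f = ida (dom f) \<and> f \<bullet> dg f = ida (cod f)"

lemma uni_arrow: "uni f \<Longrightarrow> arrow f" by (simp add: uni_def)
lemma uniD: "uni f \<Longrightarrow> dg f \<bullet> f = ida (dom f)" "uni f \<Longrightarrow> f \<bullet> dg f = ida (cod f)"
  by (simp_all add: uni_def)
lemma uniD_assoc:
  "uni f \<Longrightarrow> arrow h \<Longrightarrow> cod h = dom f \<Longrightarrow> dg f \<bullet> f \<bullet> h = h"
  "uni f \<Longrightarrow> arrow h \<Longrightarrow> cod h = cod f \<Longrightarrow> f \<bullet> dg f \<bullet> h = h"
  by (simp_all flip: assoc_cmp add: uniD uni_arrow)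
lemma uniD_assoc_aux:
  "arrow f \<Longrightarrow> dg f \<bullet> f = ida (dom f) \<Longrightarrow> arrow h \<Longrightarrow> cod h = dom f \<Longrightarrow> dg f \<bullet> f \<bullet> h = h"
  "arrow f \<Longrightarrow> f \<bullet> dg f = ida (cod f) \<Longrightarrow> arrow h \<Longrightarrow> cod h = cod f \<Longrightarrow> f \<bullet> dg f \<bullet> h = h"
  by (simp_all flip: assoc_cmp)
lemma uni_dg [simp]: "uni f \<Longrightarrow> uni (dg f)" by (simp add: uni_def)
lemma uni_ida [simp]: "A \<in> Obj V \<Longrightarrow> uni (ida A)" by (simp add: uni_def)
lemma uni_cmp [simp]: "uni f \<Longrightarrow> uni g \<Longrightarrow> dom g = cod f \<Longrightarrow> uni (g \<bullet> f)"
  unfolding uni_def by (simp add: uniD_assoc_aux)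
lemma uni_tns [simp]: "uni f \<Longrightarrow> uni g \<Longrightarrow> uni (f \<boxtimes> g)"
  by (simp add: uni_def tns_cmp)
lemma uni_al [simp]: "A \<in> Obj V \<Longrightarrow> B \<in> Obj V \<Longrightarrow> C \<in> Obj V \<Longrightarrow> uni (al A B C)"
  using associator_unitary[of A B C] unfolding uni_def is_unitary_def
  by (auto intro!: arr_eqI simp: mor_simps)
lemma uni_lu [simp]: "A \<in> Obj V \<Longrightarrow> uni (lu A)"
  using left_unitor_unitary[of A] unfolding uni_def is_unitary_def
  by (auto intro!: arr_eqI simp: mor_simps)
lemma uni_ru [simp]: "A \<in> Obj V \<Longrightarrow> uni (ru A)"
  using right_unitor_unitary[of A] unfolding uni_def is_unitary_def
  by (auto intro!: arr_eqI simp: mor_simps)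
lemma uni_sy [simp]: "A \<in> Obj V \<Longrightarrow> B \<in> Obj V \<Longrightarrow> uni (sy A B)"
  using symmetry_unitary[of A B] unfolding uni_def is_unitary_def
  by (auto intro!: arr_eqI simp: mor_simps)

declare uni_arrow [simp]

lemma uni_cancel_l:
  assumes "uni h" "arrow f" "arrow g" "cod f = dom h" "cod g = dom h"
  shows "h \<bullet> f = h \<bullet> g \<longleftrightarrow> f = g"
proof
  assume "h \<bullet> f = h \<bullet> g"
  then have "dg h \<bullet> h \<bullet> f = dg h \<bullet> h \<bullet> g" by simp
  then show "f = g" using assms by (simp add: uniD_assoc)
qed simp
lemma uni_cancel_r:
  assumes "uni h" "arrow f" "arrow g" "dom f = cod h" "dom g = cod h"
  shows "f \<bullet> h = g \<bullet> h \<longleftrightarrow> f = g"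
proof
  assume "f \<bullet> h = g \<bullet> h"
  then have "(f \<bullet> h) \<bullet> dg h = (g \<bullet> h) \<bullet> dg h" by simp
  then show "f = g" using assms by (simp add: uniD)
qed simp

lemma al_nat: "arrow f \<Longrightarrow> arrow g \<Longrightarrow> arrow h \<Longrightarrow> cod f = A \<Longrightarrow> cod g = B \<Longrightarrow> cod h = C \<Longrightarrow>
  al A B C \<bullet> ((f \<boxtimes> g) \<boxtimes> h) = (f \<boxtimes> (g \<boxtimes> h)) \<bullet> al (dom f) (dom g) (dom h)"
  by (rule arr_eqI) (auto simp: mor_simps arrow_def simp del: arrow_obj intro: associator_natural)
lemma lu_nat: "arrow f \<Longrightarrow> cod f = B \<Longrightarrow> lu B \<bullet> (ida \<I> \<boxtimes> f) = f \<bullet> lu (dom f)"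
  by (rule arr_eqI) (auto simp: mor_simps arrow_def simp del: arrow_obj intro: left_unitor_natural)
lemma ru_nat: "arrow f \<Longrightarrow> cod f = B \<Longrightarrow> ru B \<bullet> (f \<boxtimes> ida \<I>) = f \<bullet> ru (dom f)"
  by (rule arr_eqI) (auto simp: mor_simps arrow_def simp del: arrow_obj intro: right_unitor_natural)
lemma sy_nat: "arrow f \<Longrightarrow> arrow g \<Longrightarrow> cod f = A \<Longrightarrow> cod g = B \<Longrightarrow>
  sy A B \<bullet> (f \<boxtimes> g) = (g \<boxtimes> f) \<bullet> sy (dom f) (dom g)"
  by (rule arr_eqI) (auto simp: mor_simps arrow_def simp del: arrow_obj intro: symmetry_natural)
lemma sy_sy: "A \<in> Obj V \<Longrightarrow> B \<in> Obj V \<Longrightarrow> sy B A \<bullet> sy A B = ida (A \<odot> B)"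
  by (rule arr_eqI) (auto simp: mor_simps intro: symmetry_involutive)
lemma sy_dg: "A \<in> Obj V \<Longrightarrow> B \<in> Obj V \<Longrightarrow> dg (sy A B) = sy B A"
  by (rule uni_cancel_r[of "sy A B", THEN iffD1]) (auto simp: sy_sy uniD)
lemma pent: "A \<in> Obj V \<Longrightarrow> B \<in> Obj V \<Longrightarrow> C \<in> Obj V \<Longrightarrow> D \<in> Obj V \<Longrightarrow>
  (ida A \<boxtimes> al B C D) \<bullet> al A (B \<odot> C) D \<bullet> (al A B C \<boxtimes> ida D) = al A B (C \<odot> D) \<bullet> al (A \<odot> B) C D"
  by (rule arr_eqI) (auto simp: mor_simps intro: pentagon)
lemma tri: "A \<in> Obj V \<Longrightarrow> B \<in> Obj V \<Longrightarrow> (ida A \<boxtimes> lu B) \<bullet> al A \<I> B = ru A \<boxtimes> ida B"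
  by (rule arr_eqI) (auto simp: mor_simps intro: triangle)
lemma hex: "A \<in> Obj V \<Longrightarrow> B \<in> Obj V \<Longrightarrow> C \<in> Obj V \<Longrightarrow>
  al B C A \<bullet> sy A (B \<odot> C) \<bullet> al A B C = (ida B \<boxtimes> sy A C) \<bullet> al B A C \<bullet> (sy A B \<boxtimes> ida C)"
  by (rule arr_eqI) (auto simp: mor_simps intro: hexagon)

section \<open>Consequences of the coherence axioms for unitors and symmetry\<close>

lemma lu_faithful:
  assumes f: "arrow f" "arrow g" and d: "dom f = dom g" "cod f = cod g"
    and e: "ida \<I> \<boxtimes> f = ida \<I> \<boxtimes> g"
  shows "f = g"
proof -
  have "f \<bullet> lu (dom f) = lu (cod g) \<bullet> (ida \<I> \<boxtimes> f)" by (rule lu_nat[symmetric, OF f(1) d(2)])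
  also have "\<dots> = g \<bullet> lu (dom g)" unfolding e by (rule lu_nat[OF f(2) refl])
  finally show ?thesis using uni_cancel_r[of "lu (dom g)" f g] f d by (simp only: d arrow_obj uni_lu dom_cod)
qed

lemma ru_faithful:
  assumes f: "arrow f" "arrow g" and d: "dom f = dom g" "cod f = cod g"
    and e: "f \<boxtimes> ida \<I> = g \<boxtimes> ida \<I>"
  shows "f = g"
proof -
  have "f \<bullet> ru (dom f) = ru (cod g) \<bullet> (f \<boxtimes> ida \<I>)" by (rule ru_nat[symmetric, OF f(1) d(2)])
  also have "\<dots> = g \<bullet> ru (dom g)" unfolding e by (rule ru_nat[OF f(2) refl])
  finally show ?thesis using uni_cancel_r[of "ru (dom g)" f g] f d by (simp only: d arrow_obj uni_ru dom_cod)
qed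

text \<open>Kelly's argument: after tensoring with the unit on the left, the pentagon at
  \<open>\<I>\<close>, \<open>\<I>\<close>, \<open>A\<close>, \<open>B\<close> and two triangles
  give the equation up to the unitary \<open>?k\<close>; faithfulness removes the extra
  unit.\<close>

lemma lu_tensor:
  assumes [simp]: "A \<in> Obj V" "B \<in> Obj V"
  shows "lu (A \<odot> B) \<bullet> al \<I> A B = lu A \<boxtimes> ida B"
proof (rule lu_faithful)
  let ?i = "ida \<I>"
  let ?k = "al \<I> (\<I> \<odot> A) B \<bullet> (al \<I> \<I> A \<boxtimes> ida B)"
  have "(?i \<boxtimes> (lu (A \<odot> B) \<bullet> al \<I> A B)) \<bullet> ?k = (?i \<boxtimes> lu (A \<odot> B)) \<bullet> (?i \<boxtimes> al \<I> A B) \<bullet> ?k"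
    by (simp add: tns_cmp_assoc)
  also have "\<dots> = (?i \<boxtimes> lu (A \<odot> B)) \<bullet> al \<I> \<I> (A \<odot> B) \<bullet> al (\<I> \<odot> \<I>) A B"
    by (simp add: pent)
  also have "\<dots> = ((?i \<boxtimes> lu (A \<odot> B)) \<bullet> al \<I> \<I> (A \<odot> B)) \<bullet> al (\<I> \<odot> \<I>) A B" by simp
  also have "\<dots> = (ru \<I> \<boxtimes> (ida A \<boxtimes> ida B)) \<bullet> al (\<I> \<odot> \<I>) A B" by (subst tri) simp_all
  also have "\<dots> = al \<I> A B \<bullet> ((ru \<I> \<boxtimes> ida A) \<boxtimes> ida B)" by (subst al_nat) simp_all
  also have "\<dots> = al \<I> A B \<bullet> (((?i \<boxtimes> lu A) \<bullet> al \<I> \<I> A) \<boxtimes> (ida B \<bullet> ida B))"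
    using tri[of \<I> A] by simp
  also have "\<dots> = al \<I> A B \<bullet> ((?i \<boxtimes> lu A) \<boxtimes> ida B) \<bullet> (al \<I> \<I> A \<boxtimes> ida B)"
    by (subst tns_cmp[symmetric]) simp_all
  also have "\<dots> = (al \<I> A B \<bullet> ((?i \<boxtimes> lu A) \<boxtimes> ida B)) \<bullet> (al \<I> \<I> A \<boxtimes> ida B)" by simp
  also have "\<dots> = (?i \<boxtimes> (lu A \<boxtimes> ida B)) \<bullet> ?k" by (subst al_nat) simp_all
  finally show "?i \<boxtimes> (lu (A \<odot> B) \<bullet> al \<I> A B) = ?i \<boxtimes> (lu A \<boxtimes> ida B)"
    using uni_cancel_r[of ?k "?i \<boxtimes> (lu (A \<odot> B) \<bullet> al \<I> A B)" "?i \<boxtimes> (lu A \<boxtimes> ida B)"] by simp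
qed simp_all

text \<open>The mirror image of \<open>lu_tensor\<close>, with the pentagon at \<open>A\<close>,
  \<open>B\<close>, \<open>\<I>\<close>, \<open>\<I>\<close>.\<close>

lemma ru_tensor:
  assumes [simp]: "A \<in> Obj V" "B \<in> Obj V"
  shows "(ida A \<boxtimes> ru B) \<bullet> al A B \<I> = ru (A \<odot> B)"
proof (rule ru_faithful)
  let ?i = "ida \<I>"
  have "al A B \<I> \<bullet> (((ida A \<boxtimes> ru B) \<bullet> al A B \<I>) \<boxtimes> (?i \<bullet> ?i))
      = al A B \<I> \<bullet> ((ida A \<boxtimes> ru B) \<boxtimes> ?i) \<bullet> (al A B \<I> \<boxtimes> ?i)"
    by (subst tns_cmp[symmetric]) simp_all
  also have "\<dots> = (al A B \<I> \<bullet> ((ida A \<boxtimes> ru B) \<boxtimes> ?i)) \<bullet> (al A B \<I> \<boxtimes> ?i)" by simp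
  also have "\<dots> = ((ida A \<boxtimes> (ru B \<boxtimes> ?i)) \<bullet> al A (B \<odot> \<I>) \<I>) \<bullet> (al A B \<I> \<boxtimes> ?i)"
    by (subst al_nat) simp_all
  also have "\<dots> = ((ida A \<bullet> ida A) \<boxtimes> ((ida B \<boxtimes> lu \<I>) \<bullet> al B \<I> \<I>)) \<bullet> al A (B \<odot> \<I>) \<I> \<bullet> (al A B \<I> \<boxtimes> ?i)"
    using tri[of B \<I>] by simp
  also have "\<dots> = (ida A \<boxtimes> (ida B \<boxtimes> lu \<I>)) \<bullet> (ida A \<boxtimes> al B \<I> \<I>) \<bullet> al A (B \<odot> \<I>) \<I> \<bullet> (al A B \<I> \<boxtimes> ?i)"
    by (subst tns_cmp[symmetric]) simp_all
  also have "\<dots> = (ida A \<boxtimes> (ida B \<boxtimes> lu \<I>)) \<bullet> al A B (\<I> \<odot> \<I>) \<bullet> al (A \<odot> B) \<I> \<I>"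
    by (subst pent) simp_all
  also have "\<dots> = ((ida A \<boxtimes> (ida B \<boxtimes> lu \<I>)) \<bullet> al A B (\<I> \<odot> \<I>)) \<bullet> al (A \<odot> B) \<I> \<I>" by simp
  also have "\<dots> = (al A B \<I> \<bullet> ((ida A \<boxtimes> ida B) \<boxtimes> lu \<I>)) \<bullet> al (A \<odot> B) \<I> \<I>"
    by (subst al_nat) simp_all
  also have "\<dots> = al A B \<I> \<bullet> ((ida (A \<odot> B) \<boxtimes> lu \<I>) \<bullet> al (A \<odot> B) \<I> \<I>)" by simp
  also have "\<dots> = al A B \<I> \<bullet> (ru (A \<odot> B) \<boxtimes> ?i)" by (subst tri) simp_all
  finally show "((ida A \<boxtimes> ru B) \<bullet> al A B \<I>) \<boxtimes> ?i = ru (A \<odot> B) \<boxtimes> ?i"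
    using uni_cancel_l[of "al A B \<I>" "((ida A \<boxtimes> ru B) \<bullet> al A B \<I>) \<boxtimes> ?i" "ru (A \<odot> B) \<boxtimes> ?i"] by simp
qed simp_all

text \<open>Naturality of the unitor at itself identifies \<open>lu (\<I> \<odot> \<I>)\<close> with
  \<open>ida \<I> \<boxtimes> lu \<I>\<close>; then \<open>lu_tensor\<close> and the triangle have
  the same left side.\<close>

lemma lu_unit: "lu \<I> = ru \<I>"
proof (rule ru_faithful)
  have "lu \<I> \<bullet> lu (\<I> \<odot> \<I>) = lu \<I> \<bullet> (ida \<I> \<boxtimes> lu \<I>)"
    by (subst lu_nat[of "lu \<I>" \<I>]) simp_all
  then have "lu (\<I> \<odot> \<I>) = ida \<I> \<boxtimes> lu \<I>"
    using uni_cancel_l[of "lu \<I>" "lu (\<I> \<odot> \<I>)" "ida \<I> \<boxtimes> lu \<I>"] by simp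
  then show "lu \<I> \<boxtimes> ida \<I> = ru \<I> \<boxtimes> ida \<I>"
    using lu_tensor[of \<I> \<I>] tri[of \<I> \<I>] by simp
qed simp_all

text \<open>The hexagon at \<open>A\<close>, \<open>\<I>\<close>, \<open>\<I>\<close>, followed by
  unitors, reads \<open>?h \<bullet> (ru A \<boxtimes> ?i) = ?h \<bullet> (?h \<boxtimes>
  ?i)\<close>, and the unitary \<open>?h\<close> cancels.\<close>

lemma lu_sy:
  assumes [simp]: "A \<in> Obj V"
  shows "lu A \<bullet> sy A \<I> = ru A"
proof (rule ru_faithful)
  let ?i = "ida \<I>" let ?h = "lu A \<bullet> sy A \<I>"
  have "lu A \<bullet> (?i \<boxtimes> lu A) \<bullet> al \<I> \<I> A \<bullet> sy A (\<I> \<odot> \<I>) \<bullet> al A \<I> \<I>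
      = lu A \<bullet> (?i \<boxtimes> lu A) \<bullet> (?i \<boxtimes> sy A \<I>) \<bullet> al \<I> A \<I> \<bullet> (sy A \<I> \<boxtimes> ?i)"
    by (simp add: hex)
  moreover have "lu A \<bullet> (?i \<boxtimes> lu A) \<bullet> al \<I> \<I> A \<bullet> sy A (\<I> \<odot> \<I>) \<bullet> al A \<I> \<I> = ?h \<bullet> (ru A \<boxtimes> ?i)"
  proof -
    have "lu A \<bullet> (?i \<boxtimes> lu A) \<bullet> al \<I> \<I> A \<bullet> sy A (\<I> \<odot> \<I>) \<bullet> al A \<I> \<I>
        = lu A \<bullet> ((?i \<boxtimes> lu A) \<bullet> al \<I> \<I> A) \<bullet> sy A (\<I> \<odot> \<I>) \<bullet> al A \<I> \<I>" by simp
    also have "\<dots> = lu A \<bullet> (lu \<I> \<boxtimes> ida A) \<bullet> sy A (\<I> \<odot> \<I>) \<bullet> al A \<I> \<I>"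
      by (simp add: tri lu_unit)
    also have "\<dots> = lu A \<bullet> ((lu \<I> \<boxtimes> ida A) \<bullet> sy A (\<I> \<odot> \<I>)) \<bullet> al A \<I> \<I>" by simp
    also have "\<dots> = lu A \<bullet> (sy A \<I> \<bullet> (ida A \<boxtimes> lu \<I>)) \<bullet> al A \<I> \<I>" by (subst sy_nat) simp_all
    also have "\<dots> = ?h \<bullet> ((ida A \<boxtimes> lu \<I>) \<bullet> al A \<I> \<I>)" by simp
    also have "\<dots> = ?h \<bullet> (ru A \<boxtimes> ?i)" by (subst tri) simp_all
    finally show ?thesis .
  qed
  moreover have "lu A \<bullet> (?i \<boxtimes> lu A) \<bullet> (?i \<boxtimes> sy A \<I>) \<bullet> al \<I> A \<I> \<bullet> (sy A \<I> \<boxtimes> ?i) = ?h \<bullet> (?h \<boxtimes> ?i)"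
  proof -
    have "lu A \<bullet> (?i \<boxtimes> lu A) \<bullet> (?i \<boxtimes> sy A \<I>) \<bullet> al \<I> A \<I> \<bullet> (sy A \<I> \<boxtimes> ?i)
      = (lu A \<bullet> (?i \<boxtimes> ?h)) \<bullet> al \<I> A \<I> \<bullet> (sy A \<I> \<boxtimes> ?i)" by (simp add: tns_cmp_assoc)
    also have "\<dots> = (?h \<bullet> lu (A \<odot> \<I>)) \<bullet> al \<I> A \<I> \<bullet> (sy A \<I> \<boxtimes> ?i)"
      by (subst lu_nat[of ?h A]) simp_all
    also have "\<dots> = ?h \<bullet> (lu (A \<odot> \<I>) \<bullet> al \<I> A \<I>) \<bullet> (sy A \<I> \<boxtimes> ?i)" by simp
    also have "\<dots> = ?h \<bullet> (lu A \<boxtimes> ?i) \<bullet> (sy A \<I> \<boxtimes> ?i)" by (simp add: lu_tensor)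
    also have "\<dots> = ?h \<bullet> (?h \<boxtimes> ?i)" by (simp add: tns_cmp)
    finally show ?thesis .
  qed
  ultimately show "?h \<boxtimes> ?i = ru A \<boxtimes> ?i"
    using uni_cancel_l[of ?h "?h \<boxtimes> ?i" "ru A \<boxtimes> ?i"] by simp
qed simp_all

text \<open>Only one hexagon is an axiom. Its dagger is the other one, because the dagger of a
  symmetry is the opposite symmetry; expanding \<open>sy (A \<odot> B) C\<close> by the second and
  contracting by the first gives the braid relation.\<close>

lemma yang_baxter:
  assumes [simp]: "A \<in> Obj V" "B \<in> Obj V" "C \<in> Obj V"
  shows "(ida C \<boxtimes> sy A B) \<bullet> sy (A \<odot> B) C = al C B A \<bullet> (sy B C \<boxtimes> ida A) \<bullet> sy A (B \<odot> C) \<bullet> al A B C"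
proof -
  have "dg (al A B C \<bullet> sy C (A \<odot> B) \<bullet> al C A B) = dg ((ida A \<boxtimes> sy C B) \<bullet> al A C B \<bullet> (sy C A \<boxtimes> ida B))"
    by (simp only: hex assms)
  then have d: "dg (al C A B) \<bullet> sy (A \<odot> B) C \<bullet> dg (al A B C) = (sy A C \<boxtimes> ida B) \<bullet> dg (al A C B) \<bullet> (ida A \<boxtimes> sy B C)"
    by (simp add: sy_dg)
  have "sy (A \<odot> B) C = al C A B \<bullet> (dg (al C A B) \<bullet> sy (A \<odot> B) C \<bullet> dg (al A B C)) \<bullet> al A B C"
    by (simp add: uniD uniD_assoc)
  also have "\<dots> = al C A B \<bullet> (sy A C \<boxtimes> ida B) \<bullet> dg (al A C B) \<bullet> (ida A \<boxtimes> sy B C) \<bullet> al A B C"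
    by (simp add: d)
  finally have "(ida C \<boxtimes> sy A B) \<bullet> sy (A \<odot> B) C
      = ((ida C \<boxtimes> sy A B) \<bullet> al C A B \<bullet> (sy A C \<boxtimes> ida B)) \<bullet> dg (al A C B) \<bullet> (ida A \<boxtimes> sy B C) \<bullet> al A B C"
    by simp
  also have "\<dots> = (al C B A \<bullet> sy A (C \<odot> B) \<bullet> al A C B) \<bullet> dg (al A C B) \<bullet> (ida A \<boxtimes> sy B C) \<bullet> al A B C"
    by (subst hex) simp_all
  also have "\<dots> = al C B A \<bullet> (sy A (C \<odot> B) \<bullet> (ida A \<boxtimes> sy B C)) \<bullet> al A B C"
    by (simp add: uniD_assoc)
  also have "\<dots> = al C B A \<bullet> ((sy B C \<boxtimes> ida A) \<bullet> sy A (B \<odot> C)) \<bullet> al A B C"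
    by (subst sy_nat) simp_all
  finally show ?thesis by simp
qed

end

section \<open>Named wires\<close>

text \<open>A wire is a named occurrence of an object; the flag set to True stands for the dual object
and occurs only inside the trace of the section on nets.\<close>

type_synonym 'o wire = "'o \<times> nat \<times> bool"

text \<open>An arbitrary well-order, which picks one enumeration for each finite set of wires. The tensor
product of arrows between sets of wires thereby becomes strictly associative and commutative.\<close>

definition wle :: "'o wire \<Rightarrow> 'o wire \<Rightarrow> bool" where
  "wle x y \<longleftrightarrow> (x, y) \<in> (SOME r. Well_order r \<and> Field r = UNIV)"

definition wlt :: "'o wire \<Rightarrow> 'o wire \<Rightarrow> bool" where
  "wlt x y \<longleftrightarrow> wle x y \<and> x \<noteq> y"

interpretation wo: linorder "wle :: 'o wire \<Rightarrow> _" wlt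
proof -
  define r where "r = (SOME r. Well_order r \<and> Field r = (UNIV :: 'o wire set))"
  have w: "Well_order r \<and> Field r = UNIV"
    unfolding r_def by (rule someI_ex[OF well_ordering])
  then have "linear_order r" by (metis well_order_on_def)
  then have *: "refl r" "trans r" "antisym r" "total r"
    by (auto simp: linear_order_on_def partial_order_on_def preorder_on_def)
  have le: "wle x y \<longleftrightarrow> (x, y) \<in> r" for x y unfolding wle_def r_def ..
  show "class.linorder (wle :: 'o wire \<Rightarrow> _) wlt"
  proof (unfold_locales, unfold wlt_def le)
    fix x y z
    show 1: "(x, x) \<in> r" using *(1) by (metis UNIV_I refl_onD)
    show "(x, y) \<in> r \<Longrightarrow> (y, z) \<in> r \<Longrightarrow> (x, z) \<in> r" using *(2) by (metis transD)
    show 2: "(x, y) \<in> r \<Longrightarrow> (y, x) \<in> r \<Longrightarrow> x = y" using *(3) by (metis antisymD)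
    show "(x, y) \<in> r \<and> x \<noteq> y \<longleftrightarrow> (x, y) \<in> r \<and> (y, x) \<notin> r" using 1 2 by metis
    show "(x, y) \<in> r \<or> (y, x) \<in> r" using *(4) 1 by (metis UNIV_I total_on_def)
  qed
qed

abbreviation slist :: "'o wire set \<Rightarrow> 'o wire list" where "slist \<equiv> wo.sorted_list_of_set"

definition sd :: "'o wire list \<Rightarrow> bool" where "sd l \<longleftrightarrow> wo.sorted l \<and> distinct l"

lemma sd_slist [simp]: "sd (slist S)" by (simp add: sd_def)
lemma sd_Cons: "sd (x # l) \<longleftrightarrow> (\<forall>y\<in>set l. wlt x y) \<and> sd l"
  by (auto simp: sd_def wlt_def)
lemma sd_less: "sd (y # l) \<Longrightarrow> wlt x y \<Longrightarrow> \<forall>w\<in>set (y # l). wlt x w"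
  by (metis sd_Cons set_ConsD wo.less_trans)
lemma slist_unique: "sd l \<Longrightarrow> slist (set l) = l"
  by (simp add: sd_def wo.sorted_list_of_set_sort_remdups wo.sorted_sort_id distinct_remdups_id)
lemma slist_Cons: "finite S \<Longrightarrow> \<forall>y\<in>S. wlt x y \<Longrightarrow> slist (insert x S) = x # slist S"
  using slist_unique[of "x # slist S"] by (simp add: sd_Cons)

context dagger_compact
begin

fun wob :: "'o wire \<Rightarrow> 'o" where "wob (A, i, p) = (if p then A\<^sup>\<star> else A)"

definition wok :: "'o wire set \<Rightarrow> bool" where "wok S \<longleftrightarrow> finite S \<and> fst ` S \<subseteq> Obj V"

lemma dual_in_Obj [simp]: "A \<in> Obj V \<Longrightarrow> A\<^sup>\<star> \<in> Obj V"
  using dual by (auto simp: dagger_dual_def)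

lemma wok_simps [simp]: "wok {}" "wok (insert x S) \<longleftrightarrow> fst x \<in> Obj V \<and> wok S"
  "wok (S \<union> T) \<longleftrightarrow> wok S \<and> wok T" "wok S \<Longrightarrow> finite S" "wok S \<Longrightarrow> wok (S - T)"
  "wok S \<Longrightarrow> wok (S \<inter> T)" "wok S \<Longrightarrow> wok (T \<inter> S)"
  by (auto simp: wok_def)

fun obl :: "'o wire list \<Rightarrow> 'o" where
  "obl [] = \<I>"
| "obl (x # l) = wob x \<odot> obl l"

lemma wob_Obj: "fst x \<in> Obj V \<Longrightarrow> wob x \<in> Obj V" by (cases x) auto
lemma obl_Obj: "wok (set l) \<Longrightarrow> obl l \<in> Obj V" by (induction l) (auto intro: wob_Obj)

text \<open>The structural isomorphism that merges two sorted lists of wires. The last branch goes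
through the symmetry, so that commutativity needs no induction.\<close>

function mu :: "'o wire list \<Rightarrow> 'o wire list \<Rightarrow> ('o, 'm) arr" where
  "mu [] b = lu (obl b)"
| "mu (x # a) [] = ru (obl (x # a))"
| "mu (x # a) (y # b) =
    (if wlt x y then (ida (wob x) \<boxtimes> mu a (y # b)) \<bullet> al (wob x) (obl a) (obl (y # b))
     else ((ida (wob y) \<boxtimes> mu b (x # a)) \<bullet> al (wob y) (obl b) (obl (x # a))) \<bullet> sy (obl (x # a)) (obl (y # b)))"
  by pat_completeness auto
termination by (relation "measure (\<lambda>(a, b). length a + length b)") auto

text \<open>Defined through the set of names and not by recursion along \<open>mu\<close>, so that
  commutativity and associativity are those of union.\<close>

definition mg :: "'o wire list \<Rightarrow> 'o wire list \<Rightarrow> 'o wire list" where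
  "mg a b = slist (set a \<union> set b)"

lemma mg_Cons: "sd (x # a) \<Longrightarrow> \<forall>y\<in>set b. wlt x y \<Longrightarrow> mg (x # a) b = x # mg a b"
  unfolding mg_def by (simp add: sd_Cons slist_Cons ball_Un del: wo.sorted_list_of_set_insert_remove)
lemma mg_comm: "mg a b = mg b a" by (simp add: mg_def Un_commute)
lemma mg_Nil [simp]: "sd b \<Longrightarrow> mg [] b = b" "sd b \<Longrightarrow> mg b [] = b"
  by (simp_all add: mg_def slist_unique)
lemma set_mg [simp]: "set (mg a b) = set a \<union> set b" by (simp add: mg_def)
lemma sd_mg [simp]: "sd (mg a b)" by (simp add: mg_def)
abbreviation good2 :: "'o wire list \<Rightarrow> 'o wire list \<Rightarrow> bool" where
  "good2 a b \<equiv> sd a \<and> sd b \<and> set a \<inter> set b = {} \<and> wok (set a) \<and> wok (set b)"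

lemma uni_mu: "good2 a b \<Longrightarrow> uni (mu a b) \<and> dom (mu a b) = obl a \<odot> obl b \<and> cod (mu a b) = obl (mg a b)"
proof (induction a b rule: mu.induct)
  case (3 x a y b)
  then have *: "sd a" "sd b" "wok (set a)" "wok (set b)" "set a \<inter> set b = {}" "x \<noteq> y"
    "fst x \<in> Obj V" "fst y \<in> Obj V" "y \<notin> set a" "x \<notin> set b"
    by (auto simp: sd_Cons)
  show ?case
  proof (cases "wlt x y")
    case True
    then have m: "mg (x # a) (y # b) = x # mg a (y # b)"
      using 3(3) by (intro mg_Cons) (auto simp: sd_Cons dest: wo.less_trans)
    then show ?thesis using 3 True * by (simp add: obl_Obj wob_Obj)
  next
    case False
    then have yx: "wlt y x" using * wo.neq_iff by blast
    then have m: "mg (x # a) (y # b) = y # mg b (x # a)"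
      using 3(3) by (subst mg_comm, intro mg_Cons) (auto simp: sd_Cons dest: wo.less_trans)
    have "good2 b (x # a)" using 3(3) by (auto simp: sd_Cons)
    then show ?thesis using 3(2)[OF False] False * m by (simp add: obl_Obj wob_Obj)
  qed
qed (simp_all add: obl_Obj wob_Obj)

lemma mu_simps [simp]: "good2 a b \<Longrightarrow> uni (mu a b)" "good2 a b \<Longrightarrow> arrow (mu a b)"
  "good2 a b \<Longrightarrow> dom (mu a b) = obl a \<odot> obl b" "good2 a b \<Longrightarrow> cod (mu a b) = obl (mg a b)"
  using uni_mu[of a b] by simp_all

text \<open>For two nonempty lists the two orders unfold to different branches of \<open>mu\<close>,
  and the second branch is by definition the first one with the roles exchanged, composed with the
  symmetry. Involutivity does the rest.\<close>

lemma mu_comm: assumes "good2 a b" shows "mu b a \<bullet> sy (obl a) (obl b) = mu a b"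
proof (cases a)
  case Nil
  have "lu (obl b) \<bullet> sy (obl b) \<I> \<bullet> sy \<I> (obl b) = ru (obl b) \<bullet> sy \<I> (obl b)"
    using lu_sy[of "obl b"] assms by (simp flip: assoc_cmp add: obl_Obj)
  then have "ru (obl b) \<bullet> sy \<I> (obl b) = lu (obl b)" using assms by (simp add: sy_sy obl_Obj)
  then show ?thesis using Nil by (cases b) (simp_all add: lu_sy lu_unit)
next
  case (Cons x a')
  show ?thesis
  proof (cases b)
    case Nil then show ?thesis using assms Cons by (simp add: lu_sy obl_Obj wob_Obj)
  next
    case b: (Cons y b')
    from assms have xy: "x \<noteq> y" unfolding Cons b by auto
    note o = obl_Obj wob_Obj
    have "sd a'" "sd b'" "good2 a' b" "good2 b' a" using assms unfolding Cons b by (auto simp: sd_Cons)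
    note g = this[unfolded Cons b]
    show ?thesis
    proof (cases "wlt x y")
      case True
      then have "\<not> wlt y x" using wo.less_asym by blast
      then show ?thesis using True assms g unfolding Cons b by (simp add: o sy_sy)
    next
      case False
      then have "wlt y x" using xy wo.neq_iff by blast
      then show ?thesis using False assms g unfolding Cons b by (simp add: o)
    qed
  qed
qed

text \<open>The first branch of \<open>mu\<close>, extended to an empty \<open>b\<close>, where
  \<open>ru_tensor\<close> takes the place of the recursion.\<close>

lemma mu_min:
  assumes "good2 (x # a) b" "\<forall>y\<in>set b. wlt x y"
  shows "mu (x # a) b = (ida (wob x) \<boxtimes> mu a b) \<bullet> al (wob x) (obl a) (obl b)"
proof (cases b)
  case Nil
  have "mu a [] = ru (obl a)" by (cases a) (simp_all add: lu_unit)
  then show ?thesis using assms Nil ru_tensor[of "wob x" "obl a"] by (simp add: obl_Obj wob_Obj)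
next
  case (Cons y b') then show ?thesis using assms by simp
qed

abbreviation good3 :: "'o wire list \<Rightarrow> 'o wire list \<Rightarrow> 'o wire list \<Rightarrow> bool" where
  "good3 a b c \<equiv> sd a \<and> sd b \<and> sd c \<and> set a \<inter> set b = {} \<and> set a \<inter> set c = {} \<and> set b \<inter> set c = {} \<and>
    wok (set a) \<and> wok (set b) \<and> wok (set c)"

definition mu_as :: "'o wire list \<Rightarrow> 'o wire list \<Rightarrow> 'o wire list \<Rightarrow> bool" where
  "mu_as a b c \<longleftrightarrow> mu (mg a b) c \<bullet> (mu a b \<boxtimes> ida (obl c))
     = mu a (mg b c) \<bullet> (ida (obl a) \<boxtimes> mu b c) \<bullet> al (obl a) (obl b) (obl c)"

text \<open>Commutativity of \<open>mu\<close> turns both sides into the two bracketings of the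
  reversed triple; the permutations left over agree by \<open>yang_baxter\<close>.\<close>

lemma mu_as_rev:
  assumes g: "good3 a b c" and r: "mu_as c b a"
  shows "mu_as a b c"
proof -
  have [simp]: "obl a \<in> Obj V" "obl b \<in> Obj V" "obl c \<in> Obj V"
    using g by (simp_all add: obl_Obj)
  have s1: "good2 a b" "good2 b a" "good2 b c" "good2 c b" "good2 (mg a b) c" "good2 c (mg a b)"
    "good2 a (mg b c)" "good2 (mg b c) a" "good2 (mg c b) a" "good2 c (mg b a)"
    using g by auto
  note [simp] = mg_comm[of b a] mg_comm[of c b]
  have "mu (mg a b) c \<bullet> (mu a b \<boxtimes> ida (obl c))
    = (mu c (mg a b) \<bullet> sy (obl (mg a b)) (obl c)) \<bullet> (mu a b \<boxtimes> ida (obl c))"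
    using mu_comm[OF s1(5)] by simp
  also have "\<dots> = mu c (mg a b) \<bullet> (sy (obl (mg a b)) (obl c) \<bullet> (mu a b \<boxtimes> ida (obl c)))"
    using s1 by (simp add: obl_Obj)
  also have "\<dots> = mu c (mg a b) \<bullet> (ida (obl c) \<boxtimes> (mu b a \<bullet> sy (obl a) (obl b))) \<bullet> sy (obl a \<odot> obl b) (obl c)"
    using s1 by (simp add: sy_nat mu_comm)
  also have "\<dots> = mu c (mg a b) \<bullet> (ida (obl c) \<boxtimes> mu b a) \<bullet> (ida (obl c) \<boxtimes> sy (obl a) (obl b)) \<bullet> sy (obl a \<odot> obl b) (obl c)"
    using s1 by (simp add: tns_cmp_assoc)
  also have "\<dots> = mu c (mg a b) \<bullet> (ida (obl c) \<boxtimes> mu b a) \<bullet> al (obl c) (obl b) (obl a) \<bullet>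
      (sy (obl b) (obl c) \<boxtimes> ida (obl a)) \<bullet> sy (obl a) (obl b \<odot> obl c) \<bullet> al (obl a) (obl b) (obl c)"
    by (simp add: yang_baxter)
  also have "\<dots> = (mu c (mg b a) \<bullet> (ida (obl c) \<boxtimes> mu b a) \<bullet> al (obl c) (obl b) (obl a)) \<bullet>
      (sy (obl b) (obl c) \<boxtimes> ida (obl a)) \<bullet> sy (obl a) (obl b \<odot> obl c) \<bullet> al (obl a) (obl b) (obl c)"
    using s1 by simp
  also have "\<dots> = (mu (mg c b) a \<bullet> (mu c b \<boxtimes> ida (obl a))) \<bullet>
      (sy (obl b) (obl c) \<boxtimes> ida (obl a)) \<bullet> sy (obl a) (obl b \<odot> obl c) \<bullet> al (obl a) (obl b) (obl c)"
    using r unfolding mu_as_def by simp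
  also have "\<dots> = mu (mg b c) a \<bullet> ((mu c b \<bullet> sy (obl b) (obl c)) \<boxtimes> ida (obl a)) \<bullet> sy (obl a) (obl b \<odot> obl c)
      \<bullet> al (obl a) (obl b) (obl c)"
    using s1 by (simp add: tns_cmp_assoc obl_Obj)
  also have "\<dots> = mu (mg b c) a \<bullet> ((mu b c \<boxtimes> ida (obl a)) \<bullet> sy (obl a) (obl b \<odot> obl c)) \<bullet> al (obl a) (obl b) (obl c)"
    using s1 by (simp add: mu_comm obl_Obj)
  also have "\<dots> = mu (mg b c) a \<bullet> (sy (obl a) (obl (mg b c)) \<bullet> (ida (obl a) \<boxtimes> mu b c)) \<bullet> al (obl a) (obl b) (obl c)"
    using s1 by (subst sy_nat) (simp_all add: obl_Obj)
  also have "\<dots> = (mu (mg b c) a \<bullet> sy (obl a) (obl (mg b c))) \<bullet> (ida (obl a) \<boxtimes> mu b c) \<bullet> al (obl a) (obl b) (obl c)"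
    using s1 by (simp add: obl_Obj)
  also have "\<dots> = mu a (mg b c) \<bullet> (ida (obl a) \<boxtimes> mu b c) \<bullet> al (obl a) (obl b) (obl c)"
    using mu_comm[OF s1(7)] by simp
  finally show ?thesis unfolding mu_as_def .
qed

text \<open>Moving \<open>b\<close> to the front on the left side and then past \<open>c\<close>
  costs two instances of associativity, and the permutations involved are those of the
  hexagon.\<close>

lemma mu_as_swap:
  assumes g: "good3 a b c" and r: "mu_as b a c" "mu_as b c a"
  shows "mu_as a b c"
proof -
  have [simp]: "obl a \<in> Obj V" "obl b \<in> Obj V" "obl c \<in> Obj V"
    using g by (simp_all add: obl_Obj)
  have s1: "good2 a b" "good2 b a" "good2 b c" "good2 a c" "good2 c a" "good2 (mg a b) c" "good2 b (mg a c)"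
    "good2 a (mg b c)" "good2 (mg b c) a"
    using g by auto
  note [simp] = mg_comm[of b a] mg_comm[of c b] mg_comm[of c a]
  have "mu (mg a b) c \<bullet> (mu a b \<boxtimes> ida (obl c))
    = mu (mg a b) c \<bullet> (mu b a \<boxtimes> ida (obl c)) \<bullet> (sy (obl a) (obl b) \<boxtimes> ida (obl c))"
    using s1 by (simp add: tns_cmp mu_comm)
  also have "\<dots> = (mu (mg b a) c \<bullet> (mu b a \<boxtimes> ida (obl c))) \<bullet> (sy (obl a) (obl b) \<boxtimes> ida (obl c))"
    using s1 by simp
  also have "\<dots> = (mu b (mg a c) \<bullet> (ida (obl b) \<boxtimes> mu a c) \<bullet> al (obl b) (obl a) (obl c)) \<bullet> (sy (obl a) (obl b) \<boxtimes> ida (obl c))"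
    using r(1) unfolding mu_as_def by simp
  also have "\<dots> = mu b (mg a c) \<bullet> (ida (obl b) \<boxtimes> (mu c a \<bullet> sy (obl a) (obl c))) \<bullet> al (obl b) (obl a) (obl c) \<bullet> (sy (obl a) (obl b) \<boxtimes> ida (obl c))"
    using s1 by (simp add: mu_comm)
  also have "\<dots> = mu b (mg a c) \<bullet> (ida (obl b) \<boxtimes> mu c a) \<bullet> (ida (obl b) \<boxtimes> sy (obl a) (obl c)) \<bullet> al (obl b) (obl a) (obl c) \<bullet> (sy (obl a) (obl b) \<boxtimes> ida (obl c))"
    using s1 by (simp add: tns_cmp_assoc)
  also have "\<dots> = mu b (mg a c) \<bullet> (ida (obl b) \<boxtimes> mu c a) \<bullet> al (obl b) (obl c) (obl a) \<bullet> sy (obl a) (obl b \<odot> obl c) \<bullet> al (obl a) (obl b) (obl c)"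
    using hex[of "obl a" "obl b" "obl c"] by simp
  also have "\<dots> = (mu b (mg c a) \<bullet> (ida (obl b) \<boxtimes> mu c a) \<bullet> al (obl b) (obl c) (obl a)) \<bullet> sy (obl a) (obl b \<odot> obl c) \<bullet> al (obl a) (obl b) (obl c)"
    using s1 by simp
  also have "\<dots> = (mu (mg b c) a \<bullet> (mu b c \<boxtimes> ida (obl a))) \<bullet> sy (obl a) (obl b \<odot> obl c) \<bullet> al (obl a) (obl b) (obl c)"
    using r(2) unfolding mu_as_def by simp
  also have "\<dots> = mu (mg b c) a \<bullet> ((mu b c \<boxtimes> ida (obl a)) \<bullet> sy (obl a) (obl b \<odot> obl c)) \<bullet> al (obl a) (obl b) (obl c)"
    using s1 by (simp add: obl_Obj)
  also have "\<dots> = mu (mg b c) a \<bullet> (sy (obl a) (obl (mg b c)) \<bullet> (ida (obl a) \<boxtimes> mu b c)) \<bullet> al (obl a) (obl b) (obl c)"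
    using s1 by (subst sy_nat) (simp_all add: obl_Obj)
  also have "\<dots> = (mu (mg b c) a \<bullet> sy (obl a) (obl (mg b c))) \<bullet> (ida (obl a) \<boxtimes> mu b c) \<bullet> al (obl a) (obl b) (obl c)"
    using s1 by (simp add: obl_Obj)
  also have "\<dots> = mu a (mg b c) \<bullet> (ida (obl a) \<boxtimes> mu b c) \<bullet> al (obl a) (obl b) (obl c)"
    using mu_comm[OF s1(8)] by simp
  finally show ?thesis unfolding mu_as_def .
qed

text \<open>A least head stays in front in every merge, so it splits off by \<open>mu_min\<close>;
  the pentagon moves it through the three associators.\<close>

lemma mu_as_min:
  assumes g: "good3 (x # a) b c" and m: "\<forall>y\<in>set b. wlt x y" "\<forall>y\<in>set c. wlt x y" and r: "mu_as a b c"
  shows "mu_as (x # a) b c"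
proof -
  let ?X = "wob x"
  have [simp]: "obl a \<in> Obj V" "obl b \<in> Obj V" "obl c \<in> Obj V" "?X \<in> Obj V"
    using g by (simp_all add: obl_Obj wob_Obj)
  have s1: "good2 (x # a) b" "good2 a b" "good2 b c" "good2 (x # mg a b) c" "good2 (mg a b) c"
    "good2 (x # a) (mg b c)" "good2 a (mg b c)"
    using g m by (auto simp: sd_Cons)
  have [simp]: "mg (x # a) b = x # mg a b" using g m by (simp add: mg_Cons)
  have "mu (mg (x # a) b) c \<bullet> (mu (x # a) b \<boxtimes> ida (obl c))
    = ((ida ?X \<boxtimes> mu (mg a b) c) \<bullet> al ?X (obl (mg a b)) (obl c)) \<bullet>
      (((ida ?X \<boxtimes> mu a b) \<bullet> al ?X (obl a) (obl b)) \<boxtimes> (ida (obl c) \<bullet> ida (obl c)))"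
    using s1 m by (simp add: mu_min)
  also have "\<dots> = ((ida ?X \<boxtimes> mu (mg a b) c) \<bullet> al ?X (obl (mg a b)) (obl c)) \<bullet>
      ((ida ?X \<boxtimes> mu a b) \<boxtimes> ida (obl c)) \<bullet> (al ?X (obl a) (obl b) \<boxtimes> ida (obl c))"
    using s1 by (subst tns_cmp[symmetric]) simp_all
  also have "\<dots> = (ida ?X \<boxtimes> mu (mg a b) c) \<bullet> (al ?X (obl (mg a b)) (obl c) \<bullet>
      ((ida ?X \<boxtimes> mu a b) \<boxtimes> ida (obl c))) \<bullet> (al ?X (obl a) (obl b) \<boxtimes> ida (obl c))"
    using s1 by (simp add: obl_Obj)
  also have "\<dots> = (ida ?X \<boxtimes> mu (mg a b) c) \<bullet> ((ida ?X \<boxtimes> (mu a b \<boxtimes> ida (obl c))) \<bullet> al ?X (obl a \<odot> obl b) (obl c))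
      \<bullet> (al ?X (obl a) (obl b) \<boxtimes> ida (obl c))"
    using s1 by (subst al_nat) simp_all
  also have "\<dots> = (ida ?X \<boxtimes> (mu (mg a b) c \<bullet> (mu a b \<boxtimes> ida (obl c)))) \<bullet> al ?X (obl a \<odot> obl b) (obl c)
      \<bullet> (al ?X (obl a) (obl b) \<boxtimes> ida (obl c))"
    using s1 by (simp add: tns_cmp_assoc)
  also have "\<dots> = (ida ?X \<boxtimes> (mu a (mg b c) \<bullet> (ida (obl a) \<boxtimes> mu b c) \<bullet> al (obl a) (obl b) (obl c)))
      \<bullet> al ?X (obl a \<odot> obl b) (obl c) \<bullet> (al ?X (obl a) (obl b) \<boxtimes> ida (obl c))"
    using r unfolding mu_as_def by simp
  also have "\<dots> = (ida ?X \<boxtimes> mu a (mg b c)) \<bullet> (ida ?X \<boxtimes> (ida (obl a) \<boxtimes> mu b c)) \<bullet> (ida ?X \<boxtimes> al (obl a) (obl b) (obl c))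
      \<bullet> al ?X (obl a \<odot> obl b) (obl c) \<bullet> (al ?X (obl a) (obl b) \<boxtimes> ida (obl c))"
    using s1 by (simp add: tns_cmp_assoc)
  also have "\<dots> = (ida ?X \<boxtimes> mu a (mg b c)) \<bullet> ((ida ?X \<boxtimes> (ida (obl a) \<boxtimes> mu b c)) \<bullet> al ?X (obl a) (obl b \<odot> obl c))
      \<bullet> al (?X \<odot> obl a) (obl b) (obl c)"
    using s1 by (simp add: pent)
  also have "\<dots> = (ida ?X \<boxtimes> mu a (mg b c)) \<bullet> (al ?X (obl a) (obl (mg b c)) \<bullet> ((ida ?X \<boxtimes> ida (obl a)) \<boxtimes> mu b c))
      \<bullet> al (?X \<odot> obl a) (obl b) (obl c)"
    using s1 by (subst al_nat) simp_all
  also have "\<dots> = mu (x # a) (mg b c) \<bullet> (ida (obl (x # a)) \<boxtimes> mu b c) \<bullet> al (obl (x # a)) (obl b) (obl c)"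
    using s1 m by (simp add: mu_min ball_Un obl_Obj)
  finally show ?thesis unfolding mu_as_def .
qed

text \<open>Induction on the total length, peeling off the least of the three heads. It can be
  peeled directly if it lies in \<open>a\<close>; otherwise \<open>mu_as_swap\<close> or
  \<open>mu_as_rev\<close> first brings the list that contains it to the front.\<close>

lemma mu_assoc: "good3 a b c \<Longrightarrow> mu_as a b c"
proof (induction "length a + length b + length c" arbitrary: a b c rule: less_induct)
  case less
  note o = obl_Obj wob_Obj
  have ru: "mu l [] = ru (obl l)" for l by (cases l) (simp_all add: lu_unit)
  have min: "mu_as (x # p) q r"
    if "length (x # p) + length q + length r = length a + length b + length c" "good3 (x # p) q r"
      "\<forall>y\<in>set q. wlt x y" "\<forall>y\<in>set r. wlt x y" for x p q r
    using that less.hyps[of p q r] by (intro mu_as_min) (auto simp: sd_Cons)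
  consider "a = []" | "b = []" | "c = []" | x a' y b' z c' where "a = x # a'" "b = y # b'" "c = z # c'"
    by (cases a; cases b; cases c) auto
  then show ?case
  proof cases
    case 1
    have g: "good2 b c" using less(2) by auto
    have "mu b c \<bullet> (lu (obl b) \<boxtimes> ida (obl c)) = (mu b c \<bullet> lu (obl b \<odot> obl c)) \<bullet> al \<I> (obl b) (obl c)"
      using less(2) g by (simp add: o lu_tensor)
    also have "\<dots> = (lu (obl (mg b c)) \<bullet> (ida \<I> \<boxtimes> mu b c)) \<bullet> al \<I> (obl b) (obl c)"
      using g by (simp add: lu_nat)
    also have "\<dots> = lu (obl (mg b c)) \<bullet> (ida \<I> \<boxtimes> mu b c) \<bullet> al \<I> (obl b) (obl c)"
      using less(2) g by (simp add: o)
    finally show ?thesis using less(2) 1 unfolding mu_as_def by simp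
  next
    case 2
    then show ?thesis unfolding mu_as_def using less(2) by (simp add: o ru tri)
  next
    case 3
    have g: "good2 a b" using less(2) by auto
    then show ?thesis using 3 less(2) unfolding mu_as_def by (simp add: o ru ru_tensor ru_nat)
  next
    case 4
    note abc = 4
    have d: "x \<noteq> y" "x \<noteq> z" "y \<noteq> z" using less(2) abc by auto
    consider "wlt x y" "wlt x z" | "wlt y x" "wlt y z" | "wlt z x" "wlt z y"
      using d wo.neq_iff wo.less_trans by metis
    then show ?thesis
    proof cases
      case 1
      show ?thesis unfolding abc
        by (rule min) (use less(2) 1 abc sd_less[of y b' x] sd_less[of z c' x] in simp_all)
    next
      case 2
      show ?thesis unfolding abc
      proof (rule mu_as_swap)
        show "mu_as (y # b') (x # a') (z # c')" "mu_as (y # b') (z # c') (x # a')"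
          by (rule min; use less(2) 2 abc sd_less[of x a' y] sd_less[of z c' y] in \<open>simp add: Int_commute\<close>; fail)+
      qed (use less(2) abc in simp)
    next
      case 3
      show ?thesis unfolding abc
      proof (rule mu_as_rev)
        show "mu_as (z # c') (y # b') (x # a')"
          by (rule min; use less(2) 3 abc sd_less[of x a' z] sd_less[of y b' z] in \<open>simp add: Int_commute\<close>; fail)
      qed (use less(2) abc in simp)
    qed
  qed
qed

end

section \<open>Arrows between sets of named wires\<close>

text \<open>\<open>Bad\<close> absorbs every mismatch of interfaces. Products and composites become
  total, so that \<open>prd\<close> is associative and commutative without side conditions and can
  be folded over finite sets and lists.\<close>

datatype ('o, 'm) na = NA (src: "'o wire set") (ar: "('o, 'm) arr") (tgt: "'o wire set") | Bad

text \<open>A bracketing of named wires: the form in which the domains and codomains of actual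
  morphisms of \<open>V\<close> present themselves, units included.\<close>

datatype 'o tree = Em | Lf "'o wire" | Br "'o tree" "'o tree"

fun lvs :: "'o tree \<Rightarrow> 'o wire list" where
  "lvs Em = []" | "lvs (Lf x) = [x]" | "lvs (Br s t) = lvs s @ lvs t"

context dagger_compact
begin

definition obs :: "'o wire set \<Rightarrow> 'o" where "obs S = obl (slist S)"
definition MU :: "'o wire set \<Rightarrow> 'o wire set \<Rightarrow> ('o, 'm) arr" where "MU S T = mu (slist S) (slist T)"

lemma obs_Obj [simp]: "wok S \<Longrightarrow> obs S \<in> Obj V"
  unfolding obs_def by (rule obl_Obj) simp

lemma MU_simps [simp]:
  assumes "wok S" "wok T" "S \<inter> T = {}"
  shows "uni (MU S T)" "arrow (MU S T)" "dom (MU S T) = obs S \<odot> obs T" "cod (MU S T) = obs (S \<union> T)"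
  using assms uni_mu[of "slist S" "slist T"] unfolding MU_def obs_def by (auto simp: mg_def)

lemma MU_comm: "wok S \<Longrightarrow> wok T \<Longrightarrow> S \<inter> T = {} \<Longrightarrow> MU T S \<bullet> sy (obs S) (obs T) = MU S T"
  using mu_comm[of "slist S" "slist T"] unfolding MU_def obs_def by simp
lemma MU_assoc: "wok S \<Longrightarrow> wok T \<Longrightarrow> wok U \<Longrightarrow> S \<inter> T = {} \<Longrightarrow> S \<inter> U = {} \<Longrightarrow> T \<inter> U = {} \<Longrightarrow>
  MU (S \<union> T) U \<bullet> (MU S T \<boxtimes> ida (obs U)) = MU S (T \<union> U) \<bullet> (ida (obs S) \<boxtimes> MU T U) \<bullet> al (obs S) (obs T) (obs U)"
  using mu_assoc[of "slist S" "slist T" "slist U"] unfolding MU_def obs_def mu_as_def by (simp add: mg_def)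
lemma obs_empty [simp]: "obs {} = \<I>" by (simp add: obs_def)
lemma MU_empty [simp]: "MU {} T = lu (obs T)" "MU T {} = ru (obs T)"
  by (simp_all add: MU_def obs_def, cases "slist T") (simp_all add: lu_unit)

fun ok :: "('o, 'm) na \<Rightarrow> bool" where
  "ok (NA S p T) \<longleftrightarrow> wok S \<and> wok T \<and> arrow p \<and> dom p = obs S \<and> cod p = obs T"
| "ok Bad \<longleftrightarrow> False"

definition prd :: "('o, 'm) na \<Rightarrow> ('o, 'm) na \<Rightarrow> ('o, 'm) na" (infixr "\<diamondop>" 65) where
  "P \<diamondop> Q = (if ok P \<and> ok Q \<and> src P \<inter> src Q = {} \<and> tgt P \<inter> tgt Q = {}
    then NA (src P \<union> src Q) (MU (tgt P) (tgt Q) \<bullet> (ar P \<boxtimes> ar Q) \<bullet> dg (MU (src P) (src Q))) (tgt P \<union> tgt Q)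
    else Bad)"

definition sq :: "('o, 'm) na \<Rightarrow> ('o, 'm) na \<Rightarrow> ('o, 'm) na" (infixr "\<triangleleft>" 60) where
  "Q \<triangleleft> P = (if ok P \<and> ok Q \<and> tgt P = src Q then NA (src P) (ar Q \<bullet> ar P) (tgt Q) else Bad)"

definition Idw :: "'o wire set \<Rightarrow> ('o, 'm) na" where "Idw S = NA S (ida (obs S)) S"

lemma ok_iff: "ok P \<longleftrightarrow> P \<noteq> Bad \<and> wok (src P) \<and> wok (tgt P) \<and> arrow (ar P) \<and> dom (ar P) = obs (src P) \<and> cod (ar P) = obs (tgt P)"
  by (cases P) auto
lemma okD [simp]: "ok P \<Longrightarrow> wok (src P)" "ok P \<Longrightarrow> wok (tgt P)" by (simp_all add: ok_iff)
lemma okE: "ok P \<Longrightarrow> arrow (ar P)" "ok P \<Longrightarrow> dom (ar P) = obs (src P)" "ok P \<Longrightarrow> cod (ar P) = obs (tgt P)"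
  by (cases P; simp)+

lemma ok_prd [simp]: "ok (P \<diamondop> Q) \<longleftrightarrow> ok P \<and> ok Q \<and> src P \<inter> src Q = {} \<and> tgt P \<inter> tgt Q = {}"
proof (cases "ok P \<and> ok Q \<and> src P \<inter> src Q = {} \<and> tgt P \<inter> tgt Q = {}")
  case True then show ?thesis by (simp add: prd_def okE)
next
  case False then show ?thesis unfolding prd_def by auto
qed
lemma src_prd [simp]: "ok P \<Longrightarrow> ok Q \<Longrightarrow> src P \<inter> src Q = {} \<Longrightarrow> tgt P \<inter> tgt Q = {} \<Longrightarrow> src (P \<diamondop> Q) = src P \<union> src Q"
  and tgt_prd [simp]: "ok P \<Longrightarrow> ok Q \<Longrightarrow> src P \<inter> src Q = {} \<Longrightarrow> tgt P \<inter> tgt Q = {} \<Longrightarrow> tgt (P \<diamondop> Q) = tgt P \<union> tgt Q"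
  by (auto simp: prd_def)
lemma ok_sq [simp]: "ok (Q \<triangleleft> P) \<longleftrightarrow> ok P \<and> ok Q \<and> tgt P = src Q"
proof (cases "ok P \<and> ok Q \<and> tgt P = src Q")
  case True then show ?thesis by (simp add: sq_def okE)
next
  case False then show ?thesis unfolding sq_def by auto
qed
lemma src_sq [simp]: "ok P \<Longrightarrow> ok Q \<Longrightarrow> tgt P = src Q \<Longrightarrow> src (Q \<triangleleft> P) = src P"
  and tgt_sq [simp]: "ok P \<Longrightarrow> ok Q \<Longrightarrow> tgt P = src Q \<Longrightarrow> tgt (Q \<triangleleft> P) = tgt Q"
  by (auto simp: sq_def)
lemma Idw_simps [simp]: "ok (Idw S) \<longleftrightarrow> wok S" "src (Idw S) = S" "tgt (Idw S) = S"
  by (auto simp: Idw_def)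

lemma bad_eq: "\<not> ok (P \<diamondop> Q) \<Longrightarrow> P \<diamondop> Q = Bad" unfolding ok_prd by (auto simp: prd_def)

lemma bad_sq: "\<not> ok (Q \<triangleleft> P) \<Longrightarrow> Q \<triangleleft> P = Bad" unfolding ok_sq by (auto simp: sq_def)

lemma sq_assoc: "(h \<triangleleft> g) \<triangleleft> f = h \<triangleleft> (g \<triangleleft> f)"
proof (cases "ok f \<and> ok g \<and> ok h \<and> tgt f = src g \<and> tgt g = src h")
  case True then show ?thesis by (simp add: sq_def okE)
next
  case False
  then have "\<not> ok ((h \<triangleleft> g) \<triangleleft> f)" "\<not> ok (h \<triangleleft> (g \<triangleleft> f))" by auto
  then show ?thesis using bad_sq by metis
qed
lemma Idw_sq [simp]: "ok P \<Longrightarrow> tgt P = T \<Longrightarrow> Idw T \<triangleleft> P = P" "ok P \<Longrightarrow> src P = T \<Longrightarrow> P \<triangleleft> Idw T = P"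
  by (cases P; auto simp: sq_def Idw_def)+

text \<open>Exchanging the factors creates one symmetry at the source and one at the target, and
  both are absorbed by the merging isomorphisms.\<close>

lemma prd_comm: "P \<diamondop> Q = Q \<diamondop> P"
proof (cases "ok P \<and> ok Q \<and> src P \<inter> src Q = {} \<and> tgt P \<inter> tgt Q = {}")
  case True
  then have [simp]: "ok P" "ok Q" and s: "src P \<inter> src Q = {}" "src Q \<inter> src P = {}"
    and t: "tgt P \<inter> tgt Q = {}" "tgt Q \<inter> tgt P = {}" by auto
  note [simp] = okE
  let ?p = "ar P" let ?q = "ar Q"
  have m: "MU (tgt P) (tgt Q) = MU (tgt Q) (tgt P) \<bullet> sy (obs (tgt P)) (obs (tgt Q))"
    using t by (simp add: MU_comm)
  have m': "dg (MU (src Q) (src P)) = sy (obs (src P)) (obs (src Q)) \<bullet> dg (MU (src P) (src Q))"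
  proof -
    have "dg (MU (src Q) (src P)) = dg (MU (src P) (src Q) \<bullet> sy (obs (src Q)) (obs (src P)))"
      using s by (simp add: MU_comm)
    also have "\<dots> = sy (obs (src P)) (obs (src Q)) \<bullet> dg (MU (src P) (src Q))"
      using s by (simp add: sy_dg)
    finally show ?thesis .
  qed
  have "MU (tgt P) (tgt Q) \<bullet> (?p \<boxtimes> ?q) \<bullet> dg (MU (src P) (src Q))
      = MU (tgt Q) (tgt P) \<bullet> (sy (obs (tgt P)) (obs (tgt Q)) \<bullet> (?p \<boxtimes> ?q)) \<bullet> dg (MU (src P) (src Q))"
    unfolding m using s t by simp
  also have "\<dots> = MU (tgt Q) (tgt P) \<bullet> ((?q \<boxtimes> ?p) \<bullet> sy (obs (src P)) (obs (src Q))) \<bullet> dg (MU (src P) (src Q))"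
    by (subst sy_nat) simp_all
  also have "\<dots> = MU (tgt Q) (tgt P) \<bullet> (?q \<boxtimes> ?p) \<bullet> dg (MU (src Q) (src P))"
    unfolding m' using s t by simp
  finally show ?thesis using s t unfolding prd_def by (simp add: Un_commute)
next
  case False
  then show ?thesis unfolding prd_def by auto
qed

lemma prd_assoc: "(P \<diamondop> Q) \<diamondop> R = P \<diamondop> (Q \<diamondop> R)"
proof (cases "ok ((P \<diamondop> Q) \<diamondop> R)")
  case True
  then have [simp]: "ok P" "ok Q" "ok R"
    and s: "src P \<inter> src Q = {}" "src P \<inter> src R = {}" "src Q \<inter> src R = {}"
    and t: "tgt P \<inter> tgt Q = {}" "tgt P \<inter> tgt R = {}" "tgt Q \<inter> tgt R = {}" by auto
  note [simp] = okE
  let ?p = "ar P" let ?q = "ar Q" let ?r = "ar R"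
  let ?S = "src P" let ?S' = "src Q" let ?S'' = "src R"
  let ?T = "tgt P" let ?T' = "tgt Q" let ?T'' = "tgt R"
  have su: "(?S \<union> ?S') \<inter> ?S'' = {}" "?S \<inter> (?S' \<union> ?S'') = {}" "(?T \<union> ?T') \<inter> ?T'' = {}" "?T \<inter> (?T' \<union> ?T'') = {}"
    using s t by auto
  have d: "(dg (MU ?S ?S') \<boxtimes> ida (obs ?S'')) \<bullet> dg (MU (?S \<union> ?S') ?S'')
     = dg (al (obs ?S) (obs ?S') (obs ?S'')) \<bullet> (ida (obs ?S) \<boxtimes> dg (MU ?S' ?S'')) \<bullet> dg (MU ?S (?S' \<union> ?S''))"
  proof -
    have "dg (MU (?S \<union> ?S') ?S'' \<bullet> (MU ?S ?S' \<boxtimes> ida (obs ?S''))) =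
       dg (MU ?S (?S' \<union> ?S'') \<bullet> (ida (obs ?S) \<boxtimes> MU ?S' ?S'') \<bullet> al (obs ?S) (obs ?S') (obs ?S''))"
      using s by (simp add: MU_assoc)
    then show ?thesis using s su by simp
  qed
  have "MU (?T \<union> ?T') ?T'' \<bullet> ((MU ?T ?T' \<bullet> (?p \<boxtimes> ?q) \<bullet> dg (MU ?S ?S')) \<boxtimes> ?r) \<bullet> dg (MU (?S \<union> ?S') ?S'')
    = MU (?T \<union> ?T') ?T'' \<bullet> ((MU ?T ?T' \<bullet> (?p \<boxtimes> ?q) \<bullet> dg (MU ?S ?S')) \<boxtimes> (ida (obs ?T'') \<bullet> ?r \<bullet> ida (obs ?S''))) \<bullet> dg (MU (?S \<union> ?S') ?S'')"
    by simp
  also have "\<dots> = MU (?T \<union> ?T') ?T'' \<bullet> (MU ?T ?T' \<boxtimes> ida (obs ?T'')) \<bullet> ((?p \<boxtimes> ?q) \<boxtimes> ?r) \<bullet> (dg (MU ?S ?S') \<boxtimes> ida (obs ?S'')) \<bullet> dg (MU (?S \<union> ?S') ?S'')"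
    using s t su by (simp add: tns_cmp_assoc)
  also have "\<dots> = (MU (?T \<union> ?T') ?T'' \<bullet> (MU ?T ?T' \<boxtimes> ida (obs ?T''))) \<bullet> ((?p \<boxtimes> ?q) \<boxtimes> ?r) \<bullet> ((dg (MU ?S ?S') \<boxtimes> ida (obs ?S'')) \<bullet> dg (MU (?S \<union> ?S') ?S''))"
    using s t su by simp
  also have "\<dots> = (MU ?T (?T' \<union> ?T'') \<bullet> (ida (obs ?T) \<boxtimes> MU ?T' ?T'') \<bullet> al (obs ?T) (obs ?T') (obs ?T'')) \<bullet> ((?p \<boxtimes> ?q) \<boxtimes> ?r) \<bullet>
      dg (al (obs ?S) (obs ?S') (obs ?S'')) \<bullet> (ida (obs ?S) \<boxtimes> dg (MU ?S' ?S'')) \<bullet> dg (MU ?S (?S' \<union> ?S''))"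
    using t by (simp only: d MU_assoc okD \<open>ok P\<close> \<open>ok Q\<close> \<open>ok R\<close>)
  also have "\<dots> = MU ?T (?T' \<union> ?T'') \<bullet> (ida (obs ?T) \<boxtimes> MU ?T' ?T'') \<bullet> (al (obs ?T) (obs ?T') (obs ?T'') \<bullet> ((?p \<boxtimes> ?q) \<boxtimes> ?r)) \<bullet>
      dg (al (obs ?S) (obs ?S') (obs ?S'')) \<bullet> (ida (obs ?S) \<boxtimes> dg (MU ?S' ?S'')) \<bullet> dg (MU ?S (?S' \<union> ?S''))"
    using s t su by simp
  also have "\<dots> = MU ?T (?T' \<union> ?T'') \<bullet> (ida (obs ?T) \<boxtimes> MU ?T' ?T'') \<bullet> ((?p \<boxtimes> (?q \<boxtimes> ?r)) \<bullet> al (obs ?S) (obs ?S') (obs ?S'')) \<bullet>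
      dg (al (obs ?S) (obs ?S') (obs ?S'')) \<bullet> (ida (obs ?S) \<boxtimes> dg (MU ?S' ?S'')) \<bullet> dg (MU ?S (?S' \<union> ?S''))"
    by (subst al_nat) simp_all
  also have "\<dots> = MU ?T (?T' \<union> ?T'') \<bullet> (ida (obs ?T) \<boxtimes> MU ?T' ?T'') \<bullet> (?p \<boxtimes> (?q \<boxtimes> ?r)) \<bullet>
      (ida (obs ?S) \<boxtimes> dg (MU ?S' ?S'')) \<bullet> dg (MU ?S (?S' \<union> ?S''))"
    using s t su by (simp add: uniD_assoc)
  also have "\<dots> = MU ?T (?T' \<union> ?T'') \<bullet> ((ida (obs ?T) \<bullet> ?p \<bullet> ida (obs ?S)) \<boxtimes> (MU ?T' ?T'' \<bullet> (?q \<boxtimes> ?r) \<bullet> dg (MU ?S' ?S''))) \<bullet> dg (MU ?S (?S' \<union> ?S''))"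
    using s t su by (simp add: tns_cmp_assoc)
  also have "\<dots> = MU ?T (?T' \<union> ?T'') \<bullet> (?p \<boxtimes> (MU ?T' ?T'' \<bullet> (?q \<boxtimes> ?r) \<bullet> dg (MU ?S' ?S''))) \<bullet> dg (MU ?S (?S' \<union> ?S''))"
    by simp
  finally show ?thesis using s t su unfolding prd_def by (auto simp: Un_assoc)
next
  case False
  have "\<not> ok (P \<diamondop> (Q \<diamondop> R))"
  proof
    assume "ok (P \<diamondop> (Q \<diamondop> R))"
    then have "ok P" "ok Q" "ok R" "src P \<inter> src Q = {}" "src P \<inter> src R = {}" "src Q \<inter> src R = {}"
      "tgt P \<inter> tgt Q = {}" "tgt P \<inter> tgt R = {}" "tgt Q \<inter> tgt R = {}" by auto
    then show False using False by (simp add: Int_Un_distrib2)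
  qed
  with False show ?thesis using bad_eq by metis
qed

lemma prd_left_comm: "P \<diamondop> (Q \<diamondop> R) = Q \<diamondop> (P \<diamondop> R)"
  by (metis prd_assoc prd_comm)
lemmas prd_ac = prd_assoc prd_comm prd_left_comm

lemma prd_unit [simp]: "ok P \<Longrightarrow> Idw {} \<diamondop> P = P" "ok P \<Longrightarrow> P \<diamondop> Idw {} = P"
proof -
  assume P: "ok P"
  then obtain S p T where p: "P = NA S p T" by (cases P) auto
  have "lu (obs T) \<bullet> (ida \<I> \<boxtimes> p) \<bullet> dg (lu (obs S)) = (lu (obs T) \<bullet> (ida \<I> \<boxtimes> p)) \<bullet> dg (lu (obs S))"
    using P p by simp
  also have "\<dots> = p" using P p by (simp add: lu_nat uniD)
  finally show "Idw {} \<diamondop> P = P" using P p by (simp add: prd_def Idw_def)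
  then show "P \<diamondop> Idw {} = P" by (simp add: prd_comm)
qed

lemma Idw_prd: "wok S \<Longrightarrow> wok T \<Longrightarrow> S \<inter> T = {} \<Longrightarrow> Idw S \<diamondop> Idw T = Idw (S \<union> T)"
  by (simp add: prd_def Idw_def uniD)

text \<open>Disjointness of the inner interfaces has to be assumed: if they overlap, the right side
  is \<open>Bad\<close> while the left side may be defined. Overlaps at the outer interfaces make
  both sides \<open>Bad\<close>.\<close>

lemma ic:
  assumes [simp]: "ok f" "ok f'" "ok g" "ok g'" and m: "src f' = tgt f" "src g' = tgt g" and d: "tgt f \<inter> tgt g = {}"
  shows "(f' \<triangleleft> f) \<diamondop> (g' \<triangleleft> g) = (f' \<diamondop> g') \<triangleleft> (f \<diamondop> g)"
proof (cases "src f \<inter> src g = {} \<and> tgt f' \<inter> tgt g' = {}")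
  case True
  then have s: "src f \<inter> src g = {}" "tgt f' \<inter> tgt g' = {}" by auto
  note [simp] = okE m
  have "MU (tgt f') (tgt g') \<bullet> ((ar f' \<bullet> ar f) \<boxtimes> (ar g' \<bullet> ar g)) \<bullet> dg (MU (src f) (src g))
     = (MU (tgt f') (tgt g') \<bullet> (ar f' \<boxtimes> ar g') \<bullet> dg (MU (tgt f) (tgt g))) \<bullet> (MU (tgt f) (tgt g) \<bullet> (ar f \<boxtimes> ar g) \<bullet> dg (MU (src f) (src g)))"
    using s d by (simp add: uniD_assoc tns_cmp_assoc)
  then show ?thesis using s d by (simp add: prd_def sq_def)
next
  case False
  then show ?thesis using m d by (auto simp: prd_def sq_def)
qed

lemma sq_Idw_prd:
  assumes "ok f" "ok g" "src f = tgt g" "wok R" "tgt g \<inter> R = {}"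
  shows "(f \<triangleleft> g) \<diamondop> Idw R = (f \<diamondop> Idw R) \<triangleleft> (g \<diamondop> Idw R)"
  using ic[of g f "Idw R" "Idw R"] assms by simp

section \<open>Finite products\<close>

definition BP :: "('a \<Rightarrow> ('o, 'm) na) \<Rightarrow> 'a set \<Rightarrow> ('o, 'm) na" where
  "BP F X = Finite_Set.fold (\<lambda>x. prd (F x)) (Idw {}) X"

lemma BP_empty [simp]: "BP F {} = Idw {}" by (simp add: BP_def)
lemma BP_insert: "finite X \<Longrightarrow> x \<notin> X \<Longrightarrow> BP F (insert x X) = F x \<diamondop> BP F X"
proof -
  interpret comp_fun_commute "\<lambda>x. prd (F x)"
    by standard (auto simp: fun_eq_iff prd_left_comm)
  show "finite X \<Longrightarrow> x \<notin> X \<Longrightarrow> BP F (insert x X) = F x \<diamondop> BP F X"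
    unfolding BP_def by simp
qed

definition fam :: "('a \<Rightarrow> ('o, 'm) na) \<Rightarrow> 'a set \<Rightarrow> bool" where
  "fam F X \<longleftrightarrow> finite X \<and> (\<forall>x\<in>X. ok (F x)) \<and>
    (\<forall>x\<in>X. \<forall>y\<in>X. x \<noteq> y \<longrightarrow> src (F x) \<inter> src (F y) = {} \<and> tgt (F x) \<inter> tgt (F y) = {})"

lemma fam_insert: "fam F (insert x X) \<Longrightarrow> fam F X \<and> ok (F x) \<and> finite X \<and> (x \<notin> X \<longrightarrow> src (F x) \<inter> (\<Union>y\<in>X. src (F y)) = {} \<and> tgt (F x) \<inter> (\<Union>y\<in>X. tgt (F y)) = {})"
  unfolding fam_def by auto

lemma BP_ok: "fam F X \<Longrightarrow> ok (BP F X) \<and> src (BP F X) = (\<Union>x\<in>X. src (F x)) \<and> tgt (BP F X) = (\<Union>x\<in>X. tgt (F x))"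
proof -
  assume f: "fam F X"
  then have "finite X" by (simp add: fam_def)
  then show ?thesis using f
  proof (induction X rule: finite_induct)
    case (insert x X)
    then show ?case using fam_insert[OF insert(4)] by (simp add: BP_insert)
  qed simp
qed

lemma BP_union: "finite X \<Longrightarrow> finite Y \<Longrightarrow> X \<inter> Y = {} \<Longrightarrow> fam F Y \<Longrightarrow> BP F (X \<union> Y) = BP F X \<diamondop> BP F Y"
proof (induction X rule: finite_induct)
  case empty then show ?case using BP_ok[of F Y] by simp
next
  case (insert x X) then show ?case by (simp add: BP_insert prd_assoc)
qed

lemma BP_prd: "finite X \<Longrightarrow> BP (\<lambda>x. F x \<diamondop> G x) X = BP F X \<diamondop> BP G X"
proof (induction X rule: finite_induct)
  case (insert x X) then show ?case by (simp add: BP_insert prd_ac)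
qed simp

lemma BP_sq: "finite X \<Longrightarrow> fam F X \<Longrightarrow> fam G X \<Longrightarrow> (\<And>x. x \<in> X \<Longrightarrow> src (F x) = tgt (G x)) \<Longrightarrow>
  BP (\<lambda>x. F x \<triangleleft> G x) X = BP F X \<triangleleft> BP G X"
proof (induction X rule: finite_induct)
  case (insert x X)
  have f: "fam F X" "fam G X" "ok (F x)" "ok (G x)" using insert fam_insert by metis+
  have "tgt (G x) \<inter> (\<Union>y\<in>X. tgt (G y)) = {}" using insert fam_insert by metis
  then show ?case using insert f BP_ok[of F X] BP_ok[of G X]
    by (simp add: BP_insert ic)
qed simp

lemma BP_Idw: "finite X \<Longrightarrow> inj_on s X \<Longrightarrow> wok (s ` X) \<Longrightarrow> BP (\<lambda>x. Idw {s x}) X = Idw (s ` X)"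
  by (induction X rule: finite_induct) (auto simp: BP_insert Idw_prd)

lemma BP_cong: "finite X \<Longrightarrow> (\<And>x. x \<in> X \<Longrightarrow> F x = G x) \<Longrightarrow> BP F X = BP G X"
  by (induction X rule: finite_induct) (auto simp: BP_insert)

section \<open>Nodes\<close>

fun obt :: "'o tree \<Rightarrow> 'o" where
  "obt Em = \<I>" | "obt (Lf x) = wob x" | "obt (Br s t) = obt s \<odot> obt t"

text \<open>The coherence isomorphism from a bracketed tensor to the normal form of its set of
  leaves. A single leaf needs a right unitor because the object of a list always ends in the
  unit.\<close>

fun kap :: "'o tree \<Rightarrow> ('o, 'm) arr" where
  "kap Em = ida \<I>"
| "kap (Lf x) = dg (ru (wob x))"
| "kap (Br s t) = MU (set (lvs s)) (set (lvs t)) \<bullet> (kap s \<boxtimes> kap t)"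

definition tok :: "'o tree \<Rightarrow> bool" where "tok t \<longleftrightarrow> wok (set (lvs t)) \<and> distinct (lvs t)"

lemma tok_simps [simp]: "tok Em" "tok (Lf x) \<longleftrightarrow> fst x \<in> Obj V"
  "tok (Br s t) \<longleftrightarrow> tok s \<and> tok t \<and> set (lvs s) \<inter> set (lvs t) = {}"
  by (auto simp: tok_def)
lemma tok_wok [simp]: "tok t \<Longrightarrow> wok (set (lvs t))" by (simp add: tok_def)

lemma obt_Obj [simp]: "tok t \<Longrightarrow> obt t \<in> Obj V"
  by (induction t) (auto intro: wob_Obj)

lemma obs_single: "obs {x} = wob x \<odot> \<I>" by (simp add: obs_def)

lemma kap_simps: "tok t \<Longrightarrow> uni (kap t) \<and> dom (kap t) = obt t \<and> cod (kap t) = obs (set (lvs t))"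
  by (induction t) (auto simp: obs_single wob_Obj)
lemma kap_simps' [simp]: "tok t \<Longrightarrow> uni (kap t)" "tok t \<Longrightarrow> arrow (kap t)" "tok t \<Longrightarrow> dom (kap t) = obt t"
   "tok t \<Longrightarrow> cod (kap t) = obs (set (lvs t))"
  using kap_simps[of t] by auto

definition nok :: "'m \<Rightarrow> 'o tree \<Rightarrow> 'o tree \<Rightarrow> bool" where
  "nok f s t \<longleftrightarrow> tok s \<and> tok t \<and> f \<in> Hom V (obt s) (obt t)"

text \<open>Transport of a morphism along the unitaries \<open>kap\<close>. A tree that repeats a
  name fails \<open>nok\<close> and yields \<open>Bad\<close>.\<close>

definition N :: "'m \<Rightarrow> 'o tree \<Rightarrow> 'o tree \<Rightarrow> ('o, 'm) na" where
  "N f s t = (if nok f s t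
     then NA (set (lvs s)) (kap t \<bullet> Arr (obt s) f (obt t) \<bullet> dg (kap s)) (set (lvs t)) else Bad)"

lemma arrow_Arr [simp]: "arrow (Arr A f B) \<longleftrightarrow> A \<in> Obj V \<and> B \<in> Obj V \<and> f \<in> Hom V A B"
  by (simp add: arrow_def)

lemma ok_N [simp]: "ok (N f s t) \<longleftrightarrow> nok f s t" by (auto simp: N_def nok_def)
lemma src_N [simp]: "nok f s t \<Longrightarrow> src (N f s t) = set (lvs s)" and tgt_N [simp]: "nok f s t \<Longrightarrow> tgt (N f s t) = set (lvs t)"
  by (auto simp: N_def)

text \<open>The way back: an equation between arrows on sets of wires is an equation in
  \<open>V\<close>.\<close>

lemma N_inj: assumes "nok f s t" "nok g s t" "N f s t = N g s t" shows "f = g"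
proof -
  have "kap t \<bullet> Arr (obt s) f (obt t) \<bullet> dg (kap s) = kap t \<bullet> Arr (obt s) g (obt t) \<bullet> dg (kap s)"
    using assms by (simp add: N_def)
  then have "Arr (obt s) f (obt t) \<bullet> dg (kap s) = Arr (obt s) g (obt t) \<bullet> dg (kap s)"
    using assms uni_cancel_l[of "kap t"] by (simp add: nok_def)
  then have "Arr (obt s) f (obt t) = Arr (obt s) g (obt t)"
    using assms uni_cancel_r[of "dg (kap s)"] by (simp add: nok_def)
  then show ?thesis by simp
qed

lemma nok_comp: "nok f s r \<Longrightarrow> nok g r t \<Longrightarrow> nok (g \<cdot> f) s t"
  unfolding nok_def using comp_in_Hom[of "obt s" "obt r" "obt t" f g] by auto

lemma N_sq:
  assumes "nok f s r" "nok g r t"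
  shows "N g r t \<triangleleft> N f s r = N (g \<cdot> f) s t"
proof -
  note n = nok_comp[OF assms]
  have "kap t \<bullet> Arr (obt s) (g \<cdot> f) (obt t) \<bullet> dg (kap s)
    = kap t \<bullet> (Arr (obt r) g (obt t) \<bullet> Arr (obt s) f (obt r)) \<bullet> dg (kap s)"
    by (simp add: cmp_def)
  also have "\<dots> = (kap t \<bullet> Arr (obt r) g (obt t) \<bullet> dg (kap r)) \<bullet> (kap r \<bullet> Arr (obt s) f (obt r) \<bullet> dg (kap s))"
    using assms by (simp add: nok_def uniD_assoc)
  finally show ?thesis using assms n by (simp add: sq_def) (simp add: N_def)
qed

lemma nok_tensor: "nok f s t \<Longrightarrow> nok g s' t' \<Longrightarrow> set (lvs s) \<inter> set (lvs s') = {} \<Longrightarrow> set (lvs t) \<inter> set (lvs t') = {} \<Longrightarrow>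
   nok (f \<otimes> g) (Br s s') (Br t t')"
  unfolding nok_def using tensor_in_Hom[of "obt s" "obt t" "obt s'" "obt t'" f g] by auto

lemma N_prd:
  assumes "nok f s t" "nok g s' t'" and d: "set (lvs s) \<inter> set (lvs s') = {}" "set (lvs t) \<inter> set (lvs t') = {}"
  shows "N f s t \<diamondop> N g s' t' = N (f \<otimes> g) (Br s s') (Br t t')"
proof -
  note n = nok_tensor[OF assms]
  let ?f = "Arr (obt s) f (obt t)" let ?g = "Arr (obt s') g (obt t')"
  have "(MU (set (lvs t)) (set (lvs t')) \<bullet> (kap t \<boxtimes> kap t')) \<bullet> Arr (obt s \<odot> obt s') (f \<otimes> g) (obt t \<odot> obt t')
        \<bullet> dg (MU (set (lvs s)) (set (lvs s')) \<bullet> (kap s \<boxtimes> kap s'))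
    = (MU (set (lvs t)) (set (lvs t')) \<bullet> (kap t \<boxtimes> kap t')) \<bullet> (?f \<boxtimes> ?g)
        \<bullet> dg (MU (set (lvs s)) (set (lvs s')) \<bullet> (kap s \<boxtimes> kap s'))"
    by (simp add: tns_def)
  also have "\<dots> = MU (set (lvs t)) (set (lvs t')) \<bullet> ((kap t \<bullet> ?f \<bullet> dg (kap s)) \<boxtimes> (kap t' \<bullet> ?g \<bullet> dg (kap s')))
        \<bullet> dg (MU (set (lvs s)) (set (lvs s')))"
    using assms by (simp add: nok_def tns_cmp_assoc)
  finally show ?thesis using assms n by (simp add: prd_def) (simp add: N_def)
qed

lemma nok_id: "tok s \<Longrightarrow> tok t \<Longrightarrow> obt s = obt t \<Longrightarrow> nok \<one>[obt s] s t"
  unfolding nok_def using ident_in_Hom[of "obt s"] by simp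

lemma N_id: "tok t \<Longrightarrow> N \<one>[obt t] t t = Idw (set (lvs t))"
  using nok_id[of t t] by (simp add: N_def Idw_def flip: ida_def) (simp add: uniD)

text \<open>Coherence in usable form: a structural isomorphism that commutes with \<open>kap\<close>
  turns into an identity once its bracketings are forgotten.\<close>

lemma N_struct:
  assumes "tok s" "tok t" "set (lvs s) = set (lvs t)" "uni (Arr (obt s) f (obt t))" "kap t \<bullet> Arr (obt s) f (obt t) = kap s"
  shows "nok f s t" "N f s t = Idw (set (lvs s))"
proof -
  have "arrow (Arr (obt s) f (obt t))" using assms(4) by (rule uni_arrow)
  then show n: "nok f s t" using assms unfolding nok_def by simp
  have "kap t \<bullet> Arr (obt s) f (obt t) \<bullet> dg (kap s) = (kap t \<bullet> Arr (obt s) f (obt t)) \<bullet> dg (kap s)"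
    using assms(1-4) n unfolding nok_def by simp
  also have "\<dots> = ida (obs (set (lvs s)))" using assms(1) unfolding assms(5) by (simp add: uniD)
  finally show "N f s t = Idw (set (lvs s))" using n assms by (simp add: N_def Idw_def)
qed

lemma N_assoc:
  assumes "tok (Br (Br a b) c)"
  shows "nok \<a>[obt a, obt b, obt c] (Br (Br a b) c) (Br a (Br b c))"
    and "N \<a>[obt a, obt b, obt c] (Br (Br a b) c) (Br a (Br b c)) = Idw (set (lvs (Br (Br a b) c)))"
proof -
  let ?A = "set (lvs a)" let ?B = "set (lvs b)" let ?C = "set (lvs c)"
  have d: "?A \<inter> ?B = {}" "?A \<inter> ?C = {}" "?B \<inter> ?C = {}" "?A \<inter> (?B \<union> ?C) = {}" "(?A \<union> ?B) \<inter> ?C = {}" using assms by auto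
  have t [simp]: "tok a" "tok b" "tok c" using assms by auto
  let ?al = "al (obt a) (obt b) (obt c)"
  have "(MU ?A (?B \<union> ?C) \<bullet> (kap a \<boxtimes> (MU ?B ?C \<bullet> (kap b \<boxtimes> kap c)))) \<bullet> ?al
      = (MU ?A (?B \<union> ?C) \<bullet> ((ida (obs ?A) \<bullet> kap a) \<boxtimes> (MU ?B ?C \<bullet> (kap b \<boxtimes> kap c)))) \<bullet> ?al" by simp
  also have "\<dots> = MU ?A (?B \<union> ?C) \<bullet> (ida (obs ?A) \<boxtimes> MU ?B ?C) \<bullet> ((kap a \<boxtimes> (kap b \<boxtimes> kap c)) \<bullet> ?al)"
    using d by (simp add: tns_cmp_assoc)
  also have "\<dots> = MU ?A (?B \<union> ?C) \<bullet> (ida (obs ?A) \<boxtimes> MU ?B ?C) \<bullet> (al (obs ?A) (obs ?B) (obs ?C) \<bullet> ((kap a \<boxtimes> kap b) \<boxtimes> kap c))"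
    using d by (subst al_nat) simp_all
  also have "\<dots> = (MU ?A (?B \<union> ?C) \<bullet> (ida (obs ?A) \<boxtimes> MU ?B ?C) \<bullet> al (obs ?A) (obs ?B) (obs ?C)) \<bullet> ((kap a \<boxtimes> kap b) \<boxtimes> kap c)"
    using d by simp
  also have "\<dots> = (MU (?A \<union> ?B) ?C \<bullet> (MU ?A ?B \<boxtimes> ida (obs ?C))) \<bullet> ((kap a \<boxtimes> kap b) \<boxtimes> kap c)"
    using d by (simp add: MU_assoc)
  also have "\<dots> = MU (?A \<union> ?B) ?C \<bullet> ((MU ?A ?B \<bullet> (kap a \<boxtimes> kap b)) \<boxtimes> kap c)"
    using d by (simp add: tns_cmp)
  finally have "kap (Br a (Br b c)) \<bullet> ?al = kap (Br (Br a b) c)" by simp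
  then show "nok \<a>[obt a, obt b, obt c] (Br (Br a b) c) (Br a (Br b c))"
    "N \<a>[obt a, obt b, obt c] (Br (Br a b) c) (Br a (Br b c)) = Idw (set (lvs (Br (Br a b) c)))"
    using N_struct[of "Br (Br a b) c" "Br a (Br b c)" "\<a>[obt a, obt b, obt c]"] assms d
    by (auto simp: al_def[symmetric] Un_assoc Int_Un_distrib Int_Un_distrib2)
qed

lemma N_lunit:
  assumes [simp]: "tok a"
  shows "nok \<l>[obt a] (Br Em a) a" "N \<l>[obt a] (Br Em a) a = Idw (set (lvs a))"
  using N_struct[of "Br Em a" a "\<l>[obt a]"] by (auto simp: lu_def[symmetric] lu_nat)

lemma N_runit:
  assumes [simp]: "tok a"
  shows "nok \<r>[obt a] (Br a Em) a" "N \<r>[obt a] (Br a Em) a = Idw (set (lvs a))"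
  using N_struct[of "Br a Em" a "\<r>[obt a]"] by (auto simp: ru_def[symmetric] ru_nat)

lemma N_symm:
  assumes "tok (Br a b)"
  shows "nok \<s>[obt a, obt b] (Br a b) (Br b a)" "N \<s>[obt a, obt b] (Br a b) (Br b a) = Idw (set (lvs (Br a b)))"
proof -
  let ?A = "set (lvs a)" let ?B = "set (lvs b)"
  have d: "?A \<inter> ?B = {}" "?B \<inter> ?A = {}" and t [simp]: "tok a" "tok b" using assms by auto
  have "(MU ?B ?A \<bullet> (kap b \<boxtimes> kap a)) \<bullet> sy (obt a) (obt b) = MU ?B ?A \<bullet> ((kap b \<boxtimes> kap a) \<bullet> sy (obt a) (obt b))"
    using d by simp
  also have "\<dots> = MU ?B ?A \<bullet> (sy (obs ?A) (obs ?B) \<bullet> (kap a \<boxtimes> kap b))" by (subst sy_nat) simp_all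
  also have "\<dots> = (MU ?B ?A \<bullet> sy (obs ?A) (obs ?B)) \<bullet> (kap a \<boxtimes> kap b)" using d by simp
  also have "\<dots> = MU ?A ?B \<bullet> (kap a \<boxtimes> kap b)" using d by (simp add: MU_comm)
  finally have "kap (Br b a) \<bullet> sy (obt a) (obt b) = kap (Br a b)" by simp
  then show "nok \<s>[obt a, obt b] (Br a b) (Br b a)" "N \<s>[obt a, obt b] (Br a b) (Br b a) = Idw (set (lvs (Br a b)))"
    using N_struct[of "Br a b" "Br b a" "\<s>[obt a, obt b]"] assms d
    by (auto simp: sy_def[symmetric] Un_commute)
qed

lemma nok_dagger: "nok f s t \<Longrightarrow> nok (f\<dagger>) t s"
  unfolding nok_def using dagger_in_Hom[of "obt s" "obt t" f] by simp

lemma N_dagger_struct: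
  assumes "nok f s t" "N f s t = Idw (set (lvs s))"
  shows "N (f\<dagger>) t s = Idw (set (lvs s))" "set (lvs t) = set (lvs s)"
proof -
  have e: "kap t \<bullet> Arr (obt s) f (obt t) \<bullet> dg (kap s) = ida (obs (set (lvs s)))" and l: "set (lvs t) = set (lvs s)"
    using assms by (simp_all add: N_def Idw_def)
  have t: "tok s" "tok t" "f \<in> Hom V (obt s) (obt t)" using assms by (simp_all add: nok_def)
  have "dg (kap t \<bullet> Arr (obt s) f (obt t) \<bullet> dg (kap s)) = ida (obs (set (lvs s)))" using e t by simp
  then have "kap s \<bullet> Arr (obt t) (f\<dagger>) (obt s) \<bullet> dg (kap t) = ida (obs (set (lvs s)))"
    using t dagger_in_Hom[of "obt s" "obt t" f] by (simp add: dg_def[of "Arr _ _ _"])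
  then show "N (f\<dagger>) t s = Idw (set (lvs s))" "set (lvs t) = set (lvs s)"
    using nok_dagger[OF assms(1)] l by (simp_all add: N_def Idw_def)
qed

end

section \<open>Trace and nets\<close>

abbreviation (input) pw :: "'o wire \<Rightarrow> bool" where "pw x \<equiv> \<not> snd (snd x)"

fun bar :: "'o wire \<Rightarrow> 'o wire" where "bar (A, i, p) = (A, i, True)"
fun shift :: "nat \<Rightarrow> 'o wire \<Rightarrow> 'o wire" where "shift k (A, i, p) = (A, i + k, p)"

lemma bar_simps [simp]: "fst (bar x) = fst x" "snd (snd (bar x))" by (cases x; simp)+
lemma shift_simps [simp]: "fst (shift k x) = fst x" "snd (snd (shift k x)) = snd (snd x)" by (cases x; simp)+
lemma bar_eq: "pw x \<Longrightarrow> pw y \<Longrightarrow> bar x = bar y \<longleftrightarrow> x = y" by (cases x; cases y) auto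
lemma shift_eq [simp]: "shift k x = shift k y \<longleftrightarrow> x = y" by (cases x; cases y) auto

lemma shift_fresh:
  assumes "finite S" shows "\<exists>k. \<forall>x. shift k x \<notin> S"
proof -
  obtain m where m: "\<And>x. x \<in> S \<Longrightarrow> fst (snd x) \<le> m"
    using assms finite_nat_set_iff_bounded_le[of "(fst \<circ> snd) ` S"] by auto
  have "shift (Suc m) x \<notin> S" for x using m[of "shift (Suc m) x"] by (cases x) auto
  then show ?thesis by blast
qed

context dagger_compact
begin

text \<open>The dual end is named after \<open>x\<close>, but the other end may carry a different
  name. This allows the cup of a trace to be opened at fresh names.\<close>

definition cupn :: "'o wire \<Rightarrow> 'o wire \<Rightarrow> ('o, 'm) na" where
  "cupn x y = N (\<eta> (fst x)) Em (Br (Lf (bar x)) (Lf y))"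
definition capn :: "'o wire \<Rightarrow> ('o, 'm) na" where
  "capn x = N ((\<eta> (fst x))\<dagger>) (Br (Lf (bar x)) (Lf x)) Em"
definition ren :: "'o wire \<Rightarrow> 'o wire \<Rightarrow> ('o, 'm) na" where
  "ren x y = N \<one>[fst x] (Lf x) (Lf y)"

lemma wob_simps [simp]: "pw x \<Longrightarrow> wob x = fst x" "wob (bar x) = (fst x)\<^sup>\<star>"
  by (cases x; simp)+

lemma eta_Hom: "A \<in> Obj V \<Longrightarrow> \<eta> A \<in> Hom V \<I> (A\<^sup>\<star> \<odot> A)"
  and eps_Hom: "A \<in> Obj V \<Longrightarrow> \<epsilon> A \<in> Hom V (A \<odot> A\<^sup>\<star>) \<I>"
  and eps_eta: "A \<in> Obj V \<Longrightarrow> \<epsilon> A = (\<eta> A)\<dagger> \<cdot> \<s>[A, A\<^sup>\<star>]"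
  and snake_eq: "A \<in> Obj V \<Longrightarrow> \<l>[A] \<cdot> (\<epsilon> A \<otimes> \<one>[A]) \<cdot> \<a>[A, A\<^sup>\<star>, A]\<dagger> \<cdot> (\<one>[A] \<otimes> \<eta> A) \<cdot> \<r>[A]\<dagger> = \<one>[A]"
  and snake_eq': "A \<in> Obj V \<Longrightarrow> \<r>[A\<^sup>\<star>] \<cdot> (\<one>[A\<^sup>\<star>] \<otimes> \<epsilon> A) \<cdot> \<a>[A\<^sup>\<star>, A, A\<^sup>\<star>] \<cdot> (\<eta> A \<otimes> \<one>[A\<^sup>\<star>]) \<cdot> \<l>[A\<^sup>\<star>]\<dagger> = \<one>[A\<^sup>\<star>]"
  using dual[of A] unfolding dagger_dual_def by auto

lemma bar_neq: "pw y \<Longrightarrow> bar x \<noteq> y" "pw y \<Longrightarrow> y \<noteq> bar x" by (auto)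

lemma cupn_simps [simp]:
  assumes "fst x \<in> Obj V" "pw y" "fst y = fst x"
  shows "ok (cupn x y)" "src (cupn x y) = {}" "tgt (cupn x y) = {bar x, y}"
proof -
  have "nok (\<eta> (fst x)) Em (Br (Lf (bar x)) (Lf y))"
    using assms by (simp add: nok_def eta_Hom bar_neq)
  then show "ok (cupn x y)" "src (cupn x y) = {}" "tgt (cupn x y) = {bar x, y}"
    unfolding cupn_def by simp_all
qed

lemma capn_simps [simp]:
  assumes "fst x \<in> Obj V" "pw x"
  shows "ok (capn x)" "tgt (capn x) = {}" "src (capn x) = {bar x, x}"
proof -
  have "nok (\<eta> (fst x)) Em (Br (Lf (bar x)) (Lf x))"
    using assms by (simp add: nok_def eta_Hom bar_neq)
  then show "ok (capn x)" "tgt (capn x) = {}" "src (capn x) = {bar x, x}"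
    unfolding capn_def by (simp_all add: nok_dagger)
qed

lemma ren_nok: "A \<in> Obj V \<Longrightarrow> pw x \<Longrightarrow> pw y \<Longrightarrow> fst x = A \<Longrightarrow> fst y = A \<Longrightarrow> nok \<one>[A] (Lf x) (Lf y)"
  using nok_id[of "Lf x" "Lf y"] by simp

lemma ren_simps [simp]:
  assumes "fst x \<in> Obj V" "pw x" "pw y" "fst y = fst x"
  shows "ok (ren x y)" "src (ren x y) = {x}" "tgt (ren x y) = {y}"
  using ren_nok[OF assms(1-3) refl assms(4)] unfolding ren_def by simp_all

lemma ren_ren:
  assumes "fst x \<in> Obj V" "pw x" "pw y" "fst y = fst x"
  shows "ren y x \<triangleleft> ren x y = Idw {x}"
proof -
  have n: "nok \<one>[fst x] (Lf x) (Lf y)" "nok \<one>[fst x] (Lf y) (Lf x)"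
    by (rule ren_nok; use assms in \<open>simp; fail\<close>)+
  have i: "\<one>[fst x] \<cdot> \<one>[fst x] = \<one>[fst x]"
    by (rule ident_comp) (use assms(1) ident_in_Hom in auto)
  have w: "obt (Lf x) = fst x" using assms(2) by simp
  have "ren y x \<triangleleft> ren x y = N \<one>[obt (Lf x)] (Lf x) (Lf x)"
    unfolding ren_def assms(4) N_sq[OF n] i w ..
  also have "\<dots> = Idw {x}" using assms(1) N_id[of "Lf x"] by simp
  finally show ?thesis .
qed

text \<open>The first snake equation of \<open>V\<close>. Its counit is the cap preceded by a
  symmetry, and symmetries are invisible on sets of wires.\<close>

lemma snake1:
  assumes x: "fst x \<in> Obj V" "pw x" and y: "pw y" "fst y = fst x" "x \<noteq> y"
  shows "(capn x \<diamondop> Idw {y}) \<triangleleft> (Idw {x} \<diamondop> cupn x y) = ren x y"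
proof -
  define A where "A = fst x"
  let ?X = "Lf x" let ?B = "Lf (bar x)" let ?Y = "Lf y"
  have A: "A \<in> Obj V" "fst x = A" "fst y = A" "wob x = A" "wob y = A" "wob (bar x) = A\<^sup>\<star>"
    and d: "bar x \<noteq> x" "bar x \<noteq> y" "x \<noteq> bar x" "y \<noteq> bar x" "y \<noteq> x"
    using assms bar_neq[of x x] bar_neq[of y x] by (auto simp: A_def)
  note [simp] = A d y(3)
  have n1: "nok \<one>[A] ?X ?X" "nok \<one>[A] ?Y ?Y" using nok_id[of ?X ?X] nok_id[of ?Y ?Y] by simp_all
  have e: "nok (\<eta> A) Em (Br ?B ?Y)" "nok (\<epsilon> A) (Br ?X ?B) Em" "nok ((\<eta> A)\<dagger>) (Br ?B ?X) Em"
    using nok_dagger[of "\<eta> A" Em "Br ?B ?X"] by (simp_all add: nok_def eta_Hom eps_Hom)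
  have s: "nok \<s>[A, A\<^sup>\<star>] (Br ?X ?B) (Br ?B ?X)" "N \<s>[A, A\<^sup>\<star>] (Br ?X ?B) (Br ?B ?X) = Idw {x, bar x}"
    using N_symm[of ?X ?B] by simp_all
  have cap: "capn x = N (\<epsilon> A) (Br ?X ?B) Em"
  proof -
    have "N (\<epsilon> A) (Br ?X ?B) Em = N ((\<eta> A)\<dagger>) (Br ?B ?X) Em \<triangleleft> Idw {x, bar x}"
      using N_sq[OF s(1) e(3)] s(2) by (simp add: eps_eta)
    then show ?thesis using e(3) by (simp add: capn_def insert_commute)
  qed
  have id: "Idw {x} = N \<one>[A] ?X ?X" "Idw {y} = N \<one>[A] ?Y ?Y" using N_id[of ?X] N_id[of ?Y] by simp_all
  have c1: "capn x \<diamondop> Idw {y} = N (\<epsilon> A \<otimes> \<one>[A]) (Br (Br ?X ?B) ?Y) (Br Em ?Y)"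
    unfolding cap id by (rule N_prd) (simp_all add: e n1)
  have c2: "Idw {x} \<diamondop> cupn x y = N (\<one>[A] \<otimes> \<eta> A) (Br ?X Em) (Br ?X (Br ?B ?Y))"
    unfolding cupn_def id A by (rule N_prd) (simp_all add: e n1)
  have m1: "nok (\<epsilon> A \<otimes> \<one>[A]) (Br (Br ?X ?B) ?Y) (Br Em ?Y)" by (rule nok_tensor) (simp_all add: e n1)
  have m2: "nok (\<one>[A] \<otimes> \<eta> A) (Br ?X Em) (Br ?X (Br ?B ?Y))" by (rule nok_tensor) (simp_all add: e n1)
  have al: "nok (\<a>[A, A\<^sup>\<star>, A]\<dagger>) (Br ?X (Br ?B ?Y)) (Br (Br ?X ?B) ?Y)"
    "N (\<a>[A, A\<^sup>\<star>, A]\<dagger>) (Br ?X (Br ?B ?Y)) (Br (Br ?X ?B) ?Y) = Idw {x, bar x, y}"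
    using N_assoc[of ?X ?B ?Y] N_dagger_struct[of "\<a>[A, A\<^sup>\<star>, A]" "Br (Br ?X ?B) ?Y" "Br ?X (Br ?B ?Y)"]
      nok_dagger[of "\<a>[A, A\<^sup>\<star>, A]" "Br (Br ?X ?B) ?Y" "Br ?X (Br ?B ?Y)"] by simp_all
  have l: "nok \<l>[A] (Br Em ?Y) ?Y" "N \<l>[A] (Br Em ?Y) ?Y = Idw {y}" using N_lunit[of ?Y] by simp_all
  have r: "nok (\<r>[A]\<dagger>) ?X (Br ?X Em)" "N (\<r>[A]\<dagger>) ?X (Br ?X Em) = Idw {x}"
    using N_runit[of ?X] N_dagger_struct[of "\<r>[A]" "Br ?X Em" ?X] nok_dagger[of "\<r>[A]" "Br ?X Em" ?X] by simp_all
  have "(capn x \<diamondop> Idw {y}) \<triangleleft> (Idw {x} \<diamondop> cupn x y)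
    = Idw {y} \<triangleleft> N (\<epsilon> A \<otimes> \<one>[A]) (Br (Br ?X ?B) ?Y) (Br Em ?Y) \<triangleleft> Idw {x, bar x, y} \<triangleleft>
      N (\<one>[A] \<otimes> \<eta> A) (Br ?X Em) (Br ?X (Br ?B ?Y)) \<triangleleft> Idw {x}"
    unfolding c1 c2 using m1 m2 by simp
  also have "\<dots> = N (\<l>[A] \<cdot> (\<epsilon> A \<otimes> \<one>[A]) \<cdot> \<a>[A, A\<^sup>\<star>, A]\<dagger> \<cdot> (\<one>[A] \<otimes> \<eta> A) \<cdot> \<r>[A]\<dagger>) ?X ?Y"
    unfolding l(2)[symmetric] al(2)[symmetric] r(2)[symmetric]
    by (simp only: N_sq[OF r(1) m2] N_sq[OF nok_comp[OF r(1) m2] al(1)]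
      N_sq[OF nok_comp[OF nok_comp[OF r(1) m2] al(1)] m1] N_sq[OF nok_comp[OF nok_comp[OF nok_comp[OF r(1) m2] al(1)] m1] l(1)])
  also have "\<dots> = ren x y" by (simp add: snake_eq ren_def)
  finally show ?thesis .
qed

definition posw :: "'o wire set \<Rightarrow> bool" where "posw S \<longleftrightarrow> wok S \<and> (\<forall>x\<in>S. pw x)"

lemma posw_alt: "posw S \<longleftrightarrow> finite S \<and> (\<forall>x\<in>S. fst x \<in> Obj V \<and> pw x)"
  unfolding posw_def wok_def by auto
lemma posw_mem: "posw S \<Longrightarrow> x \<in> S \<Longrightarrow> fst x \<in> Obj V \<and> pw x" by (simp add: posw_alt)
lemma posw_simps [simp]: "posw {}" "posw (insert x S) \<longleftrightarrow> fst x \<in> Obj V \<and> pw x \<and> posw S"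
  "posw (S \<union> T) \<longleftrightarrow> posw S \<and> posw T" "posw S \<Longrightarrow> posw (S - T)"
  "posw S \<Longrightarrow> posw (S \<inter> T)" "posw S \<Longrightarrow> posw (T \<inter> S)" "posw S \<Longrightarrow> posw (shift k ` S)"
  by (auto simp: posw_alt)
lemma posw_bar [simp]: "posw S \<Longrightarrow> wok (bar ` S)"
  unfolding posw_alt wok_def by auto
lemma bar_disj [simp]: "posw S \<Longrightarrow> bar ` X \<inter> S = {}" "posw S \<Longrightarrow> S \<inter> bar ` X = {}"
  unfolding posw_alt by auto
lemma bar_disj2: "posw S \<Longrightarrow> posw T \<Longrightarrow> S \<inter> T = {} \<Longrightarrow> bar ` S \<inter> bar ` T = {}"
  unfolding posw_alt by (fastforce simp: bar_eq)
lemma posw_wok [simp]: "posw S \<Longrightarrow> wok S" "posw S \<Longrightarrow> finite S" unfolding posw_alt wok_def by auto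

definition CUP :: "('o wire \<Rightarrow> 'o wire) \<Rightarrow> 'o wire set \<Rightarrow> ('o, 'm) na" where "CUP r X = BP (\<lambda>x. cupn x (r x)) X"
definition CAP :: "'o wire set \<Rightarrow> ('o, 'm) na" where "CAP X = BP capn X"

lemma famI: "finite X \<Longrightarrow> (\<And>x. x \<in> X \<Longrightarrow> ok (F x)) \<Longrightarrow>
  (\<And>x y. x \<in> X \<Longrightarrow> y \<in> X \<Longrightarrow> x \<noteq> y \<Longrightarrow> src (F x) \<inter> src (F y) = {} \<and> tgt (F x) \<inter> tgt (F y) = {}) \<Longrightarrow> fam F X"
  unfolding fam_def by blast

lemma fam_capn: assumes "posw X" shows "fam capn X"
proof (rule famI)
  fix x y assume "x \<in> X" "y \<in> X" "x \<noteq> y"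
  then show "src (capn x) \<inter> src (capn y) = {} \<and> tgt (capn x) \<inter> tgt (capn y) = {}"
    using posw_mem[OF assms, of x] posw_mem[OF assms, of y] by (simp add: bar_eq bar_neq)
qed (use assms posw_mem[OF assms] in simp_all)

lemma CAP_simps [simp]: assumes "posw X" shows "ok (CAP X)" "src (CAP X) = bar ` X \<union> X" "tgt (CAP X) = {}"
proof -
  have "(\<Union>x\<in>X. src (capn x)) = (\<Union>x\<in>X. {bar x, x})" "(\<Union>x\<in>X. tgt (capn x)) = (\<Union>x\<in>X. {})"
    by (rule SUP_cong; use posw_mem[OF assms] in \<open>simp; fail\<close>)+
  then show "ok (CAP X)" "src (CAP X) = bar ` X \<union> X" "tgt (CAP X) = {}"
    using BP_ok[OF fam_capn[OF assms]] unfolding CAP_def by auto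
qed

lemma fam_cupn: assumes "posw X" shows "fam (\<lambda>x. cupn x (shift k x)) X"
proof (rule famI)
  fix x y assume "x \<in> X" "y \<in> X" "x \<noteq> y"
  then show "src (cupn x (shift k x)) \<inter> src (cupn y (shift k y)) = {} \<and> tgt (cupn x (shift k x)) \<inter> tgt (cupn y (shift k y)) = {}"
    using posw_mem[OF assms, of x] posw_mem[OF assms, of y] by (simp add: bar_eq bar_neq)
qed (use assms posw_mem[OF assms] in simp_all)

lemma shift0 [simp]: "shift 0 x = x" by (cases x) simp

lemma CUP_simps [simp]:
  assumes "posw X" shows "ok (CUP (shift k) X)" "tgt (CUP (shift k) X) = bar ` X \<union> shift k ` X" "src (CUP (shift k) X) = {}"
proof -
  have "(\<Union>x\<in>X. tgt (cupn x (shift k x))) = (\<Union>x\<in>X. {bar x, shift k x})" "(\<Union>x\<in>X. src (cupn x (shift k x))) = (\<Union>x\<in>X. {})"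
    by (rule SUP_cong; use posw_mem[OF assms] in \<open>simp; fail\<close>)+
  then show "ok (CUP (shift k) X)" "tgt (CUP (shift k) X) = bar ` X \<union> shift k ` X" "src (CUP (shift k) X) = {}"
    using BP_ok[OF fam_cupn[OF assms, of k]] unfolding CUP_def by auto
qed

lemma CAP_union: "posw X \<Longrightarrow> posw Y \<Longrightarrow> X \<inter> Y = {} \<Longrightarrow> CAP (X \<union> Y) = CAP X \<diamondop> CAP Y"
  unfolding CAP_def by (rule BP_union) (auto intro: fam_capn)
lemma CUP_union: "posw X \<Longrightarrow> posw Y \<Longrightarrow> X \<inter> Y = {} \<Longrightarrow> CUP (shift k) (X \<union> Y) = CUP (shift k) X \<diamondop> CUP (shift k) Y"
  unfolding CUP_def by (rule BP_union) (auto intro: fam_cupn)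

text \<open>The three facts that eliminate a bundle of traced wires: cups ending in fresh names
  straighten against caps to a renaming; the cups of a trace are those cups followed by the renaming
  back; and the two renamings cancel.\<close>

lemma snakes:
  assumes X: "posw X" and k: "\<And>x. shift k x \<notin> X"
  shows "(CAP X \<diamondop> Idw (shift k ` X)) \<triangleleft> (Idw X \<diamondop> CUP (shift k) X) = BP (\<lambda>x. ren x (shift k x)) X" (is ?A)
    and "CUP (shift 0) X = (Idw (bar ` X) \<diamondop> BP (\<lambda>x. ren (shift k x) x) X) \<triangleleft> CUP (shift k) X" (is ?B)
    and "BP (\<lambda>x. ren (shift k x) x) X \<triangleleft> BP (\<lambda>x. ren x (shift k x)) X = Idw X" (is ?C)
    and "fam (\<lambda>x. ren (shift k x) x) X" "fam (\<lambda>x. ren x (shift k x)) X"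
proof -
  note m = posw_mem[OF X]
  have f: "finite X" using X by simp
  show r: "fam (\<lambda>x. ren (shift k x) x) X" "fam (\<lambda>x. ren x (shift k x)) X"
    by (rule famI; use m f in \<open>simp; fail\<close>)+
  have neq: "x \<in> X \<Longrightarrow> y \<in> X \<Longrightarrow> shift k x \<noteq> y" "x \<in> X \<Longrightarrow> y \<in> X \<Longrightarrow> y \<noteq> shift k x" for x y using k by metis+
  have i: "Idw (shift k ` X) = BP (\<lambda>x. Idw {shift k x}) X" "Idw X = BP (\<lambda>x. Idw {x}) X"
    "Idw (bar ` X) = BP (\<lambda>x. Idw {bar x}) X"
    using X f BP_Idw[of X "shift k"] BP_Idw[of X "\<lambda>x. x"] BP_Idw[of X bar] posw_simps(7)[of X k] m
    by (auto simp: inj_on_def bar_eq)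
  have g1: "fam (\<lambda>x. capn x \<diamondop> Idw {shift k x}) X" "fam (\<lambda>x. Idw {x} \<diamondop> cupn x (shift k x)) X"
    "fam (\<lambda>x. Idw {bar x} \<diamondop> ren (shift k x) x) X" "fam (\<lambda>x. cupn x (shift k x)) X"
    by (rule famI; use m f neq in \<open>simp add: bar_eq bar_neq; fail\<close>)+
  show ?A unfolding i CAP_def CUP_def BP_prd[OF f, symmetric]
  proof (subst BP_sq[symmetric, OF f g1(1,2)])
    show "x \<in> X \<Longrightarrow> src (capn x \<diamondop> Idw {shift k x}) = tgt (Idw {x} \<diamondop> cupn x (shift k x))" for x
      using m[of x] neq[of x x] by (simp add: bar_neq insert_commute)
    show "BP (\<lambda>x. (capn x \<diamondop> Idw {shift k x}) \<triangleleft> (Idw {x} \<diamondop> cupn x (shift k x))) X = BP (\<lambda>x. ren x (shift k x)) X"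
      by (rule BP_cong[OF f], rule snake1) (use m neq in simp_all)
  qed
  have "(Idw {bar x} \<diamondop> ren (shift k x) x) \<triangleleft> cupn x (shift k x) = cupn x x" if x: "x \<in> X" for x
  proof -
    let ?A = "fst x"
    have A: "?A \<in> Obj V" "wob x = ?A" "wob (shift k x) = ?A" "bar x \<noteq> x" "bar x \<noteq> shift k x" using m[OF x] bar_neq[of x x] bar_neq[of "shift k x" x] by auto
    have n: "nok \<one>[?A] (Lf (shift k x)) (Lf x)" by (rule ren_nok) (use m[OF x] in simp_all)
    have n2: "nok \<one>[?A\<^sup>\<star>] (Lf (bar x)) (Lf (bar x))" using nok_id[of "Lf (bar x)" "Lf (bar x)"] A by simp
    have e: "nok (\<eta> ?A) Em (Br (Lf (bar x)) (Lf (shift k x)))" using A by (simp add: nok_def eta_Hom)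
    have "Idw {bar x} = N \<one>[?A\<^sup>\<star>] (Lf (bar x)) (Lf (bar x))" using N_id[of "Lf (bar x)"] A by simp
    then have "Idw {bar x} \<diamondop> ren (shift k x) x = N (\<one>[?A\<^sup>\<star>] \<otimes> \<one>[?A]) (Br (Lf (bar x)) (Lf (shift k x))) (Br (Lf (bar x)) (Lf x))"
      unfolding ren_def using N_prd[OF n2 n] A by simp
    then have "(Idw {bar x} \<diamondop> ren (shift k x) x) \<triangleleft> cupn x (shift k x) = N ((\<one>[?A\<^sup>\<star>] \<otimes> \<one>[?A]) \<cdot> \<eta> ?A) Em (Br (Lf (bar x)) (Lf x))"
      unfolding cupn_def using N_sq[OF e nok_tensor[OF n2 n]] A by simp
    also have "(\<one>[?A\<^sup>\<star>] \<otimes> \<one>[?A]) \<cdot> \<eta> ?A = \<eta> ?A"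
      using A eta_Hom[of ?A] by (simp add: tensor_ident ident_comp[of \<I>])
    finally show ?thesis by (simp add: cupn_def)
  qed
  then have "CUP (shift 0) X = BP (\<lambda>x. (Idw {bar x} \<diamondop> ren (shift k x) x) \<triangleleft> cupn x (shift k x)) X"
    unfolding CUP_def by (intro BP_cong[OF f]) simp
  also have "\<dots> = BP (\<lambda>x. Idw {bar x} \<diamondop> ren (shift k x) x) X \<triangleleft> CUP (shift k) X"
    unfolding CUP_def using m neq by (intro BP_sq[OF f g1(3,4)]) (simp add: bar_neq insert_commute)
  finally show ?B unfolding i BP_prd[OF f, symmetric] .
  have "BP (\<lambda>x. ren (shift k x) x) X \<triangleleft> BP (\<lambda>x. ren x (shift k x)) X = BP (\<lambda>x. ren (shift k x) x \<triangleleft> ren x (shift k x)) X"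
    using m by (intro BP_sq[OF f r, symmetric]) simp
  also have "\<dots> = BP (\<lambda>x. Idw {x}) X" using m by (intro BP_cong[OF f] ren_ren) simp_all
  finally show ?C using i by simp
qed

text \<open>The trace joins every wire that is both an input and an output.\<close>

definition TR :: "'o wire set \<Rightarrow> ('o, 'm) na \<Rightarrow> ('o, 'm) na" where
  "TR X P = (CAP X \<diamondop> Idw (tgt P - X)) \<triangleleft> (P \<diamondop> Idw (bar ` X)) \<triangleleft> (CUP (shift 0) X \<diamondop> Idw (src P - X))"
definition tr :: "('o, 'm) na \<Rightarrow> ('o, 'm) na" where "tr P = TR (src P \<inter> tgt P) P"
definition okp :: "('o, 'm) na \<Rightarrow> bool" where "okp P \<longleftrightarrow> ok P \<and> posw (src P) \<and> posw (tgt P)"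

lemma okpD [simp]: "okp P \<Longrightarrow> ok P" "okp P \<Longrightarrow> posw (src P)" "okp P \<Longrightarrow> posw (tgt P)" by (auto simp: okp_def)

lemma sq3: "ok A \<Longrightarrow> ok B \<Longrightarrow> ok C \<Longrightarrow> tgt C = src B \<Longrightarrow> tgt B = src A \<Longrightarrow>
  ok (A \<triangleleft> B \<triangleleft> C) \<and> src (A \<triangleleft> B \<triangleleft> C) = src C \<and> tgt (A \<triangleleft> B \<triangleleft> C) = tgt A"
  by simp

lemma tr_simps [simp]:
  assumes "okp P" shows "ok (tr P)" "src (tr P) = src P - tgt P" "tgt (tr P) = tgt P - src P" "okp (tr P)"
proof -
  let ?X = "src P \<inter> tgt P"
  have o: "ok P" "posw ?X" using assms by simp_all
  have d: "bar ` ?X \<inter> src P = {}" "bar ` ?X \<inter> tgt P = {}" using assms by simp_all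
  then have e: "(bar ` ?X \<union> ?X) \<inter> (tgt P - ?X) = {}" "(bar ` ?X \<union> ?X) \<inter> (src P - ?X) = {}" by blast+
  have u: "bar ` ?X \<union> ?X \<union> (tgt P - ?X) = tgt P \<union> bar ` ?X" "bar ` ?X \<union> ?X \<union> (src P - ?X) = src P \<union> bar ` ?X"
    "tgt P - ?X = tgt P - src P" "src P - ?X = src P - tgt P" by blast+
  have w: "wok (tgt P - ?X)" "wok (src P - ?X)" "wok (bar ` ?X)" using o assms by simp_all
  have a: "ok (CAP ?X \<diamondop> Idw (tgt P - ?X))" "src (CAP ?X \<diamondop> Idw (tgt P - ?X)) = tgt P \<union> bar ` ?X"
     "tgt (CAP ?X \<diamondop> Idw (tgt P - ?X)) = tgt P - src P"
    using o w e u by (simp_all del: Diff_Int)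
  have b: "ok (P \<diamondop> Idw (bar ` ?X))" "src (P \<diamondop> Idw (bar ` ?X)) = src P \<union> bar ` ?X" "tgt (P \<diamondop> Idw (bar ` ?X)) = tgt P \<union> bar ` ?X"
    using o w d by (simp_all add: Int_commute)
  have c: "ok (CUP (shift 0) ?X \<diamondop> Idw (src P - ?X))" "src (CUP (shift 0) ?X \<diamondop> Idw (src P - ?X)) = src P - tgt P"
     "tgt (CUP (shift 0) ?X \<diamondop> Idw (src P - ?X)) = src P \<union> bar ` ?X"
    using o w e u by (simp_all del: Diff_Int)
  show "ok (tr P)" "src (tr P) = src P - tgt P" "tgt (tr P) = tgt P - src P"
    unfolding tr_def TR_def
    using sq3[OF a(1) b(1) c(1)] a b c by (simp_all only:)
  then show "okp (tr P)" unfolding okp_def using okpD(2,3)[OF assms] posw_simps(4) by metis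
qed

lemma CAP_empty [simp]: "CAP {} = Idw {}" "CUP r {} = Idw {}" by (simp_all add: CAP_def CUP_def)

lemma tr_disj: "ok P \<Longrightarrow> src P \<inter> tgt P = {} \<Longrightarrow> tr P = P"
  unfolding tr_def TR_def by simp

end

section \<open>Composition and locality of the trace\<close>

context dagger_compact
begin

text \<open>The trace joins the outputs \<open>X\<close> of \<open>P\<close> to the inputs
  \<open>X\<close> of \<open>Q\<close>. Under fresh names for the latter the two arrows can be run
  one after the other, and what connects them is a bundle of snakes.\<close>

lemma tr_comp:
  assumes P: "okp P" and Q: "okp Q" and sP: "src P = S" and tP: "tgt P = X \<union> T'" and sQ: "src Q = X \<union> S'" and tQ: "tgt Q = T"
    and d: "X \<inter> S = {}" "X \<inter> S' = {}" "X \<inter> T = {}" "X \<inter> T' = {}" "S \<inter> S' = {}" "S \<inter> T = {}" "S \<inter> T' = {}"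
      "S' \<inter> T = {}" "S' \<inter> T' = {}" "T \<inter> T' = {}"
  shows "tr (P \<diamondop> Q) = (Q \<diamondop> Idw T') \<triangleleft> (P \<diamondop> Idw S')"
proof -
  have pw: "posw S" "posw X" "posw T'" "posw S'" "posw T" using okpD[OF P] okpD[OF Q] sP tP sQ tQ by auto
  have o [simp]: "ok P" "ok Q" using P Q by auto
  obtain k where k: "\<And>x. shift k x \<notin> S \<union> X \<union> T' \<union> S' \<union> T" 
    using shift_fresh[of "S \<union> X \<union> T' \<union> S' \<union> T"] pw posw_wok(2) finite_UnI by metis
  define B where "B = bar ` X"
  define R where "R = shift k ` X"
  have R: "posw R" "R \<inter> S = {}" "R \<inter> X = {}" "R \<inter> T' = {}" "R \<inter> S' = {}" "R \<inter> T = {}"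
    using pw(2) k unfolding R_def by (simp, blast+)
  have B: "B \<inter> S = {}" "B \<inter> X = {}" "B \<inter> T' = {}" "B \<inter> S' = {}" "B \<inter> T = {}" "B \<inter> R = {}" "wok B"
    unfolding B_def using pw R(1) by simp_all
  have d': "S \<inter> X = {}" "S' \<inter> X = {}" "T \<inter> X = {}" "T' \<inter> X = {}" "S' \<inter> S = {}" "T \<inter> S = {}" "T' \<inter> S = {}"
      "T \<inter> S' = {}" "T' \<inter> S' = {}" "T' \<inter> T = {}"
     "S \<inter> R = {}" "X \<inter> R = {}" "T' \<inter> R = {}" "S' \<inter> R = {}" "T \<inter> R = {}"
     "S \<inter> B = {}" "X \<inter> B = {}" "T' \<inter> B = {}" "S' \<inter> B = {}" "T \<inter> B = {}" "R \<inter> B = {}"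
    using d R B by (simp_all add: Int_commute)
  note [simp] = d d' R(2-6) B(1-6) Int_Un_distrib Int_Un_distrib2
  have wk: "wok S" "wok X" "wok T'" "wok S'" "wok T" "wok R" "wok B" using pw R B by simp_all
  define C where "C = CAP X"
  define U0 where "U0 = CUP (shift 0) X"
  define Uk where "Uk = CUP (shift k) X"
  define R1 where "R1 = BP (\<lambda>x. ren x (shift k x)) X"
  define R2 where "R2 = BP (\<lambda>x. ren (shift k x) x) X"
  note sn = snakes[OF pw(2), of k, folded C_def U0_def Uk_def R1_def R2_def B_def R_def]
  have kX: "\<And>x. shift k x \<notin> X" using k by auto
  have C: "ok C" "src C = B \<union> X" "tgt C = {}" and U0: "ok U0" "src U0 = {}" "tgt U0 = B \<union> X"
    and Uk: "ok Uk" "src Uk = {}" "tgt Uk = B \<union> R"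
    using pw unfolding C_def U0_def Uk_def B_def R_def by simp_all
  have u1: "(\<Union>x\<in>X. src (ren x (shift k x))) = (\<Union>x\<in>X. {x})" "(\<Union>x\<in>X. tgt (ren x (shift k x))) = (\<Union>x\<in>X. {shift k x})"
     "(\<Union>x\<in>X. src (ren (shift k x) x)) = (\<Union>x\<in>X. {shift k x})" "(\<Union>x\<in>X. tgt (ren (shift k x) x)) = (\<Union>x\<in>X. {x})"
    by (rule SUP_cong; use posw_mem[OF pw(2)] in \<open>simp; fail\<close>)+
  have R1: "ok R1" "src R1 = X" "tgt R1 = R" and R2: "ok R2" "src R2 = R" "tgt R2 = X"
    using BP_ok[OF sn(5)[OF kX]] BP_ok[OF sn(4)[OF kX]] u1 unfolding R1_def R2_def R_def by auto
  note st = sP tP sQ tQ C U0 Uk R1 R2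
  have ID: "Idw (T' \<union> T) = Idw T' \<diamondop> Idw T" "Idw (S \<union> S') = Idw S \<diamondop> Idw S'" "Idw (X \<union> T') = Idw X \<diamondop> Idw T'"
     "Idw (R \<union> S') = Idw R \<diamondop> Idw S'" "Idw (B \<union> R) = Idw B \<diamondop> Idw R"
    by (rule Idw_prd[symmetric]; use wk d d' R(2-6) B(6) in \<open>simp only:\<close>)+
  have I: "(S \<union> (X \<union> S')) \<inter> (X \<union> T' \<union> T) = X" "X \<union> T' \<union> T - X = T' \<union> T" "S \<union> (X \<union> S') - X = S \<union> S'"
    using d by blast+
  have "ok (P \<diamondop> Q)" "src (P \<diamondop> Q) = S \<union> (X \<union> S')" "tgt (P \<diamondop> Q) = X \<union> T' \<union> T" using st by simp_all
  then have e0: "tr (P \<diamondop> Q) = (C \<diamondop> (Idw T' \<diamondop> Idw T)) \<triangleleft> ((P \<diamondop> Q) \<diamondop> Idw B) \<triangleleft> (U0 \<diamondop> (Idw S \<diamondop> Idw S'))"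
    unfolding tr_def TR_def C_def[symmetric] U0_def[symmetric] by (simp only: I ID(1,2) B_def C_def U0_def)
  have e1: "U0 \<diamondop> (Idw S \<diamondop> Idw S') = ((Idw B \<diamondop> R2) \<diamondop> (Idw S \<diamondop> Idw S')) \<triangleleft> (Uk \<diamondop> (Idw S \<diamondop> Idw S'))"
    using ic[of Uk "Idw B \<diamondop> R2" "Idw S \<diamondop> Idw S'" "Idw S \<diamondop> Idw S'"] sn(2)[OF kX] st wk by (simp add: ID(2)[symmetric])
  \<comment> \<open>\<open>Q'\<close> reads the traced inputs of \<open>Q\<close> from the fresh
    wires \<open>R\<close>.\<close>
  define Q' where "Q' = Q \<triangleleft> (R2 \<diamondop> Idw S')"
  have Q': "ok Q'" "src Q' = R \<union> S'" "tgt Q' = T" unfolding Q'_def using st wk by simp_all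
  have "P \<diamondop> (Idw B \<diamondop> Q') = (P \<triangleleft> Idw S) \<diamondop> ((Idw B \<triangleleft> Idw B) \<diamondop> (Q \<triangleleft> (R2 \<diamondop> Idw S')))"
    unfolding Q'_def using st wk by simp
  also have "\<dots> = (P \<triangleleft> Idw S) \<diamondop> ((Idw B \<diamondop> Q) \<triangleleft> (Idw B \<diamondop> (R2 \<diamondop> Idw S')))"
    using st wk by (subst ic) simp_all
  also have "\<dots> = (P \<diamondop> (Idw B \<diamondop> Q)) \<triangleleft> (Idw S \<diamondop> (Idw B \<diamondop> (R2 \<diamondop> Idw S')))"
    using st wk by (subst ic) (simp_all)
  finally have e2: "((P \<diamondop> Q) \<diamondop> Idw B) \<triangleleft> ((Idw B \<diamondop> R2) \<diamondop> (Idw S \<diamondop> Idw S')) = P \<diamondop> (Idw B \<diamondop> Q')"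
    by (simp only: prd_ac)
  \<comment> \<open>\<open>W\<close> is \<open>P\<close> with its outputs \<open>X\<close> already
    consumed by the caps, so that it runs entirely before \<open>Q'\<close>.\<close>
  define W where "W = (C \<diamondop> Idw T') \<triangleleft> (P \<diamondop> Idw B)"
  have W: "ok W" "src W = S \<union> B" "tgt W = T'" unfolding W_def using st wk by (simp_all add: Un_ac)
  have "W \<diamondop> Q' = W \<diamondop> (Idw T \<triangleleft> Q')" using Q' by simp
  also have "\<dots> = ((C \<diamondop> Idw T') \<diamondop> Idw T) \<triangleleft> ((P \<diamondop> Idw B) \<diamondop> Q')"
    unfolding W_def using st wk Q' by (subst ic) (simp_all add: Un_ac)
  finally have e3: "(C \<diamondop> (Idw T' \<diamondop> Idw T)) \<triangleleft> (P \<diamondop> (Idw B \<diamondop> Q')) = W \<diamondop> Q'"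
    by (simp only: prd_assoc)
  have e4: "W \<diamondop> Q' = (Idw T' \<diamondop> Q') \<triangleleft> (W \<diamondop> (Idw R \<diamondop> Idw S'))"
    using ic[of W "Idw T'" "Idw (R \<union> S')" Q'] W Q' wk by (simp add: ID(4)[symmetric])
  have "((W \<diamondop> Idw R) \<triangleleft> (Uk \<diamondop> Idw S)) \<diamondop> (Idw S' \<triangleleft> Idw S') = ((W \<diamondop> Idw R) \<diamondop> Idw S') \<triangleleft> ((Uk \<diamondop> Idw S) \<diamondop> Idw S')"
    using W st wk by (subst ic) (simp_all add: Un_ac)
  then have e5: "(W \<diamondop> (Idw R \<diamondop> Idw S')) \<triangleleft> (Uk \<diamondop> (Idw S \<diamondop> Idw S')) = ((W \<diamondop> Idw R) \<triangleleft> (Uk \<diamondop> Idw S)) \<diamondop> Idw S'"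
    using wk by (simp add: prd_assoc)
  have e6: "W \<diamondop> Idw R = ((C \<diamondop> Idw T') \<diamondop> Idw R) \<triangleleft> ((P \<diamondop> Idw B) \<diamondop> Idw R)"
    unfolding W_def using st wk by (intro sq_Idw_prd) (simp_all add: Un_ac)
  have "(P \<diamondop> (Idw B \<diamondop> Idw R)) \<triangleleft> (Idw S \<diamondop> Uk) = P \<diamondop> Uk"
    using ic[of "Idw S" P Uk "Idw (B \<union> R)"] st wk by (simp add: ID(5)[symmetric])
  also have "\<dots> = ((Idw X \<diamondop> Idw T') \<diamondop> Uk) \<triangleleft> P"
    using ic[of P "Idw (X \<union> T')" "Idw {}" Uk] st wk by (simp add: ID(3)[symmetric])
  finally have e7: "((P \<diamondop> Idw B) \<diamondop> Idw R) \<triangleleft> (Uk \<diamondop> Idw S) = ((Idw X \<diamondop> Idw T') \<diamondop> Uk) \<triangleleft> P"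
    by (simp only: prd_ac)
  \<comment> \<open>Here caps and cups meet, and the bundle straightens to the renaming from
    \<open>X\<close> to \<open>R\<close>.\<close>
  have "((C \<diamondop> Idw R) \<triangleleft> (Idw X \<diamondop> Uk)) \<diamondop> Idw T' = ((C \<diamondop> Idw R) \<diamondop> Idw T') \<triangleleft> ((Idw X \<diamondop> Uk) \<diamondop> Idw T')"
    using st wk by (intro sq_Idw_prd) (simp_all add: Un_ac)
  then have e8: "((C \<diamondop> Idw T') \<diamondop> Idw R) \<triangleleft> ((Idw X \<diamondop> Idw T') \<diamondop> Uk) = R1 \<diamondop> Idw T'"
    using sn(1)[OF kX] by (simp add: prd_ac)
  have e9: "(W \<diamondop> Idw R) \<triangleleft> (Uk \<diamondop> Idw S) = (R1 \<diamondop> Idw T') \<triangleleft> P"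
    unfolding e6 sq_assoc e7 by (simp only: sq_assoc[symmetric] e8)
  have e10: "Idw T' \<diamondop> Q' = (Idw T' \<diamondop> Q) \<triangleleft> (Idw T' \<diamondop> (R2 \<diamondop> Idw S'))"
    unfolding Q'_def using ic[of "Idw T'" "Idw T'" "R2 \<diamondop> Idw S'" Q] st wk by simp
  have e11: "((R1 \<diamondop> Idw T') \<triangleleft> P) \<diamondop> Idw S' = ((R1 \<diamondop> Idw T') \<diamondop> Idw S') \<triangleleft> (P \<diamondop> Idw S')"
    using st wk by (intro sq_Idw_prd) simp_all
  have "(R2 \<diamondop> Idw (T' \<union> S')) \<triangleleft> (R1 \<diamondop> Idw (T' \<union> S')) = (R2 \<triangleleft> R1) \<diamondop> Idw (T' \<union> S')"
    using st wk by (subst sq_Idw_prd) simp_all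
  also have "\<dots> = Idw (X \<union> (T' \<union> S'))" using sn(3)[OF kX] wk by (simp add: Idw_prd)
  finally have e12: "(Idw T' \<diamondop> (R2 \<diamondop> Idw S')) \<triangleleft> ((R1 \<diamondop> Idw T') \<diamondop> Idw S') = Idw (X \<union> (T' \<union> S'))"
    using wk by (simp add: Idw_prd[symmetric] prd_ac)
  have "tr (P \<diamondop> Q) = (C \<diamondop> (Idw T' \<diamondop> Idw T)) \<triangleleft> (P \<diamondop> (Idw B \<diamondop> Q')) \<triangleleft> (Uk \<diamondop> (Idw S \<diamondop> Idw S'))"
    unfolding e0 e1 e2[symmetric] by (simp only: sq_assoc)
  also have "\<dots> = (Idw T' \<diamondop> Q') \<triangleleft> (((R1 \<diamondop> Idw T') \<triangleleft> P) \<diamondop> Idw S')"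
    unfolding sq_assoc[symmetric] e3 e4 by (simp only: sq_assoc e5 e9)
  also have "\<dots> = (Idw T' \<diamondop> Q) \<triangleleft> ((Idw T' \<diamondop> (R2 \<diamondop> Idw S')) \<triangleleft> ((R1 \<diamondop> Idw T') \<diamondop> Idw S')) \<triangleleft> (P \<diamondop> Idw S')"
    unfolding e10 e11 by (simp only: sq_assoc)
  also have "\<dots> = (Q \<diamondop> Idw T') \<triangleleft> (P \<diamondop> Idw S')"
    unfolding e12 using st wk by (simp add: prd_comm[of "Idw T'"] Un_ac)
  finally show ?thesis .
qed

text \<open>Since the product is defined, the wires closed inside \<open>P\<close> do not occur in
  \<open>C\<close>. Closing them first and the remaining ones later is therefore the same as closing
  all at once.\<close>

lemma tr_tr:
  assumes P: "okp P" and C: "okp C" and o: "ok (P \<diamondop> C)"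
  shows "tr (tr P \<diamondop> C) = tr (P \<diamondop> C)"
proof -
  define X where "X = src P \<inter> tgt P"
  define S where "S = src P - X"
  define T where "T = tgt P - X"
  define U where "U = src C"
  define W where "W = tgt C"
  \<comment> \<open>The wires that can be closed only after \<open>C\<close> has been added;
    together with \<open>X\<close> they are all traced wires of the product.\<close>
  define Y where "Y = (S \<union> U) \<inter> (T \<union> W)"
  define A where "A = S \<union> U - Y"
  define D where "D = T \<union> W - Y"
  define BX where "BX = bar ` X"
  define BY where "BY = bar ` Y"
  have sP: "src P = X \<union> S" "tgt P = X \<union> T" unfolding X_def S_def T_def by auto
  have oo: "ok P" "ok C" using P C by auto
  have d1: "X \<inter> S = {}" "X \<inter> T = {}" "S \<inter> T = {}" "X \<inter> U = {}" "S \<inter> U = {}" "X \<inter> W = {}" "T \<inter> W = {}"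
    using o oo unfolding X_def S_def T_def U_def W_def by auto
  have SU: "S \<union> U = Y \<union> A" "T \<union> W = Y \<union> D" unfolding A_def D_def Y_def by auto
  have d2: "Y \<inter> A = {}" "Y \<inter> D = {}" "A \<inter> D = {}" "X \<inter> Y = {}" "X \<inter> A = {}" "X \<inter> D = {}"
    using d1 unfolding A_def D_def Y_def by auto
  have pw: "posw X" "posw S" "posw T" "posw U" "posw W" using P C unfolding X_def S_def T_def U_def W_def by simp_all
  then have pw2: "posw Y" "posw A" "posw D" unfolding Y_def A_def D_def by simp_all
  have b: "BX \<inter> X = {}" "BX \<inter> S = {}" "BX \<inter> T = {}" "BX \<inter> U = {}" "BX \<inter> W = {}" "BX \<inter> Y = {}" "BX \<inter> A = {}" "BX \<inter> D = {}"
    "BY \<inter> X = {}" "BY \<inter> S = {}" "BY \<inter> T = {}" "BY \<inter> U = {}" "BY \<inter> W = {}" "BY \<inter> Y = {}" "BY \<inter> A = {}" "BY \<inter> D = {}"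
    "BX \<inter> BY = {}"
    unfolding BX_def BY_def using pw pw2 bar_disj2[OF pw(1) pw2(1) d2(4)] by simp_all
  have dd': "S \<inter> X = {}" "T \<inter> X = {}" "T \<inter> S = {}" "U \<inter> X = {}" "U \<inter> S = {}" "W \<inter> X = {}" "W \<inter> T = {}"
     "A \<inter> Y = {}" "D \<inter> Y = {}" "D \<inter> A = {}" "Y \<inter> X = {}" "A \<inter> X = {}" "D \<inter> X = {}"
     "X \<inter> BX = {}" "S \<inter> BX = {}" "T \<inter> BX = {}" "U \<inter> BX = {}" "W \<inter> BX = {}" "Y \<inter> BX = {}" "A \<inter> BX = {}" "D \<inter> BX = {}"
     "X \<inter> BY = {}" "S \<inter> BY = {}" "T \<inter> BY = {}" "U \<inter> BY = {}" "W \<inter> BY = {}" "Y \<inter> BY = {}" "A \<inter> BY = {}" "D \<inter> BY = {}" "BY \<inter> BX = {}"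
    using d1 d2 b by (simp_all add: Int_commute)
  note [simp] = d1 d2 b dd' Int_Un_distrib Int_Un_distrib2
  have wk: "wok X" "wok S" "wok T" "wok U" "wok W" "wok Y" "wok A" "wok D" "wok BX" "wok BY"
    using pw pw2 unfolding BX_def BY_def by simp_all
  define CX where "CX = CAP X"
  define CY where "CY = CAP Y"
  define UX where "UX = CUP (shift 0) X"
  define UY where "UY = CUP (shift 0) Y"
  have c: "ok CX" "src CX = BX \<union> X" "tgt CX = {}" "ok CY" "src CY = BY \<union> Y" "tgt CY = {}"
    "ok UX" "src UX = {}" "tgt UX = BX \<union> X" "ok UY" "src UY = {}" "tgt UY = BY \<union> Y"
    using pw pw2 unfolding CX_def CY_def UX_def UY_def BX_def BY_def by simp_all
  note st = sP U_def[symmetric] W_def[symmetric] c oo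
  have t: "tr P = (CX \<diamondop> Idw T) \<triangleleft> (P \<diamondop> Idw BX) \<triangleleft> (UX \<diamondop> Idw S)"
    unfolding tr_def TR_def CX_def UX_def BX_def T_def S_def X_def ..
  have tr: "ok (tr P)" "src (tr P) = S" "tgt (tr P) = T" unfolding t using st wk by (simp_all add: Un_ac)
  have I: "Idw (T \<union> W) = Idw Y \<diamondop> Idw D" "Idw (S \<union> U) = Idw Y \<diamondop> Idw A" unfolding SU using wk by (simp_all add: Idw_prd)
  have "tr P \<diamondop> (C \<diamondop> Idw BY) = tr P \<diamondop> (Idw (W \<union> BY) \<triangleleft> (C \<diamondop> Idw BY) \<triangleleft> Idw (U \<union> BY))"
    using st wk by simp
  also have "\<dots> = ((CX \<diamondop> Idw T) \<diamondop> Idw (W \<union> BY)) \<triangleleft> ((P \<diamondop> Idw BX) \<diamondop> (C \<diamondop> Idw BY)) \<triangleleft> ((UX \<diamondop> Idw S) \<diamondop> Idw (U \<union> BY))"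
    unfolding t using st wk by (subst ic; (subst ic)?; simp add: Un_ac)
  also have "(CX \<diamondop> Idw T) \<diamondop> Idw (W \<union> BY) = CX \<diamondop> ((Idw BY \<diamondop> Idw Y) \<diamondop> Idw D)"
  proof -
    have "(CX \<diamondop> Idw T) \<diamondop> Idw (W \<union> BY) = CX \<diamondop> (Idw (T \<union> W) \<diamondop> Idw BY)" using wk by (simp add: Idw_prd[symmetric] prd_assoc)
    then show ?thesis unfolding I by (simp only: prd_ac)
  qed
  also have "(UX \<diamondop> Idw S) \<diamondop> Idw (U \<union> BY) = UX \<diamondop> ((Idw BY \<diamondop> Idw Y) \<diamondop> Idw A)"
  proof -
    have "(UX \<diamondop> Idw S) \<diamondop> Idw (U \<union> BY) = UX \<diamondop> (Idw (S \<union> U) \<diamondop> Idw BY)" using wk by (simp add: Idw_prd[symmetric] prd_assoc)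
    then show ?thesis unfolding I by (simp only: prd_ac)
  qed
  finally have e1: "(tr P \<diamondop> C) \<diamondop> Idw BY = (CX \<diamondop> ((Idw BY \<diamondop> Idw Y) \<diamondop> Idw D)) \<triangleleft> ((P \<diamondop> Idw BX) \<diamondop> (C \<diamondop> Idw BY)) \<triangleleft> (UX \<diamondop> ((Idw BY \<diamondop> Idw Y) \<diamondop> Idw A))"
    by (simp only: prd_assoc)
  have e2: "(CY \<diamondop> Idw D) \<triangleleft> (CX \<diamondop> ((Idw BY \<diamondop> Idw Y) \<diamondop> Idw D)) = (CX \<diamondop> CY) \<diamondop> Idw D"
    using ic[of CX "Idw {}" "Idw (BY \<union> Y \<union> D)" "CY \<diamondop> Idw D"] st wk by (simp add: Idw_prd prd_assoc)
  have e3: "(UX \<diamondop> ((Idw BY \<diamondop> Idw Y) \<diamondop> Idw A)) \<triangleleft> (UY \<diamondop> Idw A) = (UX \<diamondop> UY) \<diamondop> Idw A"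
    using ic[of "Idw {}" UX "UY \<diamondop> Idw A" "Idw (BY \<union> Y \<union> A)"] st wk by (simp add: Idw_prd prd_assoc)
  have i1: "src (tr P \<diamondop> C) \<inter> tgt (tr P \<diamondop> C) = Y" "src (tr P \<diamondop> C) - Y = A" "tgt (tr P \<diamondop> C) - Y = D"
    using tr st unfolding Y_def A_def D_def by simp_all
  have "tr (tr P \<diamondop> C) = (CY \<diamondop> Idw D) \<triangleleft> ((tr P \<diamondop> C) \<diamondop> Idw BY) \<triangleleft> (UY \<diamondop> Idw A)"
    unfolding tr_def[of "tr P \<diamondop> C"] TR_def i1 CY_def UY_def BY_def ..
  also have "\<dots> = ((CY \<diamondop> Idw D) \<triangleleft> (CX \<diamondop> ((Idw BY \<diamondop> Idw Y) \<diamondop> Idw D))) \<triangleleft> ((P \<diamondop> Idw BX) \<diamondop> (C \<diamondop> Idw BY)) \<triangleleft>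
      ((UX \<diamondop> ((Idw BY \<diamondop> Idw Y) \<diamondop> Idw A)) \<triangleleft> (UY \<diamondop> Idw A))"
    unfolding e1 by (simp only: sq_assoc)
  also have "\<dots> = ((CX \<diamondop> CY) \<diamondop> Idw D) \<triangleleft> ((P \<diamondop> C) \<diamondop> (Idw BX \<diamondop> Idw BY)) \<triangleleft> ((UX \<diamondop> UY) \<diamondop> Idw A)"
    unfolding e2 e3 by (simp only: prd_ac)
  also have "\<dots> = TR (X \<union> Y) (P \<diamondop> C)"
  proof -
    have "tgt (P \<diamondop> C) - (X \<union> Y) = D" "src (P \<diamondop> C) - (X \<union> Y) = A"
      using st d1 d2 unfolding D_def A_def by (auto simp: Int_Un_distrib Int_Un_distrib2)
    moreover have "Idw (bar ` (X \<union> Y)) = Idw BX \<diamondop> Idw BY" unfolding image_Un BX_def[symmetric] BY_def[symmetric] using wk by (simp add: Idw_prd)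
    moreover have "CAP (X \<union> Y) = CX \<diamondop> CY" "CUP (shift 0) (X \<union> Y) = UX \<diamondop> UY"
      unfolding CX_def CY_def UX_def UY_def using CAP_union CUP_union pw pw2 d2 by blast+
    ultimately show ?thesis unfolding TR_def by simp
  qed
  also have "\<dots> = tr (P \<diamondop> C)"
  proof -
    have "src (P \<diamondop> C) \<inter> tgt (P \<diamondop> C) = X \<union> Y" using st unfolding Y_def by auto
    then show ?thesis unfolding tr_def by simp
  qed
  finally show ?thesis .
qed

end

section \<open>Calculus of nets\<close>

text \<open>A net is a list of nodes in which an output and an input of the same name are joined. Its
denotation is the trace of the product of its nodes, so that neither the order of the nodes nor the
names of the joined wires matter.\<close>

type_synonym ('o, 'm) node = "'m \<times> 'o tree \<times> 'o tree"

abbreviation w :: "'o \<Rightarrow> nat \<Rightarrow> 'o tree" where "w A i \<equiv> Lf (A, i, False)"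

definition ins :: "('o, 'm) node list \<Rightarrow> 'o wire list" where "ins D = concat (map (\<lambda>(f, s, t). lvs s) D)"
definition outs :: "('o, 'm) node list \<Rightarrow> 'o wire list" where "outs D = concat (map (\<lambda>(f, s, t). lvs t) D)"

lemma ins_simps [simp]: "ins [] = []" "ins ((f, s, t) # D) = lvs s @ ins D" "ins (D @ E) = ins D @ ins E"
  "outs [] = []" "outs ((f, s, t) # D) = lvs t @ outs D" "outs (D @ E) = outs D @ outs E"
  by (simp_all add: ins_def outs_def)

lemma mset_ins: "mset D = mset E \<Longrightarrow> mset (ins D) = mset (ins E)"
  and mset_outs: "mset D = mset E \<Longrightarrow> mset (outs D) = mset (outs E)"
proof -
  have c: "mset (concat (map f D)) = (\<Sum>x\<in>#mset D. mset (f x))" for f :: "'c \<Rightarrow> 'd list" and D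
    by (induction D) auto
  show "mset D = mset E \<Longrightarrow> mset (ins D) = mset (ins E)" "mset D = mset E \<Longrightarrow> mset (outs D) = mset (outs E)"
    unfolding ins_def outs_def c by simp_all
qed

text \<open>Relates a tree to its renamings. Negative wires are excluded because they occur only
  inside the trace.\<close>

fun lk :: "'o tree \<Rightarrow> 'o tree \<Rightarrow> bool" where
  "lk Em Em \<longleftrightarrow> True"
| "lk (Lf x) (Lf y) \<longleftrightarrow> fst x = fst y \<and> \<not> snd (snd x) \<and> \<not> snd (snd y)"
| "lk (Br s t) (Br s' t') \<longleftrightarrow> lk s s' \<and> lk t t'"
| "lk _ _ \<longleftrightarrow> False"

fun sub :: "'o wire \<Rightarrow> 'o wire \<Rightarrow> 'o tree \<Rightarrow> 'o tree" where
  "sub b a Em = Em"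
| "sub b a (Lf x) = (if x = b then Lf a else Lf x)"
| "sub b a (Br s t) = Br (sub b a s) (sub b a t)"

lemma distinct_mset_swap: "mset xs = mset ys \<Longrightarrow> distinct xs = distinct ys"
  by (rule mset_eq_imp_distinct_iff)

context dagger_compact
begin

definition wkt :: "'o tree \<Rightarrow> bool" where "wkt t \<longleftrightarrow> posw (set (lvs t))"
lemma wkt_simps [simp]: "wkt Em" "wkt (Lf x) \<longleftrightarrow> fst x \<in> Obj V \<and> pw x" "wkt (Br s t) \<longleftrightarrow> wkt s \<and> wkt t"
  by (auto simp: wkt_def)
lemma tok_wkt: "wkt t \<Longrightarrow> distinct (lvs t) \<Longrightarrow> tok t" by (simp add: tok_def wkt_def)
lemma wkt_obt: "wkt t \<Longrightarrow> obt t \<in> Obj V" by (induction t) auto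
lemma lk_obt: "lk s t \<Longrightarrow> obt t = obt s" by (induction s t rule: lk.induct) auto
lemma lk_wkt: "lk s t \<Longrightarrow> wkt s \<Longrightarrow> wkt t" by (induction s t rule: lk.induct) auto

fun wn :: "('o, 'm) node \<Rightarrow> bool" where
  "wn (f, s, t) \<longleftrightarrow> wkt s \<and> wkt t \<and> f \<in> Hom V (obt s) (obt t)"

fun nd :: "('o, 'm) node \<Rightarrow> ('o, 'm) na" where "nd (f, s, t) = N f s t"

text \<open>Keeps the product of the nodes away from \<open>Bad\<close>. A name may still occur once
  among the inputs and once among the outputs, which is a joined wire.\<close>

definition valid :: "('o, 'm) node list \<Rightarrow> bool" where
  "valid D \<longleftrightarrow> (\<forall>n\<in>set D. wn n) \<and> distinct (ins D) \<and> distinct (outs D)"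

definition prodl :: "('o, 'm) node list \<Rightarrow> ('o, 'm) na" where
  "prodl D = foldr (\<lambda>n. prd (nd n)) D (Idw {})"

definition den :: "('o, 'm) node list \<Rightarrow> ('o, 'm) na" where "den D = tr (prodl D)"

lemma prodl_simps [simp]: "prodl [] = Idw {}" "prodl (n # D) = nd n \<diamondop> prodl D"
  by (simp_all add: prodl_def)

lemma valid_Cons: "valid ((f, s, t) # D) \<longleftrightarrow> wn (f, s, t) \<and> valid D \<and> distinct (lvs s) \<and> distinct (lvs t) \<and>
   set (lvs s) \<inter> set (ins D) = {} \<and> set (lvs t) \<inter> set (outs D) = {}"
  unfolding valid_def by auto
lemma valid_append: "valid (D @ E) \<longleftrightarrow> valid D \<and> valid E \<and> set (ins D) \<inter> set (ins E) = {} \<and> set (outs D) \<inter> set (outs E) = {}"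
  unfolding valid_def by auto
lemma valid_mset: "mset D = mset E \<Longrightarrow> valid D = valid E"
  unfolding valid_def using mset_ins[of D E] mset_outs[of D E] distinct_mset_swap set_mset_mset by metis
lemma valid_Nil [simp]: "valid []" by (simp add: valid_def)

lemma wn_nok: "wn (f, s, t) \<Longrightarrow> distinct (lvs s) \<Longrightarrow> distinct (lvs t) \<Longrightarrow> nok f s t"
  by (simp add: nok_def tok_wkt)

lemma prodl_ok: "valid D \<Longrightarrow> okp (prodl D) \<and> src (prodl D) = set (ins D) \<and> tgt (prodl D) = set (outs D)"
proof (induction D)
  case Nil show ?case by (simp add: okp_def)
next
  case (Cons n D)
  obtain f s t where n: "n = (f, s, t)" by (cases n)
  have v: "wn (f, s, t)" "valid D" "distinct (lvs s)" "distinct (lvs t)"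
    "set (lvs s) \<inter> set (ins D) = {}" "set (lvs t) \<inter> set (outs D) = {}" using Cons.prems unfolding n valid_Cons by auto
  have N: "nok f s t" using v wn_nok by blast
  have ih: "okp (prodl D)" "src (prodl D) = set (ins D)" "tgt (prodl D) = set (outs D)" using Cons.IH v by auto
  have p: "posw (set (lvs s))" "posw (set (lvs t))" "posw (set (ins D))" "posw (set (outs D))"
    using v(1) okpD(2,3)[OF ih(1)] ih(2,3) by (auto simp: wkt_def)
  have o: "ok (prodl D)" using ih by simp
  then have r: "ok (prodl (n # D))" "src (prodl (n # D)) = set (ins (n # D))" "tgt (prodl (n # D)) = set (outs (n # D))"
    unfolding n using N v ih(2,3) by simp_all
  moreover have "posw (set (ins (n # D)))" "posw (set (outs (n # D)))" using p by (simp_all add: n)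
  ultimately show ?case unfolding okp_def by (simp only:)
qed

lemma prodl_append: "valid E \<Longrightarrow> prodl (D @ E) = prodl D \<diamondop> prodl E"
  using prodl_ok by (induction D) (auto simp: prd_assoc)

lemma prodl_mset: "mset D = mset E \<Longrightarrow> prodl D = prodl E"
proof -
  assume m: "mset D = mset E"
  have "fold (\<lambda>n. prd (nd n)) (rev D) = fold (\<lambda>n. prd (nd n)) (rev E)"
    by (rule fold_multiset_equiv) (auto simp: fun_eq_iff prd_left_comm m)
  then show ?thesis unfolding prodl_def foldr_conv_fold by simp
qed

lemma den_mset: "mset D = mset E \<Longrightarrow> den D = den E"
  unfolding den_def using prodl_mset by metis

text \<open>The principle behind local rewriting: by \<open>tr_tr\<close> the subnet may be traced
  out first, so only its denotation matters.\<close>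

lemma den_cong:
  assumes "valid (L @ C)" "valid (R @ C)" "den L = den R"
  shows "den (L @ C) = den (R @ C)"
proof -
  have "tr (prodl L \<diamondop> prodl C) = tr (tr (prodl L) \<diamondop> prodl C)" "tr (prodl R \<diamondop> prodl C) = tr (tr (prodl R) \<diamondop> prodl C)"
    using assms prodl_ok[of L] prodl_ok[of R] prodl_ok[of C] by (auto simp: valid_append intro!: tr_tr[symmetric])
  then show ?thesis using assms unfolding den_def by (simp add: prodl_append valid_append)
qed

lemma den_rw:
  assumes "den L = den R" "mset D = mset (L @ C)" "mset D' = mset (R @ C)" "valid D" "valid D'"
  shows "den D = den D'"
  using den_cong[OF _ _ assms(1), of C] assms den_mset valid_mset by metis

lemma den_single: "valid [(f, s, t)] \<Longrightarrow> set (lvs s) \<inter> set (lvs t) = {} \<Longrightarrow> den [(f, s, t)] = N f s t"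
  unfolding den_def using prodl_ok[of "[(f, s, t)]"] wn_nok[of f s t] by (simp add: valid_Cons tr_disj)

lemma den_comp:
  assumes "wn (f, s, r)" "wn (g, r, t)" "distinct (lvs s @ lvs r @ lvs t)"
  shows "den [(f, s, r), (g, r, t)] = N (g \<cdot> f) s t"
proof -
  have n: "nok f s r" "nok g r t" using assms wn_nok by auto
  have "tr (N f s r \<diamondop> N g r t) = (N g r t \<diamondop> Idw {}) \<triangleleft> (N f s r \<diamondop> Idw {})"
    using assms n by (intro tr_comp[where X = "set (lvs r)" and S = "set (lvs s)" and T = "set (lvs t)"])
      (auto simp: okp_def wkt_def)
  then show ?thesis unfolding den_def using n by (simp add: N_sq)
qed

lemma wn_id: "wkt s \<Longrightarrow> lk s t \<Longrightarrow> wn (\<one>[obt s], s, t)"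
  using lk_obt[of s t] lk_wkt[of s t] ident_in_Hom[OF wkt_obt] by auto

lemma den_id_node:
  assumes "wn (f, s, t)" "lk r s" "wkt r" "distinct (lvs r @ lvs s @ lvs t)"
  shows "den [(\<one>[obt r], r, s), (f, s, t)] = N f r t"
proof -
  have "f \<cdot> \<one>[obt r] = f" using assms lk_obt[OF assms(2)] wkt_obt comp_ident[of "obt r" "obt t" f] by simp
  then show ?thesis using den_comp[OF wn_id[OF assms(3,2)] assms(1,4)] by simp
qed

lemma den_node_id:
  assumes "wn (f, s, t)" "lk t r" "distinct (lvs s @ lvs t @ lvs r)"
  shows "den [(f, s, t), (\<one>[obt t], t, r)] = N f s r"
proof -
  have t: "wkt t" using assms by simp
  have "\<one>[obt t] \<cdot> f = f" using assms wkt_obt ident_comp[of "obt s" "obt t" f] by simp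
  then show ?thesis using den_comp[OF assms(1) wn_id[OF t assms(2)] assms(3)] by simp
qed

lemma lvs_sub: "lvs (sub b a t) = map (\<lambda>x. if x = b then a else x) (lvs t)" by (induction t) auto
lemma sub_id: "b \<notin> set (lvs t) \<Longrightarrow> sub b a t = t" by (induction t) auto
lemma lk_refl: "wkt t \<Longrightarrow> lk t t" by (induction t) auto
lemma lk_sub: "wkt t \<Longrightarrow> fst a = fst b \<Longrightarrow> pw a \<Longrightarrow> lk t (sub b a t)" by (induction t) auto
lemma lk_sym: "lk s t \<Longrightarrow> lk t s" by (induction s t rule: lk.induct) auto

lemma nok_lk: "wkt s \<Longrightarrow> lk s t \<Longrightarrow> distinct (lvs s) \<Longrightarrow> distinct (lvs t) \<Longrightarrow> nok \<one>[obt s] s t"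
  using wn_id[of s t] by (auto intro: wn_nok)

lemma N_id_Br:
  assumes "wkt s" "wkt s'" "lk s t" "lk s' t'" "distinct (lvs s @ lvs s')" "distinct (lvs t @ lvs t')"
  shows "N \<one>[obt (Br s s')] (Br s s') (Br t t') = N \<one>[obt s] s t \<diamondop> N \<one>[obt s'] s' t'"
  using assms N_prd[OF nok_lk nok_lk, of s t s' t'] by (simp add: tensor_ident wkt_obt)

text \<open>Renaming one leaf touches only that wire, whatever the bracketing around it; the other
  leaves pass as identities.\<close>

lemma N_sub:
  assumes "wkt t" "distinct (lvs t)" "b \<in> set (lvs t)" "a \<notin> set (lvs t)" "fst a = fst b" "pw a"
  shows "N \<one>[obt t] t (sub b a t) = ren b a \<diamondop> Idw (set (lvs t) - {b})"
    and "N \<one>[obt t] (sub b a t) t = ren a b \<diamondop> Idw (set (lvs t) - {b})"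
proof -
  have "N \<one>[obt t] t (sub b a t) = ren b a \<diamondop> Idw (set (lvs t) - {b}) \<and>
    N \<one>[obt t] (sub b a t) t = ren a b \<diamondop> Idw (set (lvs t) - {b})"
    using assms
  proof (induction t)
    case (Lf x)
    then have [simp]: "x = b" "fst a = fst b" "pw a" "pw b" "fst b \<in> Obj V" by auto
    show ?case by (simp add: ren_def ren_nok)
  next
    case (Br t1 t2)
    have w: "wkt t1" "wkt t2" using Br by auto
    have I: "N \<one>[obt t] t t = Idw (set (lvs t))" if "wkt t" "distinct (lvs t)" for t
      using N_id tok_wkt that by blast
    have o: "obt (sub b a t) = obt t" if "wkt t" for t using lk_obt[OF lk_sub] that Br by auto
    show ?case
    proof (cases "b \<in> set (lvs t1)")
      case True
      then have b2: "b \<notin> set (lvs t2)" using Br by auto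
      have k: "set (lvs (Br t1 t2)) - {b} = (set (lvs t1) - {b}) \<union> set (lvs t2)" using b2 by auto
      have I2: "Idw (set (lvs (Br t1 t2)) - {b}) = Idw (set (lvs t1) - {b}) \<diamondop> Idw (set (lvs t2))"
        unfolding k using w Br(4) by (subst Idw_prd) (auto simp: wkt_def)
      have ih: "N \<one>[obt t1] t1 (sub b a t1) = ren b a \<diamondop> Idw (set (lvs t1) - {b})"
        "N \<one>[obt t1] (sub b a t1) t1 = ren a b \<diamondop> Idw (set (lvs t1) - {b})"
        using Br.IH(1) Br.prems True by auto
      have d: "distinct (lvs (sub b a t1) @ lvs t2)"
        using Br.prems True unfolding lvs_sub by (auto simp: distinct_map inj_on_def)
      have "N \<one>[obt (Br t1 t2)] (Br t1 t2) (Br (sub b a t1) t2) = N \<one>[obt t1] t1 (sub b a t1) \<diamondop> N \<one>[obt t2] t2 t2"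
        using d Br.prems w by (intro N_id_Br) (auto intro: lk_sub lk_refl)
      moreover have "N \<one>[obt (Br (sub b a t1) t2)] (Br (sub b a t1) t2) (Br t1 t2) = N \<one>[obt (sub b a t1)] (sub b a t1) t1 \<diamondop> N \<one>[obt t2] t2 t2"
        using d Br.prems w by (intro N_id_Br) (auto intro: lk_sub lk_refl lk_sym lk_wkt)
      ultimately show ?thesis using I[of t2] w Br.prems o[OF w(1)] ih b2 unfolding I2 by (simp add: sub_id prd_assoc)
    next
      case False
      then have b2: "b \<in> set (lvs t2)" using Br by auto
      have k: "set (lvs (Br t1 t2)) - {b} = set (lvs t1) \<union> (set (lvs t2) - {b})" using False by auto
      have I2: "Idw (set (lvs (Br t1 t2)) - {b}) = Idw (set (lvs t1)) \<diamondop> Idw (set (lvs t2) - {b})"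
        unfolding k using w Br(4) by (subst Idw_prd) (auto simp: wkt_def)
      have ih: "N \<one>[obt t2] t2 (sub b a t2) = ren b a \<diamondop> Idw (set (lvs t2) - {b})"
        "N \<one>[obt t2] (sub b a t2) t2 = ren a b \<diamondop> Idw (set (lvs t2) - {b})"
        using Br.IH(2) Br.prems b2 by auto
      have d: "distinct (lvs t1 @ lvs (sub b a t2))"
        using Br.prems b2 unfolding lvs_sub by (auto simp: distinct_map inj_on_def)
      have "N \<one>[obt (Br t1 t2)] (Br t1 t2) (Br t1 (sub b a t2)) = N \<one>[obt t1] t1 t1 \<diamondop> N \<one>[obt t2] t2 (sub b a t2)"
        using d Br.prems w by (intro N_id_Br) (auto intro: lk_sub lk_refl)
      moreover have "N \<one>[obt (Br t1 (sub b a t2))] (Br t1 (sub b a t2)) (Br t1 t2) = N \<one>[obt t1] t1 t1 \<diamondop> N \<one>[obt (sub b a t2)] (sub b a t2) t2"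
        using d Br.prems w by (intro N_id_Br) (auto intro: lk_sub lk_refl lk_sym lk_wkt)
      ultimately show ?thesis using I[of t1] w Br.prems o[OF w(2)] ih False unfolding I2 by (simp add: sub_id prd_left_comm)
    qed
  qed simp
  then show "N \<one>[obt t] t (sub b a t) = ren b a \<diamondop> Idw (set (lvs t) - {b})"
    "N \<one>[obt t] (sub b a t) t = ren a b \<diamondop> Idw (set (lvs t) - {b})" by auto
qed

text \<open>By \<open>tr_comp\<close> with the single joined wire \<open>b\<close>, the net is a
  composite of \<open>f\<close> with a renaming of one leaf, and this renaming is an identity
  morphism of \<open>V\<close>.\<close>

lemma den_id_in:
  assumes f: "wn (f, s, t)" and a: "fst a = fst b" "pw a" "b \<in> set (lvs s)"
    and d: "distinct (lvs s)" "distinct (lvs t)" "set (lvs s) \<inter> set (lvs t) = {}" "a \<notin> set (lvs s)" "a \<notin> set (lvs t)"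
  shows "den [(\<one>[fst a], Lf a, Lf b), (f, s, t)] = N f (sub b a s) t"
proof -
  have w: "wkt s" "wkt t" "f \<in> Hom V (obt s) (obt t)" using f by auto
  have b: "fst b \<in> Obj V" "pw b" using posw_mem[of "set (lvs s)" b] w(1) a unfolding wkt_def by auto
  have n: "nok f s t" using f d wn_nok by blast
  have r: "ok (ren a b)" "src (ren a b) = {a}" "tgt (ren a b) = {b}" using a b by simp_all
  have "tr (ren a b \<diamondop> N f s t) = (N f s t \<diamondop> Idw {}) \<triangleleft> (ren a b \<diamondop> Idw (set (lvs s) - {b}))"
    using a b w n r d
    by (intro tr_comp[where X = "{b}" and S = "{a}" and T = "set (lvs t)"]) (auto simp: okp_def wkt_def)
  also have "\<dots> = N f s t \<triangleleft> N \<one>[obt s] (sub b a s) s"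
    using N_sub(2)[of s b a] a d w n by simp
  also have "\<dots> = N (f \<cdot> \<one>[obt s]) (sub b a s) t"
  proof (rule N_sq[OF _ n])
    have "distinct (lvs (sub b a s))" using d unfolding lvs_sub by (auto simp: distinct_map inj_on_def)
    then show "nok \<one>[obt s] (sub b a s) s"
      using nok_lk[OF lk_wkt[OF lk_sub] lk_sym[OF lk_sub]] lk_obt[OF lk_sub] a w d by metis
  qed
  also have "f \<cdot> \<one>[obt s] = f" using w wkt_obt comp_ident[of "obt s" "obt t" f] by simp
  finally show ?thesis unfolding den_def using n r by (simp add: ren_def)
qed

lemma den_id_out:
  assumes f: "wn (f, s, t)" and a: "fst a = fst b" "pw a" "b \<in> set (lvs t)"
    and d: "distinct (lvs s)" "distinct (lvs t)" "set (lvs s) \<inter> set (lvs t) = {}" "a \<notin> set (lvs s)" "a \<notin> set (lvs t)"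
  shows "den [(f, s, t), (\<one>[fst a], Lf b, Lf a)] = N f s (sub b a t)"
proof -
  have w: "wkt s" "wkt t" "f \<in> Hom V (obt s) (obt t)" using f by auto
  have b: "fst b \<in> Obj V" "pw b" using posw_mem[of "set (lvs t)" b] w(2) a unfolding wkt_def by auto
  have n: "nok f s t" using f d wn_nok by blast
  have r: "ok (ren b a)" "src (ren b a) = {b}" "tgt (ren b a) = {a}" using a b by simp_all
  have "tr (N f s t \<diamondop> ren b a) = (ren b a \<diamondop> Idw (set (lvs t) - {b})) \<triangleleft> (N f s t \<diamondop> Idw {})"
    using a b w n r d
    by (intro tr_comp[where X = "{b}" and S = "set (lvs s)" and T = "{a}"]) (auto simp: okp_def wkt_def)
  also have "\<dots> = N \<one>[obt t] t (sub b a t) \<triangleleft> N f s t"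
    using N_sub(1)[of t b a] a d w n by simp
  also have "\<dots> = N (\<one>[obt t] \<cdot> f) s (sub b a t)"
  proof (rule N_sq[OF n])
    have "distinct (lvs (sub b a t))" using d unfolding lvs_sub by (auto simp: distinct_map inj_on_def)
    then show "nok \<one>[obt t] t (sub b a t)"
      using nok_lk[OF _ lk_sub] a w d by metis
  qed
  also have "\<one>[obt t] \<cdot> f = f" using w wkt_obt ident_comp[of "obt s" "obt t" f] by simp
  finally show ?thesis unfolding den_def using n r a by (simp add: ren_def)
qed

section \<open>Nets representing arrows\<close>

text \<open>The fresh copy \<^term>\<open>t0\<close> of the target is there because an input wire may pass through
to the output, whereas a wire that is both input and output of a net is traced out.\<close>

definition rep :: "'m \<Rightarrow> 'o tree \<Rightarrow> 'o tree \<Rightarrow> ('o, 'm) node list \<Rightarrow> bool" where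
  "rep f s t D \<longleftrightarrow> wkt s \<and> wkt t \<and> f \<in> Hom V (obt s) (obt t) \<and> (\<forall>n\<in>set D. wn n) \<and>
    mset (lvs s) + mset (outs D) = mset (lvs t) + mset (ins D) \<and>
    (\<forall>t0. lk t t0 \<and> distinct (lvs s @ outs D @ lvs t0) \<longrightarrow> den (D @ [(\<one>[obt t], t, t0)]) = N f s t0)"

lemma shift_tree:
  assumes "finite S" "wkt t" "distinct (lvs t)"
  obtains t0 where "lk t t0" "set (lvs t0) \<inter> S = {}" "distinct (lvs t0)"
proof -
  obtain k where k: "\<And>x. shift k x \<notin> S" using shift_fresh[OF assms(1)] by blast
  have "\<exists>t0. lk t t0 \<and> lvs t0 = map (shift k) (lvs t)" using assms(2)
  proof (induction t)
    case Em show ?case by (rule exI[of _ Em]) simp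
  next
    case (Lf x) then show ?case by (intro exI[of _ "Lf (shift k x)"]) simp
  next
    case (Br t1 t2)
    then obtain t1' t2' where "lk t1 t1'" "lvs t1' = map (shift k) (lvs t1)" "lk t2 t2'" "lvs t2' = map (shift k) (lvs t2)" by auto
    then show ?case by (intro exI[of _ "Br t1' t2'"]) simp
  qed
  then obtain t0 where t0: "lk t t0" "lvs t0 = map (shift k) (lvs t)" by blast
  have "set (lvs t0) \<inter> S = {}" using k t0(2) by (simp, blast)
  moreover have "distinct (lvs t0)" using assms(3) t0(2) by (simp add: distinct_map inj_on_def)
  ultimately show ?thesis using that t0(1) by blast
qed

text \<open>The balance condition of \<open>rep\<close> says that every wire starts in the source or
  as an output of a node and ends in the target or as an input of a node. Distinctness of the starts
  is thus distinctness of the ends.\<close>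

lemma distinct_bal:
  assumes "distinct (lvs s @ outs D @ xs)" "mset (lvs s) + mset (outs D) = mset (lvs t) + mset (ins D)"
  shows "distinct (lvs t @ ins D @ xs)"
proof -
  have "mset (lvs s @ outs D @ xs) = mset (lvs t @ ins D @ xs)" using assms(2) by (simp add: add.assoc[symmetric])
  then show ?thesis using assms(1) distinct_mset_swap by blast
qed

lemma rep_node: "wn (f, s, t) \<Longrightarrow> rep f s t [(f, s, t)]"
  unfolding rep_def using den_node_id[of f s t] by auto

text \<open>A coherence isomorphism contributes no node at all; only the closing identity node
  remains.\<close>

lemma rep_struct:
  assumes w: "wkt s" "wkt t" and f: "f \<in> Hom V (obt s) (obt t)" and m: "mset (lvs s) = mset (lvs t)"
    and n: "distinct (lvs s) \<Longrightarrow> N f s t = Idw (set (lvs s))"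
  shows "rep f s t []"
  unfolding rep_def
proof (intro conjI allI impI)
  fix t0 assume a: "lk t t0 \<and> distinct (lvs s @ outs [] @ lvs t0)"
  have dt: "distinct (lvs t)" "set (lvs t) = set (lvs s)" using a m distinct_mset_swap[OF m] set_mset_mset by (auto dest: mset_eq_setD)
  have n1: "nok f s t" using w f a dt wn_nok by auto
  have v: "wn (\<one>[obt t], t, t0)" using wn_id w a by blast
  have n2: "nok \<one>[obt t] t t0" using wn_nok[OF v] a dt by auto
  have "den [(\<one>[obt t], t, t0)] = N \<one>[obt t] t t0"
    using v a dt by (intro den_single) (auto simp: valid_Cons)
  also have "\<dots> = N \<one>[obt t] t t0 \<triangleleft> N f s t" using n a n2 dt by simp
  also have "\<dots> = N (\<one>[obt t] \<cdot> f) s t0" by (rule N_sq[OF n1 n2])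
  also have "\<one>[obt t] \<cdot> f = f" using f w wkt_obt ident_comp[of "obt s" "obt t" f] by simp
  finally show "den ([] @ [(\<one>[obt t], t, t0)]) = N f s t0" by simp
qed (use assms in auto)

lemma rep_id: "wkt s \<Longrightarrow> A = obt s \<Longrightarrow> rep \<one>[A] s s []"
  using rep_struct[of s s "\<one>[obt s]"] ident_in_Hom[OF wkt_obt, of s] N_id[OF tok_wkt, of s] by auto

lemma rep_comp:
  assumes f: "rep f s r D" and g: "rep g r t E"
  shows "rep (g \<cdot> f) s t (D @ E)"
proof -
  have w: "wkt s" "wkt r" "wkt t" "f \<in> Hom V (obt s) (obt r)" "g \<in> Hom V (obt r) (obt t)" "\<forall>n\<in>set D. wn n" "\<forall>n\<in>set E. wn n"
    and m: "mset (lvs s) + mset (outs D) = mset (lvs r) + mset (ins D)" "mset (lvs r) + mset (outs E) = mset (lvs t) + mset (ins E)"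
    using f g unfolding rep_def by auto
  have m': "mset (lvs s) + mset (outs (D @ E)) = mset (lvs t) + mset (ins (D @ E))"
  proof -
    have "mset (lvs s) + mset (outs (D @ E)) = (mset (lvs s) + mset (outs D)) + mset (outs E)" by simp
    also have "\<dots> = (mset (lvs r) + mset (outs E)) + mset (ins D)" unfolding m(1) by (simp add: ac_simps)
    also have "\<dots> = mset (lvs t) + mset (ins (D @ E))" unfolding m(2) by (simp add: ac_simps)
    finally show ?thesis .
  qed
  have "den ((D @ E) @ [(\<one>[obt t], t, t0)]) = N (g \<cdot> f) s t0" if t0: "lk t t0" and d: "distinct (lvs s @ outs (D @ E) @ lvs t0)" for t0
  proof -
    have dr: "distinct (lvs r @ ins D @ outs E @ lvs t0)"
      using distinct_bal[of s D "outs E @ lvs t0" r] m(1) d by simp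
    have dt: "distinct (lvs t @ ins (D @ E) @ lvs t0)" using distinct_bal[OF _ m', of "lvs t0"] d by simp
    define S where "S = set (lvs s) \<union> set (lvs r) \<union> set (lvs t) \<union> set (lvs t0) \<union> set (ins D) \<union> set (outs D) \<union> set (ins E) \<union> set (outs E)"
    \<comment> \<open>The fresh copy \<open>r0\<close> separates the two nets: \<open>D\<close>
      closed by an identity from \<open>r\<close> to \<open>r0\<close> stands for \<open>f\<close>,
      and afterwards the same identity node is absorbed into \<open>g\<close>, which then reads from
      \<open>r\<close> as \<open>E\<close> does.\<close>
    obtain r0 where r0: "lk r r0" "set (lvs r0) \<inter> S = {}" "distinct (lvs r0)"
      using shift_tree[of S r] w(2) dr unfolding S_def by auto
    have wr0: "wkt r0" "obt r0 = obt r" "wkt t0" "obt t0 = obt t" using r0(1) t0 w lk_wkt lk_obt by auto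
    have st0: "set (lvs s) \<inter> set (lvs t0) = {}" using d by auto
    have nodes: "wn (f, s, r0)" "wn (g, r0, t0)" "wn (\<one>[obt r], r, r0)" "wn (g, r, t0)" "wn (\<one>[obt t], t, t0)"
      using w wr0 wn_id[OF w(2) r0(1)] wn_id[OF w(3) t0] by auto
    have rt0: "set (lvs r) \<inter> set (lvs t0) = {}" using dr by auto
    have sr0: "set (lvs s) \<inter> set (lvs r0) = {}" using r0(2) unfolding S_def by blast
    have e1: "den (D @ [(\<one>[obt r], r, r0)]) = den [(f, s, r0)]"
    proof -
      have "den (D @ [(\<one>[obt r], r, r0)]) = N f s r0"
        using f r0 d unfolding rep_def S_def by auto
      then show ?thesis using den_single[of f s r0] nodes d r0(3) sr0 by (auto simp: valid_Cons)
    qed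
    have e2: "den (E @ [(\<one>[obt t], t, t0)]) = den [(g, r, t0)]"
    proof -
      have "den (E @ [(\<one>[obt t], t, t0)]) = N g r t0"
        using g t0 dr unfolding rep_def by auto
      then show ?thesis using den_single[of g r t0] nodes dr rt0 by (auto simp: valid_Cons)
    qed
    have dd: "distinct (lvs r @ lvs r0 @ lvs t0)" "distinct (lvs s @ lvs r0 @ lvs t0)"
      using dr d r0(2,3) unfolding S_def by auto
    have e3: "den [(\<one>[obt r], r, r0), (g, r0, t0)] = den [(g, r, t0)]"
      using den_id_node[OF nodes(2) r0(1) w(2) dd(1)] den_single[of g r t0] nodes dr rt0 by (auto simp: valid_Cons)
    have vs: "valid ([(f, s, r0)] @ [(g, r0, t0)])" "valid ((D @ [(\<one>[obt r], r, r0)]) @ [(g, r0, t0)])"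
      "valid ([(\<one>[obt r], r, r0), (g, r0, t0)] @ D)" "valid ([(g, r, t0)] @ D)"
      "valid ((E @ [(\<one>[obt t], t, t0)]) @ D)"
      using nodes w(6,7) d dr dt r0 unfolding S_def valid_def by auto
    have "N (g \<cdot> f) s t0 = den ([(f, s, r0)] @ [(g, r0, t0)])"
      using den_comp[OF nodes(1,2) dd(2)] by simp
    also have "\<dots> = den ((D @ [(\<one>[obt r], r, r0)]) @ [(g, r0, t0)])" by (rule den_cong[OF vs(1,2) e1[symmetric]])
    also have "\<dots> = den ([(\<one>[obt r], r, r0), (g, r0, t0)] @ D)" by (rule den_mset) simp
    also have "\<dots> = den ([(g, r, t0)] @ D)" by (rule den_cong[OF vs(3,4) e3])
    also have "\<dots> = den ((E @ [(\<one>[obt t], t, t0)]) @ D)" by (rule den_cong[OF vs(4,5) e2[symmetric]])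
    also have "\<dots> = den ((D @ E) @ [(\<one>[obt t], t, t0)])" by (rule den_mset) simp
    finally show ?thesis by simp
  qed
  then show ?thesis unfolding rep_def using w m' comp_in_Hom[of "obt s" "obt r" "obt t" f g] wkt_obt by auto
qed

lemma rep_tensor:
  assumes f: "rep f s t D" and g: "rep g s' t' E"
  shows "rep (f \<otimes> g) (Br s s') (Br t t') (D @ E)"
proof -
  have w: "wkt s" "wkt t" "wkt s'" "wkt t'" "f \<in> Hom V (obt s) (obt t)" "g \<in> Hom V (obt s') (obt t')" "\<forall>n\<in>set D. wn n" "\<forall>n\<in>set E. wn n"
    and m: "mset (lvs s) + mset (outs D) = mset (lvs t) + mset (ins D)" "mset (lvs s') + mset (outs E) = mset (lvs t') + mset (ins E)"
    using f g unfolding rep_def by auto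
  have m': "mset (lvs (Br s s')) + mset (outs (D @ E)) = mset (lvs (Br t t')) + mset (ins (D @ E))"
  proof -
    have "mset (lvs (Br s s')) + mset (outs (D @ E)) = (mset (lvs s) + mset (outs D)) + (mset (lvs s') + mset (outs E))" by (simp add: ac_simps)
    also have "\<dots> = mset (lvs (Br t t')) + mset (ins (D @ E))" unfolding m by (simp add: ac_simps)
    finally show ?thesis .
  qed
  have "den ((D @ E) @ [(\<one>[obt (Br t t')], Br t t', t0)]) = N (f \<otimes> g) (Br s s') t0"
    if t0: "lk (Br t t') t0" and d: "distinct (lvs (Br s s') @ outs (D @ E) @ lvs t0)" for t0
  proof -
    obtain u u' where u: "t0 = Br u u'" "lk t u" "lk t' u'" using t0 by (cases t0) auto
    have wu: "wkt u" "obt u = obt t" "wkt u'" "obt u' = obt t'" using u w lk_wkt lk_obt by auto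
    have dt: "distinct (lvs (Br t t') @ ins (D @ E) @ lvs t0)" using distinct_bal[OF d m'] .
    have i: "wn (\<one>[obt t], t, u)" "wn (\<one>[obt t'], t', u')" "wn (\<one>[obt (Br t t')], Br t t', t0)"
      using wn_id[of t u] wn_id[of t' u'] wn_id[of "Br t t'" t0] w u t0 by auto
    have nn: "wn (f, s, u)" "wn (g, s', u')" using w wu by auto
    have e1: "den (D @ [(\<one>[obt t], t, u)]) = N f s u" "den (E @ [(\<one>[obt t'], t', u')]) = N g s' u'"
      using f g u d unfolding rep_def by auto
    have su: "set (lvs s) \<inter> set (lvs u) = {}" "set (lvs s') \<inter> set (lvs u') = {}" using d u(1) by auto
    have s1: "N f s u = den [(f, s, u)]" "N g s' u' = den [(g, s', u')]"
      using den_single[of f s u] den_single[of g s' u'] nn d u(1) su by (auto simp: valid_Cons)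
    have "set (lvs s) \<subseteq> set (lvs t) \<union> set (ins D)" "set (lvs s') \<subseteq> set (lvs t') \<union> set (ins E)"
      using arg_cong[OF m(1), of set_mset] arg_cong[OF m(2), of set_mset] by auto
    then have sx: "set (lvs s) \<inter> set (lvs t') = {}" "set (lvs s) \<inter> set (ins E) = {}"
       "set (lvs s') \<inter> set (lvs t) = {}" "set (lvs s') \<inter> set (ins D) = {}"
      using dt by auto
    have vs: "valid ((D @ [(\<one>[obt t], t, u)]) @ (E @ [(\<one>[obt t'], t', u')]))" "valid ([(f, s, u)] @ (E @ [(\<one>[obt t'], t', u')]))"
       "valid ((E @ [(\<one>[obt t'], t', u')]) @ [(f, s, u)])" "valid ([(g, s', u')] @ [(f, s, u)])"
       "valid ([(\<one>[obt (Br t t')], Br t t', t0)] @ (D @ E))"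
       "valid ([(\<one>[obt t], t, u), (\<one>[obt t'], t', u')] @ (D @ E))"
      using w(7,8) sx i nn d[unfolded u(1)] dt[unfolded u(1)] unfolding valid_def u(1)
      by (simp_all add: Int_Un_distrib Int_Un_distrib2 Int_commute ball_Un)
    have du: "distinct (lvs (Br t t'))" "distinct (lvs (Br u u'))" "distinct (lvs t)" "distinct (lvs u)" "distinct (lvs t')" "distinct (lvs u')"
      using d dt u(1) by auto
    have n3: "nok \<one>[obt (Br t t')] (Br t t') (Br u u')" "nok \<one>[obt t] t u" "nok \<one>[obt t'] t' u'"
      using wn_nok[OF i(3)[unfolded u(1)] du(1,2)] wn_nok[OF i(1) du(3,4)] wn_nok[OF i(2) du(5,6)] by simp_all
    \<comment> \<open>The closing identity splits into one identity per factor, so each net can be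
      closed separately.\<close>
    have nb: "N \<one>[obt (Br t t')] (Br t t') (Br u u') = N \<one>[obt t] t u \<diamondop> N \<one>[obt t'] t' u'"
      by (rule N_id_Br) (use w u du in auto)
    have p: "prodl [(\<one>[obt (Br t t')], Br t t', t0)] = prodl [(\<one>[obt t], t, u), (\<one>[obt t'], t', u')]"
    proof -
      have "prodl [(\<one>[obt (Br t t')], Br t t', t0)] = N \<one>[obt (Br t t')] (Br t t') (Br u u')"
        unfolding u(1) using n3(1) by (simp del: obt.simps)
      then show ?thesis unfolding nb using n3 by simp
    qed
    have "den ((D @ E) @ [(\<one>[obt (Br t t')], Br t t', t0)]) = den ([(\<one>[obt (Br t t')], Br t t', t0)] @ (D @ E))" by (rule den_mset) simp
    also have "\<dots> = den ([(\<one>[obt t], t, u), (\<one>[obt t'], t', u')] @ (D @ E))"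
      by (rule den_cong[OF vs(5,6)]) (simp only: den_def p)
    also have "\<dots> = den ((D @ [(\<one>[obt t], t, u)]) @ (E @ [(\<one>[obt t'], t', u')]))" by (rule den_mset) simp
    also have "\<dots> = den ([(f, s, u)] @ (E @ [(\<one>[obt t'], t', u')]))" by (rule den_cong[OF vs(1,2)]) (simp only: e1 s1)
    also have "\<dots> = den ((E @ [(\<one>[obt t'], t', u')]) @ [(f, s, u)])" by (rule den_mset) simp
    also have "\<dots> = den ([(g, s', u')] @ [(f, s, u)])" by (rule den_cong[OF vs(3,4)]) (simp only: e1 s1)
    also have "\<dots> = tr (N (f \<otimes> g) (Br s s') (Br u u'))"
    proof -
      have "N f s u \<diamondop> N g s' u' = N (f \<otimes> g) (Br s s') (Br u u')"
        using nn d u by (intro N_prd wn_nok) auto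
      then show ?thesis unfolding den_def using nn d u wn_nok[of g s' u'] wn_nok[of f s u] by (simp add: prd_comm[of "N g s' u'"])
    qed
    also have "\<dots> = N (f \<otimes> g) (Br s s') t0"
    proof -
      have "nok (f \<otimes> g) (Br s s') (Br u u')" using nn d u by (intro nok_tensor wn_nok) auto
      then show ?thesis unfolding u(1) using d u by (intro tr_disj) auto
    qed
    finally show ?thesis .
  qed
  then show ?thesis unfolding rep_def using w m' tensor_in_Hom[of "obt s" "obt t" "obt s'" "obt t'" f g] wkt_obt by auto
qed

text \<open>Closing both nets by the same identity node onto a fresh target gives equal arrows
  \<open>N\<close>, and \<open>N_inj\<close> applies.\<close>

lemma rep_eq:
  assumes f: "rep f s t D" and g: "rep g s t E" and e: "den D = den E" and d: "distinct (lvs s @ outs D)" "distinct (lvs s @ outs E)"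
  shows "f = g"
proof -
  have w: "wkt s" "wkt t" "f \<in> Hom V (obt s) (obt t)" "g \<in> Hom V (obt s) (obt t)" "\<forall>n\<in>set D. wn n" "\<forall>n\<in>set E. wn n"
    and m: "mset (lvs s) + mset (outs D) = mset (lvs t) + mset (ins D)" "mset (lvs s) + mset (outs E) = mset (lvs t) + mset (ins E)"
    using f g unfolding rep_def by auto
  have dt: "distinct (lvs t @ ins D)" "distinct (lvs t @ ins E)" using distinct_bal[OF _ m(1), of "[]"] distinct_bal[OF _ m(2), of "[]"] d by simp_all
  obtain t0 where t0: "lk t t0" "set (lvs t0) \<inter> (set (lvs s) \<union> set (lvs t) \<union> set (outs D) \<union> set (outs E)) = {}" "distinct (lvs t0)"
    using shift_tree[of "set (lvs s) \<union> set (lvs t) \<union> set (outs D) \<union> set (outs E)" t] w dt by auto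
  have i: "wn (\<one>[obt t], t, t0)" using wn_id w t0 by blast
  have "N f s t0 = den (D @ [(\<one>[obt t], t, t0)])" using f t0 d unfolding rep_def by auto
  also have "\<dots> = den (E @ [(\<one>[obt t], t, t0)])"
    by (rule den_cong[OF _ _ e]) (use w dt d i t0 in \<open>auto simp: valid_def\<close>)
  also have "\<dots> = N g s t0" using g t0 d unfolding rep_def by auto
  finally have "N f s t0 = N g s t0" .
  moreover have "nok f s t0" "nok g s t0"
    using w t0 d lk_wkt[OF t0(1)] lk_obt[OF t0(1)] by (auto intro!: wn_nok)
  ultimately show ?thesis using N_inj by blast
qed

text \<open>If no wire passes straight from source to target, the net itself already has the
  interfaces \<open>s\<close> and \<open>t\<close>; the closing identity of \<open>rep\<close> is
  then undone by the identity node in the other direction.\<close>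

lemma rep_closed:
  assumes f: "rep f s t D" and d: "distinct (lvs s @ outs D)" and st: "set (lvs s) \<inter> set (lvs t) = {}"
  shows "den D = N f s t"
proof -
  have w: "wkt s" "wkt t" "f \<in> Hom V (obt s) (obt t)" "\<forall>n\<in>set D. wn n"
    and m: "mset (lvs s) + mset (outs D) = mset (lvs t) + mset (ins D)"
    using f unfolding rep_def by auto
  have dt: "distinct (lvs t @ ins D)" using distinct_bal[OF _ m, of "[]"] d by simp
  have v: "valid D" using w d dt unfolding valid_def by auto
  have eq: "set (lvs s) \<union> set (outs D) = set (lvs t) \<union> set (ins D)"
    using arg_cong[OF m, of set_mset] by simp
  have b: "set (ins D) - set (outs D) = set (lvs s)" "set (outs D) - set (ins D) = set (lvs t)"
    using eq d dt st by auto
  obtain t0 where t0: "lk t t0" "set (lvs t0) \<inter> (set (lvs s) \<union> set (lvs t) \<union> set (outs D) \<union> set (ins D)) = {}" "distinct (lvs t0)"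
    using shift_tree[of "set (lvs s) \<union> set (lvs t) \<union> set (outs D) \<union> set (ins D)" t] w dt by auto
  have i: "wn (\<one>[obt t], t, t0)" using wn_id w t0 by blast
  have n: "nok \<one>[obt t] t t0" using wn_nok[OF i] dt t0 by auto
  have n': "nok f s t" using w d dt by (intro wn_nok) auto
  have P: "okp (prodl D)" "src (prodl D) = set (ins D)" "tgt (prodl D) = set (outs D)" using prodl_ok[OF v] by auto
  have Q: "okp (den D)" "src (den D) = set (lvs s)" "tgt (den D) = set (lvs t)"
    unfolding den_def using P b by simp_all
  have o: "okp (N \<one>[obt t] t t0)" using n i unfolding okp_def by (simp add: wkt_def)
  have "N f s t0 = den (D @ [(\<one>[obt t], t, t0)])" using f t0 d unfolding rep_def by auto
  also have "\<dots> = tr (prodl D \<diamondop> N \<one>[obt t] t t0)" unfolding den_def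
    using i n dt t0 v by (subst prodl_append) (auto simp: valid_Cons)
  also have "\<dots> = tr (tr (prodl D) \<diamondop> N \<one>[obt t] t t0)"
    using P o n dt t0 by (intro tr_tr[symmetric]) auto
  also have "\<dots> = (N \<one>[obt t] t t0 \<diamondop> Idw {}) \<triangleleft> (den D \<diamondop> Idw {})"
    unfolding den_def[symmetric] using Q o n st t0
    by (intro tr_comp[where X = "set (lvs t)" and S = "set (lvs s)" and T = "set (lvs t0)"]) auto
  also have "\<dots> = N \<one>[obt t] t t0 \<triangleleft> den D" using Q n by simp
  finally have e: "N f s t0 = N \<one>[obt t] t t0 \<triangleleft> den D" .
  have t0w: "wkt t0" "obt t0 = obt t" "lk t0 t" using lk_wkt lk_obt lk_sym t0 w by auto
  have n2: "nok \<one>[obt t] t0 t" using nok_lk[OF t0w(1) t0w(3)] t0 dt t0w(2) by simp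
  have n3: "nok f s t0" using w t0w d t0 by (intro wn_nok) auto
  have ii: "\<one>[obt t] \<cdot> \<one>[obt t] = \<one>[obt t]" "\<one>[obt t] \<cdot> f = f"
    using w wkt_obt ident_in_Hom[of "obt t"] ident_comp[of "obt t" "obt t"] ident_comp[of "obt s" "obt t" f] by auto
  have tt: "N \<one>[obt t] t t = Idw (set (lvs t))" by (rule N_id) (use w dt in \<open>simp add: tok_wkt\<close>)
  have "N \<one>[obt t] t0 t \<triangleleft> N f s t0 = N f s t" using N_sq[OF n3 n2] ii by simp
  moreover have "N \<one>[obt t] t0 t \<triangleleft> N \<one>[obt t] t t0 \<triangleleft> den D = den D"
    using N_sq[OF n n2] ii tt Q by (simp add: sq_assoc[symmetric])
  ultimately show ?thesis using e by simp
qed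

end

section \<open>Rewriting steps whose side conditions the simplifier can compute\<close>

fun chk :: "'a list \<Rightarrow> 'a list \<Rightarrow> bool" where
  "chk [] D \<longleftrightarrow> True" | "chk (n # L) D \<longleftrightarrow> n \<in> set D \<and> chk L (remove1 n D)"
fun dl :: "'a list \<Rightarrow> 'a list \<Rightarrow> 'a list" where
  "dl [] D = D" | "dl (n # L) D = dl L (remove1 n D)"

lemma chk_mset: "chk L D \<Longrightarrow> mset D = mset (L @ dl L D)"
proof (induction L arbitrary: D)
  case (Cons n L)
  then have "mset (remove1 n D) = mset (L @ dl L (remove1 n D))" using Cons.IH by (metis chk.simps(2))
  moreover have "mset D = add_mset n (mset (remove1 n D))" using Cons.prems by (simp add: insert_DiffM)
  ultimately show ?case by (simp only: dl.simps append_Cons mset.simps)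
qed simp

fun sbi :: "'o wire \<Rightarrow> 'o wire \<Rightarrow> ('o, 'm) node \<Rightarrow> ('o, 'm) node" where
  "sbi b a (f, s, t) = (f, sub b a s, t)"
fun sbo :: "'o wire \<Rightarrow> 'o wire \<Rightarrow> ('o, 'm) node \<Rightarrow> ('o, 'm) node" where
  "sbo b a (f, s, t) = (f, s, sub b a t)"

context dagger_compact
begin

text \<open>Shaped for \<open>rule\<close> followed by \<open>simp\<close>: for concrete nets all
  premises but the last are decided by computation, and the last one is the goal about the rewritten
  net, with the new nodes in front.\<close>

lemma net_step:
  assumes "den L = den R" "chk L D" "valid D" "valid (R @ dl L D)" "den (R @ dl L D) = den D'"
  shows "den D = den D'"
  using den_rw[OF assms(1) chk_mset[OF assms(2)] refl assms(3,4)] assms(5) by simp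

lemma net_perm: assumes "chk D D'" "dl D D' = []" shows "den D = den D'"
  using chk_mset[OF assms(1)] unfolding assms(2) by (intro den_mset) simp

text \<open>The substitution is mapped over the whole remaining net, but by validity only one node
  reads the wire \<open>j\<close>. The condition on that node excludes loops at it, to which
  \<open>den_id_in\<close> does not apply.\<close>

lemma id_in:
  assumes D: "chk [(\<one>[A], w A i, w A j)] D" "valid D"
    and b: "(A, j, False) \<in> set (ins (dl [(\<one>[A], w A i, w A j)] D))"
    and c: "\<forall>(f, s, t)\<in>set (dl [(\<one>[A], w A i, w A j)] D). (A, j, False) \<in> set (lvs s) \<longrightarrow>
       set (lvs s) \<inter> set (lvs t) = {} \<and> (A, i, False) \<notin> set (lvs t)"
    and v: "valid (map (sbi (A, j, False) (A, i, False)) (dl [(\<one>[A], w A i, w A j)] D))"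
    and e: "den (map (sbi (A, j, False) (A, i, False)) (dl [(\<one>[A], w A i, w A j)] D)) = den D'"
  shows "den D = den D'"
proof -
  let ?a = "(A, i, False)" let ?b = "(A, j, False)"
  define C where "C = dl [(\<one>[A], w A i, w A j)] D"
  have m: "mset D = mset ((\<one>[A], w A i, w A j) # C)" using chk_mset[OF D(1)] unfolding C_def by simp
  obtain f s t where n: "(f, s, t) \<in> set C" "?b \<in> set (lvs s)"
    using b unfolding C_def[symmetric] ins_def by auto
  obtain C1 C2 where C: "C = C1 @ (f, s, t) # C2" using split_list[OF n(1)] by auto
  have vD: "valid ((\<one>[A], w A i, w A j) # C1 @ (f, s, t) # C2)" using D(2) valid_mset[OF m] C by simp
  have d: "distinct (lvs s)" "distinct (lvs t)" "wn (f, s, t)" "wn (\<one>[A], w A i, w A j)" "?a \<notin> set (lvs s)"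
     "?b \<notin> set (ins C1)" "?b \<notin> set (ins C2)"
    using vD n(2) unfolding valid_def by auto
  have st: "set (lvs s) \<inter> set (lvs t) = {}" "?a \<notin> set (lvs t)" using c n unfolding C_def[symmetric] by auto
  have id: "sbi ?b ?a x = x" if "x \<in> set E" "?b \<notin> set (ins E)" for x and E :: "('o, 'm) node list"
  proof -
    obtain f s t where "x = (f, s, t)" by (cases x)
    then show ?thesis using that sub_id[of ?b s ?a] unfolding ins_def by auto
  qed
  have R: "map (sbi ?b ?a) C = C1 @ (f, sub ?b ?a s, t) # C2"
    unfolding C using id[of _ C1] id[of _ C2] d(6,7) by (simp add: map_idI)
  have vR: "valid (C1 @ (f, sub ?b ?a s, t) # C2)" using v unfolding C_def[symmetric] R .
  have s': "wn (f, sub ?b ?a s, t)" "distinct (lvs (sub ?b ?a s))" using vR unfolding valid_def by auto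
  have a0: "fst ?a = fst ?b" "\<not> snd (snd ?a)" by simp_all
  have "set (lvs (sub ?b ?a s)) \<inter> set (lvs t) = {}" using st unfolding lvs_sub by auto
  then have "den [(f, sub ?b ?a s, t)] = N f (sub ?b ?a s) t"
    using s' d by (intro den_single) (auto simp: valid_Cons)
  then have e1: "den [(\<one>[A], w A i, w A j), (f, s, t)] = den [(f, sub ?b ?a s, t)]"
    using den_id_in[OF d(3) a0 n(2) d(1,2) st(1) d(5) st(2)] by simp
  have "den D = den ([(\<one>[A], w A i, w A j), (f, s, t)] @ (C1 @ C2))" by (rule den_mset) (simp add: m C)
  also have "\<dots> = den ([(f, sub ?b ?a s, t)] @ (C1 @ C2))"
  proof (rule den_cong[OF _ _ e1])
    show "valid ([(\<one>[A], w A i, w A j), (f, s, t)] @ C1 @ C2)"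
      using vD by (rule valid_mset[THEN iffD1, rotated]) simp
    show "valid ([(f, sub ?b ?a s, t)] @ C1 @ C2)" using vR by (rule valid_mset[THEN iffD1, rotated]) simp
  qed
  also have "\<dots> = den (map (sbi ?b ?a) C)" unfolding R by (rule den_mset) simp
  finally show ?thesis using e unfolding C_def by simp
qed

lemma id_out:
  assumes D: "chk [(\<one>[A], w A i, w A j)] D" "valid D"
    and b: "(A, i, False) \<in> set (outs (dl [(\<one>[A], w A i, w A j)] D))"
    and c: "\<forall>(f, s, t)\<in>set (dl [(\<one>[A], w A i, w A j)] D). (A, i, False) \<in> set (lvs t) \<longrightarrow>
       set (lvs s) \<inter> set (lvs t) = {} \<and> (A, j, False) \<notin> set (lvs s)"
    and v: "valid (map (sbo (A, i, False) (A, j, False)) (dl [(\<one>[A], w A i, w A j)] D))"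
    and e: "den (map (sbo (A, i, False) (A, j, False)) (dl [(\<one>[A], w A i, w A j)] D)) = den D'"
  shows "den D = den D'"
proof -
  let ?a = "(A, j, False)" let ?b = "(A, i, False)"
  define C where "C = dl [(\<one>[A], w A i, w A j)] D"
  have m: "mset D = mset ((\<one>[A], w A i, w A j) # C)" using chk_mset[OF D(1)] unfolding C_def by simp
  obtain f s t where n: "(f, s, t) \<in> set C" "?b \<in> set (lvs t)"
    using b unfolding C_def[symmetric] outs_def by auto
  obtain C1 C2 where C: "C = C1 @ (f, s, t) # C2" using split_list[OF n(1)] by auto
  have vD: "valid ((\<one>[A], w A i, w A j) # C1 @ (f, s, t) # C2)" using D(2) valid_mset[OF m] C by simp
  have d: "distinct (lvs s)" "distinct (lvs t)" "wn (f, s, t)" "wn (\<one>[A], w A i, w A j)" "?a \<notin> set (lvs t)"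
     "?b \<notin> set (outs C1)" "?b \<notin> set (outs C2)"
    using vD n(2) unfolding valid_def by auto
  have st: "set (lvs s) \<inter> set (lvs t) = {}" "?a \<notin> set (lvs s)" using c n unfolding C_def[symmetric] by auto
  have id: "sbo ?b ?a x = x" if "x \<in> set E" "?b \<notin> set (outs E)" for x and E :: "('o, 'm) node list"
  proof -
    obtain f s t where "x = (f, s, t)" by (cases x)
    then show ?thesis using that sub_id[of ?b t ?a] unfolding outs_def by auto
  qed
  have R: "map (sbo ?b ?a) C = C1 @ (f, s, sub ?b ?a t) # C2"
    unfolding C using id[of _ C1] id[of _ C2] d(6,7) by (simp add: map_idI)
  have vR: "valid (C1 @ (f, s, sub ?b ?a t) # C2)" using v unfolding C_def[symmetric] R .
  have s': "wn (f, s, sub ?b ?a t)" "distinct (lvs (sub ?b ?a t))" using vR unfolding valid_def by auto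
  have a0: "fst ?a = fst ?b" "\<not> snd (snd ?a)" by simp_all
  have "set (lvs s) \<inter> set (lvs (sub ?b ?a t)) = {}" using st unfolding lvs_sub by auto
  then have "den [(f, s, sub ?b ?a t)] = N f s (sub ?b ?a t)"
    using s' d by (intro den_single) (auto simp: valid_Cons)
  then have e1: "den [(f, s, t), (\<one>[A], w A i, w A j)] = den [(f, s, sub ?b ?a t)]"
    using den_id_out[OF d(3) a0 n(2) d(1,2) st(1) st(2) d(5)] by simp
  have "den D = den ([(f, s, t), (\<one>[A], w A i, w A j)] @ (C1 @ C2))" by (rule den_mset) (simp add: m C)
  also have "\<dots> = den ([(f, s, sub ?b ?a t)] @ (C1 @ C2))"
  proof (rule den_cong[OF _ _ e1])
    show "valid ([(f, s, t), (\<one>[A], w A i, w A j)] @ C1 @ C2)"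
      using vD by (rule valid_mset[THEN iffD1, rotated]) simp
    show "valid ([(f, s, sub ?b ?a t)] @ C1 @ C2)" using vR by (rule valid_mset[THEN iffD1, rotated]) simp
  qed
  also have "\<dots> = den (map (sbo ?b ?a) C)" unfolding R by (rule den_mset) simp
  finally show ?thesis using e unfolding C_def by simp
qed

section \<open>Compiling arrows to nets\<close>

lemma rep_mset: assumes "rep f s t D" "mset D = mset E" shows "rep f s t E"
proof -
  have "mset (D @ X) = mset (E @ X)" for X using assms(2) by simp
  then have d: "den (D @ X) = den (E @ X)" for X by (rule den_mset)
  have o: "mset (outs D) = mset (outs E)" "mset (ins D) = mset (ins E)" "set D = set E"
    using mset_outs[OF assms(2)] mset_ins[OF assms(2)] mset_eq_setD[OF assms(2)] by auto
  have "distinct (lvs s @ outs E @ X) = distinct (lvs s @ outs D @ X)" for X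
    by (rule distinct_mset_swap) (simp add: o)
  then show ?thesis using assms(1) unfolding rep_def o d by auto
qed

text \<open>The introduction rules for \<open>cp\<close> are run as a logic program: the list ks supplies names for
new wires, and D accumulates the nodes; the lists have no logical content.\<close>

definition cp :: "'m \<Rightarrow> 'o tree \<Rightarrow> 'o tree \<Rightarrow> nat list \<Rightarrow> ('o, 'm) node list \<Rightarrow> nat list \<Rightarrow> ('o, 'm) node list \<Rightarrow> bool" where
  "cp f s t ks D ks' D' \<longleftrightarrow> (\<exists>E. D' = E @ D \<and> rep f s t E)"

lemma cp_rep: "cp f s t ks [] ks' D \<Longrightarrow> rep f s t D" by (auto simp: cp_def)

lemma cp_comp: "cp f s r ks D ks1 D1 \<Longrightarrow> cp g r t ks1 D1 ks2 D2 \<Longrightarrow> cp (g \<cdot> f) s t ks D ks2 D2"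
  unfolding cp_def using rep_mset[OF rep_comp, of f s r _ g t] by fastforce
lemma cp_tensor: "cp f s t ks D ks1 D1 \<Longrightarrow> cp g s' t' ks1 D1 ks2 D2 \<Longrightarrow> cp (f \<otimes> g) (Br s s') (Br t t') ks D ks2 D2"
  unfolding cp_def using rep_mset[OF rep_tensor, of f s t _ g s' t'] by fastforce
lemma cp_id: "wkt s \<Longrightarrow> A = obt s \<Longrightarrow> cp \<one>[A] s s ks D ks D"
  unfolding cp_def using rep_id by auto
lemma cp_empty: "rep f s t [] \<Longrightarrow> cp f s t ks D ks D" unfolding cp_def by auto

lemma rep_dagger_struct:
  assumes "wkt s" "wkt t" "f \<in> Hom V (obt s) (obt t)" "mset (lvs s) = mset (lvs t)"
    "distinct (lvs s) \<Longrightarrow> N f s t = Idw (set (lvs s))"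
  shows "rep (f\<dagger>) t s []"
proof (rule rep_struct)
  show "f\<dagger> \<in> Hom V (obt t) (obt s)" using assms dagger_in_Hom wkt_obt by blast
  assume d: "distinct (lvs t)"
  then have d': "distinct (lvs s)" using assms(4) distinct_mset_swap by blast
  then show "N (f\<dagger>) t s = Idw (set (lvs t))"
    using N_dagger_struct[of f s t] wn_nok[of f s t] assms d by auto
qed (use assms in auto)

lemma struct_al: assumes "wkt a" "wkt b" "wkt c" "obt a = A" "obt b = B" "obt c = C"
  shows "rep \<a>[A, B, C] (Br (Br a b) c) (Br a (Br b c)) []" "rep (\<a>[A, B, C]\<dagger>) (Br a (Br b c)) (Br (Br a b) c) []"
proof -
  have "arrow (al A B C)" using assms wkt_obt by auto
  then have h: "\<a>[A, B, C] \<in> Hom V ((A \<odot> B) \<odot> C) (A \<odot> B \<odot> C)" unfolding arrow_def by (simp add: mor_simps)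
  have n: "N \<a>[A, B, C] (Br (Br a b) c) (Br a (Br b c)) = Idw (set (lvs (Br (Br a b) c)))" if "distinct (lvs (Br (Br a b) c))"
    using N_assoc(2)[of a b c] tok_wkt[of "Br (Br a b) c"] that assms by auto
  show "rep \<a>[A, B, C] (Br (Br a b) c) (Br a (Br b c)) []" "rep (\<a>[A, B, C]\<dagger>) (Br a (Br b c)) (Br (Br a b) c) []"
    by (rule rep_struct rep_dagger_struct; use assms h n in \<open>simp add: ac_simps; fail\<close>)+
qed

lemma struct_l: assumes "wkt a" "obt a = A"
  shows "rep \<l>[A] (Br Em a) a []" "rep (\<l>[A]\<dagger>) a (Br Em a) []"
proof -
  have "arrow (lu A)" using assms wkt_obt by auto
  then have h: "\<l>[A] \<in> Hom V (\<I> \<odot> A) A" unfolding arrow_def by (simp add: mor_simps)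
  have n: "N \<l>[A] (Br Em a) a = Idw (set (lvs a))" if "distinct (lvs a)"
    using N_lunit(2)[of a] tok_wkt[of a] that assms by auto
  show "rep \<l>[A] (Br Em a) a []" "rep (\<l>[A]\<dagger>) a (Br Em a) []"
    by (rule rep_struct rep_dagger_struct; use assms h n in \<open>simp; fail\<close>)+
qed

lemma struct_r: assumes "wkt a" "obt a = A"
  shows "rep \<r>[A] (Br a Em) a []" "rep (\<r>[A]\<dagger>) a (Br a Em) []"
proof -
  have "arrow (ru A)" using assms wkt_obt by auto
  then have h: "\<r>[A] \<in> Hom V (A \<odot> \<I>) A" unfolding arrow_def by (simp add: mor_simps)
  have n: "N \<r>[A] (Br a Em) a = Idw (set (lvs a))" if "distinct (lvs a)"
    using N_runit(2)[of a] tok_wkt[of a] that assms by auto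
  show "rep \<r>[A] (Br a Em) a []" "rep (\<r>[A]\<dagger>) a (Br a Em) []"
    by (rule rep_struct rep_dagger_struct; use assms h n in \<open>simp; fail\<close>)+
qed

lemma struct_s: assumes "wkt a" "wkt b" "obt a = A" "obt b = B"
  shows "rep \<s>[A, B] (Br a b) (Br b a) []" "rep (\<s>[A, B]\<dagger>) (Br b a) (Br a b) []"
proof -
  have "arrow (sy A B)" using assms wkt_obt by auto
  then have h: "\<s>[A, B] \<in> Hom V (A \<odot> B) (B \<odot> A)" unfolding arrow_def by (simp add: mor_simps)
  have n: "N \<s>[A, B] (Br a b) (Br b a) = Idw (set (lvs (Br a b)))" if "distinct (lvs (Br a b))"
    using N_symm(2)[of a b] tok_wkt[of "Br a b"] that assms by auto
  show "rep \<s>[A, B] (Br a b) (Br b a) []" "rep (\<s>[A, B]\<dagger>) (Br b a) (Br a b) []"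
    by (rule rep_struct rep_dagger_struct; use assms h n in \<open>simp; fail\<close>)+
qed

text \<open>None of these rules adds a node of its own, so coherence isomorphisms and bare
  identities leave no trace in a compiled net.\<close>

lemmas cps = cp_comp cp_tensor cp_id cp_empty[OF struct_al(1)] cp_empty[OF struct_al(2)] cp_empty[OF struct_l(1)] cp_empty[OF struct_l(2)]
  cp_empty[OF struct_r(1)] cp_empty[OF struct_r(2)] cp_empty[OF struct_s(1)] cp_empty[OF struct_s(2)]

lemma cp_n: "f \<in> Hom V (obt s) (obt t) \<Longrightarrow> wkt s \<Longrightarrow> wkt t \<Longrightarrow> cp f s t ks D ks ((f, s, t) # D)"
  unfolding cp_def using rep_node[of f s t] by auto
text \<open>The digit in \<open>cp0\<close>, \<open>cp1\<close>, \<open>cp2\<close> counts the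
  output wires of a generator; their names are taken from the front of the supply list.\<close>

lemma cp0: "f \<in> Hom V P \<I> \<Longrightarrow> obt s = P \<Longrightarrow> wkt s \<Longrightarrow> cp f s Em ks D ks ((f, s, Em) # D)"
  by (rule cp_n) auto
lemma cp1: "f \<in> Hom V P B \<Longrightarrow> obt s = P \<Longrightarrow> wkt s \<Longrightarrow> B \<in> Obj V \<Longrightarrow> cp f s (w B k) (k # ks) D ks ((f, s, w B k) # D)"
  unfolding cp_def using rep_node[of f s "w B k"] by auto
lemma cp2: "f \<in> Hom V P (B \<odot> C) \<Longrightarrow> obt s = P \<Longrightarrow> wkt s \<Longrightarrow> B \<in> Obj V \<Longrightarrow> C \<in> Obj V \<Longrightarrow>
  cp f s (Br (w B k) (w C l)) (k # l # ks) D ks ((f, s, Br (w B k) (w C l)) # D)"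
  unfolding cp_def using rep_node[of f s "Br (w B k) (w C l)"] by auto

text \<open>Turns an equation in \<open>V\<close> into a rewrite rule for nets. Disjointness of
  \<open>s\<close> and \<open>t\<close> ensures that no wire of the boundary is traced, so the rule
  needs no closing node.\<close>

lemma law:
  assumes "f = g" "cp f s t ks [] ks' D" "cp g s t ls [] ls' E" "distinct (lvs s @ outs D)" "distinct (lvs s @ outs E)"
    "set (lvs s) \<inter> set (lvs t) = {}"
  shows "den D = den E"
  using rep_closed[OF cp_rep[OF assms(2)] assms(4,6)] rep_closed[OF cp_rep[OF assms(3)] assms(5,6)] assms(1) by simp

text \<open>The converse of \<open>law\<close>: an equation in \<open>V\<close> is proved by
  compiling both sides and rewriting one net into the other.\<close>

lemma net_eq:
  assumes "cp f s t ks [] ks' D" "cp g s t ls [] ls' E" "distinct (lvs s @ outs D)" "distinct (lvs s @ outs E)" "den D = den E"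
  shows "f = g"
  using rep_eq[OF cp_rep[OF assms(1)] cp_rep[OF assms(2)] assms(5,3,4)] .

declare valid_def [simp] wob_simps [simp del]

section \<open>Symmetric dagger Frobenius algebras\<close>

text \<open>The digits count inputs and outputs, and wire names follow in the order inputs, outputs.
  In \<open>n12\<close> and \<open>n10\<close> the dagger is supplied by the abbreviation.\<close>

abbreviation n21 :: "'o \<Rightarrow> 'm \<Rightarrow> nat \<Rightarrow> nat \<Rightarrow> nat \<Rightarrow> ('o, 'm) node" where "n21 A m i j k \<equiv> (m, Br (w A i) (w A j), w A k)"
abbreviation n12 :: "'o \<Rightarrow> 'm \<Rightarrow> nat \<Rightarrow> nat \<Rightarrow> nat \<Rightarrow> ('o, 'm) node" where "n12 A m i j k \<equiv> (m\<dagger>, w A i, Br (w A j) (w A k))"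
abbreviation n01 :: "'o \<Rightarrow> 'm \<Rightarrow> nat \<Rightarrow> ('o, 'm) node" where "n01 A u i \<equiv> (u, Em, w A i)"
abbreviation n10 :: "'o \<Rightarrow> 'm \<Rightarrow> nat \<Rightarrow> ('o, 'm) node" where "n10 A u i \<equiv> (u\<dagger>, w A i, Em)"
abbreviation n11 :: "'o \<Rightarrow> 'o \<Rightarrow> 'm \<Rightarrow> nat \<Rightarrow> nat \<Rightarrow> ('o, 'm) node" where "n11 A B f i j \<equiv> (f, w A i, w B j)"
abbreviation idn :: "'o \<Rightarrow> nat \<Rightarrow> nat \<Rightarrow> ('o, 'm) node" where "idn A i j \<equiv> (\<one>[A], w A i, w A j)"
abbreviation cup :: "'o \<Rightarrow> nat \<Rightarrow> nat \<Rightarrow> ('o, 'm) node" where "cup A i j \<equiv> (\<eta> A, Em, Br (w (A\<^sup>\<star>) i) (w A j))"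
abbreviation cap :: "'o \<Rightarrow> nat \<Rightarrow> nat \<Rightarrow> ('o, 'm) node" where "cap A i j \<equiv> ((\<eta> A)\<dagger>, Br (w (A\<^sup>\<star>) i) (w A j), Em)"

lemma eta_types [simp]: "A \<in> Obj V \<Longrightarrow> \<eta> A \<in> Hom V \<I> (A\<^sup>\<star> \<odot> A)" "A \<in> Obj V \<Longrightarrow> (\<eta> A)\<dagger> \<in> Hom V (A\<^sup>\<star> \<odot> A) \<I>"
  using eta_Hom dagger_in_Hom[OF unit_obj_in_Obj] by auto

lemma one_type [simp]: "A \<in> Obj V \<Longrightarrow> \<one>[A] \<in> Hom V A A" by (rule ident_in_Hom)

lemma yank:
  assumes [simp]: "A \<in> Obj V" and "i \<noteq> j" "k \<noteq> i" "k \<noteq> j"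
  shows "den [cap A k i, cup A k j] = den [idn A i j]"
  \<comment> \<open>On the right side the identity is compiled to a node with
    \<open>one_type\<close> and not to a bare wire, because its two ends carry different names. The
    same is done in all later laws with an identity on one side.\<close>
  by (rule law[OF snake_eq[of A, unfolded eps_eta[OF assms(1)]], where s = "w A i" and t = "w A j" and ks = "[k, j]" and ls = "[j]"],
      (rule cps cp2[OF eta_types(1)] cp0[OF eta_types(2)] | (simp; fail))+, (rule cp1[OF one_type] | simp)+, use assms in auto)

definition sfa :: "'o \<Rightarrow> 'm \<Rightarrow> 'm \<Rightarrow> bool" where
  "sfa A m u \<longleftrightarrow> dagger_frobenius_algebra V A m u \<and> u\<dagger> \<cdot> m \<cdot> \<s>[A, A] = u\<dagger> \<cdot> m"

lemma dfa_types:
  assumes "dagger_frobenius_algebra V A m u"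
  shows "A \<in> Obj V" "m \<in> Hom V (A \<odot> A) A" "u \<in> Hom V \<I> A" "m\<dagger> \<in> Hom V A (A \<odot> A)" "u\<dagger> \<in> Hom V A \<I>"
  using assms dagger_in_Hom[of "A \<odot> A" A m] dagger_in_Hom[of \<I> A u]
  unfolding dagger_frobenius_algebra_def frobenius_algebra_def monoid_object_def by auto

lemma dfa_eqs:
  assumes "dagger_frobenius_algebra V A m u"
  shows "m \<cdot> (m \<otimes> \<one>[A]) = m \<cdot> (\<one>[A] \<otimes> m) \<cdot> \<a>[A, A, A]"
     "m \<cdot> (u \<otimes> \<one>[A]) \<cdot> \<l>[A]\<dagger> = \<one>[A]"
     "m \<cdot> (\<one>[A] \<otimes> u) \<cdot> \<r>[A]\<dagger> = \<one>[A]"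
     "\<a>[A, A, A] \<cdot> (m\<dagger> \<otimes> \<one>[A]) \<cdot> m\<dagger> = (\<one>[A] \<otimes> m\<dagger>) \<cdot> m\<dagger>"
     "\<l>[A] \<cdot> (u\<dagger> \<otimes> \<one>[A]) \<cdot> m\<dagger> = \<one>[A]"
     "\<r>[A] \<cdot> (\<one>[A] \<otimes> u\<dagger>) \<cdot> m\<dagger> = \<one>[A]"
     "(\<one>[A] \<otimes> m) \<cdot> \<a>[A, A, A] \<cdot> (m\<dagger> \<otimes> \<one>[A]) = m\<dagger> \<cdot> m"
     "(m \<otimes> \<one>[A]) \<cdot> \<a>[A, A, A]\<dagger> \<cdot> (\<one>[A] \<otimes> m\<dagger>) = m\<dagger> \<cdot> m"
  using assms unfolding dagger_frobenius_algebra_def frobenius_algebra_def monoid_object_def comonoid_object_def by auto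

context
  fixes A m u assumes dfa: "dagger_frobenius_algebra V A m u"
begin

private lemma ty [simp]: "A \<in> Obj V" "m \<in> Hom V (A \<odot> A) A" "u \<in> Hom V \<I> A" "m\<dagger> \<in> Hom V A (A \<odot> A)" "u\<dagger> \<in> Hom V A \<I>"
  using dfa_types[OF dfa] .
private lemmas gens = cp1[OF ty(2)] cp1[OF ty(3)] cp2[OF ty(4)] cp0[OF ty(5)]

lemma fr_assoc:
  assumes "distinct [i, j, k, l, p]" "distinct [i, j, k, l, q]"
  shows "den [n21 A m p k l, n21 A m i j p] = den [n21 A m i q l, n21 A m j k q]"
  by (rule law[OF dfa_eqs(1)[OF dfa], where s = "Br (Br (w A i) (w A j)) (w A k)" and t = "w A l" and ks = "[p, l]" and ls = "[q, l]"],
      (rule cps gens | (simp; fail))+, use assms in auto)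

lemma fr_coassoc:
  assumes "distinct [i, j, k, l, p]" "distinct [i, j, k, l, q]"
  shows "den [n12 A m p i j, n12 A m l p k] = den [n12 A m q j k, n12 A m l i q]"
  by (rule law[OF dfa_eqs(4)[OF dfa], where s = "w A l" and t = "Br (w A i) (Br (w A j) (w A k))" and ks = "[p, k, i, j]" and ls = "[i, q, j, k]"],
      (rule cps gens | (simp; fail))+, use assms in auto)

lemma fr_frob1:
  assumes "distinct [i, j, k, l, p]" "distinct [i, j, k, l, q]"
  shows "den [n21 A m p j l, n12 A m i k p] = den [n12 A m q k l, n21 A m i j q]"
  by (rule law[OF dfa_eqs(7)[OF dfa], where s = "Br (w A i) (w A j)" and t = "Br (w A k) (w A l)" and ks = "[k, p, l]" and ls = "[q, k, l]"],
      (rule cps gens | (simp; fail))+, use assms in auto)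

lemma fr_frob2:
  assumes "distinct [i, j, k, l, p]" "distinct [i, j, k, l, q]"
  shows "den [n21 A m i p k, n12 A m j p l] = den [n12 A m q k l, n21 A m i j q]"
  by (rule law[OF dfa_eqs(8)[OF dfa], where s = "Br (w A i) (w A j)" and t = "Br (w A k) (w A l)" and ks = "[p, l, k]" and ls = "[q, k, l]"],
      (rule cps gens | (simp; fail))+, use assms in auto)

lemma fr_unl:
  assumes "distinct [i, j, p]"
  shows "den [n21 A m p i j, n01 A u p] = den [idn A i j]"
  by (rule law[OF dfa_eqs(2)[OF dfa], where s = "w A i" and t = "w A j" and ks = "[p, j]" and ls = "[j]"],
      (rule cps gens | (simp; fail))+, (rule cp1[OF one_type] | simp)+, use assms in auto)

lemma fr_unr:
  assumes "distinct [i, j, p]"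
  shows "den [n21 A m i p j, n01 A u p] = den [idn A i j]"
  by (rule law[OF dfa_eqs(3)[OF dfa], where s = "w A i" and t = "w A j" and ks = "[p, j]" and ls = "[j]"],
      (rule cps gens | (simp; fail))+, (rule cp1[OF one_type] | simp)+, use assms in auto)

lemma fr_counl:
  assumes "distinct [i, j, p]"
  shows "den [n10 A u p, n12 A m i p j] = den [idn A i j]"
  by (rule law[OF dfa_eqs(5)[OF dfa], where s = "w A i" and t = "w A j" and ks = "[p, j]" and ls = "[j]"],
      (rule cps gens | (simp; fail))+, (rule cp1[OF one_type] | simp)+, use assms in auto)

lemma fr_counr:
  assumes "distinct [i, j, p]"
  shows "den [n10 A u p, n12 A m i j p] = den [idn A i j]"
  by (rule law[OF dfa_eqs(6)[OF dfa], where s = "w A i" and t = "w A j" and ks = "[j, p]" and ls = "[j]"],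
      (rule cps gens | (simp; fail))+, (rule cp1[OF one_type] | simp)+, use assms in auto)

end

lemma sfa_dfa: "sfa A m u \<Longrightarrow> dagger_frobenius_algebra V A m u" by (simp add: sfa_def)

context
  fixes A m u assumes sfa: "sfa A m u"
begin

private lemma sfa_is_dfa: "dagger_frobenius_algebra V A m u" using sfa by (rule sfa_dfa)
private lemma sty [simp]: "A \<in> Obj V" "m \<in> Hom V (A \<odot> A) A" "u \<in> Hom V \<I> A" "m\<dagger> \<in> Hom V A (A \<odot> A)" "u\<dagger> \<in> Hom V A \<I>"
  using dfa_types[OF sfa_is_dfa] .
private lemmas sgens = cp1[OF sty(2)] cp1[OF sty(3)] cp2[OF sty(4)] cp0[OF sty(5)]

lemma fr_sym:
  assumes "distinct [i, j, p]"
  shows "den [n10 A u p, n21 A m i j p] = den [n10 A u p, n21 A m j i p]"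
proof -
  have "den [n10 A u p, n21 A m j i p] = den [n10 A u p, n21 A m i j p]"
    by (rule law[where f = "u\<dagger> \<cdot> m \<cdot> \<s>[A, A]" and g = "u\<dagger> \<cdot> m" and s = "Br (w A i) (w A j)" and t = "Em" and ks = "[p]" and ls = "[p]"])
      (use sfa in \<open>simp add: sfa_def\<close>, (rule cps sgens | (simp; fail))+, use assms in auto)
  then show ?thesis by simp
qed

lemma fr_cosym_eq: "\<s>[A, A] \<cdot> m\<dagger> \<cdot> u = m\<dagger> \<cdot> u"
proof -
  define M where "M = Arr (A \<odot> A) m A"
  define U where "U = Arr \<I> u A"
  have [simp]: "arrow M" "dom M = A \<odot> A" "cod M = A" "arrow U" "dom U = \<I>" "cod U = A" unfolding M_def U_def by simp_all
  have "dg U \<bullet> M \<bullet> sy A A = dg U \<bullet> M"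
    using sfa unfolding sfa_def by (intro arr_eqI) (simp_all add: mor_simps M_def U_def)
  then have "dg (dg U \<bullet> M \<bullet> sy A A) = dg (dg U \<bullet> M)" by simp
  then have "mor (sy A A \<bullet> dg M \<bullet> U) = mor (dg M \<bullet> U)" by (simp add: sy_dg)
  then show ?thesis by (simp add: mor_simps M_def U_def)
qed

lemma fr_cosym:
  assumes "distinct [i, j, p]"
  shows "den [n12 A m p i j, n01 A u p] = den [n12 A m p j i, n01 A u p]"
proof -
  have "den [n12 A m p j i, n01 A u p] = den [n12 A m p i j, n01 A u p]"
    by (rule law[OF fr_cosym_eq, where s = "Em" and t = "Br (w A i) (w A j)" and ks = "[p, j, i]" and ls = "[p, i, j]"],
       (rule cps sgens | (simp; fail))+, use assms in auto)
  then show ?thesis by simp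
qed

end

context
  fixes A m u assumes dfa: "dagger_frobenius_algebra V A m u"
begin

private lemma tz [simp]: "A \<in> Obj V" "m \<in> Hom V (A \<odot> A) A" "u \<in> Hom V \<I> A" "m\<dagger> \<in> Hom V A (A \<odot> A)" "u\<dagger> \<in> Hom V A \<I>"
  using dfa_types[OF dfa] .
private lemmas zgens = cp1[OF tz(2)] cp1[OF tz(3)] cp2[OF tz(4)] cp0[OF tz(5)]

text \<open>The Frobenius law merges the coform \<open>m\<dagger> \<cdot> u\<close> and the form
  \<open>u\<dagger> \<cdot> m\<close> into \<open>m\<dagger> \<cdot> m\<close> with a unit and a
  counit attached, and these cancel. The carrier of an algebra is thus a dual of itself.\<close>

lemma fr_snake_eq:
  "\<r>[A] \<cdot> (\<one>[A] \<otimes> (u\<dagger> \<cdot> m)) \<cdot> \<a>[A, A, A] \<cdot> ((m\<dagger> \<cdot> u) \<otimes> \<one>[A]) \<cdot> \<l>[A]\<dagger> = \<one>[A]"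
  "\<l>[A] \<cdot> ((u\<dagger> \<cdot> m) \<otimes> \<one>[A]) \<cdot> \<a>[A, A, A]\<dagger> \<cdot> (\<one>[A] \<otimes> (m\<dagger> \<cdot> u)) \<cdot> \<r>[A]\<dagger> = \<one>[A]"
proof -
  have "den [n10 A u 5, n21 A m 4 2 5, n12 A m 3 1 4, n01 A u 3] = den [idn A 2 1]"
    apply (rule net_step[OF fr_frob1[OF dfa, of 3 2 1 5 4 4]]; simp)
    apply (rule net_step[OF fr_unl[OF dfa, of 2 4 3]]; simp)
    apply (rule net_step[OF fr_counr[OF dfa, of 4 1 5]]; simp)
    apply (rule id_in[where A = A and i = 2 and j = 4]; simp)
    done
  then show "\<r>[A] \<cdot> (\<one>[A] \<otimes> (u\<dagger> \<cdot> m)) \<cdot> \<a>[A, A, A] \<cdot> ((m\<dagger> \<cdot> u) \<otimes> \<one>[A]) \<cdot> \<l>[A]\<dagger> = \<one>[A]"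
    by (intro net_eq[where s = "w A 2" and t = "w A 1" and ks = "[3, 1, 4, 5]" and ls = "[1]"])
      ((rule cps zgens | (simp; fail))+, (rule cp1[OF one_type] | simp)+)
  have "den [n10 A u 5, n21 A m 2 4 5, n12 A m 3 4 1, n01 A u 3] = den [idn A 2 1]"
    apply (rule net_step[OF fr_frob2[OF dfa, of 2 3 5 1 4 4]]; simp)
    apply (rule net_step[OF fr_unr[OF dfa, of 2 4 3]]; simp)
    apply (rule net_step[OF fr_counl[OF dfa, of 4 1 5]]; simp)
    apply (rule id_in[where A = A and i = 2 and j = 4]; simp)
    done
  then show "\<l>[A] \<cdot> ((u\<dagger> \<cdot> m) \<otimes> \<one>[A]) \<cdot> \<a>[A, A, A]\<dagger> \<cdot> (\<one>[A] \<otimes> (m\<dagger> \<cdot> u)) \<cdot> \<r>[A]\<dagger> = \<one>[A]"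
    by (intro net_eq[where s = "w A 2" and t = "w A 1" and ks = "[3, 4, 1, 5]" and ls = "[1]"])
      ((rule cps zgens | (simp; fail))+, (rule cp1[OF one_type] | simp)+)
qed

lemma fr_snake2:
  assumes "distinct [i, j, p, q, r]"
  shows "den [n10 A u r, n21 A m j q r, n12 A m p q i, n01 A u p] = den [idn A j i]"
  by (rule law[OF fr_snake_eq(2), where s = "w A j" and t = "w A i" and ks = "[p, q, i, r]" and ls = "[i]"],
      (rule cps zgens | (simp; fail))+, (rule cp1[OF one_type] | simp)+, use assms in auto)

end

end

context dagger_compact
begin

section \<open>Normalisability\<close>

text \<open>The normaliser condition freed from the trace over the dual object: the loop
  \<open>m \<cdot> m\<dagger>\<close> is inverted by the square of \<open>z\<close>. In this form it
  passes easily to tensor products and opposites.\<close>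

definition spec :: "'o \<Rightarrow> 'm \<Rightarrow> 'm \<Rightarrow> bool" where
  "spec A m z \<longleftrightarrow> central V A m z \<and> positive_definite V A z \<and> m \<cdot> m\<dagger> \<cdot> z \<cdot> z = \<one>[A]"

context
  fixes A m u z assumes dfa: "dagger_frobenius_algebra V A m u" and cen: "central V A m z"
begin

private lemma th [simp]: "A \<in> Obj V" "m \<in> Hom V (A \<odot> A) A" "u \<in> Hom V \<I> A" "m\<dagger> \<in> Hom V A (A \<odot> A)" "u\<dagger> \<in> Hom V A \<I>" "z \<in> Hom V A A"
  using dfa_types[OF dfa] cen unfolding central_def by auto
private lemmas hgens = cp1[OF th(2)] cp1[OF th(3)] cp2[OF th(4)] cp0[OF th(5)] cp1[OF th(6)] cp2[OF eta_types(1)] cp0[OF eta_types(2)]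

private lemma ceq: "m \<cdot> (z \<otimes> \<one>[A]) = z \<cdot> m" "m \<cdot> (\<one>[A] \<otimes> z) = z \<cdot> m"
  using conjunct2[OF cen[unfolded central_def]] by (blast, metis)

lemma fr_cen1:
  assumes "distinct [i, j, k, p]" "distinct [i, j, k, q]"
  shows "den [n21 A m p j k, n11 A A z i p] = den [n11 A A z q k, n21 A m i j q]"
  by (rule law[OF ceq(1), where s = "Br (w A i) (w A j)" and t = "w A k" and ks = "[p, k]" and ls = "[q, k]"],
      (rule cps hgens | (simp; fail))+, use assms in auto)

lemma fr_cen2:
  assumes "distinct [i, j, k, p]" "distinct [i, j, k, q]"
  shows "den [n21 A m i p k, n11 A A z j p] = den [n11 A A z q k, n21 A m i j q]"
  by (rule law[OF ceq(2), where s = "Br (w A i) (w A j)" and t = "w A k" and ks = "[p, k]" and ls = "[q, k]"],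
      (rule cps hgens | (simp; fail))+, use assms in auto)

lemma fr_trace:
  assumes t: "trace_mult V dual \<eta> \<epsilon> A m \<cdot> z \<cdot> z = u\<dagger>" and "distinct [a, b, c, x, y, x']"
  shows "den [cap A x' y, n21 A m c x y, cup A x' x, n11 A A z b c, n11 A A z a b] = den [n10 A u a]"
  by (rule law[OF t[unfolded trace_mult_def eps_eta[OF th(1)]], where s = "w A a" and t = "Em" and ks = "[b, c, x', x, y]" and ls = "[]"],
      (rule cps hgens | (simp; fail))+, use assms(2) in auto)

text \<open>Only the trace in the normalising condition enters here: it is cyclic.\<close>

lemma normalisable_sym:
  assumes t: "trace_mult V dual \<eta> \<epsilon> A m \<cdot> z \<cdot> z = u\<dagger>"
  shows "u\<dagger> \<cdot> m \<cdot> \<s>[A, A] = u\<dagger> \<cdot> m"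
proof -
  \<comment> \<open>Multiplication by wire 2 and by wire 1 (with both \<open>z\<close> moved onto
    it), closed into one loop through the wires 8 and 11. The product in one order cuts this loop at
    11, in the other order at 8; the net knows no difference.\<close>
  let ?E = "[n21 A m 2 11 8, n21 A m 10 8 11, n11 A A z 9 10, n11 A A z 1 9]"
  have "den [n10 A u 3, n21 A m 1 2 3] = den ?E"
    apply (rule net_step[OF fr_trace[OF t, symmetric, of 3 4 5 7 11 6]]; simp)
    apply (rule net_step[OF fr_cen1[symmetric, of 1 2 4 9 3]]; simp)
    apply (rule net_step[OF fr_cen1[symmetric, of 9 2 5 10 4]]; simp)
    apply (rule net_step[OF fr_assoc[OF dfa, of 10 2 7 11 5 8]]; simp)
    apply (rule net_step[OF yank[of A 11 7 6]]; simp)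
    apply (rule id_in[where A = A and i = 11 and j = 7]; simp)
    by (rule net_perm; simp)
  moreover have "den [n10 A u 3, n21 A m 2 1 3] = den ?E"
    apply (rule net_step[OF fr_trace[OF t, symmetric, of 3 4 5 7 8 6]]; simp)
    apply (rule net_step[OF fr_cen2[symmetric, of 2 1 4 9 3]]; simp)
    apply (rule net_step[OF fr_cen2[symmetric, of 2 9 5 10 4]]; simp)
    apply (rule net_step[OF fr_assoc[OF dfa, of 2 10 7 8 5 11]]; simp)
    apply (rule net_step[OF yank[of A 8 7 6]]; simp)
    apply (rule id_in[where A = A and i = 8 and j = 7]; simp)
    done
  ultimately have "den [n10 A u 3, n21 A m 2 1 3] = den [n10 A u 3, n21 A m 1 2 3]" by simp
  then show ?thesis
    by (intro net_eq[where s = "Br (w A 1) (w A 2)" and t = "Em" and ks = "[3]" and ls = "[3]"])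
      (rule cps hgens | simp)+
qed

text \<open>In a symmetric algebra the loop may be closed by form and coform instead of the cup and
  cap of \<open>V\<close>; the Frobenius law then reduces the trace of multiplication to
  \<open>u\<dagger> \<cdot> m \<cdot> m\<dagger>\<close>.\<close>

lemma fr_trace_spec:
  assumes s: "sfa A m u" and "distinct [t, x, y, x', a, b, r]"
  shows "den [cap A x' y, n21 A m t x y, cup A x' x] = den [n10 A u r, n21 A m a b r, n12 A m t a b]"
proof -
  let ?T = "\<epsilon> A \<cdot> (m \<otimes> \<one>[A\<^sup>\<star>]) \<cdot> \<a>[A, A, A\<^sup>\<star>]\<dagger> \<cdot> (\<one>[A] \<otimes> (\<s>[A\<^sup>\<star>, A] \<cdot> \<eta> A)) \<cdot> \<r>[A]\<dagger>"
  have "den [cap A 4 3, n21 A m 1 2 3, cup A 4 2] = den [n10 A u 7, n21 A m 3 5 7, n12 A m 1 3 5]"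
    apply (rule net_step[OF yank[of A 3 2 4]]; simp)
    apply (rule net_step[OF fr_snake2[OF dfa, symmetric, of 2 3 6 5 7]]; simp)
    apply (rule net_step[OF fr_cosym[OF s, of 5 2 6]]; simp)
    apply (rule net_step[OF fr_frob2[OF dfa, of 1 6 3 5 2 8]]; simp)
    apply (rule net_step[OF fr_unr[OF dfa, of 1 8 6]]; simp)
    apply (rule id_in[where A = A and i = 1 and j = 8]; simp)
    by (rule net_perm; simp)
  \<comment> \<open>The computation with fixed names is lifted to an equation of morphisms, from
    which \<open>law\<close> derives the version with arbitrary names.\<close>
  then have e: "?T = u\<dagger> \<cdot> m \<cdot> m\<dagger>" unfolding eps_eta[OF th(1)]
    by (intro net_eq[where s = "w A 1" and t = "Em" and ks = "[4, 2, 3]" and ls = "[3, 5, 7]"])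
      (rule cps hgens | simp)+
  show ?thesis
    by (rule law[OF e[unfolded eps_eta[OF th(1)]], where s = "w A t" and t = "Em" and ks = "[x', x, y]" and ls = "[a, b, r]"],
      (rule cps hgens | (simp; fail))+, use assms(2) in auto)
qed

lemma normalisable_special:
  assumes t: "trace_mult V dual \<eta> \<epsilon> A m \<cdot> z \<cdot> z = u\<dagger>"
  shows "m \<cdot> m\<dagger> \<cdot> z \<cdot> z = \<one>[A]"
proof -
  have s: "sfa A m u" unfolding sfa_def using dfa normalisable_sym[OF t] by simp
  \<comment> \<open>The identity node on the output is there only to be opened into a Frobenius
    snake. Its form meets the loop \<open>m \<cdot> m\<dagger>\<close>, the two together are the
    trace, and the trace absorbs both \<open>z\<close>; the remaining snake is the identity.\<close>
  have "den [idn A 6 7, n21 A m 4 5 6, n12 A m 3 4 5, n11 A A z 2 3, n11 A A z 1 2] = den [idn A 1 7]"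
    apply (rule net_step[OF fr_snake2[OF dfa, symmetric, of 7 6 8 9 10]]; simp)
    apply (rule net_step[OF fr_assoc[OF dfa, of 4 5 9 10 6 11]]; simp)
    apply (rule net_step[OF fr_frob1[OF dfa, of 3 9 4 11 5 12]]; simp)
    apply (rule net_step[OF fr_trace_spec[OF s, symmetric, of 12 13 14 15 4 11 10]]; simp)
    apply (rule net_step[OF fr_cen1[of 2 9 12 3 16]]; simp)
    apply (rule net_step[OF fr_cen1[of 1 9 16 2 17]]; simp)
    apply (rule net_step[OF fr_trace[OF t, of 17 16 12 13 14 15]]; simp)
    apply (rule net_step[OF fr_snake2[OF dfa, of 7 1 8 9 17]]; simp)
    done
  moreover have "den [idn A 6 7, n21 A m 4 5 6, n12 A m 3 4 5, n11 A A z 2 3, n11 A A z 1 2]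
      = den [n21 A m 4 5 7, n12 A m 3 4 5, n11 A A z 2 3, n11 A A z 1 2]"
    by (rule id_out[where A = A and i = 6 and j = 7]; simp)
  ultimately have "den [n21 A m 4 5 7, n12 A m 3 4 5, n11 A A z 2 3, n11 A A z 1 2] = den [idn A 1 7]" by simp
  then show ?thesis
    by (intro net_eq[where s = "w A 1" and t = "w A 7" and ks = "[2, 3, 4, 5, 7]" and ls = "[7]"])
      ((rule cps hgens | (simp; fail))+, (rule cp1[OF one_type] | simp)+)
qed

lemma fr_special:
  assumes t: "m \<cdot> m\<dagger> \<cdot> z \<cdot> z = \<one>[A]" and "distinct [i, j, p, q, r, s]"
  shows "den [n21 A m r s j, n12 A m q r s, n11 A A z p q, n11 A A z i p] = den [idn A i j]"
  by (rule law[OF t, where s = "w A i" and t = "w A j" and ks = "[p, q, r, s, j]" and ls = "[j]"],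
      (rule cps hgens | (simp; fail))+, (rule cp1[OF one_type] | simp)+, use assms in auto)

lemma special_normalisable:
  assumes s: "sfa A m u" and e: "m \<cdot> m\<dagger> \<cdot> z \<cdot> z = \<one>[A]"
  shows "trace_mult V dual \<eta> \<epsilon> A m \<cdot> z \<cdot> z = u\<dagger>"
proof -
  have "den [cap A 4 6, n21 A m 3 5 6, cup A 4 5, n11 A A z 2 3, n11 A A z 1 2] = den [n10 A u 1]"
    apply (rule net_step[OF fr_trace_spec[OF s, of 3 5 6 4 7 8 9]]; simp)
    apply (rule net_step[OF fr_special[OF e, of 1 9 2 3 7 8]]; simp)
    apply (rule id_in[where A = A and i = 1 and j = 9]; simp)
    done
  then show ?thesis unfolding trace_mult_def eps_eta[OF th(1)]
    by (intro net_eq[where s = "w A 1" and t = "Em" and ks = "[2, 3, 4, 5, 6]" and ls = "[]"])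
      (rule cps hgens | simp)+
qed

end

text \<open>From here on the objects of the construction are described without dual objects.\<close>

lemma normalisable_iff:
  "dagger_frobenius_algebra V A m u \<and> normalisable V dual \<eta> \<epsilon> A m u \<longleftrightarrow> sfa A m u \<and> (\<exists>z. spec A m z)"
  unfolding normalisable_def spec_def using normalisable_sym normalisable_special special_normalisable sfa_def
  by metis

section \<open>Constructions of algebras\<close>

lemma dfaI:
  assumes "A \<in> Obj V" "m \<in> Hom V (A \<odot> A) A" "u \<in> Hom V \<I> A" 
     "m \<cdot> (m \<otimes> \<one>[A]) = m \<cdot> (\<one>[A] \<otimes> m) \<cdot> \<a>[A, A, A]"
     "m \<cdot> (u \<otimes> \<one>[A]) \<cdot> \<l>[A]\<dagger> = \<one>[A]"
     "m \<cdot> (\<one>[A] \<otimes> u) \<cdot> \<r>[A]\<dagger> = \<one>[A]"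
     "\<a>[A, A, A] \<cdot> (m\<dagger> \<otimes> \<one>[A]) \<cdot> m\<dagger> = (\<one>[A] \<otimes> m\<dagger>) \<cdot> m\<dagger>"
     "\<l>[A] \<cdot> (u\<dagger> \<otimes> \<one>[A]) \<cdot> m\<dagger> = \<one>[A]"
     "\<r>[A] \<cdot> (\<one>[A] \<otimes> u\<dagger>) \<cdot> m\<dagger> = \<one>[A]"
     "(\<one>[A] \<otimes> m) \<cdot> \<a>[A, A, A] \<cdot> (m\<dagger> \<otimes> \<one>[A]) = m\<dagger> \<cdot> m"
     "(m \<otimes> \<one>[A]) \<cdot> \<a>[A, A, A]\<dagger> \<cdot> (\<one>[A] \<otimes> m\<dagger>) = m\<dagger> \<cdot> m"
  shows "dagger_frobenius_algebra V A m u"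
  unfolding dagger_frobenius_algebra_def frobenius_algebra_def monoid_object_def comonoid_object_def
  using assms dagger_in_Hom[of "A \<odot> A" A m] dagger_in_Hom[of \<I> A u] by simp

lemma cp_regroup:
  assumes "wkt a" "wkt b" "wkt c" "wkt d" "obt a = A" "obt b = B" "obt c = C" "obt d = D"
  shows "cp (regroup V A B C D) (Br (Br a b) (Br c d)) (Br a (Br (Br b c) d)) ks E ks E"
    "cp ((regroup V A B C D)\<dagger>) (Br a (Br (Br b c) d)) (Br (Br a b) (Br c d)) ks E ks E"
proof -
  have o [simp]: "A \<in> Obj V" "B \<in> Obj V" "C \<in> Obj V" "D \<in> Obj V" using assms wkt_obt by auto
  show "cp (regroup V A B C D) (Br (Br a b) (Br c d)) (Br a (Br (Br b c) d)) ks E ks E"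
    unfolding regroup_def by (rule cps | simp add: assms)+
  have "(regroup V A B C D)\<dagger> = mor (dg ((ida A \<boxtimes> dg (al B C D)) \<bullet> al A B (C \<odot> D)))"
    by (simp add: regroup_def mor_simps del: dg_cmp dg_tns)
  also have "\<dots> = mor (dg (al A B (C \<odot> D)) \<bullet> (ida A \<boxtimes> al B C D))" by simp
  finally have e: "(regroup V A B C D)\<dagger> = \<a>[A, B, C \<odot> D]\<dagger> \<cdot> (\<one>[A] \<otimes> \<a>[B, C, D])" by (simp add: mor_simps)
  show "cp ((regroup V A B C D)\<dagger>) (Br a (Br (Br b c) d)) (Br (Br a b) (Br c d)) ks E ks E"
    unfolding e by (rule cps | simp add: assms)+
qed

end

context dagger_compact
begin

lemma cp_Hom: "cp f s t ks [] ks' D \<Longrightarrow> f \<in> Hom V (obt s) (obt t)"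
  by (auto simp: cp_def rep_def)

context
  fixes A m u B n v assumes dfaA: "dagger_frobenius_algebra V A m u" and dfaB: "dagger_frobenius_algebra V B n v"
begin

private lemma ti [simp]: "A \<in> Obj V" "m \<in> Hom V (A \<odot> A) A" "u \<in> Hom V \<I> A" "m\<dagger> \<in> Hom V A (A \<odot> A)" "u\<dagger> \<in> Hom V A \<I>"
  "B \<in> Obj V" "n \<in> Hom V (B \<odot> B) B" "v \<in> Hom V \<I> B" "n\<dagger> \<in> Hom V B (B \<odot> B)" "v\<dagger> \<in> Hom V B \<I>"
  using dfa_types[OF dfaA] dfa_types[OF dfaB] by auto
private lemmas igens = cp1[OF ti(2)] cp1[OF ti(3)] cp2[OF ti(4)] cp0[OF ti(5)] cp1[OF ti(7)] cp1[OF ti(8)] cp2[OF ti(9)] cp0[OF ti(10)]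

abbreviation (input) "TT \<equiv> tensor_mult V A m B n"
abbreviation (input) "UU \<equiv> tensor_unit V u v"

section \<open>Tensor products of algebras\<close>

lemma tensor_mult_dagger:
  "TT\<dagger> = (regroup V A B A B)\<dagger> \<cdot> (\<one>[A] \<otimes> (\<s>[A, B] \<otimes> \<one>[B])) \<cdot> regroup V A A B B \<cdot> (m\<dagger> \<otimes> n\<dagger>)"
proof -
  define M where "M = Arr (A \<odot> A) m A"
  define N where "N = Arr (B \<odot> B) n B"
  define rg where "rg C D E F = (ida C \<boxtimes> dg (al D E F)) \<bullet> al C D (E \<odot> F)" for C D E F
  have r: "regroup V C D E F = mor (rg C D E F)" for C D E F unfolding rg_def regroup_def by (simp add: mor_simps)
  have rr [simp]: "C \<in> Obj V \<Longrightarrow> D \<in> Obj V \<Longrightarrow> E \<in> Obj V \<Longrightarrow> F \<in> Obj V \<Longrightarrow> arrow (rg C D E F)"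
    "dom (rg C D E F) = (C \<odot> D) \<odot> (E \<odot> F)" "cod (rg C D E F) = C \<odot> ((D \<odot> E) \<odot> F)" for C D E F
    unfolding rg_def by simp_all
  have [simp]: "arrow M" "dom M = A \<odot> A" "cod M = A" "arrow N" "dom N = B \<odot> B" "cod N = B" unfolding M_def N_def by simp_all
  have "TT\<dagger> = mor (dg ((M \<boxtimes> N) \<bullet> dg (rg A A B B) \<bullet> (ida A \<boxtimes> (sy B A \<boxtimes> ida B)) \<bullet> rg A B A B))"
    by (simp add: tensor_mult_def mor_simps r M_def N_def del: dg_cmp dg_tns dg_dg)
  also have "\<dots> = mor (dg (rg A B A B) \<bullet> (ida A \<boxtimes> (sy A B \<boxtimes> ida B)) \<bullet> rg A A B B \<bullet> (dg M \<boxtimes> dg N))"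
    by (simp add: sy_dg)
  finally show ?thesis by (simp add: mor_simps r M_def N_def)
qed

lemma tensor_unit_dagger: "UU\<dagger> = \<l>[\<I>] \<cdot> (u\<dagger> \<otimes> v\<dagger>)"
proof -
  define M where "M = Arr \<I> u A"
  define N where "N = Arr \<I> v B"
  have [simp]: "arrow M" "dom M = \<I>" "cod M = A" "arrow N" "dom N = \<I>" "cod N = B" unfolding M_def N_def by simp_all
  have "UU\<dagger> = mor (dg ((M \<boxtimes> N) \<bullet> dg (lu \<I>)))"
    by (simp add: tensor_unit_def mor_simps M_def N_def del: dg_cmp dg_tns dg_dg)
  also have "\<dots> = mor (lu \<I> \<bullet> (dg M \<boxtimes> dg N))" by simp
  finally show ?thesis by (simp add: mor_simps M_def N_def)
qed

lemma cp_tensor_mult: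
  assumes "wkt a" "wkt b" "wkt c" "wkt d" "obt a = A" "obt b = B" "obt c = A" "obt d = B"
  shows "cp TT (Br (Br a b) (Br c d)) (Br (w A k) (w B l)) (k # l # ks) D ks ((n, Br b d, w B l) # (m, Br a c, w A k) # D)"
  unfolding tensor_mult_def by (rule cps igens cp_regroup | simp add: assms)+

lemma cp_tensor_mult_dagger:
  assumes "wkt a" "wkt b" "obt a = A" "obt b = B"
  shows "cp (TT\<dagger>) (Br a b) (Br (Br (w A k) (w B l)) (Br (w A k') (w B l'))) (k # k' # l # l' # ks) D ks
    ((n\<dagger>, b, Br (w B l) (w B l')) # (m\<dagger>, a, Br (w A k) (w A k')) # D)"
  unfolding tensor_mult_dagger by (rule cps igens cp_regroup | simp add: assms)+

lemma cp_tensor_unit: "cp UU Em (Br (w A k) (w B l)) (k # l # ks) D ks ((v, Em, w B l) # (u, Em, w A k) # D)"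
  unfolding tensor_unit_def by (rule cps igens | simp)+

lemma cp_tensor_unit_dagger:
  assumes "wkt a" "wkt b" "obt a = A" "obt b = B"
  shows "cp (UU\<dagger>) (Br a b) Em ks D ks ((v\<dagger>, b, Em) # (u\<dagger>, a, Em) # D)"
  unfolding tensor_unit_dagger by (rule cps igens | simp add: assms)+

lemma tensor_types: "TT \<in> Hom V ((A \<odot> B) \<odot> A \<odot> B) (A \<odot> B)" "UU \<in> Hom V \<I> (A \<odot> B)"
  using cp_Hom[OF cp_tensor_mult[of "w A 1" "w B 2" "w A 3" "w B 4" 5 6 "[]" "[]"]] cp_Hom[OF cp_tensor_unit[of 1 2 "[]" "[]"]] by simp_all

private lemmas tgens = cp_tensor_mult cp_tensor_mult_dagger cp_tensor_unit cp_tensor_unit_dagger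

text \<open>The unit laws of the two factors each end in an identity node of their own, so the
  identity of the product has to be split.\<close>

private lemma id_AB: "\<one>[A \<odot> B] = \<one>[A] \<otimes> \<one>[B]" by (simp add: tensor_ident)

text \<open>Regroupings and symmetries vanish in the nets, so each law is the law of
  \<open>A\<close> next to that of \<open>B\<close>. Wires of \<open>A\<close> have small numbers,
  those of \<open>B\<close> start at 21.\<close>

lemma tensor_dfa: "dagger_frobenius_algebra V (A \<odot> B) TT UU"
proof -
  note LA = dfaA and LB = dfaB
  have e0: "TT \<cdot> (TT \<otimes> \<one>[A \<odot> B]) = TT \<cdot> (\<one>[A \<odot> B] \<otimes> TT) \<cdot> \<a>[A \<odot> B, A \<odot> B, A \<odot> B]"
    apply (rule net_eq[where s = "Br (Br (Br (w A 1) (w B 21)) (Br (w A 2) (w B 22))) (Br (w A 3) (w B 23))" and t = "Br (w A 5) (w B 25)" and ks = "[4, 24, 5, 25]" and ls = "[6, 26, 5, 25]"])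
    apply ((rule cps tgens | (simp; fail))+)[1]
    apply ((rule cps tgens | (simp; fail))+)[1]
    apply (simp; fail)
    apply (simp; fail)
    apply (rule net_step[OF fr_assoc[OF LA, of 1 2 3 5 4 6]]; simp)
    apply (rule net_step[OF fr_assoc[OF LB, of 21 22 23 25 24 26]]; simp)
    by ((rule net_perm; simp)?)
  have e1: "TT \<cdot> (UU \<otimes> \<one>[A \<odot> B]) \<cdot> \<l>[A \<odot> B]\<dagger> = \<one>[A] \<otimes> \<one>[B]"
    apply (rule net_eq[where s = "Br (w A 1) (w B 21)" and t = "Br (w A 2) (w B 22)" and ks = "[3, 23, 2, 22]" and ls = "[2, 22]"])
    apply ((rule cps tgens | (simp; fail))+)[1]
    apply ((rule cp_tensor cp1[OF one_type] | (simp; fail))+)[1]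
    apply (simp; fail)
    apply (simp; fail)
    apply (rule net_step[OF fr_unl[OF LA, of 1 2 3]]; simp)
    apply (rule net_step[OF fr_unl[OF LB, of 21 22 23]]; simp)
    by ((rule net_perm; simp)?)
  have e2: "TT \<cdot> (\<one>[A \<odot> B] \<otimes> UU) \<cdot> \<r>[A \<odot> B]\<dagger> = \<one>[A] \<otimes> \<one>[B]"
    apply (rule net_eq[where s = "Br (w A 1) (w B 21)" and t = "Br (w A 2) (w B 22)" and ks = "[3, 23, 2, 22]" and ls = "[2, 22]"])
    apply ((rule cps tgens | (simp; fail))+)[1]
    apply ((rule cp_tensor cp1[OF one_type] | (simp; fail))+)[1]
    apply (simp; fail)
    apply (simp; fail)
    apply (rule net_step[OF fr_unr[OF LA, of 1 2 3]]; simp)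
    apply (rule net_step[OF fr_unr[OF LB, of 21 22 23]]; simp)
    by ((rule net_perm; simp)?)
  have e3: "\<a>[A \<odot> B, A \<odot> B, A \<odot> B] \<cdot> (TT\<dagger> \<otimes> \<one>[A \<odot> B]) \<cdot> TT\<dagger> = (\<one>[A \<odot> B] \<otimes> TT\<dagger>) \<cdot> TT\<dagger>"
    apply (rule net_eq[where s = "Br (w A 1) (w B 21)" and t = "Br (Br (w A 4) (w B 24)) (Br (Br (w A 5) (w B 25)) (Br (w A 3) (w B 23)))" and ks = "[2, 3, 22, 23, 4, 5, 24, 25]" and ls = "[4, 6, 24, 26, 5, 3, 25, 23]"])
    apply ((rule cps tgens | (simp; fail))+)[1]
    apply ((rule cps tgens | (simp; fail))+)[1]
    apply (simp; fail)
    apply (simp; fail)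
    apply (rule net_step[OF fr_coassoc[OF LA, of 4 5 3 1 2 6]]; simp)
    apply (rule net_step[OF fr_coassoc[OF LB, of 24 25 23 21 22 26]]; simp)
    by ((rule net_perm; simp)?)
  have e4: "\<l>[A \<odot> B] \<cdot> (UU\<dagger> \<otimes> \<one>[A \<odot> B]) \<cdot> TT\<dagger> = \<one>[A] \<otimes> \<one>[B]"
    apply (rule net_eq[where s = "Br (w A 1) (w B 21)" and t = "Br (w A 2) (w B 22)" and ks = "[3, 2, 23, 22]" and ls = "[2, 22]"])
    apply ((rule cps tgens | (simp; fail))+)[1]
    apply ((rule cp_tensor cp1[OF one_type] | (simp; fail))+)[1]
    apply (simp; fail)
    apply (simp; fail)
    apply (rule net_step[OF fr_counl[OF LA, of 1 2 3]]; simp)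
    apply (rule net_step[OF fr_counl[OF LB, of 21 22 23]]; simp)
    by ((rule net_perm; simp)?)
  have e5: "\<r>[A \<odot> B] \<cdot> (\<one>[A \<odot> B] \<otimes> UU\<dagger>) \<cdot> TT\<dagger> = \<one>[A] \<otimes> \<one>[B]"
    apply (rule net_eq[where s = "Br (w A 1) (w B 21)" and t = "Br (w A 2) (w B 22)" and ks = "[2, 3, 22, 23]" and ls = "[2, 22]"])
    apply ((rule cps tgens | (simp; fail))+)[1]
    apply ((rule cp_tensor cp1[OF one_type] | (simp; fail))+)[1]
    apply (simp; fail)
    apply (simp; fail)
    apply (rule net_step[OF fr_counr[OF LA, of 1 2 3]]; simp)
    apply (rule net_step[OF fr_counr[OF LB, of 21 22 23]]; simp)
    by ((rule net_perm; simp)?)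
  have e6: "(\<one>[A \<odot> B] \<otimes> TT) \<cdot> \<a>[A \<odot> B, A \<odot> B, A \<odot> B] \<cdot> (TT\<dagger> \<otimes> \<one>[A \<odot> B]) = TT\<dagger> \<cdot> TT"
    apply (rule net_eq[where s = "Br (Br (w A 1) (w B 21)) (Br (w A 2) (w B 22))" and t = "Br (Br (w A 3) (w B 23)) (Br (w A 5) (w B 25))" and ks = "[3, 4, 23, 24, 5, 25]" and ls = "[6, 26, 3, 5, 23, 25]"])
    apply ((rule cps tgens | (simp; fail))+)[1]
    apply ((rule cps tgens | (simp; fail))+)[1]
    apply (simp; fail)
    apply (simp; fail)
    apply (rule net_step[OF fr_frob1[OF LA, of 1 2 3 5 4 6]]; simp)
    apply (rule net_step[OF fr_frob1[OF LB, of 21 22 23 25 24 26]]; simp)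
    by ((rule net_perm; simp)?)
  have e7: "(TT \<otimes> \<one>[A \<odot> B]) \<cdot> \<a>[A \<odot> B, A \<odot> B, A \<odot> B]\<dagger> \<cdot> (\<one>[A \<odot> B] \<otimes> TT\<dagger>) = TT\<dagger> \<cdot> TT"
    apply (rule net_eq[where s = "Br (Br (w A 1) (w B 21)) (Br (w A 2) (w B 22))" and t = "Br (Br (w A 3) (w B 23)) (Br (w A 5) (w B 25))" and ks = "[4, 5, 24, 25, 3, 23]" and ls = "[6, 26, 3, 5, 23, 25]"])
    apply ((rule cps tgens | (simp; fail))+)[1]
    apply ((rule cps tgens | (simp; fail))+)[1]
    apply (simp; fail)
    apply (simp; fail)
    apply (rule net_step[OF fr_frob2[OF LA, of 1 2 3 5 4 6]]; simp)
    apply (rule net_step[OF fr_frob2[OF LB, of 21 22 23 25 24 26]]; simp)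
    by ((rule net_perm; simp)?)
  show ?thesis
    by (rule dfaI) (use e0 e1 e2 e3 e4 e5 e6 e7 tensor_types in \<open>simp_all add: id_AB\<close>)
qed

lemma tensor_sfa:
  assumes LA: "sfa A m u" and LB: "sfa B n v"
  shows "sfa (A \<odot> B) TT UU"
  unfolding sfa_def
proof (intro conjI tensor_dfa)
  show "UU\<dagger> \<cdot> TT \<cdot> \<s>[A \<odot> B, A \<odot> B] = UU\<dagger> \<cdot> TT"
    apply (rule net_eq[where s = "Br (Br (w A 1) (w B 21)) (Br (w A 2) (w B 22))" and t = "Em" and ks = "[3, 23]" and ls = "[3, 23]"])
    apply ((rule cps tgens | (simp; fail))+)[1]
    apply ((rule cps tgens | (simp; fail))+)[1]
    apply (simp; fail)
    apply (simp; fail)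
    apply (rule net_step[OF fr_sym[OF LA, of 2 1 3]]; simp)
    apply (rule net_step[OF fr_sym[OF LB, of 22 21 23]]; simp)
    by ((rule net_perm; simp)?)
qed

lemma posdef_tensor:
  assumes z: "positive_definite V A z" and y: "positive_definite V B y"
  shows "positive_definite V (A \<odot> B) (z \<otimes> y)"
proof -
  obtain X h where h: "X \<in> Obj V" "h \<in> Hom V A X" "z = h\<dagger> \<cdot> h" "z \<in> Hom V A A" using z unfolding positive_definite_def positive_def by auto
  obtain Y k where k: "Y \<in> Obj V" "k \<in> Hom V B Y" "y = k\<dagger> \<cdot> k" "y \<in> Hom V B B" using y unfolding positive_definite_def positive_def by auto
  have e: "z \<otimes> y = (h \<otimes> k)\<dagger> \<cdot> (h \<otimes> k)"
    using h k dagger_in_Hom[of A X h] dagger_in_Hom[of B Y k]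
    by (simp add: dagger_tensor[of A X B Y h k] tensor_comp[of A X A B Y B h "h\<dagger>" k "k\<dagger>"])
  have p: "positive V (A \<odot> B) (z \<otimes> y)" unfolding positive_def
    using h k e tensor_in_Hom[of A A B B z y] tensor_in_Hom[of A X B Y h k] by (auto intro!: bexI[of _ "X \<odot> Y"] bexI[of _ "h \<otimes> k"])
  obtain z' where z': "z' \<in> Hom V A A" "z' \<cdot> z = \<one>[A]" "z \<cdot> z' = \<one>[A]" using z unfolding positive_definite_def is_iso_def by auto
  obtain y' where y': "y' \<in> Hom V B B" "y' \<cdot> y = \<one>[B]" "y \<cdot> y' = \<one>[B]" using y unfolding positive_definite_def is_iso_def by auto
  have "is_iso V (A \<odot> B) (A \<odot> B) (z \<otimes> y)" unfolding is_iso_def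
  proof (intro conjI bexI[of _ "z' \<otimes> y'"])
    show "(z' \<otimes> y') \<cdot> (z \<otimes> y) = \<one>[A \<odot> B]" "(z \<otimes> y) \<cdot> (z' \<otimes> y') = \<one>[A \<odot> B]"
      using z' y' h k tensor_comp[of A A A B B B z z' y y'] tensor_comp[of A A A B B B z' z y' y] by (simp_all add: tensor_ident)
  qed (use z' y' h k tensor_in_Hom[of A A B B] in auto)
  with p show ?thesis unfolding positive_definite_def by simp
qed

lemma tensor_spec:
  assumes z: "spec A m z" and y: "spec B n y"
  shows "spec (A \<odot> B) TT (z \<otimes> y)"
  unfolding spec_def central_def
proof (intro conjI posdef_tensor)
  have cA: "central V A m z" and cB: "central V B n y" using z y unfolding spec_def by auto
  have [simp]: "z \<in> Hom V A A" "y \<in> Hom V B B" using cA cB unfolding central_def by auto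
  have sA: "m \<cdot> m\<dagger> \<cdot> z \<cdot> z = \<one>[A]" and sB: "n \<cdot> n\<dagger> \<cdot> y \<cdot> y = \<one>[B]" using z y unfolding spec_def by auto
  note zg = cp1[OF \<open>z \<in> Hom V A A\<close>] cp1[OF \<open>y \<in> Hom V B B\<close>]
  show "z \<otimes> y \<in> Hom V (A \<odot> B) (A \<odot> B)" by (rule tensor_in_Hom) simp_all
  show "TT \<cdot> ((z \<otimes> y) \<otimes> \<one>[A \<odot> B]) = (z \<otimes> y) \<cdot> TT"
    apply (rule net_eq[where s = "Br (Br (w A 1) (w B 21)) (Br (w A 2) (w B 22))" and t = "Br (w A 3) (w B 23)" and ks = "[4, 24, 3, 23]" and ls = "[5, 25, 3, 23]"])
    apply ((rule cps tgens zg | (simp; fail))+)[1]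
    apply ((rule cps tgens zg | (simp; fail))+)[1]
    apply (simp; fail)
    apply (simp; fail)
    apply (rule net_step[OF fr_cen1[OF dfaA cA, of 1 2 3 4 5]]; simp)
    apply (rule net_step[OF fr_cen1[OF dfaB cB, of 21 22 23 24 25]]; simp)
    by ((rule net_perm; simp)?)
  have "TT \<cdot> (\<one>[A \<odot> B] \<otimes> (z \<otimes> y)) = (z \<otimes> y) \<cdot> TT"
    apply (rule net_eq[where s = "Br (Br (w A 1) (w B 21)) (Br (w A 2) (w B 22))" and t = "Br (w A 3) (w B 23)" and ks = "[4, 24, 3, 23]" and ls = "[5, 25, 3, 23]"])
    apply ((rule cps tgens zg | (simp; fail))+)[1]
    apply ((rule cps tgens zg | (simp; fail))+)[1]
    apply (simp; fail)
    apply (simp; fail)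
    apply (rule net_step[OF fr_cen2[OF dfaA cA, of 1 2 3 4 5]]; simp)
    apply (rule net_step[OF fr_cen2[OF dfaB cB, of 21 22 23 24 25]]; simp)
    by ((rule net_perm; simp)?)
  then show "(z \<otimes> y) \<cdot> TT = TT \<cdot> (\<one>[A \<odot> B] \<otimes> (z \<otimes> y))" by (rule sym)
  have "TT \<cdot> TT\<dagger> \<cdot> (z \<otimes> y) \<cdot> (z \<otimes> y) = \<one>[A] \<otimes> \<one>[B]"
    apply (rule net_eq[where s = "Br (w A 1) (w B 21)" and t = "Br (w A 2) (w B 22)" and ks = "[3, 23, 4, 24, 5, 6, 25, 26, 2, 22]" and ls = "[2, 22]"])
    apply ((rule cps tgens zg | (simp; fail))+)[1]
    apply ((rule cp_tensor cp1[OF one_type] | (simp; fail))+)[1]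
    apply (simp; fail)
    apply (simp; fail)
    apply (rule net_step[OF fr_special[OF dfaA cA sA, of 1 2 3 4 5 6]]; simp)
    apply (rule net_step[OF fr_special[OF dfaB cB sB, of 21 22 23 24 25 26]]; simp)
    by ((rule net_perm; simp)?)
  then show "TT \<cdot> TT\<dagger> \<cdot> (z \<otimes> y) \<cdot> (z \<otimes> y) = \<one>[A \<odot> B]" by (simp add: id_AB)
qed (use z y spec_def in auto)

end

end

context dagger_compact
begin

context
  fixes A m u assumes dfa: "dagger_frobenius_algebra V A m u"
begin

private lemma tj [simp]: "A \<in> Obj V" "m \<in> Hom V (A \<odot> A) A" "u \<in> Hom V \<I> A" "m\<dagger> \<in> Hom V A (A \<odot> A)" "u\<dagger> \<in> Hom V A \<I>"
  using dfa_types[OF dfa] by auto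
private lemmas jgens = cp1[OF tj(2)] cp1[OF tj(3)] cp2[OF tj(4)] cp0[OF tj(5)]

section \<open>The opposite algebra\<close>

lemma opposite_dagger: "(m \<cdot> \<s>[A, A])\<dagger> = \<s>[A, A] \<cdot> m\<dagger>"
proof -
  define M where "M = Arr (A \<odot> A) m A"
  have [simp]: "arrow M" "dom M = A \<odot> A" "cod M = A" unfolding M_def by simp_all
  have "(m \<cdot> \<s>[A, A])\<dagger> = mor (dg (M \<bullet> sy A A))" by (simp add: mor_simps M_def del: dg_cmp)
  also have "\<dots> = mor (sy A A \<bullet> dg M)" by (simp add: sy_dg)
  finally show ?thesis by (simp add: mor_simps M_def)
qed

text \<open>Every law of \<open>m\<close> is read with its wires in reverse order: associativity and
  coassociativity are reversed, while the left and right unit laws, and likewise the two Frobenius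
  laws, are interchanged.\<close>

lemma opposite_dfa: "dagger_frobenius_algebra V A (m \<cdot> \<s>[A, A]) u"
proof (rule dfaI, unfold opposite_dagger)
  show "m \<cdot> \<s>[A, A] \<in> Hom V (A \<odot> A) A" using symmetry_in_Hom[of A A] comp_in_Hom[of "A \<odot> A" "A \<odot> A" A "\<s>[A, A]" m] by simp
  show "(m \<cdot> \<s>[A, A]) \<cdot> ((m \<cdot> \<s>[A, A]) \<otimes> \<one>[A]) = (m \<cdot> \<s>[A, A]) \<cdot> (\<one>[A] \<otimes> (m \<cdot> \<s>[A, A])) \<cdot> \<a>[A, A, A]"
    apply (rule net_eq[where s = "Br (Br (w A 1) (w A 2)) (w A 3)" and t = "w A 5" and ks = "[4, 5]" and ls = "[6, 5]"])
    apply ((rule cps jgens | (simp; fail))+)[1]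
    apply ((rule cps jgens | (simp; fail))+)[1]
    apply (simp; fail)
    apply (simp; fail)
    apply (rule net_step[OF fr_assoc[OF dfa, symmetric, of 3 2 1 5 6 4]]; simp)
    by ((rule net_perm; simp)?)
  show "(m \<cdot> \<s>[A, A]) \<cdot> (u \<otimes> \<one>[A]) \<cdot> \<l>[A]\<dagger> = \<one>[A]"
    apply (rule net_eq[where s = "w A 1" and t = "w A 2" and ks = "[3, 2]" and ls = "[2]"])
    apply ((rule cps jgens | (simp; fail))+)[1]
    apply ((rule cp1[OF one_type] | (simp; fail))+)[1]
    apply (simp; fail)
    apply (simp; fail)
    apply (rule net_step[OF fr_unr[OF dfa, of 1 2 3]]; simp)
    by ((rule net_perm; simp)?)
  show "(m \<cdot> \<s>[A, A]) \<cdot> (\<one>[A] \<otimes> u) \<cdot> \<r>[A]\<dagger> = \<one>[A]"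
    apply (rule net_eq[where s = "w A 1" and t = "w A 2" and ks = "[3, 2]" and ls = "[2]"])
    apply ((rule cps jgens | (simp; fail))+)[1]
    apply ((rule cp1[OF one_type] | (simp; fail))+)[1]
    apply (simp; fail)
    apply (simp; fail)
    apply (rule net_step[OF fr_unl[OF dfa, of 1 2 3]]; simp)
    by ((rule net_perm; simp)?)
  show "\<a>[A, A, A] \<cdot> ((\<s>[A, A] \<cdot> m\<dagger>) \<otimes> \<one>[A]) \<cdot> \<s>[A, A] \<cdot> m\<dagger> = (\<one>[A] \<otimes> (\<s>[A, A] \<cdot> m\<dagger>)) \<cdot> \<s>[A, A] \<cdot> m\<dagger>"
    apply (rule net_eq[where s = "w A 1" and t = "Br (w A 4) (Br (w A 5) (w A 3))" and ks = "[3, 2, 5, 4]" and ls = "[6, 4, 3, 5]"])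
    apply ((rule cps jgens | (simp; fail))+)[1]
    apply ((rule cps jgens | (simp; fail))+)[1]
    apply (simp; fail)
    apply (simp; fail)
    apply (rule net_step[OF fr_coassoc[OF dfa, symmetric, of 3 5 4 1 6 2]]; simp)
    by ((rule net_perm; simp)?)
  show "\<l>[A] \<cdot> (u\<dagger> \<otimes> \<one>[A]) \<cdot> \<s>[A, A] \<cdot> m\<dagger> = \<one>[A]"
    apply (rule net_eq[where s = "w A 1" and t = "w A 2" and ks = "[2, 3]" and ls = "[2]"])
    apply ((rule cps jgens | (simp; fail))+)[1]
    apply ((rule cp1[OF one_type] | (simp; fail))+)[1]
    apply (simp; fail)
    apply (simp; fail)
    apply (rule net_step[OF fr_counr[OF dfa, of 1 2 3]]; simp)
    by ((rule net_perm; simp)?)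
  show "\<r>[A] \<cdot> (\<one>[A] \<otimes> u\<dagger>) \<cdot> \<s>[A, A] \<cdot> m\<dagger> = \<one>[A]"
    apply (rule net_eq[where s = "w A 1" and t = "w A 2" and ks = "[3, 2]" and ls = "[2]"])
    apply ((rule cps jgens | (simp; fail))+)[1]
    apply ((rule cp1[OF one_type] | (simp; fail))+)[1]
    apply (simp; fail)
    apply (simp; fail)
    apply (rule net_step[OF fr_counl[OF dfa, of 1 2 3]]; simp)
    by ((rule net_perm; simp)?)
  show "(\<one>[A] \<otimes> (m \<cdot> \<s>[A, A])) \<cdot> \<a>[A, A, A] \<cdot> ((\<s>[A, A] \<cdot> m\<dagger>) \<otimes> \<one>[A]) = (\<s>[A, A] \<cdot> m\<dagger>) \<cdot> m \<cdot> \<s>[A, A]"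
    apply (rule net_eq[where s = "Br (w A 1) (w A 2)" and t = "Br (w A 3) (w A 5)" and ks = "[4, 3, 5]" and ls = "[6, 5, 3]"])
    apply ((rule cps jgens | (simp; fail))+)[1]
    apply ((rule cps jgens | (simp; fail))+)[1]
    apply (simp; fail)
    apply (simp; fail)
    apply (rule net_step[OF fr_frob2[OF dfa, of 2 1 5 3 4 6]]; simp)
    by ((rule net_perm; simp)?)
  show "((m \<cdot> \<s>[A, A]) \<otimes> \<one>[A]) \<cdot> \<a>[A, A, A]\<dagger> \<cdot> (\<one>[A] \<otimes> (\<s>[A, A] \<cdot> m\<dagger>)) = (\<s>[A, A] \<cdot> m\<dagger>) \<cdot> m \<cdot> \<s>[A, A]"
    apply (rule net_eq[where s = "Br (w A 1) (w A 2)" and t = "Br (w A 3) (w A 5)" and ks = "[5, 4, 3]" and ls = "[6, 5, 3]"])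
    apply ((rule cps jgens | (simp; fail))+)[1]
    apply ((rule cps jgens | (simp; fail))+)[1]
    apply (simp; fail)
    apply (simp; fail)
    apply (rule net_step[OF fr_frob1[OF dfa, of 2 1 5 3 4 6]]; simp)
    by ((rule net_perm; simp)?)
qed simp_all

lemma opposite_sfa: assumes s: "sfa A m u" shows "sfa A (m \<cdot> \<s>[A, A]) u"
  unfolding sfa_def
proof (intro conjI opposite_dfa)
  show "u\<dagger> \<cdot> (m \<cdot> \<s>[A, A]) \<cdot> \<s>[A, A] = u\<dagger> \<cdot> m \<cdot> \<s>[A, A]"
    apply (rule net_eq[where s = "Br (w A 1) (w A 2)" and t = "Em" and ks = "[3]" and ls = "[3]"])
    apply ((rule cps jgens | (simp; fail))+)[1]
    apply ((rule cps jgens | (simp; fail))+)[1]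
    apply (simp; fail)
    apply (simp; fail)
    apply (rule net_step[OF fr_sym[OF s, of 1 2 3]]; simp)
    by ((rule net_perm; simp)?)
qed

lemma opposite_spec: assumes z: "spec A m z" shows "spec A (m \<cdot> \<s>[A, A]) z"
  unfolding spec_def central_def opposite_dagger
proof (intro conjI)
  have c: "central V A m z" and sp: "m \<cdot> m\<dagger> \<cdot> z \<cdot> z = \<one>[A]" using z unfolding spec_def by auto
  show zz [simp]: "z \<in> Hom V A A" using c unfolding central_def by auto
  show "positive_definite V A z" using z unfolding spec_def by auto
  note zg = jgens cp1[OF zz]
  show "(m \<cdot> \<s>[A, A]) \<cdot> (z \<otimes> \<one>[A]) = z \<cdot> m \<cdot> \<s>[A, A]"
    apply (rule net_eq[where s = "Br (w A 1) (w A 2)" and t = "w A 3" and ks = "[4, 3]" and ls = "[5, 3]"])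
    apply ((rule cps zg | (simp; fail))+)[1]
    apply ((rule cps zg | (simp; fail))+)[1]
    apply (simp; fail)
    apply (simp; fail)
    apply (rule net_step[OF fr_cen2[OF dfa c, of 2 1 3 4 5]]; simp)
    by ((rule net_perm; simp)?)
  have "(m \<cdot> \<s>[A, A]) \<cdot> (\<one>[A] \<otimes> z) = z \<cdot> m \<cdot> \<s>[A, A]"
    apply (rule net_eq[where s = "Br (w A 1) (w A 2)" and t = "w A 3" and ks = "[4, 3]" and ls = "[5, 3]"])
    apply ((rule cps zg | (simp; fail))+)[1]
    apply ((rule cps zg | (simp; fail))+)[1]
    apply (simp; fail)
    apply (simp; fail)
    apply (rule net_step[OF fr_cen1[OF dfa c, of 2 1 3 4 5]]; simp)
    by ((rule net_perm; simp)?)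
  then show "z \<cdot> m \<cdot> \<s>[A, A] = (m \<cdot> \<s>[A, A]) \<cdot> (\<one>[A] \<otimes> z)" by (rule sym)
  show "(m \<cdot> \<s>[A, A]) \<cdot> (\<s>[A, A] \<cdot> m\<dagger>) \<cdot> z \<cdot> z = \<one>[A]"
    apply (rule net_eq[where s = "w A 1" and t = "w A 2" and ks = "[3, 4, 5, 6, 2]" and ls = "[2]"])
    apply ((rule cps zg | (simp; fail))+)[1]
    apply ((rule cp1[OF one_type] | (simp; fail))+)[1]
    apply (simp; fail)
    apply (simp; fail)
    apply (rule net_step[OF fr_special[OF dfa c sp, of 1 2 3 4 5 6]]; simp)
    by ((rule net_perm; simp)?)
qed

end

text \<open>A form of the coherence theorem: morphisms that compile to the empty net with the same
  boundary trees are equal.\<close>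

lemma nil_eq: "cp f s t [] [] [] [] \<Longrightarrow> cp g s t [] [] [] [] \<Longrightarrow> distinct (lvs s) \<Longrightarrow> f = g"
  by (rule net_eq[where ks = "[]" and ls = "[]" and ks' = "[]" and ls' = "[]" and D = "[]" and E = "[]"]) simp_all

section \<open>The tensor unit as an algebra\<close>

lemma unit_sfa: "sfa \<I> \<l>[\<I>] \<one>[\<I>]"
proof -
  let ?l = "\<l>[\<I>]" let ?i = "\<one>[\<I>]"
  have i: "?i\<dagger> = ?i" by (simp add: dagger_ident)
  have l: "?l \<in> Hom V (\<I> \<odot> \<I>) \<I>" using arrow_lu[of \<I>] unfolding arrow_def by (simp add: mor_simps)
  have "dagger_frobenius_algebra V \<I> ?l ?i"
  proof (rule dfaI, unfold i)
    show "?l \<cdot> (?l \<otimes> ?i) = ?l \<cdot> (?i \<otimes> ?l) \<cdot> \<a>[\<I>, \<I>, \<I>]" by (rule nil_eq[where s = "Br (Br Em Em) Em" and t = "Em"]) (rule cps | simp)+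
    show "?l \<cdot> (?i \<otimes> ?i) \<cdot> \<l>[\<I>]\<dagger> = ?i" by (rule nil_eq[where s = "Em" and t = "Em"]) (rule cps | simp)+
    show "?l \<cdot> (?i \<otimes> ?i) \<cdot> \<r>[\<I>]\<dagger> = ?i" by (rule nil_eq[where s = "Em" and t = "Em"]) (rule cps | simp)+
    show "\<a>[\<I>, \<I>, \<I>] \<cdot> (?l\<dagger> \<otimes> ?i) \<cdot> ?l\<dagger> = (?i \<otimes> ?l\<dagger>) \<cdot> ?l\<dagger>" by (rule nil_eq[where s = "Em" and t = "Br Em (Br Em Em)"]) (rule cps | simp)+
    show "\<l>[\<I>] \<cdot> (?i \<otimes> ?i) \<cdot> ?l\<dagger> = ?i" by (rule nil_eq[where s = "Em" and t = "Em"]) (rule cps | simp)+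
    show "\<r>[\<I>] \<cdot> (?i \<otimes> ?i) \<cdot> ?l\<dagger> = ?i" by (rule nil_eq[where s = "Em" and t = "Em"]) (rule cps | simp)+
    show "(?i \<otimes> ?l) \<cdot> \<a>[\<I>, \<I>, \<I>] \<cdot> (?l\<dagger> \<otimes> ?i) = ?l\<dagger> \<cdot> ?l" by (rule nil_eq[where s = "Br Em Em" and t = "Br Em Em"]) (rule cps | simp)+
    show "(?l \<otimes> ?i) \<cdot> \<a>[\<I>, \<I>, \<I>]\<dagger> \<cdot> (?i \<otimes> ?l\<dagger>) = ?l\<dagger> \<cdot> ?l" by (rule nil_eq[where s = "Br Em Em" and t = "Br Em Em"]) (rule cps | simp)+
  qed (simp_all add: l)
  moreover have "?i \<cdot> ?l \<cdot> \<s>[\<I>, \<I>] = ?i \<cdot> ?l"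
    by (rule nil_eq[where s = "Br Em Em" and t = Em]) (rule cps | simp)+
  ultimately show ?thesis unfolding sfa_def by (simp add: i)
qed

lemma unit_spec: "spec \<I> \<l>[\<I>] \<one>[\<I>]"
proof -
  have ii: "\<one>[\<I>] \<cdot> \<one>[\<I>] = \<one>[\<I>]" by (rule ident_comp[of \<I> \<I>]) simp_all
  have "positive_definite V \<I> \<one>[\<I>]"
    unfolding positive_definite_def positive_def is_iso_def
    by (intro conjI bexI[of _ "\<I>"] bexI[of _ "\<one>[\<I>]"]) (simp_all add: dagger_ident ii)
  moreover have "\<l>[\<I>] \<cdot> (\<one>[\<I>] \<otimes> \<one>[\<I>]) = \<one>[\<I>] \<cdot> \<l>[\<I>]"
    by (rule nil_eq[where s = "Br Em Em" and t = Em]) (rule cps | simp)+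
  moreover have "\<l>[\<I>] \<cdot> \<l>[\<I>]\<dagger> \<cdot> \<one>[\<I>] \<cdot> \<one>[\<I>] = \<one>[\<I>]"
    by (rule nil_eq[where s = Em and t = Em]) (rule cps | simp)+
  ultimately show ?thesis unfolding spec_def central_def by simp
qed

section \<open>Complete positivity as positivity\<close>

text \<open>The two outer legs of the CP*-condition live on \<open>A\<^sup>\<star>\<close> and \<open>B\<^sup>\<star>\<close>. Bending them with
the Frobenius forms yields an endomorphism of \<open>A \<odot> B\<close>, and the condition says that it is
positive.\<close>

definition Hm :: "'o \<Rightarrow> 'm \<Rightarrow> 'o \<Rightarrow> 'm \<Rightarrow> 'm \<Rightarrow> 'm" where
  "Hm A m B n f = (\<one>[A] \<otimes> n) \<cdot> \<a>[A, B, B] \<cdot> ((\<one>[A] \<otimes> f) \<otimes> \<one>[B]) \<cdot> (m\<dagger> \<otimes> \<one>[B])"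

context
  fixes A m u B n v f assumes sA: "sfa A m u" and sB: "sfa B n v" and f: "f \<in> Hom V A B"
begin

private lemma tk [simp]: "A \<in> Obj V" "m \<in> Hom V (A \<odot> A) A" "u \<in> Hom V \<I> A" "m\<dagger> \<in> Hom V A (A \<odot> A)" "u\<dagger> \<in> Hom V A \<I>"
  "B \<in> Obj V" "n \<in> Hom V (B \<odot> B) B" "v \<in> Hom V \<I> B" "n\<dagger> \<in> Hom V B (B \<odot> B)" "v\<dagger> \<in> Hom V B \<I>" "f \<in> Hom V A B"
  using dfa_types[OF sfa_dfa[OF sA]] dfa_types[OF sfa_dfa[OF sB]] f by auto
private lemmas kgens = cp1[OF tk(2)] cp1[OF tk(3)] cp2[OF tk(4)] cp0[OF tk(5)] cp1[OF tk(7)] cp1[OF tk(8)] cp2[OF tk(9)] cp0[OF tk(10)]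
  cp1[OF f] cp2[OF eta_types(1)] cp0[OF eta_types(2)]

text \<open>The CP*-condition with the legs on \<open>A\<^sup>\<star>\<close> and
  \<open>B\<^sup>\<star>\<close> straightened by the duality of \<open>V\<close>. The two legs on
  \<open>B\<close> still cross: the input enters \<open>g\<dagger>\<close> and the output leaves
  \<open>g\<close>, which is why the multiplication of \<open>B\<close> appears reversed.\<close>

definition KK :: "'o \<Rightarrow> 'm \<Rightarrow> bool" where
  "KK X g \<longleftrightarrow> Hm A m B (n \<cdot> \<s>[B, B]) f =
     (g\<dagger> \<otimes> \<one>[B]) \<cdot> \<a>[X, B, B]\<dagger> \<cdot> (\<one>[X] \<otimes> \<s>[B, B]) \<cdot> \<a>[X, B, B] \<cdot> (g \<otimes> \<one>[B])"

text \<open>Only yanking is involved; no law of the algebras is used, just the duals of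
  \<open>A\<close>, \<open>B\<close> and \<open>X\<close>.\<close>

lemma KK_iff:
  assumes X [simp]: "X \<in> Obj V" and g [simp]: "g \<in> Hom V A (X \<odot> B)"
  shows "act V dual \<eta> B n \<cdot> f \<cdot> coact V dual \<eta> A m =
       (\<one>[B\<^sup>\<star>] \<otimes> (\<l>[B] \<cdot> ((\<eta> X)\<dagger> \<otimes> \<one>[B]))) \<cdot> regroup V B\<^sup>\<star> X\<^sup>\<star> X B \<cdot> (conj_map V dual \<eta> \<epsilon> A X B g \<otimes> g)
     \<longleftrightarrow> KK X g"
proof
  have g' [simp]: "g\<dagger> \<in> Hom V (X \<odot> B) A" using dagger_in_Hom[of A "X \<odot> B" g] by simp
  note gg = cp2[OF g] cp1[OF g'] kgens
  note defs = act_def coact_def conj_map_def dual_map_def eta_tensor_def eps_eta[OF tk(1)]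
  {
    assume K: "KK X g"
    have L: "den [n21 B n 8 7 4, n11 A B f 6 7, n12 A m 2 5 6] = den [(g\<dagger>, Br (w X 13) (w B 8), w A 5), (g, w A 2, Br (w X 13) (w B 4))]"
      by (rule law[OF K[unfolded KK_def Hm_def], where s = "Br (w A 2) (w B 8)" and t = "Br (w A 5) (w B 4)" and ks = "[5, 6, 7, 4]" and ls = "[13, 4, 5]"])
        ((rule cps gg | (simp; fail))+)
    show "act V dual \<eta> B n \<cdot> f \<cdot> coact V dual \<eta> A m =
       (\<one>[B\<^sup>\<star>] \<otimes> (\<l>[B] \<cdot> ((\<eta> X)\<dagger> \<otimes> \<one>[B]))) \<cdot> regroup V B\<^sup>\<star> X\<^sup>\<star> X B \<cdot> (conj_map V dual \<eta> \<epsilon> A X B g \<otimes> g)"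
      unfolding defs
      apply (rule net_eq[where s = "Br (w (A\<^sup>\<star>) 1) (w A 2)" and t = "Br (w (B\<^sup>\<star>) 3) (w B 4)" and ks = "[5, 6, 7, 3, 8, 4]" and ls = "[3, 8, 10, 11, 5, 13, 4]"])
      apply ((rule cps gg | (simp; fail))+)[1]
      apply ((rule cps gg cp_regroup | (simp; fail))+)[1]
      apply (simp; fail)
      apply (simp; fail)
      apply (rule net_step[OF L]; simp)
      apply (rule sym)
      apply (rule net_step[OF yank[of X 13 11 10]]; simp)
      apply (rule id_in[where A = X and i = 13 and j = 11]; simp)
      by ((rule net_perm; simp)?)
  next
    assume E: "act V dual \<eta> B n \<cdot> f \<cdot> coact V dual \<eta> A m =
       (\<one>[B\<^sup>\<star>] \<otimes> (\<l>[B] \<cdot> ((\<eta> X)\<dagger> \<otimes> \<one>[B]))) \<cdot> regroup V B\<^sup>\<star> X\<^sup>\<star> X B \<cdot> (conj_map V dual \<eta> \<epsilon> A X B g \<otimes> g)"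
    have L: "den [n21 B n 12 6 4, cup B 22 12, n11 A B f 5 6, cap A 21 13, n12 A m 1 13 5]
        = den [cap X 10 7, (g, w A 1, Br (w X 7) (w B 4)), cap A 21 23, (g\<dagger>, Br (w X 11) (w B 9), w A 23), cup X 10 11, cup B 22 9]"
      by (rule law[OF E[unfolded defs], where s = "Br (w (A\<^sup>\<star>) 21) (w A 1)" and t = "Br (w (B\<^sup>\<star>) 22) (w B 4)" and ks = "[13, 5, 6, 22, 12, 4]" and ls = "[22, 9, 10, 11, 23, 7, 4]"])
        ((rule cps gg cp_regroup | (simp; fail))+)
    \<comment> \<open>The two identity nodes are inserted in order to be opened into cups and caps,
      which recreates the bent legs occurring in \<open>L\<close>.\<close>
    let ?Z = "[n12 A m 1 13 5, n11 A B f 5 6, n21 B n 12 6 4, idn A 13 3, idn B 2 12]"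
    have "den ?Z = den [n21 B n 2 6 4, n11 A B f 5 6, n12 A m 1 3 5]"
      apply (rule id_out[where A = A and i = 13 and j = 3]; simp)
      apply (rule id_in[where A = B and i = 2 and j = 12]; simp)
      by ((rule net_perm; simp)?)
    moreover have "den ?Z = den [(g\<dagger>, Br (w X 7) (w B 2), w A 3), (g, w A 1, Br (w X 7) (w B 4))]"
      apply (rule net_step[OF yank[symmetric, of A 13 3 21]]; simp)
      apply (rule net_step[OF yank[symmetric, of B 2 12 22]]; simp)
      apply (rule net_step[OF L]; simp)
      apply (rule net_step[OF yank[of X 7 11 10]]; simp)
      apply (rule id_in[where A = X and i = 7 and j = 11]; simp)
      apply (rule net_step[OF yank[of A 23 3 21]]; simp)
      apply (rule id_out[where A = A and i = 23 and j = 3]; simp)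
      apply (rule net_step[OF yank[of B 2 9 22]]; simp)
      apply (rule id_in[where A = B and i = 2 and j = 9]; simp)
      by ((rule net_perm; simp)?)
    ultimately have "den [n21 B n 2 6 4, n11 A B f 5 6, n12 A m 1 3 5] = den [(g\<dagger>, Br (w X 7) (w B 2), w A 3), (g, w A 1, Br (w X 7) (w B 4))]" by simp
    then show "KK X g" unfolding KK_def Hm_def
      by (intro net_eq[where s = "Br (w A 1) (w B 2)" and t = "Br (w A 3) (w B 4)" and ks = "[3, 5, 6, 4]" and ls = "[7, 4, 3]"])
        (rule cps gg | simp)+
  }
qed

text \<open>Turning the crossed legs on \<open>B\<close> round with form and coform makes the two
  halves adjoint to each other. Associativity and symmetry of the form convert the reversed
  multiplication into \<open>n\<close>.\<close>

lemma KK_imp_positive: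
  assumes X [simp]: "X \<in> Obj V" and g [simp]: "g \<in> Hom V A (X \<odot> B)" and K: "KK X g"
  shows "\<exists>k\<in>Hom V (A \<odot> B) X. Hm A m B n f = k\<dagger> \<cdot> k"
proof
  have g' [simp]: "g\<dagger> \<in> Hom V (X \<odot> B) A" using dagger_in_Hom[of A "X \<odot> B" g] by simp
  note gg = cp2[OF g] cp1[OF g'] kgens
  \<comment> \<open>The output leg of \<open>g\<close> on \<open>B\<close> is bent down by the
    Frobenius form and becomes an input.\<close>
  define k where "k = \<r>[X] \<cdot> (\<one>[X] \<otimes> (v\<dagger> \<cdot> n)) \<cdot> \<a>[X, B, B] \<cdot> (g \<otimes> \<one>[B])"
  have kd: "k\<dagger> = (g\<dagger> \<otimes> \<one>[B]) \<cdot> \<a>[X, B, B]\<dagger> \<cdot> (\<one>[X] \<otimes> (n\<dagger> \<cdot> v)) \<cdot> \<r>[X]\<dagger>"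
  proof -
    define G where "G = Arr A g (X \<odot> B)"
    define N where "N = Arr (B \<odot> B) n B"
    define U where "U = Arr \<I> v B"
    have [simp]: "arrow G" "dom G = A" "cod G = X \<odot> B" "arrow N" "dom N = B \<odot> B" "cod N = B" "arrow U" "dom U = \<I>" "cod U = B"
      unfolding G_def N_def U_def by simp_all
    have "k\<dagger> = mor (dg (ru X \<bullet> (ida X \<boxtimes> (dg U \<bullet> N)) \<bullet> al X B B \<bullet> (G \<boxtimes> ida B)))"
      by (simp add: k_def mor_simps G_def N_def U_def del: dg_cmp dg_tns dg_dg)
    also have "\<dots> = mor ((dg G \<boxtimes> ida B) \<bullet> dg (al X B B) \<bullet> (ida X \<boxtimes> (dg N \<bullet> U)) \<bullet> dg (ru X))" by simp
    finally show ?thesis by (simp add: mor_simps G_def N_def U_def)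
  qed
  have "cp k (Br (w A 1) (w B 2)) (w X 7) [7, 8, 9] [] [] [n10 B v 9, n21 B n 8 2 9, (g, w A 1, Br (w X 7) (w B 8))]"
    unfolding k_def by (rule cps gg | (simp; fail))+
  from cp_Hom[OF this] show kH: "k \<in> Hom V (A \<odot> B) X" by simp
  have L: "den [n21 B n 11 6 8, n11 A B f 5 6, n12 A m 1 3 5] = den [(g\<dagger>, Br (w X 7) (w B 11), w A 3), (g, w A 1, Br (w X 7) (w B 8))]"
    by (rule law[OF K[unfolded KK_def Hm_def], where s = "Br (w A 1) (w B 11)" and t = "Br (w A 3) (w B 8)" and ks = "[3, 5, 6, 8]" and ls = "[7, 8, 3]"])
      ((rule cps gg | (simp; fail))+)
  show "Hm A m B n f = k\<dagger> \<cdot> k" unfolding Hm_def kd unfolding k_def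
    apply (rule net_eq[where s = "Br (w A 1) (w B 2)" and t = "Br (w A 3) (w B 4)" and ks = "[3, 5, 6, 4]" and ls = "[7, 8, 9, 10, 11, 4, 3]"])
    apply ((rule cps gg | (simp; fail))+)[1]
    apply ((rule cps gg | (simp; fail))+)[1]
    apply (simp; fail)
    apply (simp; fail)
    apply (rule sym)
    apply (rule net_step[OF L[symmetric]]; simp)
    apply (rule net_step[OF fr_assoc[OF sfa_dfa[OF sB], of 11 6 2 9 8 12]]; simp)
    apply (rule net_step[OF fr_sym[OF sB, of 11 12 9]]; simp)
    apply (rule net_step[OF fr_snake2[OF sfa_dfa[OF sB], of 4 12 10 11 9]]; simp)
    apply (rule id_out[where A = B and i = 12 and j = 4]; simp)
    by ((rule net_perm; simp)?)
qed

text \<open>The bending of \<open>KK_imp_positive\<close> in the opposite direction, undone by the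
  same Frobenius snake.\<close>

lemma positive_imp_KK:
  assumes X [simp]: "X \<in> Obj V" and k [simp]: "k \<in> Hom V (A \<odot> B) X" and H: "Hm A m B n f = k\<dagger> \<cdot> k"
  shows "\<exists>g\<in>Hom V A (X \<odot> B). KK X g"
proof
  have k' [simp]: "k\<dagger> \<in> Hom V X (A \<odot> B)" using dagger_in_Hom[of "A \<odot> B" X k] by simp
  note gg = cp1[OF k] cp2[OF k'] kgens
  \<comment> \<open>The input of \<open>k\<close> on \<open>B\<close> is bent up by the coform and
    becomes an output.\<close>
  define g where "g = (k \<otimes> \<one>[B]) \<cdot> \<a>[A, B, B]\<dagger> \<cdot> (\<one>[A] \<otimes> (n\<dagger> \<cdot> v)) \<cdot> \<r>[A]\<dagger>"
  have gd: "g\<dagger> = \<r>[A] \<cdot> (\<one>[A] \<otimes> (v\<dagger> \<cdot> n)) \<cdot> \<a>[A, B, B] \<cdot> (k\<dagger> \<otimes> \<one>[B])"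
  proof -
    define G where "G = Arr (A \<odot> B) k X"
    define N where "N = Arr (B \<odot> B) n B"
    define U where "U = Arr \<I> v B"
    have [simp]: "arrow G" "dom G = A \<odot> B" "cod G = X" "arrow N" "dom N = B \<odot> B" "cod N = B" "arrow U" "dom U = \<I>" "cod U = B"
      unfolding G_def N_def U_def by simp_all
    have "g\<dagger> = mor (dg ((G \<boxtimes> ida B) \<bullet> dg (al A B B) \<bullet> (ida A \<boxtimes> (dg N \<bullet> U)) \<bullet> dg (ru A)))"
      by (simp add: g_def mor_simps G_def N_def U_def del: dg_cmp dg_tns dg_dg)
    also have "\<dots> = mor (ru A \<bullet> (ida A \<boxtimes> (dg U \<bullet> N)) \<bullet> al A B B \<bullet> (dg G \<boxtimes> ida B))" by simp
    finally show ?thesis by (simp add: mor_simps G_def N_def U_def)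
  qed
  have "cp g (w A 1) (Br (w X 7) (w B 4)) [8, 9, 4, 7] [] [] [(k, Br (w A 1) (w B 9), w X 7), n12 B n 8 9 4, n01 B v 8]"
    unfolding g_def by (rule cps gg | (simp; fail))+
  from cp_Hom[OF this] show "g \<in> Hom V A (X \<odot> B)" by simp
  have L: "den [n21 B n 6 9 10, n11 A B f 5 6, n12 A m 1 3 5] = den [(k\<dagger>, w X 7, Br (w A 3) (w B 10)), (k, Br (w A 1) (w B 9), w X 7)]"
    by (rule law[OF H[unfolded Hm_def], where s = "Br (w A 1) (w B 9)" and t = "Br (w A 3) (w B 10)" and ks = "[3, 5, 6, 10]" and ls = "[7, 3, 10]"])
      ((rule cps gg | (simp; fail))+)
  show "KK X g" unfolding KK_def Hm_def gd unfolding g_def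
    apply (rule net_eq[where s = "Br (w A 1) (w B 2)" and t = "Br (w A 3) (w B 4)" and ks = "[3, 5, 6, 4]" and ls = "[8, 9, 4, 7, 3, 10, 11]"])
    apply ((rule cps gg | (simp; fail))+)[1]
    apply ((rule cps gg | (simp; fail))+)[1]
    apply (simp; fail)
    apply (simp; fail)
    apply (rule sym)
    apply (rule net_step[OF L[symmetric]]; simp)
    apply (rule net_step[OF fr_sym[OF sB, of 10 2 11]]; simp)
    apply (rule net_step[OF fr_assoc[OF sfa_dfa[OF sB], symmetric, of 2 6 9 11 12 10]]; simp)
    apply (rule net_step[OF fr_snake2[OF sfa_dfa[OF sB], of 4 12 8 9 11]]; simp)
    apply (rule id_out[where A = B and i = 12 and j = 4]; simp)
    by ((rule net_perm; simp)?)
qed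

lemma cp_condition_iff: "cp_condition V dual \<eta> \<epsilon> A m B n f \<longleftrightarrow> (\<exists>X\<in>Obj V. \<exists>k\<in>Hom V (A \<odot> B) X. Hm A m B n f = k\<dagger> \<cdot> k)"
  unfolding cp_condition_def using KK_iff KK_imp_positive positive_imp_KK by blast

end

end

context dagger_compact
begin

section \<open>Closure properties of completely positive maps\<close>

abbreviation "cpc \<equiv> cp_condition V dual \<eta> \<epsilon>"

lemma cpcI:
  assumes "sfa A m u" "sfa B n v" "f \<in> Hom V A B" "X \<in> Obj V" "k \<in> Hom V (A \<odot> B) X" "Hm A m B n f = k\<dagger> \<cdot> k"
  shows "cpc A m B n f"
  using cp_condition_iff[OF assms(1-3)] assms(4-6) by blast

lemma cpcE:
  assumes "cpc A m B n f" "sfa A m u" "sfa B n v" "f \<in> Hom V A B"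
  obtains X k where "X \<in> Obj V" "k \<in> Hom V (A \<odot> B) X" "Hm A m B n f = k\<dagger> \<cdot> k"
  using cp_condition_iff[OF assms(2-4)] assms(1) by blast

section \<open>Closure under multiplicative unitaries, daggers, composition and tensor\<close>

lemma fr_iso:
  assumes "f \<in> Hom V A B" "f\<dagger> \<cdot> f = \<one>[A]" "A \<in> Obj V" "B \<in> Obj V" "distinct [i, j, k]"
  shows "den [(f\<dagger>, w B j, w A k), (f, w A i, w B j)] = den [idn A i k]"
proof -
  have "f\<dagger> \<in> Hom V B A" using assms dagger_in_Hom by blast
  note g = cp1[OF assms(1)] cp1[OF this]
  show ?thesis
    by (rule law[OF assms(2), where s = "w A i" and t = "w A k" and ks = "[j, k]" and ls = "[k]"],
      (rule cps g | (simp add: assms(3,4); fail))+, (rule cp1[OF one_type] | simp add: assms(3,4))+, use assms(5) in auto)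
qed

text \<open>With \<open>n \<cdot> (f \<otimes> \<one>[B])\<close> as witness, the Frobenius law
  splits \<open>n\<dagger> \<cdot> n\<close>; then \<open>f\<close> passes through the
  comultiplication and meets \<open>f\<dagger>\<close>. All coherence isomorphisms and identities
  are covered by this lemma.\<close>

lemma cpc_unitary:
  assumes sA: "sfa A m u" and sB: "sfa B n v" and un: "is_unitary V A B f" and hom: "f \<cdot> m = n \<cdot> (f \<otimes> f)"
  shows "cpc A m B n f"
proof (rule cpcI[OF sA sB])
  note [simp] = dfa_types[OF sfa_dfa[OF sA]] dfa_types[OF sfa_dfa[OF sB]]
  have f [simp]: "f \<in> Hom V A B" and ff: "f\<dagger> \<cdot> f = \<one>[A]" "f \<cdot> f\<dagger> = \<one>[B]" using un unfolding is_unitary_def by auto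
  have f' [simp]: "f\<dagger> \<in> Hom V B A" using dagger_in_Hom[of A B f] by simp
  \<comment> \<open>The dagger of \<open>hom\<close>, conjugated by the unitary \<open>f\<close>: a
    unitary that respects multiplication also respects comultiplication.\<close>
  have com: "n\<dagger> \<cdot> f = (f \<otimes> f) \<cdot> m\<dagger>"
  proof -
    define M where "M = Arr (A \<odot> A) m A"
    define N where "N = Arr (B \<odot> B) n B"
    define F where "F = Arr A f B"
    have [simp]: "arrow M" "dom M = A \<odot> A" "cod M = A" "arrow N" "dom N = B \<odot> B" "cod N = B" "arrow F" "dom F = A" "cod F = B"
      unfolding M_def N_def F_def by simp_all
    have F: "dg F \<bullet> F = ida A" "F \<bullet> dg F = ida B"
      by (rule arr_eqI; simp add: mor_simps ff; simp add: F_def ff)+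
    have "F \<bullet> M = N \<bullet> (F \<boxtimes> F)" by (rule arr_eqI) (simp_all add: mor_simps M_def N_def F_def hom)
    then have "dg (F \<bullet> M) = dg (N \<bullet> (F \<boxtimes> F))" by simp
    then have d: "dg M \<bullet> dg F = (dg F \<boxtimes> dg F) \<bullet> dg N" by simp
    have "(F \<boxtimes> F) \<bullet> dg M = (F \<boxtimes> F) \<bullet> (dg M \<bullet> dg F) \<bullet> F" by (simp add: F)
    also have "\<dots> = ((F \<boxtimes> F) \<bullet> (dg F \<boxtimes> dg F)) \<bullet> dg N \<bullet> F" unfolding d by simp
    also have "\<dots> = dg N \<bullet> F" by (simp add: tns_cmp F)
    finally have "mor (dg N \<bullet> F) = mor ((F \<boxtimes> F) \<bullet> dg M)" by simp
    then show ?thesis by (simp add: mor_simps M_def N_def F_def)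
  qed
  have kd: "(n \<cdot> (f \<otimes> \<one>[B]))\<dagger> = (f\<dagger> \<otimes> \<one>[B]) \<cdot> n\<dagger>"
  proof -
    define N where "N = Arr (B \<odot> B) n B"
    define F where "F = Arr A f B"
    have [simp]: "arrow N" "dom N = B \<odot> B" "cod N = B" "arrow F" "dom F = A" "cod F = B" unfolding N_def F_def by simp_all
    have "(n \<cdot> (f \<otimes> \<one>[B]))\<dagger> = mor (dg (N \<bullet> (F \<boxtimes> ida B)))" by (simp add: mor_simps N_def F_def del: dg_cmp dg_tns)
    also have "\<dots> = mor ((dg F \<boxtimes> ida B) \<bullet> dg N)" by simp
    finally show ?thesis by (simp add: mor_simps N_def F_def)
  qed
  note gens = cp1[OF f] cp1[OF f'] cp1[OF \<open>m \<in> Hom V (A \<odot> A) A\<close>] cp2[OF \<open>m\<dagger> \<in> Hom V A (A \<odot> A)\<close>]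
    cp1[OF \<open>n \<in> Hom V (B \<odot> B) B\<close>] cp2[OF \<open>n\<dagger> \<in> Hom V B (B \<odot> B)\<close>]
  have L: "den [n12 B n 7 9 6, (f, w A 1, w B 7)] = den [(f, w A 5, w B 6), (f, w A 10, w B 9), n12 A m 1 10 5]"
    by (rule law[OF com, where s = "w A 1" and t = "Br (w B 9) (w B 6)" and ks = "[7, 9, 6]" and ls = "[10, 5, 9, 6]"])
      ((rule cps gens | (simp; fail))+)
  show "f \<in> Hom V A B" "B \<in> Obj V" by simp_all
  show "n \<cdot> (f \<otimes> \<one>[B]) \<in> Hom V (A \<odot> B) B"
    using tensor_in_Hom[of A B B B f "\<one>[B]"] comp_in_Hom[of "A \<odot> B" "B \<odot> B" B "f \<otimes> \<one>[B]" n] by simp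
  show "Hm A m B n f = (n \<cdot> (f \<otimes> \<one>[B]))\<dagger> \<cdot> n \<cdot> (f \<otimes> \<one>[B])"
    unfolding kd Hm_def
    apply (rule net_eq[where s = "Br (w A 1) (w B 2)" and t = "Br (w A 3) (w B 4)" and ks = "[3, 5, 6, 4]" and ls = "[7, 8, 9, 4, 3]"])
    apply ((rule cps gens | (simp; fail))+)[1]
    apply ((rule cps gens | (simp; fail))+)[1]
    apply (simp; fail)
    apply (simp; fail)
    apply (rule sym)
    apply (rule net_step[OF fr_frob1[OF sfa_dfa[OF sB], symmetric, of 7 2 9 4 6 8]]; simp)
    apply (rule net_step[OF L]; simp)
    apply (rule net_step[OF fr_iso[OF f ff(1), of 10 9 3]]; simp)
    apply (rule id_out[where A = A and i = 10 and j = 3]; simp)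
    by ((rule net_perm; simp)?)
qed

text \<open>Rotating \<open>H f\<close> by the Frobenius forms gives \<open>D\<close>, whose dagger
  is \<open>H (f\<dagger>)\<close>. Rotating the factorisation \<open>k\<dagger> \<cdot> k\<close>
  along with it exchanges the two factors and replaces \<open>X\<close> by its dual.\<close>

lemma cpc_dagger:
  assumes sA: "sfa A m u" and sB: "sfa B n v" and f [simp]: "f \<in> Hom V A B" and c: "cpc A m B n f"
  shows "cpc B n A m (f\<dagger>)"
proof -
  note ty = dfa_types[OF sfa_dfa[OF sA]] dfa_types[OF sfa_dfa[OF sB]]
  note [simp] = ty
  have f' [simp]: "f\<dagger> \<in> Hom V B A" using dagger_in_Hom[of A B f] by simp
  from cpcE[OF c sA sB f] obtain X k where X [simp]: "X \<in> Obj V" and k [simp]: "k \<in> Hom V (A \<odot> B) X" and H: "Hm A m B n f = k\<dagger> \<cdot> k" .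
  have k' [simp]: "k\<dagger> \<in> Hom V X (A \<odot> B)" using dagger_in_Hom[of "A \<odot> B" X k] by simp
  \<comment> \<open>Both outputs of \<open>k\<dagger>\<close> are closed off with Frobenius forms,
    leaving a functional on \<open>X \<odot> (B \<odot> A)\<close>. \<open>F'\<close> is its dagger,
    written out for compilation.\<close>
  define F where "F = u\<dagger> \<cdot> m \<cdot> (\<one>[A] \<otimes> (\<l>[A] \<cdot> ((v\<dagger> \<cdot> n) \<otimes> \<one>[A]) \<cdot> \<a>[B, B, A]\<dagger>)) \<cdot> \<a>[A, B, B \<odot> A] \<cdot> (k\<dagger> \<otimes> \<one>[B \<odot> A])"
  define F' where "F' = (k \<otimes> \<one>[B \<odot> A]) \<cdot> \<a>[A, B, B \<odot> A]\<dagger> \<cdot> (\<one>[A] \<otimes> (\<a>[B, B, A] \<cdot> ((n\<dagger> \<cdot> v) \<otimes> \<one>[A]) \<cdot> \<l>[A]\<dagger>)) \<cdot> (m\<dagger> \<cdot> u)"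
  \<comment> \<open>Bending the leg \<open>X\<close> of \<open>F\<close> gives the factor with
    values in the dual of \<open>X\<close>; \<open>j'\<close> is its dagger.\<close>
  define j where "j = \<r>[X\<^sup>\<star>] \<cdot> (\<one>[X\<^sup>\<star>] \<otimes> F) \<cdot> \<a>[X\<^sup>\<star>, X, B \<odot> A] \<cdot> (\<eta> X \<otimes> \<one>[B \<odot> A]) \<cdot> \<l>[B \<odot> A]\<dagger>"
  define j' where "j' = \<l>[B \<odot> A] \<cdot> ((\<eta> X)\<dagger> \<otimes> \<one>[B \<odot> A]) \<cdot> \<a>[X\<^sup>\<star>, X, B \<odot> A]\<dagger> \<cdot> (\<one>[X\<^sup>\<star>] \<otimes> F') \<cdot> \<r>[X\<^sup>\<star>]\<dagger>"
  define D where "D = (n \<otimes> \<one>[A]) \<cdot> ((\<one>[B] \<otimes> f) \<otimes> \<one>[A]) \<cdot> \<a>[B, A, A]\<dagger> \<cdot> (\<one>[B] \<otimes> m\<dagger>)"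
  define aM where "aM = Arr (A \<odot> A) m A"
  define aN where "aN = Arr (B \<odot> B) n B"
  define aU where "aU = Arr \<I> u A"
  define aV where "aV = Arr \<I> v B"
  define aK where "aK = Arr (A \<odot> B) k X"
  define aE where "aE = Arr \<I> (\<eta> X) (X\<^sup>\<star> \<odot> X)"
  define af where "af = Arr A f B"
  note adefs = aM_def aN_def aU_def aV_def aK_def aE_def af_def
  have [simp]: "arrow aM" "dom aM = A \<odot> A" "cod aM = A" "arrow aN" "dom aN = B \<odot> B" "cod aN = B" "arrow aU" "dom aU = \<I>" "cod aU = A"
    "arrow aV" "dom aV = \<I>" "cod aV = B" "arrow aK" "dom aK = A \<odot> B" "cod aK = X" "arrow aE" "dom aE = \<I>" "cod aE = X\<^sup>\<star> \<odot> X"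
    "arrow af" "dom af = A" "cod af = B"
    unfolding adefs by simp_all
  define aF where "aF = (dg aU \<bullet> aM) \<bullet> (ida A \<boxtimes> (lu A \<bullet> ((dg aV \<bullet> aN) \<boxtimes> ida A) \<bullet> dg (al B B A))) \<bullet> al A B (B \<odot> A) \<bullet> (dg aK \<boxtimes> ida (B \<odot> A))"
  define aF' where "aF' = (aK \<boxtimes> ida (B \<odot> A)) \<bullet> dg (al A B (B \<odot> A)) \<bullet> (ida A \<boxtimes> (al B B A \<bullet> ((dg aN \<bullet> aV) \<boxtimes> ida A) \<bullet> dg (lu A))) \<bullet> (dg aM \<bullet> aU)"
  have F: "F = mor aF" "F' = mor aF'" unfolding F_def aF_def F'_def aF'_def by (simp_all add: mor_simps) (simp_all add: adefs)
  have aF: "arrow aF" "dom aF = X \<odot> (B \<odot> A)" "cod aF = \<I>" "arrow aF'" "dom aF' = \<I>" "cod aF' = X \<odot> (B \<odot> A)" "dg aF = aF'"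
    unfolding aF_def aF'_def by simp_all
  define aj where "aj = ru (X\<^sup>\<star>) \<bullet> (ida (X\<^sup>\<star>) \<boxtimes> aF) \<bullet> al (X\<^sup>\<star>) X (B \<odot> A) \<bullet> (aE \<boxtimes> ida (B \<odot> A)) \<bullet> dg (lu (B \<odot> A))"
  define aj' where "aj' = lu (B \<odot> A) \<bullet> (dg aE \<boxtimes> ida (B \<odot> A)) \<bullet> dg (al (X\<^sup>\<star>) X (B \<odot> A)) \<bullet> (ida (X\<^sup>\<star>) \<boxtimes> aF') \<bullet> dg (ru (X\<^sup>\<star>))"
  have j: "j = mor aj" "j' = mor aj'" unfolding j_def aj_def j'_def aj'_def by (simp_all add: mor_simps F) (simp_all add: adefs)
  have aj: "arrow aj" "dom aj = B \<odot> A" "cod aj = X\<^sup>\<star>" "arrow aj'" "dom aj' = X\<^sup>\<star>" "cod aj' = B \<odot> A" "dg aj = aj'"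
    unfolding aj_def aj'_def using aF by simp_all
  have jd: "j\<dagger> = j'" unfolding j aj(7)[symmetric] by (simp add: mor_simps)
  have jH: "j \<in> Hom V (B \<odot> A) (X\<^sup>\<star>)" "j' \<in> Hom V (X\<^sup>\<star>) (B \<odot> A)" using aj unfolding j arrow_def by auto
  have Dd: "D\<dagger> = Hm B n A m (f\<dagger>)"
  proof -
    have "D\<dagger> = mor (dg ((aN \<boxtimes> ida A) \<bullet> ((ida B \<boxtimes> af) \<boxtimes> ida A) \<bullet> dg (al B A A) \<bullet> (ida B \<boxtimes> dg aM)))"
      by (simp add: D_def mor_simps del: dg_cmp dg_tns dg_dg) (simp add: adefs)
    also have "\<dots> = mor ((ida B \<boxtimes> aM) \<bullet> al B A A \<bullet> ((ida B \<boxtimes> dg af) \<boxtimes> ida A) \<bullet> (dg aN \<boxtimes> ida A))" by simp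
    finally show ?thesis by (simp add: Hm_def mor_simps) (simp add: adefs)
  qed
  note gens = cp1[OF ty(2)] cp1[OF ty(3)] cp2[OF ty(4)] cp0[OF ty(5)] cp1[OF ty(7)] cp1[OF ty(8)] cp2[OF ty(9)] cp0[OF ty(10)]
    cp1[OF f] cp1[OF k] cp2[OF k'] cp2[OF eta_types(1)] cp0[OF eta_types(2)]
  have L: "den [n21 B n 20 14 8, n11 A B f 19 20, n12 A m 12 7 19] = den [(k\<dagger>, w X 15, Br (w A 7) (w B 8)), (k, Br (w A 12) (w B 14), w X 15)]"
    by (rule law[OF H[unfolded Hm_def], where s = "Br (w A 12) (w B 14)" and t = "Br (w A 7) (w B 8)" and ks = "[7, 19, 20, 8]" and ls = "[15, 7, 8]"])
      ((rule cps gens | (simp; fail))+)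
  have "D = j' \<cdot> j" unfolding D_def j_def j'_def F_def F'_def
    apply (rule net_eq[where s = "Br (w B 1) (w A 2)" and t = "Br (w B 3) (w A 4)" and ks = "[19, 4, 20, 3]" and ls = "[5, 6, 7, 8, 9, 10, 11, 12, 4, 13, 14, 3, 15]"])
    apply ((rule cps gens | (simp; fail))+)[1]
    apply ((rule cps gens | (simp; fail))+)[1]
    apply (simp; fail)
    apply (simp; fail)
    apply (rule sym)
    apply (rule net_step[OF yank[of X 15 6 5]]; simp)
    apply (rule id_in[where A = X and i = 15 and j = 6]; simp)
    apply (rule net_step[OF L[symmetric]]; simp)
    apply (rule net_step[OF fr_coassoc[OF sfa_dfa[OF sA], of 7 19 4 11 12 21]]; simp)
    apply (rule net_step[OF fr_sym[OF sA, of 7 2 10]]; simp)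
    apply (rule net_step[OF fr_snake2[OF sfa_dfa[OF sA], of 21 2 11 7 10]]; simp)
    apply (rule id_in[where A = A and i = 2 and j = 21]; simp)
    apply (rule net_step[OF fr_sym[OF sB, of 8 1 9]]; simp)
    apply (rule net_step[OF fr_assoc[OF sfa_dfa[OF sB], symmetric, of 1 20 14 9 22 8]]; simp)
    apply (rule net_step[OF fr_snake2[OF sfa_dfa[OF sB], of 3 22 13 14 9]]; simp)
    apply (rule id_out[where A = B and i = 22 and j = 3]; simp)
    by ((rule net_perm; simp)?)
  \<comment> \<open>Being of the form \<open>j\<dagger> \<cdot> j\<close>, the map \<open>D\<close>
    is self-adjoint, hence equal to its dagger.\<close>
  then have "Hm B n A m (f\<dagger>) = (j' \<cdot> j)\<dagger>" using Dd by simp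
  also have "\<dots> = j\<dagger> \<cdot> j"
  proof -
    have "(j' \<cdot> j)\<dagger> = j\<dagger> \<cdot> j'\<dagger>" using jH by (intro dagger_comp) auto
    also have "j'\<dagger> = j" unfolding jd[symmetric] using jH by (intro dagger_dagger) auto
    finally show ?thesis .
  qed
  finally show ?thesis using jH by (intro cpcI[OF sB sA]) auto
qed

end

context dagger_compact
begin

lemma posdef_dagger: assumes "positive_definite V A z" "A \<in> Obj V" shows "z\<dagger> = z"
proof -
  obtain X h where h: "X \<in> Obj V" "h \<in> Hom V A X" "z = h\<dagger> \<cdot> h" using assms unfolding positive_definite_def positive_def by auto
  have "z\<dagger> = h\<dagger> \<cdot> h\<dagger>\<dagger>" unfolding h(3) using h assms(2) dagger_in_Hom[of A X h] by (intro dagger_comp) auto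
  then show ?thesis using h dagger_dagger[of A X h] assms(2) by simp
qed

text \<open>As \<open>z\<close> is invertible, the one-sided condition in \<open>spec\<close>
  determines \<open>m \<cdot> m\<dagger>\<close> as the inverse square of \<open>z\<close>, so it
  also holds in the other order.\<close>

lemma spec_commute:
  assumes s: "spec A m z" and A: "A \<in> Obj V" and m: "m \<in> Hom V (A \<odot> A) A"
  shows "z \<cdot> z \<cdot> m \<cdot> m\<dagger> = \<one>[A]"
proof -
  define Z where "Z = Arr A z A"
  define P where "P = Arr A (m \<cdot> m\<dagger>) A"
  obtain z' where z': "z' \<in> Hom V A A" "z' \<cdot> z = \<one>[A]" "z \<cdot> z' = \<one>[A]" and z: "z \<in> Hom V A A"
    and e: "m \<cdot> m\<dagger> \<cdot> z \<cdot> z = \<one>[A]"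
    using s unfolding spec_def positive_definite_def is_iso_def by auto
  define Z' where "Z' = Arr A z' A"
  have m': "m\<dagger> \<in> Hom V A (A \<odot> A)" "m \<cdot> m\<dagger> \<in> Hom V A A" using A m dagger_in_Hom[of "A \<odot> A" A m] comp_in_Hom[of A "A \<odot> A" A "m\<dagger>" m] by auto
  have [simp]: "arrow Z" "dom Z = A" "cod Z = A" "arrow Z'" "dom Z' = A" "cod Z' = A" "arrow P" "dom P = A" "cod P = A"
    unfolding Z_def Z'_def P_def using A z z' m' by simp_all
  have i: "Z' \<bullet> Z = ida A" "Z \<bullet> Z' = ida A" by (rule arr_eqI; simp add: mor_simps; simp add: Z_def Z'_def z')+
  have zz: "z \<cdot> z \<in> Hom V A A" using comp_in_Hom[OF A A A z z] .
  have "(m \<cdot> m\<dagger>) \<cdot> (z \<cdot> z) = m \<cdot> m\<dagger> \<cdot> z \<cdot> z"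
    by (rule comp_assoc[of A A "A \<odot> A" A]) (use A m m' zz in auto)
  then have "P \<bullet> Z \<bullet> Z = ida A" by (intro arr_eqI) (simp_all add: mor_simps, simp add: P_def Z_def e)
  then have "(P \<bullet> Z \<bullet> Z) \<bullet> Z' \<bullet> Z' = Z' \<bullet> Z'" by simp
  then have P: "P = Z' \<bullet> Z'" by (simp add: i) (simp flip: assoc_cmp add: i)
  have c: "Z \<bullet> Z' \<bullet> h = h" if "arrow h" "cod h = A" for h using that by (simp flip: assoc_cmp add: i)
  have zzp: "Z \<bullet> Z \<bullet> P = ida A" unfolding P by (simp add: c i)
  have "mor (Z \<bullet> Z \<bullet> P) = mor (ida A)" by (simp only: zzp)
  then show ?thesis by (simp only: mor_simps) (simp add: Z_def P_def)
qed

text \<open>The product \<open>k\<dagger> \<cdot> k\<close> of each factor can be replaced by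
  \<open>Hm\<close> inside the net for \<open>W\<dagger> \<cdot> W\<close>. What is left on
  \<open>B\<close> is a loop with two copies of \<open>z\<close>, which cancel, and a snake that
  connects \<open>f\<close> to \<open>g\<close>.\<close>

lemma cpc_comp:
  assumes sA: "sfa A m u" and sB: "sfa B n v" and sC: "sfa C l t" and z: "spec B n z"
    and f [simp]: "f \<in> Hom V A B" and g [simp]: "g \<in> Hom V B C" and cf: "cpc A m B n f" and cg: "cpc B n C l g"
  shows "cpc A m C l (g \<cdot> f)"
proof -
  note ty = dfa_types[OF sfa_dfa[OF sA]] dfa_types[OF sfa_dfa[OF sB]] dfa_types[OF sfa_dfa[OF sC]]
  note [simp] = ty
  have cz: "central V B n z" and pz: "positive_definite V B z" using z unfolding spec_def by auto
  have zH [simp]: "z \<in> Hom V B B" using cz unfolding central_def by auto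
  have zd: "z\<dagger> = z" using posdef_dagger[OF pz] by simp
  from cpcE[OF cf sA sB f] obtain X h where X [simp]: "X \<in> Obj V" and h [simp]: "h \<in> Hom V (A \<odot> B) X" and H: "Hm A m B n f = h\<dagger> \<cdot> h" .
  from cpcE[OF cg sB sC g] obtain Y k where Y [simp]: "Y \<in> Obj V" and k [simp]: "k \<in> Hom V (B \<odot> C) Y" and K: "Hm B n C l g = k\<dagger> \<cdot> k" .
  have h' [simp]: "h\<dagger> \<in> Hom V X (A \<odot> B)" and k' [simp]: "k\<dagger> \<in> Hom V Y (B \<odot> C)"
    using dagger_in_Hom[of "A \<odot> B" X h] dagger_in_Hom[of "B \<odot> C" Y k] by simp_all
  \<comment> \<open>The coform of \<open>B\<close> feeds \<open>h\<close> and \<open>k\<close>, with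
    \<open>z\<close> on the leg towards \<open>h\<close>. Since \<open>z\<close> is self-adjoint,
    the second \<open>z\<close> comes from \<open>W\<dagger>\<close>.\<close>
  define W where "W = (h \<otimes> k) \<cdot> \<a>[A \<odot> B, B, C] \<cdot> ((\<a>[A, B, B]\<dagger> \<cdot> (\<one>[A] \<otimes> ((z \<otimes> \<one>[B]) \<cdot> n\<dagger> \<cdot> v)) \<cdot> \<r>[A]\<dagger>) \<otimes> \<one>[C])"
  define W' where "W' = ((\<r>[A] \<cdot> (\<one>[A] \<otimes> (v\<dagger> \<cdot> n \<cdot> (z \<otimes> \<one>[B]))) \<cdot> \<a>[A, B, B]) \<otimes> \<one>[C]) \<cdot> \<a>[A \<odot> B, B, C]\<dagger> \<cdot> (h\<dagger> \<otimes> k\<dagger>)"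
  have Wd: "W\<dagger> = W'"
  proof -
    define aN where "aN = Arr (B \<odot> B) n B"
    define aV where "aV = Arr \<I> v B"
    define aZ where "aZ = Arr B z B"
    define ah where "ah = Arr (A \<odot> B) h X"
    define ak where "ak = Arr (B \<odot> C) k Y"
    note adefs = aN_def aV_def aZ_def ah_def ak_def
    have [simp]: "arrow aN" "dom aN = B \<odot> B" "cod aN = B" "arrow aV" "dom aV = \<I>" "cod aV = B" "arrow aZ" "dom aZ = B" "cod aZ = B"
      "arrow ah" "dom ah = A \<odot> B" "cod ah = X" "arrow ak" "dom ak = B \<odot> C" "cod ak = Y"
      unfolding adefs by simp_all
    have dz: "dg aZ = aZ" by (rule arr_eqI) (simp_all add: mor_simps, simp add: aZ_def zd)
    have "W\<dagger> = mor (dg ((ah \<boxtimes> ak) \<bullet> al (A \<odot> B) B C \<bullet> ((dg (al A B B) \<bullet> (ida A \<boxtimes> ((aZ \<boxtimes> ida B) \<bullet> dg aN \<bullet> aV)) \<bullet> dg (ru A)) \<boxtimes> ida C)))"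
      by (simp add: W_def mor_simps del: dg_cmp dg_tns dg_dg) (simp add: adefs)
    also have "\<dots> = mor (((ru A \<bullet> (ida A \<boxtimes> (dg aV \<bullet> aN \<bullet> (aZ \<boxtimes> ida B))) \<bullet> al A B B) \<boxtimes> ida C) \<bullet> dg (al (A \<odot> B) B C) \<bullet> (dg ah \<boxtimes> dg ak))"
      by (simp add: dz)
    finally show ?thesis by (simp add: W'_def mor_simps) (simp add: adefs)
  qed
  note gens = cp1[OF ty(2)] cp1[OF ty(3)] cp2[OF ty(4)] cp0[OF ty(5)] cp1[OF ty(7)] cp1[OF ty(8)] cp2[OF ty(9)] cp0[OF ty(10)]
    cp1[OF ty(12)] cp1[OF ty(13)] cp2[OF ty(14)] cp0[OF ty(15)] cp1[OF f] cp1[OF g] cp1[OF h] cp2[OF h'] cp1[OF k] cp2[OF k'] cp1[OF zH]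
  have L1: "den [n21 B n 16 8 11, n11 A B f 15 16, n12 A m 1 3 15] = den [(h\<dagger>, w X 9, Br (w A 3) (w B 11)), (h, Br (w A 1) (w B 8), w X 9)]"
    by (rule law[OF H[unfolded Hm_def], where s = "Br (w A 1) (w B 8)" and t = "Br (w A 3) (w B 11)" and ks = "[3, 15, 16, 11]" and ls = "[9, 3, 11]"])
      ((rule cps gens | (simp; fail))+)
  have L2: "den [n21 C l 17 2 4, n11 B C g 18 17, n12 B n 7 12 18] = den [(k\<dagger>, w Y 10, Br (w B 12) (w C 4)), (k, Br (w B 7) (w C 2), w Y 10)]"
    by (rule law[OF K[unfolded Hm_def], where s = "Br (w B 7) (w C 2)" and t = "Br (w B 12) (w C 4)" and ks = "[12, 18, 17, 4]" and ls = "[10, 12, 4]"])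
      ((rule cps gens | (simp; fail))+)
  \<comment> \<open>In the net below the loop precedes the two \<open>z\<close>, hence the order
    provided by \<open>spec_commute\<close>.\<close>
  have L3: "den [n11 B B z 25 26, n11 B B z 22 25, n21 B n 6 12 22, n12 B n 23 6 12] = den [idn B 23 26]"
    by (rule law[OF spec_commute[OF z ty(6,7)], where s = "w B 23" and t = "w B 26" and ks = "[6, 12, 22, 25, 26]" and ls = "[26]"],
      (rule cps gens | (simp; fail))+, (rule cp1[OF one_type] | simp)+)
  have cpW: "cp W (Br (w A 1) (w C 2)) (Br (w X 9) (w Y 10)) [5, 6, 7, 8, 9, 10] [] []
     [(k, Br (w B 7) (w C 2), w Y 10), (h, Br (w A 1) (w B 8), w X 9), n11 B B z 6 8, n12 B n 5 6 7, n01 B v 5]"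
    unfolding W_def by (rule cps gens | (simp; fail))+
  from cp_Hom[OF this] have WH: "W \<in> Hom V (A \<odot> C) (X \<odot> Y)" by simp
  have "Hm A m C l (g \<cdot> f) = W\<dagger> \<cdot> W" unfolding Wd unfolding Hm_def W_def W'_def
    apply (rule net_eq[where s = "Br (w A 1) (w C 2)" and t = "Br (w A 3) (w C 4)" and ks = "[3, 15, 18, 17, 4]" and ls = "[5, 6, 7, 8, 9, 10, 3, 11, 12, 4, 13, 14]"])
    apply ((rule cps gens | (simp; fail))+)[1]
    apply ((rule cps gens | (simp; fail))+)[1]
    apply (simp; fail)
    apply (simp; fail)
    apply (rule sym)
    apply (rule net_step[OF L1[symmetric]]; simp)
    apply (rule net_step[OF L2[symmetric]]; simp)
    \<comment> \<open>By centrality both \<open>z\<close> are parked on wire 16, the output of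
      \<open>f\<close>. This clears the way for associativity and coassociativity, which bring out
      the loop on the wires 6 and 12.\<close>
    apply (rule net_step[OF fr_cen2[OF sfa_dfa[OF sB] cz, of 16 6 11 8 19]]; simp)
    apply (rule net_step[OF fr_cen1[OF sfa_dfa[OF sB] cz, symmetric, of 16 6 11 20 19]]; simp)
    apply (rule net_step[OF fr_cen1[OF sfa_dfa[OF sB] cz, symmetric, of 20 6 13 21 11]]; simp)
    apply (rule net_step[OF fr_assoc[OF sfa_dfa[OF sB], of 21 6 12 14 13 22]]; simp)
    apply (rule net_step[OF fr_coassoc[OF sfa_dfa[OF sB], symmetric, of 6 12 18 5 23 7]]; simp)
    \<comment> \<open>Now both \<open>z\<close> are moved from the output of \<open>f\<close> to the
      output of the loop, where \<open>L3\<close> removes them together with it.\<close>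
    apply (rule net_step[OF fr_cen1[OF sfa_dfa[OF sB] cz, of 20 22 14 21 24]]; simp)
    apply (rule net_step[OF fr_cen2[OF sfa_dfa[OF sB] cz, symmetric, of 20 22 14 25 24]]; simp)
    apply (rule net_step[OF fr_cen1[OF sfa_dfa[OF sB] cz, of 16 25 14 20 24]]; simp)
    apply (rule net_step[OF fr_cen2[OF sfa_dfa[OF sB] cz, symmetric, of 16 25 14 26 24]]; simp)
    apply (rule net_step[OF L3]; simp)
    apply (rule id_in[where A = B and i = 23 and j = 26]; simp)
    apply (rule net_step[OF fr_snake2[OF sfa_dfa[OF sB], of 18 16 5 23 14]]; simp)
    apply (rule id_out[where A = B and i = 16 and j = 18]; simp)
    by ((rule net_perm; simp)?)
  then show ?thesis using WH comp_in_Hom[of A B C f g] by (intro cpcI[OF sA sC]) auto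
qed

lemma cpc_tensor:
  assumes sA: "sfa A m u" and sB: "sfa B n v" and sC: "sfa C l t" and sD: "sfa D p q"
    and f [simp]: "f \<in> Hom V A B" and g [simp]: "g \<in> Hom V C D" and cf: "cpc A m B n f" and cg: "cpc C l D p g"
  shows "cpc (A \<odot> C) (tensor_mult V A m C l) (B \<odot> D) (tensor_mult V B n D p) (f \<otimes> g)"
proof -
  note dA = sfa_dfa[OF sA] and dB = sfa_dfa[OF sB] and dC = sfa_dfa[OF sC] and dD = sfa_dfa[OF sD]
  note [simp] = dfa_types[OF dA] dfa_types[OF dB] dfa_types[OF dC] dfa_types[OF dD]
  from cpcE[OF cf sA sB f] obtain X h where X [simp]: "X \<in> Obj V" and h [simp]: "h \<in> Hom V (A \<odot> B) X" and H: "Hm A m B n f = h\<dagger> \<cdot> h" .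
  from cpcE[OF cg sC sD g] obtain Y k where Y [simp]: "Y \<in> Obj V" and k [simp]: "k \<in> Hom V (C \<odot> D) Y" and K: "Hm C l D p g = k\<dagger> \<cdot> k" .
  have h' [simp]: "h\<dagger> \<in> Hom V X (A \<odot> B)" and k' [simp]: "k\<dagger> \<in> Hom V Y (C \<odot> D)"
    using dagger_in_Hom[of "A \<odot> B" X h] dagger_in_Hom[of "C \<odot> D" Y k] by simp_all
  \<comment> \<open>The two witnesses side by side, after the middle wires \<open>C\<close> and
    \<open>B\<close> have been exchanged.\<close>
  define W where "W = (h \<otimes> k) \<cdot> (regroup V A B C D)\<dagger> \<cdot> (\<one>[A] \<otimes> (\<s>[C, B] \<otimes> \<one>[D])) \<cdot> regroup V A C B D"
  define W' where "W' = (regroup V A C B D)\<dagger> \<cdot> (\<one>[A] \<otimes> (\<s>[B, C] \<otimes> \<one>[D])) \<cdot> regroup V A B C D \<cdot> (h\<dagger> \<otimes> k\<dagger>)"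
  have Wd: "W\<dagger> = W'"
  proof -
    define ah where "ah = Arr (A \<odot> B) h X"
    define ak where "ak = Arr (C \<odot> D) k Y"
    have [simp]: "arrow ah" "dom ah = A \<odot> B" "cod ah = X" "arrow ak" "dom ak = C \<odot> D" "cod ak = Y"
      unfolding ah_def ak_def by simp_all
    define rg where "rg C D E F = (ida C \<boxtimes> dg (al D E F)) \<bullet> al C D (E \<odot> F)" for C D E F
    have r: "regroup V C D E F = mor (rg C D E F)" for C D E F unfolding rg_def regroup_def by (simp add: mor_simps)
    have rr [simp]: "C \<in> Obj V \<Longrightarrow> D \<in> Obj V \<Longrightarrow> E \<in> Obj V \<Longrightarrow> F \<in> Obj V \<Longrightarrow> arrow (rg C D E F)"
      "dom (rg C D E F) = (C \<odot> D) \<odot> (E \<odot> F)" "cod (rg C D E F) = C \<odot> ((D \<odot> E) \<odot> F)" for C D E F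
      unfolding rg_def by simp_all
    have "W\<dagger> = mor (dg ((ah \<boxtimes> ak) \<bullet> dg (rg A B C D) \<bullet> (ida A \<boxtimes> (sy C B \<boxtimes> ida D)) \<bullet> rg A C B D))"
      by (simp add: W_def mor_simps r ah_def ak_def del: dg_cmp dg_tns dg_dg)
    also have "\<dots> = mor (dg (rg A C B D) \<bullet> (ida A \<boxtimes> (sy B C \<boxtimes> ida D)) \<bullet> rg A B C D \<bullet> (dg ah \<boxtimes> dg ak))"
      by (simp add: sy_dg)
    finally show ?thesis by (simp add: W'_def mor_simps r ah_def ak_def)
  qed
  note gens = cp1[OF \<open>m \<in> Hom V (A \<odot> A) A\<close>] cp2[OF \<open>m\<dagger> \<in> Hom V A (A \<odot> A)\<close>] cp1[OF \<open>n \<in> Hom V (B \<odot> B) B\<close>]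
    cp1[OF \<open>l \<in> Hom V (C \<odot> C) C\<close>] cp2[OF \<open>l\<dagger> \<in> Hom V C (C \<odot> C)\<close>] cp1[OF \<open>p \<in> Hom V (D \<odot> D) D\<close>]
    cp1[OF f] cp1[OF g] cp1[OF h] cp2[OF h'] cp1[OF k] cp2[OF k'] cp_regroup cp_tensor_mult_dagger[OF dA dC] cp_tensor_mult[OF dB dD]
  have cpW: "cp W (Br (Br (w A 1) (w C 21)) (Br (w B 2) (w D 22))) (Br (w X 7) (w Y 27)) [7, 27] [] []
     [(k, Br (w C 21) (w D 22), w Y 27), (h, Br (w A 1) (w B 2), w X 7)]"
    unfolding W_def by (rule cps gens | (simp; fail))+
  from cp_Hom[OF this] have WH: "W \<in> Hom V ((A \<odot> C) \<odot> (B \<odot> D)) (X \<odot> Y)" by simp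
  have L1: "den [n21 B n 6 2 4, n11 A B f 5 6, n12 A m 1 3 5] = den [(h\<dagger>, w X 7, Br (w A 3) (w B 4)), (h, Br (w A 1) (w B 2), w X 7)]"
    by (rule law[OF H[unfolded Hm_def], where s = "Br (w A 1) (w B 2)" and t = "Br (w A 3) (w B 4)" and ks = "[3, 5, 6, 4]" and ls = "[7, 3, 4]"])
      ((rule cps gens | (simp; fail))+)
  have L2: "den [n21 D p 26 22 24, n11 C D g 25 26, n12 C l 21 23 25] = den [(k\<dagger>, w Y 27, Br (w C 23) (w D 24)), (k, Br (w C 21) (w D 22), w Y 27)]"
    by (rule law[OF K[unfolded Hm_def], where s = "Br (w C 21) (w D 22)" and t = "Br (w C 23) (w D 24)" and ks = "[23, 25, 26, 24]" and ls = "[27, 23, 24]"])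
      ((rule cps gens | (simp; fail))+)
  have "Hm (A \<odot> C) (tensor_mult V A m C l) (B \<odot> D) (tensor_mult V B n D p) (f \<otimes> g) = W\<dagger> \<cdot> W"
    unfolding Wd unfolding Hm_def W_def W'_def
    apply (rule net_eq[where s = "Br (Br (w A 1) (w C 21)) (Br (w B 2) (w D 22))" and t = "Br (Br (w A 3) (w C 23)) (Br (w B 4) (w D 24))" and ks = "[3, 5, 23, 25, 6, 26, 4, 24]" and ls = "[7, 27, 3, 4, 23, 24]"])
    apply ((rule cps gens | (simp; fail))+)[1]
    apply ((rule cps gens | (simp; fail))+)[1]
    apply (simp; fail)
    apply (simp; fail)
    apply (rule net_step[OF L1]; simp)
    apply (rule net_step[OF L2]; simp)
    by ((rule net_perm; simp)?)
  then show ?thesis using WH tensor_in_Hom[of A B C D f g]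
    by (intro cpcI[OF tensor_sfa[OF dA dC sA sC] tensor_sfa[OF dB dD sB sD]]) auto
qed

text \<open>Reversing the first factor makes the coform act by multiplication on the correct sides:
  two Frobenius steps and a unit law reduce \<open>Hm\<close> to
  \<open>m\<dagger> \<cdot> m\<close>.\<close>

lemma cpc_cup:
  assumes s: "sfa A m u"
  shows "cpc \<I> \<l>[\<I>] (A \<odot> A) (tensor_mult V A (m \<cdot> \<s>[A, A]) A m) (m\<dagger> \<cdot> u)"
proof -
  note dA = sfa_dfa[OF s]
  note ty = dfa_types[OF dA]
  note [simp] = ty
  note gens = cp1[OF ty(2)] cp1[OF ty(3)] cp2[OF ty(4)] cp_regroup
  define W where "W = m \<cdot> \<l>[A \<odot> A]"
  have Wd: "W\<dagger> = \<l>[A \<odot> A]\<dagger> \<cdot> m\<dagger>"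
  proof -
    define aM where "aM = Arr (A \<odot> A) m A"
    have [simp]: "arrow aM" "dom aM = A \<odot> A" "cod aM = A" unfolding aM_def by simp_all
    have "W\<dagger> = mor (dg (aM \<bullet> lu (A \<odot> A)))" by (simp add: W_def mor_simps aM_def del: dg_cmp)
    also have "\<dots> = mor (dg (lu (A \<odot> A)) \<bullet> dg aM)" by simp
    finally show ?thesis by (simp add: mor_simps aM_def)
  qed
  have cpW: "cp W (Br Em (Br (w A 1) (w A 2))) (w A 8) [8] [] [] [n21 A m 1 2 8]"
    unfolding W_def by (rule cps gens | (simp; fail))+
  from cp_Hom[OF this] have WH: "W \<in> Hom V (\<I> \<odot> (A \<odot> A)) A" by simp
  have uH: "m\<dagger> \<cdot> u \<in> Hom V \<I> (A \<odot> A)" using comp_in_Hom[of \<I> A "A \<odot> A" u "m\<dagger>"] by simp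
  have "Hm \<I> \<l>[\<I>] (A \<odot> A) (tensor_mult V A (m \<cdot> \<s>[A, A]) A m) (m\<dagger> \<cdot> u) = W\<dagger> \<cdot> W"
    unfolding Wd unfolding Hm_def W_def tensor_mult_def
    apply (rule net_eq[where s = "Br Em (Br (w A 1) (w A 2))" and t = "Br Em (Br (w A 6) (w A 7))" and ks = "[3, 4, 5, 6, 7]" and ls = "[8, 6, 7]"])
    apply ((rule cps gens | (simp; fail))+)[1]
    apply ((rule cps gens | (simp; fail))+)[1]
    apply (simp; fail)
    apply (simp; fail)
    apply (rule net_step[OF fr_frob2[OF dA, of 1 3 6 5 4 9]]; simp)
    apply (rule net_step[OF fr_unr[OF dA, of 1 9 3]]; simp)
    apply (rule id_in[where A = A and i = 1 and j = 9]; simp)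
    apply (rule net_step[OF fr_frob1[OF dA, of 1 2 6 7 5 8]]; simp)
    by ((rule net_perm; simp)?)
  then show ?thesis using WH uH
    by (intro cpcI[OF unit_sfa tensor_sfa[OF opposite_dfa[OF dA] dA opposite_sfa[OF dA s] s]]) auto
qed

end

context dagger_compact
begin

section \<open>The category of normalisable dagger Frobenius algebras\<close>

text \<open>Together with unitarity this makes the associator completely positive by
  \<open>cpc_unitary\<close>. Both sides compile to literally the same net.\<close>

lemma hom_associator:
  assumes "sfa A m u" "sfa B n v" "sfa C l t"
  shows "\<a>[A, B, C] \<cdot> tensor_mult V (A \<odot> B) (tensor_mult V A m B n) C l
    = tensor_mult V A m (B \<odot> C) (tensor_mult V B n C l) \<cdot> (\<a>[A, B, C] \<otimes> \<a>[A, B, C])"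
proof -
  note [simp] = dfa_types[OF sfa_dfa[OF assms(1)]] dfa_types[OF sfa_dfa[OF assms(2)]] dfa_types[OF sfa_dfa[OF assms(3)]]
  note g = cp1[OF \<open>m \<in> Hom V (A \<odot> A) A\<close>] cp1[OF \<open>n \<in> Hom V (B \<odot> B) B\<close>] cp1[OF \<open>l \<in> Hom V (C \<odot> C) C\<close>] cp_regroup
  show ?thesis unfolding tensor_mult_def
    by (rule net_eq[where s = "Br (Br (Br (w A 1) (w B 21)) (w C 41)) (Br (Br (w A 2) (w B 22)) (w C 42))"
        and t = "Br (w A 3) (Br (w B 23) (w C 43))" and ks = "[3, 23, 43]" and ls = "[3, 23, 43]", OF _ _ _ _ refl])
      (rule cps g | (simp; fail))+
qed

lemma hom_symmetry:
  assumes "sfa A m u" "sfa B n v"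
  shows "\<s>[A, B] \<cdot> tensor_mult V A m B n = tensor_mult V B n A m \<cdot> (\<s>[A, B] \<otimes> \<s>[A, B])"
proof -
  note [simp] = dfa_types[OF sfa_dfa[OF assms(1)]] dfa_types[OF sfa_dfa[OF assms(2)]]
  note g = cp1[OF \<open>m \<in> Hom V (A \<odot> A) A\<close>] cp1[OF \<open>n \<in> Hom V (B \<odot> B) B\<close>] cp_regroup
  show ?thesis unfolding tensor_mult_def
    apply (rule net_eq[where s = "Br (Br (w A 1) (w B 21)) (Br (w A 2) (w B 22))"
        and t = "Br (w B 23) (w A 3)" and ks = "[3, 23]" and ls = "[23, 3]"])
    apply ((rule cps g | (simp; fail))+)[1]
    apply ((rule cps g | (simp; fail))+)[1]
    apply (simp; fail)
    apply (simp; fail)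
    by (rule net_perm; simp)
qed

lemma hom_unitors:
  assumes "sfa A m u"
  shows "\<l>[A] \<cdot> tensor_mult V \<I> \<l>[\<I>] A m = m \<cdot> (\<l>[A] \<otimes> \<l>[A])"
    and "\<r>[A] \<cdot> tensor_mult V A m \<I> \<l>[\<I>] = m \<cdot> (\<r>[A] \<otimes> \<r>[A])"
proof -
  note [simp] = dfa_types[OF sfa_dfa[OF assms(1)]]
  note g = cp1[OF \<open>m \<in> Hom V (A \<odot> A) A\<close>] cp_regroup
  show "\<l>[A] \<cdot> tensor_mult V \<I> \<l>[\<I>] A m = m \<cdot> (\<l>[A] \<otimes> \<l>[A])" unfolding tensor_mult_def
    by (rule net_eq[where s = "Br (Br Em (w A 1)) (Br Em (w A 2))" and t = "w A 3" and ks = "[3]" and ls = "[3]", OF _ _ _ _ refl])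
      (rule cps g | (simp; fail))+
  show "\<r>[A] \<cdot> tensor_mult V A m \<I> \<l>[\<I>] = m \<cdot> (\<r>[A] \<otimes> \<r>[A])" unfolding tensor_mult_def
    by (rule net_eq[where s = "Br (Br (w A 1) Em) (Br (w A 2) Em)" and t = "w A 3" and ks = "[3]" and ls = "[3]", OF _ _ _ _ refl])
      (rule cps g | (simp; fail))+
qed

definition nfa :: "'o \<Rightarrow> 'm \<Rightarrow> 'm \<Rightarrow> bool" where "nfa A m u \<longleftrightarrow> sfa A m u \<and> (\<exists>z. spec A m z)"

lemma nfa_sfa: "nfa A m u \<Longrightarrow> sfa A m u" by (simp add: nfa_def)
lemma nfa_Obj: "nfa A m u \<Longrightarrow> A \<in> Obj V" by (rule dfa_types(1)[OF sfa_dfa[OF nfa_sfa]])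
lemma nfa_unit: "nfa \<I> \<l>[\<I>] \<one>[\<I>]" unfolding nfa_def using unit_sfa unit_spec by blast
lemma nfa_tensor: "nfa A m u \<Longrightarrow> nfa B n v \<Longrightarrow> nfa (A \<odot> B) (tensor_mult V A m B n) (tensor_unit V u v)"
  unfolding nfa_def using tensor_sfa[OF sfa_dfa sfa_dfa] tensor_spec[OF sfa_dfa sfa_dfa] by blast
lemma nfa_opposite: "nfa A m u \<Longrightarrow> nfa A (m \<cdot> \<s>[A, A]) u"
  unfolding nfa_def using opposite_sfa[OF sfa_dfa] opposite_spec[OF sfa_dfa] by blast

abbreviation "CP \<equiv> CPstar V dual \<eta> \<epsilon>"

lemma CP_simps:
  "(A, m, u) \<in> Obj CP \<longleftrightarrow> nfa A m u"
  "f \<in> Hom CP (A, m, u) (B, n, v) \<longleftrightarrow> f \<in> Hom V A B \<and> cpc A m B n f"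
  "comp_mor CP = comp_mor V" "ident CP (A, m, u) = \<one>[A]"
  "tensor_obj CP (A, m, u) (B, n, v) = (A \<odot> B, tensor_mult V A m B n, tensor_unit V u v)"
  "tensor CP = tensor V" "unit_obj CP = (\<I>, \<l>[\<I>], \<one>[\<I>])"
  "associator CP (A, m, u) (B, n, v) (C, l, t) = \<a>[A, B, C]"
  "left_unitor CP (A, m, u) = \<l>[A]" "right_unitor CP (A, m, u) = \<r>[A]"
  "symmetry CP (A, m, u) (B, n, v) = \<s>[A, B]" "dagger CP = dagger V"
  using normalisable_iff[of A m u] by (simp_all add: CPstar_def nfa_def)

text \<open>The inverse of a unitary is its dagger, which is completely positive by
  \<open>cpc_dagger\<close>; so isomorphism and unitarity hold inside the constructed
  category.\<close>

lemma cpc_unitary_Hom: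
  assumes "nfa A m u" "nfa B n v" "is_unitary V A B f" "f \<cdot> m = n \<cdot> (f \<otimes> f)"
  shows "is_unitary CP (A, m, u) (B, n, v) f" "is_iso CP (A, m, u) (B, n, v) f"
    "f \<in> Hom CP (A, m, u) (B, n, v)"
proof -
  have f: "f \<in> Hom V A B" "f\<dagger> \<cdot> f = \<one>[A]" "f \<cdot> f\<dagger> = \<one>[B]" using assms(3) unfolding is_unitary_def by auto
  note s = nfa_sfa[OF assms(1)] nfa_sfa[OF assms(2)]
  have c: "cpc A m B n f" using cpc_unitary[OF s assms(3,4)] .
  have c': "cpc B n A m (f\<dagger>)" using cpc_dagger[OF s f(1) c] .
  have f': "f\<dagger> \<in> Hom V B A" using dagger_in_Hom nfa_Obj assms f by blast
  show "is_unitary CP (A, m, u) (B, n, v) f" "is_iso CP (A, m, u) (B, n, v) f" "f \<in> Hom CP (A, m, u) (B, n, v)"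
    unfolding is_unitary_def is_iso_def CP_simps(2-4,12) using f f' c c' CP_simps(2)[of "f\<dagger>" B n v A m u] by blast+
qed

lemma CP_ident: "nfa A m u \<Longrightarrow> \<one>[A] \<in> Hom CP (A, m, u) (A, m, u)"
proof (rule cpc_unitary_Hom)
  assume a: "nfa A m u"
  note ty = dfa_types[OF sfa_dfa[OF nfa_sfa[OF a]]]
  have ii: "\<one>[A] \<cdot> \<one>[A] = \<one>[A]" using ident_comp[OF ty(1) ty(1)] ty by simp
  show "is_unitary V A A \<one>[A]" unfolding is_unitary_def using ty ii by (simp add: dagger_ident)
  have "\<one>[A] \<cdot> m = m" using ident_comp[of "A \<odot> A" A m] ty by simp
  moreover have "m \<cdot> \<one>[A \<odot> A] = m" using comp_ident[of "A \<odot> A" A m] ty by simp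
  ultimately show "\<one>[A] \<cdot> m = m \<cdot> (\<one>[A] \<otimes> \<one>[A])" using ty by (simp add: tensor_ident)
qed

lemma CP_assoc:
  assumes "nfa A m u" "nfa B n v" "nfa C l t"
  shows "is_unitary CP (tensor_obj CP (tensor_obj CP (A, m, u) (B, n, v)) (C, l, t)) (tensor_obj CP (A, m, u) (tensor_obj CP (B, n, v) (C, l, t))) \<a>[A, B, C]"
    "is_iso CP (tensor_obj CP (tensor_obj CP (A, m, u) (B, n, v)) (C, l, t)) (tensor_obj CP (A, m, u) (tensor_obj CP (B, n, v) (C, l, t))) \<a>[A, B, C]"
  unfolding CP_simps
  using cpc_unitary_Hom(1,2)[OF nfa_tensor[OF nfa_tensor[OF assms(1,2)] assms(3)] nfa_tensor[OF assms(1) nfa_tensor[OF assms(2,3)]]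
    associator_unitary hom_associator] nfa_Obj nfa_sfa assms by blast+

lemma CP_left:
  assumes "nfa A m u"
  shows "is_unitary CP (tensor_obj CP (unit_obj CP) (A, m, u)) (A, m, u) \<l>[A]"
    "is_iso CP (tensor_obj CP (unit_obj CP) (A, m, u)) (A, m, u) \<l>[A]"
  unfolding CP_simps
  using cpc_unitary_Hom(1,2)[OF nfa_tensor[OF nfa_unit assms] assms left_unitor_unitary hom_unitors(1)] nfa_Obj nfa_sfa assms by blast+

lemma CP_right:
  assumes "nfa A m u"
  shows "is_unitary CP (tensor_obj CP (A, m, u) (unit_obj CP)) (A, m, u) \<r>[A]"
    "is_iso CP (tensor_obj CP (A, m, u) (unit_obj CP)) (A, m, u) \<r>[A]"
  unfolding CP_simps
  using cpc_unitary_Hom(1,2)[OF nfa_tensor[OF assms nfa_unit] assms right_unitor_unitary hom_unitors(2)] nfa_Obj nfa_sfa assms by blast+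

lemma CP_symm:
  assumes "nfa A m u" "nfa B n v"
  shows "is_unitary CP (tensor_obj CP (A, m, u) (B, n, v)) (tensor_obj CP (B, n, v) (A, m, u)) \<s>[A, B]"
    "\<s>[A, B] \<in> Hom CP (tensor_obj CP (A, m, u) (B, n, v)) (tensor_obj CP (B, n, v) (A, m, u))"
  unfolding CP_simps(5)
  using cpc_unitary_Hom(1,3)[OF nfa_tensor[OF assms] nfa_tensor[OF assms(2,1)] symmetry_unitary hom_symmetry] nfa_Obj nfa_sfa assms by blast+

lemma CP_comp:
  assumes "nfa A m u" "nfa B n v" "nfa C l t" "f \<in> Hom CP (A, m, u) (B, n, v)" "g \<in> Hom CP (B, n, v) (C, l, t)"
  shows "g \<cdot> f \<in> Hom CP (A, m, u) (C, l, t)"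
proof -
  obtain z where z: "spec B n z" using assms(2) unfolding nfa_def by auto
  show ?thesis using assms(4,5) cpc_comp[OF nfa_sfa[OF assms(1)] nfa_sfa[OF assms(2)] nfa_sfa[OF assms(3)] z]
      comp_in_Hom[OF nfa_Obj[OF assms(1)] nfa_Obj[OF assms(2)] nfa_Obj[OF assms(3)]] unfolding CP_simps by blast
qed

lemma CP_dagger:
  assumes "nfa A m u" "nfa B n v" "f \<in> Hom CP (A, m, u) (B, n, v)"
  shows "f\<dagger> \<in> Hom CP (B, n, v) (A, m, u)"
  using assms cpc_dagger dagger_in_Hom nfa_Obj nfa_sfa unfolding CP_simps by blast

lemma CP_tensor:
  assumes "nfa A m u" "nfa B n v" "nfa C l t" "nfa D p q" "f \<in> Hom CP (A, m, u) (B, n, v)" "g \<in> Hom CP (C, l, t) (D, p, q)"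
  shows "f \<otimes> g \<in> Hom CP (tensor_obj CP (A, m, u) (C, l, t)) (tensor_obj CP (B, n, v) (D, p, q))"
  unfolding CP_simps
proof
  have fg: "f \<in> Hom V A B" "cpc A m B n f" "g \<in> Hom V C D" "cpc C l D p g" using assms(5,6) by (simp_all add: CP_simps)
  show "f \<otimes> g \<in> Hom V (A \<odot> C) (B \<odot> D)" using tensor_in_Hom nfa_Obj fg assms(1-4) by blast
  show "cpc (A \<odot> C) (tensor_mult V A m C l) (B \<odot> D) (tensor_mult V B n D p) (f \<otimes> g)"
    by (rule cpc_tensor[OF nfa_sfa nfa_sfa nfa_sfa nfa_sfa fg(1,3,2,4)]) (rule assms)+
qed

lemma CP_dual:
  assumes a: "nfa A m u"
  shows "dagger_dual CP (A, m, u) (A, m \<cdot> \<s>[A, A], u) (m\<dagger> \<cdot> u) ((m\<dagger> \<cdot> u)\<dagger> \<cdot> \<s>[A, A])"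
proof -
  note s = nfa_sfa[OF a] and o = nfa_opposite[OF a] and d = sfa_dfa[OF nfa_sfa[OF a]]
  note ty = dfa_types[OF d]
  have uH: "m\<dagger> \<cdot> u \<in> Hom V \<I> (A \<odot> A)" using comp_in_Hom[of \<I> A "A \<odot> A" u "m\<dagger>"] ty by simp
  have e: "m\<dagger> \<cdot> u \<in> Hom CP (unit_obj CP) (tensor_obj CP (A, m \<cdot> \<s>[A, A], u) (A, m, u))"
    unfolding CP_simps using cpc_cup[OF s] uH by simp
  have "(m\<dagger> \<cdot> u)\<dagger> \<in> Hom CP (tensor_obj CP (A, m \<cdot> \<s>[A, A], u) (A, m, u)) (unit_obj CP)"
    using CP_dagger[OF nfa_unit nfa_tensor[OF o a]] e unfolding CP_simps(5,7) by simp
  then have e2: "(m\<dagger> \<cdot> u)\<dagger> \<cdot> \<s>[A, A] \<in> Hom CP (tensor_obj CP (A, m, u) (A, m \<cdot> \<s>[A, A], u)) (unit_obj CP)"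
    using CP_comp[OF nfa_tensor[OF a o] nfa_tensor[OF o a] nfa_unit] CP_symm(2)[OF a o] unfolding CP_simps(5,7) by simp
  \<comment> \<open>The counit prescribed by the dagger is the form with crossed legs. Symmetry of
    the form removes the crossing, so that the Frobenius snakes apply.\<close>
  have c: "(m\<dagger> \<cdot> u)\<dagger> \<cdot> \<s>[A, A] = u\<dagger> \<cdot> m"
  proof -
    have "(m\<dagger> \<cdot> u)\<dagger> = u\<dagger> \<cdot> m" using dagger_comp[of \<I> A "A \<odot> A" u "m\<dagger>"] dagger_dagger[of "A \<odot> A" A m] ty by simp
    then have "(m\<dagger> \<cdot> u)\<dagger> \<cdot> \<s>[A, A] = (u\<dagger> \<cdot> m) \<cdot> \<s>[A, A]" by simp
    also have "\<dots> = u\<dagger> \<cdot> m \<cdot> \<s>[A, A]" by (rule comp_assoc[of "A \<odot> A" "A \<odot> A" A \<I>]) (use ty symmetry_in_Hom[of A A] in auto)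
    also have "\<dots> = u\<dagger> \<cdot> m" using s unfolding sfa_def by simp
    finally show ?thesis .
  qed
  have "\<l>[A] \<cdot> (((m\<dagger> \<cdot> u)\<dagger> \<cdot> \<s>[A, A]) \<otimes> \<one>[A]) \<cdot> \<a>[A, A, A]\<dagger> \<cdot> (\<one>[A] \<otimes> (m\<dagger> \<cdot> u)) \<cdot> \<r>[A]\<dagger> = \<one>[A]"
    "\<r>[A] \<cdot> (\<one>[A] \<otimes> ((m\<dagger> \<cdot> u)\<dagger> \<cdot> \<s>[A, A])) \<cdot> \<a>[A, A, A] \<cdot> ((m\<dagger> \<cdot> u) \<otimes> \<one>[A]) \<cdot> \<l>[A]\<dagger> = \<one>[A]"
    unfolding c by (rule fr_snake_eq[OF d])+
  then show ?thesis using e e2 a o unfolding dagger_dual_def CP_simps by blast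
qed

text \<open>The dual algebra can be carried by the same object: multiplication is reversed, and the
Frobenius form replaces the cup of the ambient category.\<close>

fun dual' where "dual' (A, m, u) = (A, m \<cdot> \<s>[A, A], u)"
fun eta' where "eta' (A :: 'o, m, u) = m\<dagger> \<cdot> u"
fun eps' where "eps' (A, m, u) = (m\<dagger> \<cdot> u)\<dagger> \<cdot> \<s>[A, A]"

lemmas CPs = CP_simps(1) CP_simps(3-12)

lemma CP_HomD: "f \<in> Hom CP (A, m, u) (B, n, v) \<Longrightarrow> f \<in> Hom V A B" by (simp add: CP_simps)

text \<open>Equational axioms are inherited, since the homs of \<open>CP\<close> lie in those of
  \<open>V\<close> and the operations agree. Only membership in homs, isomorphism and unitarity
  inside \<open>CP\<close>, and the dual rest on the closure lemmas.\<close>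

lemma CP_dagger_compact: "dagger_compact CP dual' eta' eps'"
  apply unfold_locales
  apply (unfold split_paired_all CPs dual'.simps eta'.simps eps'.simps)
  apply (rule CP_ident; assumption)
  apply (rule CP_comp; assumption)
  apply (blast intro: ident_comp nfa_Obj dest: CP_HomD)
  apply (blast intro: comp_ident nfa_Obj dest: CP_HomD)
  apply (blast intro: comp_assoc nfa_Obj dest: CP_HomD)
  apply (rule nfa_unit)
  apply (rule nfa_tensor; assumption)
  apply (rule CP_tensor[unfolded CPs]; assumption)
  apply (blast intro: tensor_ident nfa_Obj dest: CP_HomD)
  apply (blast intro: tensor_comp nfa_Obj dest: CP_HomD)
  apply (rule CP_assoc(2)[unfolded CPs]; assumption)
  apply (rule CP_left(2)[unfolded CPs]; assumption)
  apply (rule CP_right(2)[unfolded CPs]; assumption)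
  apply (blast intro: associator_natural nfa_Obj dest: CP_HomD)
  apply (blast intro: left_unitor_natural nfa_Obj dest: CP_HomD)
  apply (blast intro: right_unitor_natural nfa_Obj dest: CP_HomD)
  apply (blast intro: pentagon nfa_Obj dest: CP_HomD)
  apply (blast intro: triangle nfa_Obj dest: CP_HomD)
  apply (rule CP_symm(2)[unfolded CPs]; assumption)
  apply (blast intro: symmetry_natural nfa_Obj dest: CP_HomD)
  apply (blast intro: symmetry_involutive nfa_Obj dest: CP_HomD)
  apply (blast intro: hexagon nfa_Obj dest: CP_HomD)
  apply (rule CP_dagger; assumption)
  apply (blast intro: dagger_dagger nfa_Obj dest: CP_HomD)
  apply (blast intro: dagger_ident nfa_Obj dest: CP_HomD)
  apply (blast intro: dagger_comp nfa_Obj dest: CP_HomD)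
  apply (blast intro: dagger_tensor nfa_Obj dest: CP_HomD)
  apply (rule CP_assoc(1)[unfolded CPs]; assumption)
  apply (rule CP_left(1)[unfolded CPs]; assumption)
  apply (rule CP_right(1)[unfolded CPs]; assumption)
  apply (rule CP_symm(1)[unfolded CPs]; assumption)
  apply (rule CP_dual; assumption)
  done

end

theorem theorem3p5:
  fixes V :: "('o, 'm) dagger_smc"
    and dual :: "'o \<Rightarrow> 'o"
    and \<eta> \<epsilon> :: "'o \<Rightarrow> 'm"
  assumes "dagger_compact V dual \<eta> \<epsilon>"
    and "positive_dimensional V \<eta>"
  shows "\<exists>dual' \<eta>' \<epsilon>'. dagger_compact (CPstar V dual \<eta> \<epsilon>) dual' \<eta>' \<epsilon>'"
  using dagger_compact.CP_dagger_compact[OF assms(1)] by blast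

end
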